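(* Let $\lambda>0$, $s\in[0,1]$ be such that there exists a one-sided test for deciding $\mathbb P_{0,d}$ versus $\mathbb P_{1,d}$. Let $(\mathbf G,\mathbf G')\sim\mathcal G(n,\lambda/n,s)$ with planted permutation $\boldsymbol\sigma^*$. Let $c>0$ with $c\log(\lambda(2-s))<1/2$, $d=\lfloor c\log n\rfloor$, $\gamma\in(0,c\log(\lambda s))$ and $\beta=\exp(n^\gamma)$, and let $\boldsymbol{\mathcal M}$ be the output of MPAlign on $(\mathbf G,\mathbf G')$ with parameters $d,\beta$. Then there exists $\alpha>0$ such that, with probability tending to $1$ as $n\to\infty$, $\frac1n\sum_{i=1}^n\mathbf 1\{(i,\boldsymbol\sigma^*(i))\in\boldsymbol{\mathcal M}\}\ge\alpha$.
   Context: Tree model. Rooted trees are canonically labeled (root $\varnothing$; children of a node labeled $m$ with $c$ children are $\{m,1\},\dots,\{m,c\}$); $\mathcal X_n$ is the set of such trees of depth $\le n$, $p_n$ the pruning at depth $n$. $\mathrm{GW}_\mu$: law of a Galton–Watson tree with $\mathrm{Poisson}(\mu)$ offspring. Uniform random relabeling: independently at each node permute its children uniformly, then relabel canonically. A $(\lambda,s)$-augmentation of $\tau$ attaches to each node an independent $\mathrm{Poisson}(\lambda(1-s))$ number of new children, each receiving an independent $\mathrm{GW}_\lambda$ tree. Under $\mathbb P_0$, $(\mathbf t,\mathbf t')$ are independent $\mathrm{GW}_\lambda$ trees; under $\mathbb P_1$, $\boldsymbol\tau^*\sim\mathrm{GW}_{\lambda s}$ and $\mathbf t,\mathbf t'$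 are independent uniform relabelings of two independent $(\lambda,s)$-augmentations of $\boldsymbol\tau^*$. $\mathbb P_{i,n}$ is the law of $(p_n(\mathbf t),p_n(\mathbf t'))$ under $\mathbb P_i$. A one-sided test is a sequence $\mathcal T_n:\mathcal X_n^2\to\{0,1\}$ with $\mathbb P_{0,n}(\mathcal T_n=1)\to0$ and $\liminf_n\mathbb P_{1,n}(\mathcal T_n=1)>0$. Graph model $\mathcal G(n,\lambda/n,s)$: $\{(\mathbf A_{ij},\tilde{\mathbf A}_{ij})\}_{i<j\in[n]}$ i.i.d. with $(1,1),(1,0),(0,1),(0,0)$ having probabilities $\lambda s/n,\lambda(1-s)/n,\lambda(1-s)/n,1-\lambda(2-s)/n$; $\boldsymbol\sigma^*$ uniform on permutations of $[n]$, independent; $\mathbf G$ has adjacency matrix $\mathbf A$ and $\mathbf G'$ adjacency $\mathbf A'$ with $\mathbf A'_{\boldsymbol\sigma^*(i)\boldsymbol\sigma^*(j)}=\tilde{\mathbf A}_{ij}$. MPAlign (inputs $G,G'$ on $[n]$, depth $d\ge1$, threshold $\beta$): let $\psi(m,a,b)=e^{\lambda s}s^m(1-s)^{a+b-2m}/(\lambda^m m!)$; $d_i,d'_u$ are degrees in $G,G'$. For adjacent $i,j$ in $G$ and adjacent $u,v$ in $G'$, $L_0(i\leftarrow j,u\leftarrow v)=1$ and for $k\ge1$, $L_k(i\leftarrow j,u\leftarrow v)=\sum_{m=0}^{(d_i\wedge d'_u)-1}\psi(m,d_i-1,d'_u-1)\sum_{\sigma,\sigma'}\prod_{\ell=1}^m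 L_{k-1}(\sigma(\ell)\leftarrow i,\sigma'(\ell)\leftarrow u)$, with $\sigma$ (resp. $\sigma'$) ranging over injections from $[m]$ into $\mathcal N_G(i)\setminus\{j\}$ (resp. $\mathcal N_{G'}(u)\setminus\{v\}$). The output $\mathcal M$ is the set of pairs $(i,u)$ such that the balls of radius $d$ around $i$ in $G$ and around $u$ in $G'$ contain no cycle, and there exist distinct neighbors $j_1,j_2,j_3$ of $i$ in $G$ and distinct neighbors $v_1,v_2,v_3$ of $u$ in $G'$ with $L_{d-1}(j_t\leftarrow i,v_t\leftarrow u)>\beta$ for $t=1,2,3$. *)

theory Defs
  imports "HOL-Probability.Probability" "HOL-Combinatorics.Permutations"
begin

section \<open>Labeled rooted trees\<close>

text \<open>
  A canonically labeled rooted tree is identified with its set of labels: the root is \<open>[]\<close>, and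
  the children of a node \<open>u\<close> with \<open>c\<close> children are \<open>u @ [1], \<dots>, u @ [c]\<close>.
  Trees may be infinite but are locally finite.
\<close>

type_synonym tree = "nat list set"

definition trees :: "tree set" where
  "trees = {t. [] \<in> t \<and> (\<forall>u k. u @ [k] \<in> t \<longrightarrow> u \<in> t) \<and>
               (\<forall>u\<in>t. \<exists>c. {k. u @ [k] \<in> t} = {1..c})}"

definition offspring :: "tree \<Rightarrow> nat list \<Rightarrow> nat" where
  "offspring t u = card {k. u @ [k] \<in> t}"

definition trees_upto :: "nat \<Rightarrow> tree set" where
  "trees_upto n = {t \<in> trees. \<forall>u\<in>t. length u \<le> n}"

definition prune :: "nat \<Rightarrow> tree \<Rightarrow> tree" where
  "prune n t = {u \<in> t. length u \<le> n}"

text \<open>The coarsest \<open>\<sigma>\<close>-algebra making every pruning map measurable.\<close>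

definition tree_space :: "tree measure" where
  "tree_space = sigma trees {{t \<in> trees. prune n t = x} | n x. x \<in> trees_upto n}"

text \<open>The tree in which each node \<open>u\<close> has \<open>N u\<close> children; \<open>N\<close> is irrelevant off the tree.\<close>

definition tree_of :: "(nat list \<Rightarrow> nat) \<Rightarrow> tree" where
  "tree_of N = {u. \<forall>i<length u. u ! i \<in> {1..N (take i u)}}"


section \<open>Random trees\<close>

text \<open>The library's \<open>poisson_pmf\<close> is only specified for positive rates; the rates
  \<open>\<lambda>s\<close> and \<open>\<lambda>(1-s)\<close> below may vanish.\<close>

definition poisson :: "real \<Rightarrow> nat pmf" where
  "poisson \<mu> = (if \<mu> = 0 then return_pmf 0 else poisson_pmf \<mu>)"

definition poisson_family :: "real \<Rightarrow> (nat list \<Rightarrow> nat) measure" where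
  "poisson_family \<mu> = Pi\<^sub>M UNIV (\<lambda>_. measure_pmf (poisson \<mu>))"

definition GW :: "real \<Rightarrow> tree measure" where
  "GW \<mu> = distr (poisson_family \<mu>) tree_space tree_of"

text \<open>
  Each node \<open>u\<close> of \<open>t\<close> receives \<open>A u\<close> new children, labeled after its original ones. Every other
  node \<open>u\<close> of the augmented tree belongs to the tree attached to some new child, and has \<open>B u\<close>
  children. For i.i.d. \<open>B\<close> the attached trees are independent, as they use disjoint sets of labels.
\<close>

definition augment :: "tree \<Rightarrow> (nat list \<Rightarrow> nat) \<Rightarrow> (nat list \<Rightarrow> nat) \<Rightarrow> tree" where
  "augment t A B = tree_of (\<lambda>u. if u \<in> t then offspring t u + A u else B u)"

definition augmentation :: "real \<Rightarrow> real \<Rightarrow> tree \<Rightarrow> tree measure" where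
  "augmentation lam s t =
     distr (poisson_family (lam * (1 - s)) \<Otimes>\<^sub>M poisson_family lam) tree_space
       (\<lambda>(A, B). augment t A B)"

text \<open>The child \<open>u @ [k]\<close> of \<open>u\<close> is moved to position \<open>p u k\<close>; hence the new label of a node is
  obtained by applying, along its ancestral line, the permutations of its ancestors.\<close>

definition relabel :: "tree \<Rightarrow> (nat list \<Rightarrow> nat \<Rightarrow> nat) \<Rightarrow> tree" where
  "relabel t p = (\<lambda>u. map (\<lambda>i. p (take i u) (u ! i)) [0..<length u]) ` t"

definition uniform_relabeling :: "tree \<Rightarrow> tree measure" where
  "uniform_relabeling t =
     distr (Pi\<^sub>M UNIV (\<lambda>u. uniform_count_measure {q. q permutes {1..offspring t u}}))
       tree_space (relabel t)"

definition P0 :: "real \<Rightarrow> (tree \<times> tree) measure" where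
  "P0 lam = GW lam \<Otimes>\<^sub>M GW lam"

definition P1 :: "real \<Rightarrow> real \<Rightarrow> (tree \<times> tree) measure" where
  "P1 lam s = GW (lam * s) \<bind> (\<lambda>\<tau>.
     (augmentation lam s \<tau> \<bind> uniform_relabeling) \<Otimes>\<^sub>M
     (augmentation lam s \<tau> \<bind> uniform_relabeling))"

definition prune_law :: "nat \<Rightarrow> (tree \<times> tree) measure \<Rightarrow> (tree \<times> tree) measure" where
  "prune_law n P = distr P (count_space (trees_upto n \<times> trees_upto n))
     (\<lambda>(t, t'). (prune n t, prune n t'))"

definition one_sided_test :: "real \<Rightarrow> real \<Rightarrow> (nat \<Rightarrow> tree \<times> tree \<Rightarrow> nat) \<Rightarrow> bool" where
  "one_sided_test lam s T \<longleftrightarrow>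
     (\<forall>n. T n \<in> trees_upto n \<times> trees_upto n \<rightarrow> {0, 1}) \<and>
     (\<lambda>n. measure (prune_law n (P0 lam)) {x \<in> trees_upto n \<times> trees_upto n. T n x = 1})
       \<longlonglongrightarrow> 0 \<and>
     liminf (\<lambda>n. ereal (measure (prune_law n (P1 lam s))
       {x \<in> trees_upto n \<times> trees_upto n. T n x = 1})) > 0"


section \<open>Correlated random graphs\<close>

text \<open>Graphs on \<open>{1..n}\<close> are given by their adjacency relation.\<close>

type_synonym graph = "nat \<Rightarrow> nat \<Rightarrow> bool"

text \<open>The weights below form a probability distribution as soon as \<open>lam * (2 - s) \<le> n\<close>; for the
  finitely many smaller \<open>n\<close> the value is unspecified.\<close>

definition edge_pmf :: "real \<Rightarrow> real \<Rightarrow> nat \<Rightarrow> (bool \<times> bool) pmf" where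
  "edge_pmf lam s n = embed_pmf (\<lambda>x.
     if x = (True, True) then lam * s / real n
     else if x = (True, False) \<or> x = (False, True) then lam * (1 - s) / real n
     else 1 - lam * (2 - s) / real n)"

text \<open>Symmetric extension of the entries above the diagonal; the entries on the diagonal and those
  outside \<open>{1..n}\<close> are \<open>False\<close> below, by the default value of \<open>Pi_pmf\<close>.\<close>

definition sym_ext :: "(nat \<times> nat \<Rightarrow> bool) \<Rightarrow> graph" where
  "sym_ext a i j = a (min i j, max i j)"

text \<open>The law of \<open>(G, G', \<sigma>)\<close>. Writing \<open>e\<close> for the pairs of entries of
  \<open>(A, B)\<close> above the diagonal, the second graph satisfies \<open>A' (\<sigma> i) (\<sigma> j) = B i j\<close>.\<close>

definition correlated_graphs ::
  "real \<Rightarrow> real \<Rightarrow> nat \<Rightarrow> (graph \<times> graph \<times> (nat \<Rightarrow> nat)) pmf" where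
  "correlated_graphs lam s n =
     map_pmf (\<lambda>(e, \<sigma>). (sym_ext (fst \<circ> e),
                        (\<lambda>u v. sym_ext (snd \<circ> e) (inv \<sigma> u) (inv \<sigma> v)),
                        \<sigma>))
       (pair_pmf
         (Pi_pmf {(i, j). i \<in> {1..n} \<and> j \<in> {1..n} \<and> i < j} (False, False)
            (\<lambda>_. edge_pmf lam s n))
         (pmf_of_set {\<sigma>. \<sigma> permutes {1..n}}))"


section \<open>The message passing algorithm\<close>

definition nbrs :: "graph \<Rightarrow> nat \<Rightarrow> nat set" where
  "nbrs G i = {j. G i j}"

definition graph_ball :: "graph \<Rightarrow> nat \<Rightarrow> nat \<Rightarrow> nat set" where
  "graph_ball G d i = {j. \<exists>k\<le>d. (G ^^ k) i j}"

definition is_cycle :: "graph \<Rightarrow> nat list \<Rightarrow> bool" where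
  "is_cycle G xs \<longleftrightarrow>
     3 \<le> length xs \<and> distinct xs \<and> successively G xs \<and> G (last xs) (hd xs)"

definition ball_acyclic :: "graph \<Rightarrow> nat \<Rightarrow> nat \<Rightarrow> bool" where
  "ball_acyclic G d i \<longleftrightarrow> \<not> (\<exists>xs. is_cycle G xs \<and> set xs \<subseteq> graph_ball G d i)"

definition psi :: "real \<Rightarrow> real \<Rightarrow> nat \<Rightarrow> nat \<Rightarrow> nat \<Rightarrow> real" where
  "psi lam s m a b =
     exp (lam * s) * s ^ m * (1 - s) ^ (a + b - 2 * m) / (lam ^ m * fact m)"

definition injections :: "nat \<Rightarrow> nat set \<Rightarrow> (nat \<Rightarrow> nat) set" where
  "injections m S = {\<sigma> \<in> {1..m} \<rightarrow>\<^sub>E S. inj_on \<sigma> {1..m}}"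

text \<open>\<open>msg lam s G G' k i j u v\<close> is \<open>L\<^sub>k(i \<leftarrow> j, u \<leftarrow> v)\<close>.\<close>

primrec msg ::
  "real \<Rightarrow> real \<Rightarrow> graph \<Rightarrow> graph \<Rightarrow> nat \<Rightarrow> nat \<Rightarrow> nat \<Rightarrow> nat \<Rightarrow> nat \<Rightarrow> real" where
  "msg lam s G G' 0 = (\<lambda>i j u v. 1)"
| "msg lam s G G' (Suc k) = (\<lambda>i j u v.
     \<Sum>m = 0..min (card (nbrs G i)) (card (nbrs G' u)) - 1.
       psi lam s m (card (nbrs G i) - 1) (card (nbrs G' u) - 1) *
       (\<Sum>\<sigma> \<in> injections m (nbrs G i - {j}). \<Sum>\<sigma>' \<in> injections m (nbrs G' u - {v}).
          \<Prod>l = 1..m. msg lam s G G' k (\<sigma> l) i (\<sigma>' l) u))"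

definition MPAlign ::
  "real \<Rightarrow> real \<Rightarrow> nat \<Rightarrow> graph \<Rightarrow> graph \<Rightarrow> nat \<Rightarrow> real \<Rightarrow> (nat \<times> nat) set" where
  "MPAlign lam s n G G' d \<beta> = {(i, u). i \<in> {1..n} \<and> u \<in> {1..n} \<and>
     ball_acyclic G d i \<and> ball_acyclic G' d u \<and>
     (\<exists>j1 j2 j3 v1 v2 v3.
        distinct [j1, j2, j3] \<and> {j1, j2, j3} \<subseteq> nbrs G i \<and>
        distinct [v1, v2, v3] \<and> {v1, v2, v3} \<subseteq> nbrs G' u \<and>
        msg lam s G G' (d - 1) j1 i v1 u > \<beta> \<and>
        msg lam s G G' (d - 1) j2 i v2 u > \<beta> \<and>
        msg lam s G G' (d - 1) j3 i v3 u > \<beta>)}"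

end

theory Submission
  imports Defs
begin

text \<open>
  The relabelled augmentations in \<open>P1\<close> have a likelihood ratio with respect to \<open>P0\<close> that depends only
  on the isomorphism classes of the two trees and obeys the recursion of the messages. A one-sided test
  forces this ratio to exceed any constant at some fixed depth \<open>n0\<close> with probability bounded below
  under \<open>P1\<close>. Matching every common node with itself, the logarithm of the ratio at depth \<open>n0 + k\<close> is at
  least a large multiple of the number of common nodes at depth \<open>k\<close> below which the ratio is
  large, up to a cost of order \<open>(lam * s) ^ k\<close>; by the Paley--Zygmund inequality the ratio exceeds
  \<open>exp ((lam * s) ^ k)\<close> with probability bounded below uniformly in \<open>k\<close>. Three common children with this
  property make the root a vertex accepted by the algorithm.

  As \<open>c * ln (lam * (2 - s)) < 1/2\<close>, the balls of radius \<open>d + 1\<close> in the union graph have far fewer than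
  \<open>sqrt n\<close> vertices, so the joint neighbourhood of one or two vertices is found by a depth-first
  exploration with asymptotically the probability given by independent branching processes. There the
  messages are the likelihood ratios of the trees, hence the number of correctly matched vertices has mean
  of order \<open>n\<close> and variance \<open>o(n\<^sup>2)\<close>, and Chebyshev's inequality applies.
\<close>

section \<open>Product measures indexed by finite sequences\<close>

text \<open>The tree model lives on a sigma-algebra of infinite labeled trees, graph neighbourhoods
  are finite and unlabeled. Both are compared with one discrete object, \<open>ctree_pmf\<close>: a
  pair of augmentations whose common part remains visible. Its two labeled readings, relabeled
  uniformly, have the pruned law of \<open>P1\<close>; exploring the union of the two graphs
  produces exactly such a tree. The logarithm of the ratio \<open>L\<close> is not bounded below, so
  common nodes with small \<open>L\<close> could cancel the gain made at good ones. The remedy is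
  \<open>ln L \<ge> - 1 / L\<close>, together with the fact that \<open>1 / L\<close> has mean at
  most 1 under \<open>P1\<close>, being integrated there to a sum of \<open>P0\<close>-masses. A
  test provides large \<open>L\<close> with a probability that does not depend on the threshold, so
  the threshold can be fixed after all costs are known. Exploration events are only bounded from
  below, with a total deficit that tends to 0. Applied to all outcomes but the wanted one, the lower
  bound also gives the upper bound needed for pairs of vertices.\<close>

definition graft :: "'a \<Rightarrow> (nat \<Rightarrow> nat list \<Rightarrow> 'a) \<Rightarrow> nat list \<Rightarrow> 'a" where
  "graft a F u = (case u of [] \<Rightarrow> a | k # v \<Rightarrow> F k v)"

lemma graft_simps [simp]: "graft a F [] = a" "graft a F (k # v) = F k v"
  by (auto simp: graft_def)

text \<open>A nonempty word is a first letter followed by a word, so independent coordinates indexed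
  by words consist of a root coordinate and one independent family per letter. This is the branching
  property behind the recursions over labeled trees. Both measures agree on finite cylinders: a
  finite set \<open>J\<close> of words meets finitely many letters \<open>K\<close>, with finite
  fibres \<open>L k\<close>.\<close>

lemma PiM_list_split:
  fixes M :: "nat list \<Rightarrow> 'a measure"
  assumes M: "\<And>u. prob_space (M u)"
  defines "N \<equiv> \<lambda>k::nat. Pi\<^sub>M UNIV (\<lambda>u. M (k # u))"
  shows "(\<lambda>(a, F). graft a F) \<in> M [] \<Otimes>\<^sub>M Pi\<^sub>M UNIV N \<rightarrow>\<^sub>M Pi\<^sub>M UNIV M"
    and "Pi\<^sub>M UNIV M = distr (M [] \<Otimes>\<^sub>M Pi\<^sub>M UNIV N) (Pi\<^sub>M UNIV M) (\<lambda>(a, F). graft a F)"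
proof -
  have N: "prob_space (N k)" for k
    unfolding N_def by (intro prob_space_PiM M)
  show meas: "(\<lambda>(a, F). graft a F) \<in> M [] \<Otimes>\<^sub>M Pi\<^sub>M UNIV N \<rightarrow>\<^sub>M Pi\<^sub>M UNIV M"
  proof (rule measurable_PiM_single')
    fix u :: "nat list"
    show "(\<lambda>x. (case x of (a, F) \<Rightarrow> graft a F) u) \<in> M [] \<Otimes>\<^sub>M Pi\<^sub>M UNIV N \<rightarrow>\<^sub>M M u"
    proof (cases u)
      case Nil then show ?thesis by (simp add: split_beta)
    next
      case (Cons k v)
      have "(\<lambda>x. snd x k v) \<in> M [] \<Otimes>\<^sub>M Pi\<^sub>M UNIV N \<rightarrow>\<^sub>M M (k # v)"
        by (rule measurable_compose[OF _ measurable_component_singleton[of v UNIV "\<lambda>v. M (k # v)"]],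
            rule measurable_compose[OF _ measurable_component_singleton[of k UNIV N, unfolded N_def], folded N_def])
           auto
      then show ?thesis using Cons by (simp add: split_beta)
    qed
  next
    have "F k v \<in> space (M (k # v))" if "F \<in> space (Pi\<^sub>M UNIV N)" for F k v
      using that unfolding N_def by (auto simp: space_PiM PiE_def Pi_def)
    then show "(\<lambda>x. case x of (a, F) \<Rightarrow> graft a F) \<in> space (M [] \<Otimes>\<^sub>M Pi\<^sub>M UNIV N) \<rightarrow> (\<Pi>\<^sub>E i\<in>UNIV. space (M i))"
      by (auto simp: space_pair_measure graft_def split: list.splits)
  qed
  show "Pi\<^sub>M UNIV M = distr (M [] \<Otimes>\<^sub>M Pi\<^sub>M UNIV N) (Pi\<^sub>M UNIV M) (\<lambda>(a, F). graft a F)" (is "_ = ?R")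
  proof (rule measure_eqI_PiM_infinite[OF refl])
    interpret I: prob_space "Pi\<^sub>M UNIV M" by (intro prob_space_PiM M)
    interpret IN: prob_space "Pi\<^sub>M UNIV N" by (intro prob_space_PiM N)
    interpret M0: prob_space "M []" by (rule M)
    show "finite_measure (Pi\<^sub>M UNIV M)" by unfold_locales
    fix A and J :: "nat list set"
    assume J: "finite J" and A: "\<And>i. i \<in> J \<Longrightarrow> A i \<in> sets (M i)"
    \<comment> \<open>Taking the full space outside \<open>J\<close> lets the root be treated as
      constrained even if \<open>[]\<close> is not in \<open>J\<close>; its extra factor is then
      1.\<close>
    define A' where "A' u = (if u \<in> J then A u else space (M u))" for u
    have A': "A' u \<in> sets (M u)" for u using A by (auto simp: A'_def)
    define K where "K = {k. \<exists>v. k # v \<in> J}"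
    define L where "L k = {v. k # v \<in> J}" for k
    have "K \<subseteq> hd ` J" by (force simp: K_def)
    then have fK: "finite K" using J finite_subset by blast
    have fL: "finite (L k)" for k
    proof -
      have "L k \<subseteq> tl ` J" by (force simp: L_def)
      then show ?thesis using J finite_subset by blast
    qed
    let ?B = "\<lambda>k. prod_emb UNIV (\<lambda>u. M (k # u)) (L k) (Pi\<^sub>E (L k) (\<lambda>v. A (k # v)))"
    have B: "?B k \<in> sets (N k)" for k
      unfolding N_def using fL by (intro sets_PiM_I) (auto simp: A L_def)
    let ?X = "prod_emb UNIV M J (Pi\<^sub>E J A)"
    have X: "?X \<in> sets (Pi\<^sub>M UNIV M)" using J A by (intro sets_PiM_I) auto
    have Jdec: "J = (if [] \<in> J then {[]} else {}) \<union> (\<lambda>(k, v). k # v) ` (Sigma K L)"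
    proof (intro set_eqI iffI)
      fix u assume "u \<in> J"
      then show "u \<in> (if [] \<in> J then {[]} else {}) \<union> (\<lambda>(k, v). k # v) ` (Sigma K L)"
        by (cases u) (force simp: K_def L_def)+
    qed (auto simp: K_def L_def split: if_splits)
    have "emeasure ?R ?X = emeasure (M [] \<Otimes>\<^sub>M Pi\<^sub>M UNIV N)
      ((\<lambda>(a, F). graft a F) -` ?X \<inter> space (M [] \<Otimes>\<^sub>M Pi\<^sub>M UNIV N))"
      by (rule emeasure_distr[OF meas X])
    also have "(\<lambda>(a, F). graft a F) -` ?X \<inter> space (M [] \<Otimes>\<^sub>M Pi\<^sub>M UNIV N) =
       A' [] \<times> prod_emb UNIV N K (Pi\<^sub>E K ?B)" (is "?l = ?r")
    proof (intro set_eqI iffI)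
      fix x assume x: "x \<in> ?l"
      obtain a F where [simp]: "x = (a, F)" by (cases x)
      have 1: "F k v \<in> A (k # v)" if "k # v \<in> J" for k v
        using x that by (fastforce simp: prod_emb_def PiE_iff)
      have 2: "a \<in> A' []" using x by (auto simp: A'_def prod_emb_def PiE_iff space_pair_measure)
      have 3: "F \<in> space (Pi\<^sub>M UNIV N)" using x by (auto simp: space_pair_measure)
      then have 4: "F k \<in> space (N k)" for k by (auto simp: space_PiM PiE_def)
      show "x \<in> ?r"
        using 1 2 3 4 by (auto simp: prod_emb_def L_def space_PiM N_def)
    next
      fix x assume x: "x \<in> ?r"
      obtain a F where [simp]: "x = (a, F)" by (cases x)
      have 1: "F k v \<in> A (k # v)" if "k # v \<in> J" for k v
      proof -
        have "k \<in> K" "v \<in> L k" using that by (auto simp: K_def L_def)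
        moreover from this have "F k \<in> ?B k" using x by (auto simp: prod_emb_def PiE_iff)
        ultimately show ?thesis by (auto simp: prod_emb_def PiE_iff)
      qed
      have 2: "a \<in> A' []" using x by auto
      have 3: "F \<in> space (Pi\<^sub>M UNIV N)" using x by (auto simp: prod_emb_def space_PiM)
      have 4: "(a, F) \<in> space (M [] \<Otimes>\<^sub>M Pi\<^sub>M UNIV N)"
        using 2 3 A'[of "[]"] sets.sets_into_space by (auto simp: space_pair_measure)
      then have 5: "graft a F \<in> space (Pi\<^sub>M UNIV M)" using measurable_space[OF meas] by force
      have "graft a F u \<in> A u" if "u \<in> J" for u
        using that 1 2 by (cases u) (auto simp: A'_def)
      then show "x \<in> ?l" using 4 5 by (auto simp: prod_emb_def space_PiM)
    qed
    also have "emeasure (M [] \<Otimes>\<^sub>M Pi\<^sub>M UNIV N) ?r =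
      emeasure (M []) (A' []) * emeasure (Pi\<^sub>M UNIV N) (prod_emb UNIV N K (Pi\<^sub>E K ?B))"
      using fK A' B by (intro IN.emeasure_pair_measure_Times sets_PiM_I) auto
    also have "emeasure (Pi\<^sub>M UNIV N) (prod_emb UNIV N K (Pi\<^sub>E K ?B)) = (\<Prod>k\<in>K. emeasure (N k) (?B k))"
      using fK N B by (intro emeasure_PiM_emb) auto
    also have "\<dots> = (\<Prod>k\<in>K. \<Prod>v\<in>L k. emeasure (M (k # v)) (A (k # v)))"
      unfolding N_def using fL M A by (intro prod.cong refl emeasure_PiM_emb) (auto simp: L_def)
    also have "\<dots> = (\<Prod>u\<in>(\<lambda>(k, v). k # v) ` (Sigma K L). emeasure (M u) (A u))"
      using fK fL by (subst prod.reindex) (auto simp: inj_on_def prod.Sigma split_beta)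
    also have "emeasure (M []) (A' []) * \<dots> = (\<Prod>u\<in>J. emeasure (M u) (A u))"
    proof -
      let ?S = "(\<lambda>(k, v). k # v) ` (Sigma K L)"
      have "(\<Prod>u\<in>J. emeasure (M u) (A u)) =
          (\<Prod>u\<in>(if [] \<in> J then {[]} else {}) \<union> ?S. emeasure (M u) (A u))"
        using Jdec by (rule prod.cong) simp
      also have "\<dots> = (\<Prod>u\<in>(if [] \<in> J then {[]} else {}). emeasure (M u) (A u)) * (\<Prod>u\<in>?S. emeasure (M u) (A u))"
        using fK fL by (intro prod.union_disjoint) auto
      finally show ?thesis using M0.emeasure_space_1 by (auto simp: A'_def)
    qed
    also have "\<dots> = emeasure (Pi\<^sub>M UNIV M) ?X"
      using M J A by (intro emeasure_PiM_emb[symmetric]) auto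
    finally show "emeasure (Pi\<^sub>M UNIV M) ?X = emeasure ?R ?X" by simp
  qed simp
qed

lemma nn_integral_list_split:
  fixes M :: "nat list \<Rightarrow> 'a measure"
  assumes M: "\<And>u. prob_space (M u)" and f: "f \<in> borel_measurable (Pi\<^sub>M UNIV M)"
  shows "(\<integral>\<^sup>+N. f N \<partial>Pi\<^sub>M UNIV M) =
    (\<integral>\<^sup>+a. \<integral>\<^sup>+F. f (graft a F) \<partial>Pi\<^sub>M UNIV (\<lambda>k. Pi\<^sub>M UNIV (\<lambda>u. M (k # u))) \<partial>M [])"
proof -
  let ?N = "\<lambda>k. Pi\<^sub>M UNIV (\<lambda>u. M (k # u))"
  interpret IN: prob_space "Pi\<^sub>M UNIV ?N" by (intro prob_space_PiM M)
  note s = PiM_list_split[of M, OF M]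
  have "(\<integral>\<^sup>+N. f N \<partial>Pi\<^sub>M UNIV M) = (\<integral>\<^sup>+x. f ((\<lambda>(a, F). graft a F) x) \<partial>(M [] \<Otimes>\<^sub>M Pi\<^sub>M UNIV ?N))"
    by (subst s(2)) (rule nn_integral_distr[OF s(1)], simp add: f)
  also have "\<dots> = (\<integral>\<^sup>+a. \<integral>\<^sup>+F. f ((\<lambda>(a, F). graft a F) (a, F)) \<partial>Pi\<^sub>M UNIV ?N \<partial>M [])"
    by (rule IN.nn_integral_fst[symmetric]) (rule measurable_compose[OF s(1) f])
  finally show ?thesis by simp
qed

lemma nn_integral_PiM_prod:
  assumes N: "\<And>k. prob_space (N k)" and J: "finite J" "J \<subseteq> I"
    and f: "\<And>k. k \<in> J \<Longrightarrow> f k \<in> borel_measurable (N k)"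
  shows "(\<integral>\<^sup>+F. (\<Prod>k\<in>J. f k (F k)) \<partial>Pi\<^sub>M I N) = (\<Prod>k\<in>J. \<integral>\<^sup>+x. f k x \<partial>N k)"
proof -
  interpret N': prob_space "N k" for k by (rule N)
  interpret P: product_prob_space N I
    by unfold_locales
  have m: "(\<lambda>F. f k (F k)) \<in> borel_measurable (Pi\<^sub>M J N)" if "k \<in> J" for k
    by (rule measurable_compose[OF measurable_component_singleton[OF that, of N] f[OF that]])
  have "(\<Prod>k\<in>J. \<integral>\<^sup>+x. f k x \<partial>N k) = (\<integral>\<^sup>+F. (\<Prod>k\<in>J. f k (F k)) \<partial>Pi\<^sub>M J N)"
    using J f by (intro P.product_nn_integral_prod[symmetric]) auto
  also have "Pi\<^sub>M J N = distr (Pi\<^sub>M I N) (Pi\<^sub>M J N) (\<lambda>x. restrict x J)"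
    using J by (intro P.distr_PiM_restrict_finite[symmetric])
  also have "(\<integral>\<^sup>+F. (\<Prod>k\<in>J. f k (F k)) \<partial>\<dots>) = (\<integral>\<^sup>+F. (\<Prod>k\<in>J. f k (restrict F J k)) \<partial>Pi\<^sub>M I N)"
    by (rule nn_integral_distr[OF measurable_restrict_subset[OF J(2)]]) (simp add: borel_measurable_prod_ennreal m)
  finally show ?thesis by simp
qed

text \<open>The form in which the branching property is applied. Once the root value
  \<open>a\<close> is fixed, the integrand is a constant times a product over the finite set
  \<open>J a\<close> of letters, and independence factorises the inner integral. Both the set of
  relevant children and their factors may depend on \<open>a\<close>.\<close>

lemma nn_integral_list_branch:
  fixes M :: "nat list \<Rightarrow> 'a measure"
  assumes M: "\<And>u. prob_space (M u)" and f: "f \<in> borel_measurable (Pi\<^sub>M UNIV M)"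
    and J: "\<And>a. finite (J a)"
    and h: "\<And>a k. a \<in> space (M []) \<Longrightarrow> k \<in> J a \<Longrightarrow> h a k \<in> borel_measurable (Pi\<^sub>M UNIV (\<lambda>u. M (k # u)))"
    and eq: "\<And>a F. a \<in> space (M []) \<Longrightarrow> (\<And>k. F k \<in> space (Pi\<^sub>M UNIV (\<lambda>u. M (k # u)))) \<Longrightarrow>
       f (graft a F) = c a * (\<Prod>k\<in>J a. h a k (F k))"
  shows "(\<integral>\<^sup>+N. f N \<partial>Pi\<^sub>M UNIV M) =
    (\<integral>\<^sup>+a. c a * (\<Prod>k\<in>J a. \<integral>\<^sup>+N. h a k N \<partial>Pi\<^sub>M UNIV (\<lambda>u. M (k # u))) \<partial>M [])"
proof -
  let ?N = "\<lambda>k. Pi\<^sub>M UNIV (\<lambda>u. M (k # u))"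
  have "(\<integral>\<^sup>+F. f (graft a F) \<partial>Pi\<^sub>M UNIV ?N) = c a * (\<Prod>k\<in>J a. \<integral>\<^sup>+N. h a k N \<partial>?N k)"
    if a: "a \<in> space (M [])" for a
  proof -
    have "(\<integral>\<^sup>+F. f (graft a F) \<partial>Pi\<^sub>M UNIV ?N) = (\<integral>\<^sup>+F. c a * (\<Prod>k\<in>J a. h a k (F k)) \<partial>Pi\<^sub>M UNIV ?N)"
      by (intro nn_integral_cong eq a) (auto simp: space_PiM PiE_def Pi_def)
    also have "\<dots> = c a * (\<integral>\<^sup>+F. (\<Prod>k\<in>J a. h a k (F k)) \<partial>Pi\<^sub>M UNIV ?N)"
      by (intro nn_integral_cmult borel_measurable_prod_ennreal
          measurable_compose[OF measurable_component_singleton] h a) auto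
    also have "(\<integral>\<^sup>+F. (\<Prod>k\<in>J a. h a k (F k)) \<partial>Pi\<^sub>M UNIV ?N) = (\<Prod>k\<in>J a. \<integral>\<^sup>+N. h a k N \<partial>?N k)"
      by (intro nn_integral_PiM_prod prob_space_PiM M J h a) auto
    finally show ?thesis .
  qed
  then show ?thesis
    unfolding nn_integral_list_split[OF M f] by (intro nn_integral_cong)
qed

section \<open>Labeled trees\<close>

abbreviation root_degree :: "tree \<Rightarrow> nat" where
  "root_degree t \<equiv> offspring t []"

definition subtree :: "tree \<Rightarrow> nat \<Rightarrow> tree" where
  "subtree t k = {u. k # u \<in> t}"

lemma card_Suc0_le: "card {k. Suc 0 \<le> k \<and> k \<le> n} = n"
proof -
  have "{k. Suc 0 \<le> k \<and> k \<le> n} = {Suc 0..n}" by auto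
  then show ?thesis by simp
qed

lemma offspring_subtree: "offspring (subtree t k) u = offspring t (k # u)"
  by (simp add: offspring_def subtree_def)

lemma tree_Nil: "t \<in> trees \<Longrightarrow> [] \<in> t"
  by (simp add: trees_def)

lemma tree_prefix: "t \<in> trees \<Longrightarrow> u @ v \<in> t \<Longrightarrow> u \<in> t"
proof (induction v rule: rev_induct)
  case (snoc k v)
  then show ?case by (metis (no_types, lifting) append_assoc mem_Collect_eq trees_def)
qed simp

lemma tree_child_iff:
  assumes "t \<in> trees" "u \<in> t"
  shows "u @ [k] \<in> t \<longleftrightarrow> k \<in> {1..offspring t u}"
proof -
  obtain c where c: "{k. u @ [k] \<in> t} = {1..c}" using assms unfolding trees_def by blast
  then have "offspring t u = c" by (simp add: offspring_def)
  then show ?thesis using c by blast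
qed

lemma tree_Cons_iff:
  assumes "t \<in> trees"
  shows "k # u \<in> t \<longleftrightarrow> k \<in> {1..root_degree t} \<and> u \<in> subtree t k"
  using tree_prefix[OF assms, of "[k]" u] tree_child_iff[OF assms tree_Nil[OF assms], of k]
  by (auto simp: subtree_def)

lemma treesI:
  assumes "[] \<in> t" "\<And>u k. u @ [k] \<in> t \<Longrightarrow> u \<in> t"
    "\<And>u k. u \<in> t \<Longrightarrow> u @ [k] \<in> t \<longleftrightarrow> k \<in> {1..c u}"
  shows "t \<in> trees"
  using assms unfolding trees_def by blast

lemma subtree_in_trees:
  assumes t: "t \<in> trees" and k: "k \<in> {1..root_degree t}"
  shows "subtree t k \<in> trees"
proof (rule treesI[where c = "offspring (subtree t k)"])
  show "[] \<in> subtree t k" using tree_child_iff[OF t tree_Nil[OF t], of k] k by (simp add: subtree_def)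
  show "u \<in> subtree t k" if "u @ [j] \<in> subtree t k" for u j
    using that tree_prefix[OF t, of "k # u" "[j]"] by (simp add: subtree_def)
  show "(u @ [j] \<in> subtree t k) = (j \<in> {1..offspring (subtree t k) u})" if "u \<in> subtree t k" for u j
    using that tree_child_iff[OF t, of "k # u" j] by (simp add: subtree_def offspring_subtree[unfolded subtree_def])
qed

lemma tree_eqI:
  assumes "t \<in> trees" "t' \<in> trees" "root_degree t = root_degree t'"
    "\<And>k. k \<in> {1..root_degree t'} \<Longrightarrow> subtree t k = subtree t' k"
  shows "t = t'"
proof (rule set_eqI)
  fix u show "u \<in> t \<longleftrightarrow> u \<in> t'"
    using assms by (cases u) (auto simp: tree_Nil tree_Cons_iff)
qed

lemma prune_in_trees:
  assumes t: "t \<in> trees" shows "prune n t \<in> trees"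
proof (rule treesI[where c = "\<lambda>u. if length u < n then offspring t u else 0"])
  show "[] \<in> prune n t" using t by (simp add: prune_def tree_Nil)
  show "u \<in> prune n t" if "u @ [k] \<in> prune n t" for u k
    using that tree_prefix[OF t, of u "[k]"] by (simp add: prune_def)
  show "(u @ [k] \<in> prune n t) = (k \<in> {1..if length u < n then offspring t u else 0})" if "u \<in> prune n t" for u k
    using that tree_child_iff[OF t, of u k] by (auto simp: prune_def)
qed

lemma prune_in_trees_upto: "t \<in> trees \<Longrightarrow> prune n t \<in> trees_upto n"
  by (simp add: trees_upto_def prune_in_trees) (simp add: prune_def)

lemma trees_uptoD: "x \<in> trees_upto n \<Longrightarrow> x \<in> trees"
  by (simp add: trees_upto_def)

lemma prune_prune: "prune n (prune m t) = prune (min n m) t"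
  by (auto simp: prune_def)

lemma trees_upto_0: "trees_upto 0 = {{[]}}"
proof -
  have "{[]} \<in> trees" by (rule treesI[where c = "\<lambda>_. 0"]) auto
  then show ?thesis by (auto simp: trees_upto_def tree_Nil)
qed

lemma prune_0: "t \<in> trees \<Longrightarrow> prune 0 t = {[]}"
  by (auto simp: prune_def tree_Nil)

lemma root_degree_prune: "root_degree (prune (Suc n) t) = root_degree t"
  by (simp add: offspring_def prune_def)

lemma subtree_prune: "subtree (prune (Suc n) t) k = prune n (subtree t k)"
  by (simp add: subtree_def prune_def)

lemma subtree_in_trees_upto:
  assumes x: "x \<in> trees_upto (Suc n)" and k: "k \<in> {1..root_degree x}"
  shows "subtree x k \<in> trees_upto n"
  using x subtree_in_trees[OF trees_uptoD[OF x] k] by (auto simp: trees_upto_def subtree_def)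

lemma prune_Suc_eq_iff:
  assumes t: "t \<in> trees" and x: "x \<in> trees_upto (Suc n)"
  shows "prune (Suc n) t = x \<longleftrightarrow>
    root_degree t = root_degree x \<and> (\<forall>k\<in>{1..root_degree x}. prune n (subtree t k) = subtree x k)"
proof
  assume "prune (Suc n) t = x"
  then show "root_degree t = root_degree x \<and> (\<forall>k\<in>{1..root_degree x}. prune n (subtree t k) = subtree x k)"
    using root_degree_prune[of n t] subtree_prune[of n t] by auto
next
  assume "root_degree t = root_degree x \<and> (\<forall>k\<in>{1..root_degree x}. prune n (subtree t k) = subtree x k)"
  then show "prune (Suc n) t = x"
  proof (intro tree_eqI[OF prune_in_trees[OF t] trees_uptoD[OF x]])
  qed (simp_all add: root_degree_prune subtree_prune)
qed

lemma finite_trees_upto: "x \<in> trees_upto n \<Longrightarrow> finite x"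
proof (induction n arbitrary: x)
  case 0 then show ?case by (simp add: trees_upto_0)
next
  case (Suc n)
  have "x \<subseteq> insert [] (\<Union>k\<in>{1..root_degree x}. (#) k ` subtree x k)"
  proof
    fix u assume "u \<in> x"
    then show "u \<in> insert [] (\<Union>k\<in>{1..root_degree x}. (#) k ` subtree x k)"
      using tree_Cons_iff[OF trees_uptoD[OF Suc.prems]] by (cases u) auto
  qed
  moreover have "finite (\<Union>k\<in>{1..root_degree x}. (#) k ` subtree x k)"
    using subtree_in_trees_upto[OF Suc.prems] Suc.IH by auto
  ultimately show ?case using finite_subset by blast
qed

lemma countable_trees_upto: "countable (trees_upto n)"
  by (rule countable_subset[OF _ countable_Collect_finite]) (auto intro: finite_trees_upto)

section \<open>Trees given by offspring counts, and augmentations\<close>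

lemma tree_of_Nil: "[] \<in> tree_of N"
  by (simp add: tree_of_def)

lemma tree_of_snoc: "u @ [k] \<in> tree_of N \<longleftrightarrow> u \<in> tree_of N \<and> k \<in> {1..N u}"
proof -
  have "(\<forall>i<Suc (length u). (u @ [k]) ! i \<in> {1..N (take i (u @ [k]))}) \<longleftrightarrow>
    (\<forall>i<length u. u ! i \<in> {1..N (take i u)}) \<and> k \<in> {1..N u}"
    unfolding less_Suc_eq by (auto simp: nth_append)
  then show ?thesis by (simp add: tree_of_def)
qed

lemma tree_of_in_trees: "tree_of N \<in> trees"
  by (rule treesI[where c = N]) (auto simp: tree_of_Nil tree_of_snoc)

lemma offspring_tree_of: "u \<in> tree_of N \<Longrightarrow> offspring (tree_of N) u = N u"
  by (simp add: offspring_def tree_of_snoc card_Suc0_le)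

lemma root_degree_tree_of: "root_degree (tree_of N) = N []"
  by (simp add: offspring_tree_of tree_of_Nil)

lemma tree_of_Cons: "k # u \<in> tree_of N \<longleftrightarrow> k \<in> {1..N []} \<and> u \<in> tree_of (\<lambda>v. N (k # v))"
proof -
  have "(\<forall>i<Suc (length u). (k # u) ! i \<in> {1..N (take i (k # u))}) \<longleftrightarrow>
    k \<in> {1..N []} \<and> (\<forall>i<length u. u ! i \<in> {1..N (k # take i u)})"
    unfolding All_less_Suc2 by auto
  then show ?thesis by (simp add: tree_of_def)
qed

lemma subtree_tree_of: "k \<in> {1..N []} \<Longrightarrow> subtree (tree_of N) k = tree_of (\<lambda>v. N (k # v))"
  by (simp add: subtree_def tree_of_Cons)

lemma augment_in_trees: "augment t A B \<in> trees"
  by (simp add: augment_def tree_of_in_trees)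

lemma root_degree_augment: "t \<in> trees \<Longrightarrow> root_degree (augment t A B) = root_degree t + A []"
  by (simp add: augment_def root_degree_tree_of tree_Nil)

lemma subtree_augment_old:
  assumes t: "t \<in> trees" and k: "k \<in> {1..root_degree t}"
  shows "subtree (augment t A B) k = augment (subtree t k) (\<lambda>v. A (k # v)) (\<lambda>v. B (k # v))"
proof -
  have "k # v \<in> t \<longleftrightarrow> v \<in> subtree t k" for v by (simp add: subtree_def)
  then show ?thesis
    using k unfolding augment_def
    by (subst subtree_tree_of) (auto simp: tree_Nil[OF t] offspring_subtree cong: if_cong)
qed

lemma subtree_augment_new:
  assumes t: "t \<in> trees" and k: "k \<in> {Suc (root_degree t)..root_degree t + A []}"
  shows "subtree (augment t A B) k = tree_of (\<lambda>v. B (k # v))"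
proof -
  have "k # v \<notin> t" for v using tree_Cons_iff[OF t, of k v] k by auto
  then show ?thesis using k unfolding augment_def
    by (subst subtree_tree_of) (auto simp: tree_Nil[OF t] intro!: arg_cong[where f = tree_of])
qed

text \<open>For a tree \<open>t\<close>, \<open>offspring t u\<close> is 0 at labels off the tree,
  which forces the identity there. Hence a member consists of bijections at all labels, which makes
  \<open>newlabel p\<close> injective on all words and not just on \<open>t\<close>.\<close>

definition tree_perms :: "tree \<Rightarrow> (nat list \<Rightarrow> nat \<Rightarrow> nat) set" where
  "tree_perms t = {p. \<forall>u. p u permutes {1..offspring t u}}"

lemma relabel_Nil: "t \<in> trees \<Longrightarrow> [] \<in> relabel t p"
  unfolding relabel_def by (rule image_eqI[of _ _ "[]"]) (auto simp: tree_Nil)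

definition newlabel :: "(nat list \<Rightarrow> nat \<Rightarrow> nat) \<Rightarrow> nat list \<Rightarrow> nat list" where
  "newlabel p u = map (\<lambda>i. p (take i u) (u ! i)) [0..<length u]"

lemma relabel_newlabel: "relabel t p = newlabel p ` t"
  by (simp add: relabel_def newlabel_def[abs_def])

lemma newlabel_Nil [simp]: "newlabel p [] = []"
  by (simp add: newlabel_def)

lemma newlabel_snoc: "newlabel p (u @ [k]) = newlabel p u @ [p u k]"
  by (simp add: newlabel_def nth_append)

lemma newlabel_Cons: "newlabel p (k # u) = p [] k # newlabel (\<lambda>v. p (k # v)) u"
  unfolding newlabel_def length_Cons upt_conv_Cons[OF zero_less_Suc]
  by (simp add: map_Suc_upt[symmetric] del: upt_Suc)

lemma inj_newlabel:
  assumes p: "\<And>u. inj (p u)"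
  shows "inj (newlabel p)"
proof (rule injI)
  fix u v assume "newlabel p u = newlabel p v"
  then show "u = v"
  proof (induction u arbitrary: v rule: rev_induct)
    case Nil then show ?case by (cases v) (auto simp: newlabel_Cons)
  next
    case (snoc k u)
    then show ?case
    proof (cases v rule: rev_cases)
      case Nil then show ?thesis using snoc.prems by (simp add: newlabel_snoc)
    next
      case (snoc v' j)
      then have "u = v'" using snoc.prems snoc.IH by (simp add: newlabel_snoc)
      then show ?thesis using snoc snoc.prems p by (simp add: newlabel_snoc inj_eq)
    qed
  qed
qed

lemma tree_perms_inj: "p \<in> tree_perms t \<Longrightarrow> inj (p u)"
  unfolding tree_perms_def by (auto intro: permutes_inj)

lemma relabel_snoc:
  assumes t: "t \<in> trees" and p: "p \<in> tree_perms t" and u: "u \<in> t"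
  shows "newlabel p u @ [k] \<in> relabel t p \<longleftrightarrow> k \<in> {1..offspring t u}"
proof -
  have inj: "inj (newlabel p)" by (intro inj_newlabel tree_perms_inj[OF p])
  have perm: "p u permutes {1..offspring t u}" using p by (simp add: tree_perms_def)
  show ?thesis
  proof
    assume "newlabel p u @ [k] \<in> relabel t p"
    then obtain v where v: "v \<in> t" "newlabel p v = newlabel p u @ [k]" by (auto simp: relabel_newlabel)
    then obtain v' j where vj: "v = v' @ [j]" by (cases v rule: rev_cases) auto
    then have "v' = u" "p u j = k" using v inj by (auto simp: newlabel_snoc inj_eq)
    then show "k \<in> {1..offspring t u}" using v vj tree_child_iff[OF t u, of j] permutes_in_image[OF perm] by auto
  next
    assume "k \<in> {1..offspring t u}"
    then obtain j where "k = p u j" "j \<in> {1..offspring t u}" using permutes_image[OF perm] by blast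
    then show "newlabel p u @ [k] \<in> relabel t p"
      using tree_child_iff[OF t u, of j] unfolding relabel_newlabel
      by (intro image_eqI[of _ _ "u @ [j]"]) (auto simp: newlabel_snoc)
  qed
qed

lemma relabel_in_trees:
  assumes t: "t \<in> trees" and p: "p \<in> tree_perms t"
  shows "relabel t p \<in> trees"
proof -
  have "\<exists>c. {k. u @ [k] \<in> relabel t p} = {1..c}" if u: "u \<in> relabel t p" for u
  proof -
    obtain v where "v \<in> t" "u = newlabel p v" using u by (auto simp: relabel_newlabel)
    then show ?thesis using relabel_snoc[OF t p] by auto
  qed
  moreover have "u \<in> relabel t p" if uk: "u @ [k] \<in> relabel t p" for u k
  proof -
    obtain v where v: "v \<in> t" "u @ [k] = newlabel p v" using uk by (auto simp: relabel_newlabel)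
    then obtain v' j where vj: "v = v' @ [j]" by (cases v rule: rev_cases) auto
    then have "v' \<in> t" "u = newlabel p v'" using v tree_prefix[OF t] by (auto simp: newlabel_snoc)
    then show ?thesis by (auto simp: relabel_newlabel)
  qed
  ultimately show ?thesis using relabel_Nil[OF t] by (auto simp: trees_def)
qed

lemma root_degree_relabel:
  assumes t: "t \<in> trees" and p: "p \<in> tree_perms t"
  shows "root_degree (relabel t p) = root_degree t"
  using relabel_snoc[OF t p tree_Nil[OF t]] by (simp add: offspring_def[of "relabel t p"] card_Suc0_le)

lemma subtree_relabel:
  assumes t: "t \<in> trees" and p: "p \<in> tree_perms t" and k: "k \<in> {1..root_degree t}"
  shows "subtree (relabel t p) (p [] k) = relabel (subtree t k) (\<lambda>v. p (k # v))"
proof (rule set_eqI)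
  fix u
  have inj: "inj (p [])" by (rule tree_perms_inj[OF p])
  show "u \<in> subtree (relabel t p) (p [] k) \<longleftrightarrow> u \<in> relabel (subtree t k) (\<lambda>v. p (k # v))"
  proof
    assume "u \<in> subtree (relabel t p) (p [] k)"
    then obtain w where w: "w \<in> t" "newlabel p w = p [] k # u" by (auto simp: relabel_newlabel subtree_def)
    then obtain v where "w = k # v" "u = newlabel (\<lambda>v. p (k # v)) v"
      using inj by (cases w) (auto simp: newlabel_Cons inj_eq)
    then show "u \<in> relabel (subtree t k) (\<lambda>v. p (k # v))"
      using w by (auto simp: relabel_newlabel subtree_def)
  next
    assume "u \<in> relabel (subtree t k) (\<lambda>v. p (k # v))"
    then obtain v where "k # v \<in> t" "u = newlabel (\<lambda>v. p (k # v)) v" by (auto simp: relabel_newlabel subtree_def)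
    then show "u \<in> subtree (relabel t p) (p [] k)"
      by (force simp: relabel_newlabel subtree_def newlabel_Cons)
  qed
qed

text \<open>Child \<open>k\<close> of \<open>t\<close> lands in position \<open>p [] k\<close>, and
  the permutation \<open>p []\<close> reaches every child of \<open>x\<close>; so the conditions on
  the children of \<open>x\<close> can be indexed by the children of \<open>t\<close>.\<close>

lemma prune_relabel_Suc_iff:
  assumes t: "t \<in> trees" and p: "p \<in> tree_perms t" and x: "x \<in> trees_upto (Suc n)"
  shows "prune (Suc n) (relabel t p) = x \<longleftrightarrow> root_degree t = root_degree x \<and>
    (\<forall>k\<in>{1..root_degree x}. prune n (relabel (subtree t k) (\<lambda>v. p (k # v))) = subtree x (p [] k))"
proof -
  have perm: "p [] permutes {1..root_degree t}" using p by (simp add: tree_perms_def)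
  have "prune (Suc n) (relabel t p) = x \<longleftrightarrow> root_degree t = root_degree x \<and>
    (\<forall>k\<in>{1..root_degree x}. prune n (subtree (relabel t p) k) = subtree x k)"
    by (subst prune_Suc_eq_iff[OF relabel_in_trees[OF t p] x]) (simp add: root_degree_relabel[OF t p])
  also have "\<dots> \<longleftrightarrow> root_degree t = root_degree x \<and>
    (\<forall>k\<in>p [] ` {1..root_degree t}. prune n (subtree (relabel t p) k) = subtree x k)"
    using permutes_image[OF perm] by auto
  also have "\<dots> \<longleftrightarrow> root_degree t = root_degree x \<and>
    (\<forall>k\<in>{1..root_degree x}. prune n (relabel (subtree t k) (\<lambda>v. p (k # v))) = subtree x (p [] k))"
    using subtree_relabel[OF t p] by auto
  finally show ?thesis .
qed

section \<open>Pruned Galton--Watson trees and augmentations\<close>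

definition tree_event :: "nat \<Rightarrow> tree \<Rightarrow> tree set" where
  "tree_event n x = {t \<in> trees. prune n t = x}"

lemma tree_space_gen: "{{t \<in> trees. prune n t = x} | n x. x \<in> trees_upto n} \<subseteq> Pow trees"
  by auto

lemma space_tree_space [simp]: "space tree_space = trees"
  unfolding tree_space_def by (rule space_measure_of) auto

lemma sets_tree_space:
  "sets tree_space = sigma_sets trees {{t \<in> trees. prune n t = x} | n x. x \<in> trees_upto n}"
  unfolding tree_space_def by (rule sets_measure_of) auto

lemma tree_event_sets: "x \<in> trees_upto n \<Longrightarrow> tree_event n x \<in> sets tree_space"
  unfolding sets_tree_space tree_event_def by (intro sigma_sets.Basic) blast

lemma measurable_tree_space:
  assumes "f \<in> space M \<rightarrow> trees"
    and "\<And>n x. x \<in> trees_upto n \<Longrightarrow> {\<omega> \<in> space M. prune n (f \<omega>) = x} \<in> sets M"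
  shows "f \<in> M \<rightarrow>\<^sub>M tree_space"
  unfolding tree_space_def
proof (rule measurable_measure_of[OF tree_space_gen assms(1)])
  fix y assume "y \<in> {{t \<in> trees. prune n t = x} | n x. x \<in> trees_upto n}"
  then obtain n x where y: "y = {t \<in> trees. prune n t = x}" "x \<in> trees_upto n" by blast
  have "f -` y \<inter> space M = {\<omega> \<in> space M. prune n (f \<omega>) = x}"
    using assms(1) by (auto simp: y)
  then show "f -` y \<inter> space M \<in> sets M" using assms(2)[OF y(2)] by simp
qed

lemma measurable_prune: "prune n \<in> tree_space \<rightarrow>\<^sub>M count_space (trees_upto n)"
proof (rule measurable_count_space_eq_countable[THEN iffD2, OF countable_trees_upto], intro conjI ballI)
  show "prune n \<in> space tree_space \<rightarrow> trees_upto n" by (auto simp: prune_in_trees_upto)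
  fix x assume "x \<in> trees_upto n"
  then show "prune n -` {x} \<inter> space tree_space \<in> sets tree_space"
    using tree_event_sets[of x n] by (simp add: tree_event_def vimage_def Int_def conj_commute)
qed

lemma prob_indicator_prod:
  assumes "finite J"
  shows "(\<Prod>k\<in>J. indicator (S k) (z k) :: ennreal) = (if \<forall>k\<in>J. z k \<in> S k then 1 else 0)"
  using assms by (induction J) (auto simp: indicator_def)

lemma measurable_shift:
  "(\<lambda>N v. N (k # v)) \<in> Pi\<^sub>M UNIV M \<rightarrow>\<^sub>M Pi\<^sub>M UNIV (\<lambda>v. M (k # v))"
proof (rule measurable_PiM_single')
  show "(\<lambda>\<omega>. \<omega> (k # i)) \<in> Pi\<^sub>M UNIV M \<rightarrow>\<^sub>M M (k # i)" for i :: "'a list"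
    by (rule measurable_component_singleton) simp
qed (auto simp: space_PiM)

lemma space_poisson_family [simp]: "space (poisson_family \<mu>) = UNIV"
  by (simp add: poisson_family_def space_PiM)

lemma prob_space_poisson_family: "prob_space (poisson_family \<mu>)"
  unfolding poisson_family_def by (intro prob_space_PiM prob_space_measure_pmf)

lemma measurable_shift_poisson: "(\<lambda>N v. N (k # v)) \<in> poisson_family \<mu> \<rightarrow>\<^sub>M poisson_family \<mu>"
  unfolding poisson_family_def by (rule measurable_shift)

lemma shift_vimage_sets:
  "E \<in> sets (poisson_family \<mu>) \<Longrightarrow> (\<lambda>N v. N (k # v)) -` E \<in> sets (poisson_family \<mu>)"
  using measurable_sets[OF measurable_shift_poisson] by fastforce

lemma poisson_root_sets: "{N. N [] = a} \<in> sets (poisson_family \<mu>)"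
proof -
  have "(\<lambda>N. N []) \<in> poisson_family \<mu> \<rightarrow>\<^sub>M measure_pmf (poisson \<mu>)"
    unfolding poisson_family_def by (rule measurable_component_singleton) simp
  from measurable_sets[OF this, of "{a}"] show ?thesis by (simp add: vimage_def)
qed

section \<open>Galton--Watson probabilities of pruned trees\<close>

definition gw_event :: "nat \<Rightarrow> tree \<Rightarrow> (nat list \<Rightarrow> nat) set" where
  "gw_event n x = {N. prune n (tree_of N) = x}"

lemma gw_event_0: "x \<in> trees_upto 0 \<Longrightarrow> gw_event 0 x = UNIV"
  by (auto simp: gw_event_def trees_upto_0 prune_0 tree_of_in_trees)

lemma gw_event_Suc:
  assumes "x \<in> trees_upto (Suc n)"
  shows "N \<in> gw_event (Suc n) x \<longleftrightarrow> N [] = root_degree x \<and>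
    (\<forall>k\<in>{1..root_degree x}. (\<lambda>v. N (k # v)) \<in> gw_event n (subtree x k))"
  unfolding gw_event_def mem_Collect_eq prune_Suc_eq_iff[OF tree_of_in_trees assms] root_degree_tree_of
  using subtree_tree_of[of _ N] by auto

lemma gw_event_sets: "x \<in> trees_upto n \<Longrightarrow> gw_event n x \<in> sets (poisson_family \<mu>)"
proof (induction n arbitrary: x)
  case 0 then show ?case using sets.top[of "poisson_family \<mu>"] by (simp add: gw_event_0)
next
  case (Suc n)
  have "gw_event (Suc n) x = {N. N [] = root_degree x} \<inter> (\<Inter>k\<in>{1..root_degree x}.
      (\<lambda>N v. N (k # v)) -` gw_event n (subtree x k) \<inter> space (poisson_family \<mu>)) \<inter> space (poisson_family \<mu>)"
    using gw_event_Suc[OF Suc.prems] by auto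
  also have "\<dots> \<in> sets (poisson_family \<mu>)"
    using Suc.IH subtree_in_trees_upto[OF Suc.prems]
    by (cases "root_degree x = 0")
      (auto intro!: sets.Int poisson_root_sets sets.finite_INT shift_vimage_sets)
  finally show ?case .
qed

definition gw_prob :: "real \<Rightarrow> nat \<Rightarrow> tree \<Rightarrow> ennreal" where
  "gw_prob \<mu> n x = emeasure (poisson_family \<mu>) (gw_event n x)"

lemma gw_prob_0: "x \<in> trees_upto 0 \<Longrightarrow> gw_prob \<mu> 0 x = 1"
  using prob_space.emeasure_space_1[OF prob_space_poisson_family] by (simp add: gw_prob_def gw_event_0)

lemma nn_integral_pmf_single: "(\<integral>\<^sup>+a. (if a = b then c else 0) \<partial>measure_pmf p) = ennreal (pmf p b) * c"
proof -
  have "(\<integral>\<^sup>+a. (if a = b then c else 0) \<partial>measure_pmf p) = (\<integral>\<^sup>+a. c * indicator {b} a \<partial>measure_pmf p)"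
    by (intro nn_integral_cong) (auto simp: indicator_def)
  then show ?thesis by (simp add: nn_integral_cmult emeasure_pmf_single mult.commute)
qed

lemma gw_prob_Suc:
  assumes x: "x \<in> trees_upto (Suc n)"
  shows "gw_prob \<mu> (Suc n) x = ennreal (pmf (poisson \<mu>) (root_degree x)) *
    (\<Prod>k\<in>{1..root_degree x}. gw_prob \<mu> n (subtree x k))"
proof -
  let ?c = "\<lambda>a. if a = root_degree x then 1 else 0 :: ennreal"
  have "gw_prob \<mu> (Suc n) x = (\<integral>\<^sup>+N. indicator (gw_event (Suc n) x) N \<partial>poisson_family \<mu>)"
    by (simp add: gw_prob_def gw_event_sets[OF x])
  also have "\<dots> = (\<integral>\<^sup>+a. ?c a * (\<Prod>k\<in>{1..root_degree x}.
      \<integral>\<^sup>+N. indicator (gw_event n (subtree x k)) N \<partial>poisson_family \<mu>) \<partial>measure_pmf (poisson \<mu>))"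
    unfolding poisson_family_def
  proof (rule nn_integral_list_branch)
    show "indicator (gw_event (Suc n) x) \<in> borel_measurable (Pi\<^sub>M UNIV (\<lambda>_. measure_pmf (poisson \<mu>)))"
      using gw_event_sets[OF x, of \<mu>] by (simp add: poisson_family_def)
    show "indicator (gw_event n (subtree x k)) \<in> borel_measurable (Pi\<^sub>M UNIV (\<lambda>_. measure_pmf (poisson \<mu>)))"
      if "k \<in> {1..root_degree x}" for k
      using gw_event_sets[OF subtree_in_trees_upto[OF x that], of \<mu>] by (simp add: poisson_family_def)
    show "indicator (gw_event (Suc n) x) (graft a F) = ?c a *
         (\<Prod>k\<in>{1..root_degree x}. indicator (gw_event n (subtree x k)) (F k))" for a F
      by (subst prob_indicator_prod) (auto simp: indicator_def gw_event_Suc[OF x])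
  qed (auto simp: prob_space_measure_pmf)
  also have "(\<Prod>k\<in>{1..root_degree x}. \<integral>\<^sup>+N. indicator (gw_event n (subtree x k)) N \<partial>poisson_family \<mu>)
     = (\<Prod>k\<in>{1..root_degree x}. gw_prob \<mu> n (subtree x k))"
    by (intro prod.cong refl) (simp add: gw_prob_def gw_event_sets[OF subtree_in_trees_upto[OF x]])
  finally show ?thesis
    by (simp add: if_distrib[of "\<lambda>z. z * _"] nn_integral_pmf_single cong: if_cong)
qed

section \<open>Probabilities of pruned augmentations of a fixed tree\<close>

definition aug_event :: "tree \<Rightarrow> nat \<Rightarrow> tree \<Rightarrow> ((nat list \<Rightarrow> nat) \<times> (nat list \<Rightarrow> nat)) set" where
  "aug_event t n y = {(A, B). prune n (augment t A B) = y}"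

lemma aug_event_0: "y \<in> trees_upto 0 \<Longrightarrow> aug_event t 0 y = UNIV"
  by (auto simp: aug_event_def trees_upto_0 prune_0 augment_in_trees)

text \<open>Original children keep their positions and are augmented recursively with shifted
  families. The added ones follow; no descendant of an added child lies in \<open>t\<close>, so
  below it only \<open>B\<close> is read, as in a Galton--Watson tree.\<close>

lemma aug_event_Suc:
  assumes t: "t \<in> trees" and y: "y \<in> trees_upto (Suc n)"
  shows "(A, B) \<in> aug_event t (Suc n) y \<longleftrightarrow> root_degree t + A [] = root_degree y \<and>
    (\<forall>k\<in>{1..root_degree t}. (\<lambda>v. A (k # v), \<lambda>v. B (k # v)) \<in> aug_event (subtree t k) n (subtree y k)) \<and>
    (\<forall>k\<in>{Suc (root_degree t)..root_degree y}. (\<lambda>v. B (k # v)) \<in> gw_event n (subtree y k))"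
proof -
  have "(A, B) \<in> aug_event t (Suc n) y \<longleftrightarrow> root_degree t + A [] = root_degree y \<and>
    (\<forall>k\<in>{1..root_degree y}. prune n (subtree (augment t A B) k) = subtree y k)"
    unfolding aug_event_def mem_Collect_eq prod.case prune_Suc_eq_iff[OF augment_in_trees y]
      root_degree_augment[OF t] ..
  also have "\<dots> \<longleftrightarrow> root_degree t + A [] = root_degree y \<and>
    (\<forall>k\<in>{1..root_degree t} \<union> {Suc (root_degree t)..root_degree t + A []}.
       prune n (subtree (augment t A B) k) = subtree y k)"
  proof (rule conj_cong[OF refl])
    assume "root_degree t + A [] = root_degree y"
    then have "{1..root_degree t} \<union> {Suc (root_degree t)..root_degree t + A []} = {1..root_degree y}" by auto
    then show "(\<forall>k\<in>{1..root_degree y}. prune n (subtree (augment t A B) k) = subtree y k) =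
      (\<forall>k\<in>{1..root_degree t} \<union> {Suc (root_degree t)..root_degree t + A []}.
       prune n (subtree (augment t A B) k) = subtree y k)" by simp
  qed
  also have "\<dots> \<longleftrightarrow> root_degree t + A [] = root_degree y \<and>
    (\<forall>k\<in>{1..root_degree t}. (\<lambda>v. A (k # v), \<lambda>v. B (k # v)) \<in> aug_event (subtree t k) n (subtree y k)) \<and>
    (\<forall>k\<in>{Suc (root_degree t)..root_degree t + A []}. (\<lambda>v. B (k # v)) \<in> gw_event n (subtree y k))"
    by (simp add: ball_Un aug_event_def gw_event_def subtree_augment_old[OF t] subtree_augment_new[OF t])
  finally show ?thesis by auto
qed

lemma aug_event_sets:
  "t \<in> trees \<Longrightarrow> y \<in> trees_upto n \<Longrightarrow> aug_event t n y \<in> sets (poisson_family \<alpha> \<Otimes>\<^sub>M poisson_family \<mu>)"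
proof (induction n arbitrary: t y)
  case 0 then show ?case
    using sets.top[of "poisson_family \<alpha> \<Otimes>\<^sub>M poisson_family \<mu>"] by (simp add: aug_event_0 space_pair_measure)
next
  case (Suc n)
  let ?P = "poisson_family \<alpha> \<Otimes>\<^sub>M poisson_family \<mu>"
  have sp: "space ?P = UNIV" by (simp add: space_pair_measure)
  have 1: "(\<lambda>x. (\<lambda>v. fst x (k # v), \<lambda>v. snd x (k # v))) \<in> ?P \<rightarrow>\<^sub>M ?P" for k
    by (intro measurable_Pair measurable_compose[OF measurable_fst measurable_shift_poisson]
        measurable_compose[OF measurable_snd measurable_shift_poisson])
  have 2: "(\<lambda>x. (\<lambda>v. snd x (k # v))) \<in> ?P \<rightarrow>\<^sub>M poisson_family \<mu>" for k
    by (rule measurable_compose[OF measurable_snd measurable_shift_poisson])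
  have 3: "{x. root_degree t + fst x [] = root_degree y} \<in> sets ?P"
  proof (cases "root_degree t \<le> root_degree y")
    case True
    have "{x. root_degree t + fst x [] = root_degree y} = fst -` {A. A [] = root_degree y - root_degree t} \<inter> space ?P"
      using True by (auto simp: sp)
    also have "\<dots> \<in> sets ?P" by (rule measurable_sets[OF measurable_fst poisson_root_sets])
    finally show ?thesis .
  qed auto
  \<comment> \<open>Intersecting with \<open>{1..root_degree y}\<close> changes nothing when the
    first set is nonempty, and it guarantees that each \<open>subtree y k\<close> has depth at most
    \<open>n\<close>, as the induction hypothesis demands.\<close>
  have "aug_event t (Suc n) y = {x. root_degree t + fst x [] = root_degree y} \<inter>
     ((\<Inter>k\<in>{1..root_degree t} \<inter> {1..root_degree y}. (\<lambda>x. (\<lambda>v. fst x (k # v), \<lambda>v. snd x (k # v))) -` aug_event (subtree t k) n (subtree y k) \<inter> space ?P) \<inter> space ?P) \<inter>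
     ((\<Inter>k\<in>{Suc (root_degree t)..root_degree y}. (\<lambda>x. (\<lambda>v. snd x (k # v))) -` gw_event n (subtree y k) \<inter> space ?P) \<inter> space ?P)"
    by (auto simp: aug_event_Suc[OF Suc.prems] sp)
  also have "\<dots> \<in> sets ?P"
  proof (rule sets.Int[OF sets.Int[OF 3]])
    have "(\<Inter>k\<in>{1..root_degree t} \<inter> {1..root_degree y}. (\<lambda>x. (\<lambda>v. fst x (k # v), \<lambda>v. snd x (k # v))) -` aug_event (subtree t k) n (subtree y k) \<inter> space ?P) \<in> sets ?P"
      if "{1..root_degree t} \<inter> {1..root_degree y} \<noteq> {}"
      using that Suc.IH subtree_in_trees[OF Suc.prems(1)] subtree_in_trees_upto[OF Suc.prems(2)]
      by (intro sets.finite_INT measurable_sets[OF 1]) auto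
    then show "(\<Inter>k\<in>{1..root_degree t} \<inter> {1..root_degree y}. (\<lambda>x. (\<lambda>v. fst x (k # v), \<lambda>v. snd x (k # v))) -` aug_event (subtree t k) n (subtree y k) \<inter> space ?P) \<inter> space ?P \<in> sets ?P"
      by (cases "{1..root_degree t} \<inter> {1..root_degree y} = {}") (simp, blast)
    have "(\<Inter>k\<in>{Suc (root_degree t)..root_degree y}. (\<lambda>x. (\<lambda>v. snd x (k # v))) -` gw_event n (subtree y k) \<inter> space ?P) \<in> sets ?P"
      if "{Suc (root_degree t)..root_degree y} \<noteq> {}"
      using that gw_event_sets subtree_in_trees_upto[OF Suc.prems(2)]
      by (intro sets.finite_INT measurable_sets[OF 2]) auto
    then show "(\<Inter>k\<in>{Suc (root_degree t)..root_degree y}. (\<lambda>x. (\<lambda>v. snd x (k # v))) -` gw_event n (subtree y k) \<inter> space ?P) \<inter> space ?P \<in> sets ?P"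
      by (cases "{Suc (root_degree t)..root_degree y} = {}") (simp, blast)
  qed
  finally show ?case .
qed

definition aug_prob :: "real \<Rightarrow> real \<Rightarrow> nat \<Rightarrow> tree \<Rightarrow> tree \<Rightarrow> ennreal" where
  "aug_prob \<alpha> \<mu> n t y = emeasure (poisson_family \<alpha> \<Otimes>\<^sub>M poisson_family \<mu>) (aug_event t n y)"

lemma prob_space_pair_poisson: "prob_space (poisson_family \<alpha> \<Otimes>\<^sub>M poisson_family \<mu>)"
  by (intro prob_space_pair prob_space_poisson_family)

lemma aug_prob_0: "y \<in> trees_upto 0 \<Longrightarrow> aug_prob \<alpha> \<mu> 0 t y = 1"
  using prob_space.emeasure_space_1[OF prob_space_pair_poisson, of \<alpha> \<mu>]
  by (simp add: aug_prob_def aug_event_0 space_pair_measure)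

text \<open>The branching property is used twice: for \<open>B\<close> with \<open>A\<close> fixed,
  which gives a recursion for the conditional probability \<open>I\<close>, and then for
  \<open>A\<close>. The root of \<open>t\<close> must receive exactly the missing number of
  children, whence the Poisson factor.\<close>

lemma aug_prob_Suc:
  assumes t: "t \<in> trees" and y: "y \<in> trees_upto (Suc n)"
  shows "aug_prob \<alpha> \<mu> (Suc n) t y = (if root_degree t \<le> root_degree y then
     ennreal (pmf (poisson \<alpha>) (root_degree y - root_degree t)) *
     (\<Prod>k\<in>{1..root_degree t}. aug_prob \<alpha> \<mu> n (subtree t k) (subtree y k)) *
     (\<Prod>k\<in>{Suc (root_degree t)..root_degree y}. gw_prob \<mu> n (subtree y k)) else 0)"
proof (cases "root_degree t \<le> root_degree y")
  case False
  then have "aug_event t (Suc n) y = {}" by (auto simp: aug_event_Suc[OF t y])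
  then show ?thesis using False by (simp add: aug_prob_def)
next
  case True
  let ?d = "root_degree t" and ?c = "root_degree y"
  interpret B: prob_space "poisson_family \<mu>" by (rule prob_space_poisson_family)
  define I where "I n t y A = (\<integral>\<^sup>+B. indicator (aug_event t n y) (A, B) \<partial>poisson_family \<mu>)" for n t y and A :: "nat list \<Rightarrow> nat"
  have sub: "k \<in> {1..?d} \<Longrightarrow> subtree t k \<in> trees" "k \<in> {1..?c} \<Longrightarrow> subtree y k \<in> trees_upto n" for k
    using subtree_in_trees[OF t] subtree_in_trees_upto[OF y] by auto
  have I_meas: "I n t y \<in> borel_measurable (poisson_family \<alpha>)" if "t \<in> trees" "y \<in> trees_upto n" for n t y
    unfolding I_def using aug_event_sets[OF that, of \<alpha> \<mu>] by (intro B.borel_measurable_nn_integral_fst) simp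
  have I_int: "(\<integral>\<^sup>+A. I n t y A \<partial>poisson_family \<alpha>) = aug_prob \<alpha> \<mu> n t y" if "t \<in> trees" "y \<in> trees_upto n" for n t y
    unfolding I_def aug_prob_def using aug_event_sets[OF that, of \<alpha> \<mu>]
    by (subst B.nn_integral_fst) simp_all
  have I_Suc: "I (Suc n) t y (graft a F) = ((if a = ?c - ?d then 1 else 0) * (\<Prod>k\<in>{Suc ?d..?c}. gw_prob \<mu> n (subtree y k))) *
     (\<Prod>k\<in>{1..?d}. I n (subtree t k) (subtree y k) (F k))" for a F
  proof -
    let ?ca = "if a = ?c - ?d then 1 else 0 :: ennreal"
    let ?h = "\<lambda>k. indicator (if k \<le> ?d then Pair (F k) -` aug_event (subtree t k) n (subtree y k) else gw_event n (subtree y k)) :: _ \<Rightarrow> ennreal"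
    have m: "(if k \<le> ?d then Pair (F k) -` aug_event (subtree t k) n (subtree y k) else gw_event n (subtree y k)) \<in> sets (poisson_family \<mu>)"
      if "k \<in> {1..?c}" for k
      using that sub True sets_Pair1[OF aug_event_sets] gw_event_sets by auto
    have "I (Suc n) t y (graft a F) = (\<integral>\<^sup>+b. ?ca * (\<Prod>k\<in>{1..?c}. \<integral>\<^sup>+B. ?h k B \<partial>poisson_family \<mu>) \<partial>measure_pmf (poisson \<mu>))"
      unfolding I_def poisson_family_def
    proof (rule nn_integral_list_branch)
      have "Pair (graft a F) -` aug_event t (Suc n) y \<in> sets (poisson_family \<mu>)"
        by (rule sets_Pair1[OF aug_event_sets[OF t y, of \<alpha>]])
      then have "indicator (Pair (graft a F) -` aug_event t (Suc n) y) \<in> borel_measurable (poisson_family \<mu>)" by simp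
      then show "(\<lambda>B. indicator (aug_event t (Suc n) y) (graft a F, B)) \<in> borel_measurable (Pi\<^sub>M UNIV (\<lambda>_. measure_pmf (poisson \<mu>)))"
        by (simp add: poisson_family_def indicator_def[abs_def])
      show "?h k \<in> borel_measurable (Pi\<^sub>M UNIV (\<lambda>u. measure_pmf (poisson \<mu>)))" if "k \<in> {1..?c}" for k
        using m[OF that] by (simp add: poisson_family_def)
      show "indicator (aug_event t (Suc n) y) (graft a F, graft b G) = ?ca * (\<Prod>k\<in>{1..?c}. ?h k (G k))" for b G
      proof -
        have *: "{1..?c} = {1..?d} \<union> {Suc ?d..?c}" using True by auto
        have **: "?d + a = ?c \<longleftrightarrow> a = ?c - ?d" using True by auto
        have "(graft a F, graft b G) \<in> aug_event t (Suc n) y \<longleftrightarrow> a = ?c - ?d \<and>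
          (\<forall>k\<in>{1..?d}. G k \<in> Pair (F k) -` aug_event (subtree t k) n (subtree y k)) \<and>
          (\<forall>k\<in>{Suc ?d..?c}. G k \<in> gw_event n (subtree y k))"
          by (simp add: aug_event_Suc[OF t y] **)
        also have "\<dots> \<longleftrightarrow> a = ?c - ?d \<and> (\<forall>k\<in>{1..?c}. G k \<in>
          (if k \<le> ?d then Pair (F k) -` aug_event (subtree t k) n (subtree y k) else gw_event n (subtree y k)))"
          unfolding * ball_Un by (intro conj_cong ball_cong refl) auto
        finally show ?thesis
          unfolding prob_indicator_prod[OF finite_atLeastAtMost] by (simp add: indicator_def)
      qed
    qed (auto simp: prob_space_measure_pmf)
    also have "\<dots> = ?ca * (\<Prod>k\<in>{1..?c}. \<integral>\<^sup>+B. ?h k B \<partial>poisson_family \<mu>)"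
      by simp
    also have "{1..?c} = {1..?d} \<union> {Suc ?d..?c}" using True by auto
    also have "(\<Prod>k\<in>{1..?d} \<union> {Suc ?d..?c}. \<integral>\<^sup>+B. ?h k B \<partial>poisson_family \<mu>) =
       (\<Prod>k\<in>{1..?d}. \<integral>\<^sup>+B. ?h k B \<partial>poisson_family \<mu>) * (\<Prod>k\<in>{Suc ?d..?c}. \<integral>\<^sup>+B. ?h k B \<partial>poisson_family \<mu>)"
      by (rule prod.union_disjoint) auto
    also have "(\<Prod>k\<in>{1..?d}. \<integral>\<^sup>+B. ?h k B \<partial>poisson_family \<mu>) = (\<Prod>k\<in>{1..?d}. I n (subtree t k) (subtree y k) (F k))"
      by (intro prod.cong refl) (simp add: I_def indicator_def)
    also have "(\<Prod>k\<in>{Suc ?d..?c}. \<integral>\<^sup>+B. ?h k B \<partial>poisson_family \<mu>) = (\<Prod>k\<in>{Suc ?d..?c}. gw_prob \<mu> n (subtree y k))"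
      using sub True by (intro prod.cong refl) (simp add: gw_prob_def gw_event_sets)
    finally show ?thesis by (simp add: mult_ac)
  qed
  have "aug_prob \<alpha> \<mu> (Suc n) t y = (\<integral>\<^sup>+A. I (Suc n) t y A \<partial>poisson_family \<alpha>)"
    using I_int[OF t y] by simp
  also have "\<dots> = (\<integral>\<^sup>+a. ((if a = ?c - ?d then 1 else 0) * (\<Prod>k\<in>{Suc ?d..?c}. gw_prob \<mu> n (subtree y k))) *
     (\<Prod>k\<in>{1..?d}. \<integral>\<^sup>+A. I n (subtree t k) (subtree y k) A \<partial>poisson_family \<alpha>) \<partial>measure_pmf (poisson \<alpha>))"
    unfolding poisson_family_def
  proof (rule nn_integral_list_branch)
    show "I (Suc n) t y \<in> borel_measurable (Pi\<^sub>M UNIV (\<lambda>_. measure_pmf (poisson \<alpha>)))"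
      using I_meas[OF t y] by (simp add: poisson_family_def)
    show "I n (subtree t k) (subtree y k) \<in> borel_measurable (Pi\<^sub>M UNIV (\<lambda>_. measure_pmf (poisson \<alpha>)))" if "k \<in> {1..?d}" for k
      using I_meas[OF sub(1)[OF that] sub(2)] that True by (simp add: poisson_family_def)
  qed (auto simp: prob_space_measure_pmf I_Suc)
  also have "\<dots> = (\<integral>\<^sup>+a. (if a = ?c - ?d then (\<Prod>k\<in>{Suc ?d..?c}. gw_prob \<mu> n (subtree y k)) *
     (\<Prod>k\<in>{1..?d}. aug_prob \<alpha> \<mu> n (subtree t k) (subtree y k)) else 0) \<partial>measure_pmf (poisson \<alpha>))"
    using sub I_int True by (intro nn_integral_cong) (auto intro!: prod.cong)
  finally show ?thesis using True by (simp add: nn_integral_pmf_single mult_ac)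
qed

section \<open>Relabelings and the laws of pruned pairs\<close>

definition perm_measure :: "tree \<Rightarrow> nat list \<Rightarrow> (nat \<Rightarrow> nat) measure" where
  "perm_measure t u = uniform_count_measure {q. q permutes {1..offspring t u}}"

abbreviation perm_family :: "tree \<Rightarrow> (nat list \<Rightarrow> nat \<Rightarrow> nat) measure" where
  "perm_family t \<equiv> Pi\<^sub>M UNIV (perm_measure t)"

lemma prob_space_perm_measure: "prob_space (perm_measure t u)"
  unfolding perm_measure_def
  by (rule prob_space_uniform_count_measure) (auto intro: finite_permutations permutes_id)

lemma space_perm_measure: "space (perm_measure t u) = {q. q permutes {1..offspring t u}}"
  by (simp add: perm_measure_def space_uniform_count_measure)

lemma space_perm_family: "space (perm_family t) = tree_perms t"
  by (auto simp: space_PiM space_perm_measure tree_perms_def)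

lemma perm_family_subtree: "Pi\<^sub>M UNIV (\<lambda>v. perm_measure t (k # v)) = perm_family (subtree t k)"
  by (simp add: perm_measure_def[abs_def] offspring_subtree[abs_def])

definition relabel_event :: "tree \<Rightarrow> nat \<Rightarrow> tree \<Rightarrow> (nat list \<Rightarrow> nat \<Rightarrow> nat) set" where
  "relabel_event t n x = {p \<in> tree_perms t. prune n (relabel t p) = x}"

lemma relabel_event_0: "t \<in> trees \<Longrightarrow> x \<in> trees_upto 0 \<Longrightarrow> relabel_event t 0 x = space (perm_family t)"
  by (auto simp: relabel_event_def trees_upto_0 prune_0 relabel_in_trees space_perm_family)

lemma tree_perms_subtree: "p \<in> tree_perms t \<Longrightarrow> (\<lambda>v. p (k # v)) \<in> tree_perms (subtree t k)"
  by (simp add: tree_perms_def offspring_subtree)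

lemma relabel_event_Suc:
  assumes "t \<in> trees" "x \<in> trees_upto (Suc n)" "p \<in> tree_perms t"
  shows "p \<in> relabel_event t (Suc n) x \<longleftrightarrow> root_degree t = root_degree x \<and>
    (\<forall>k\<in>{1..root_degree x}. (\<lambda>v. p (k # v)) \<in> relabel_event (subtree t k) n (subtree x (p [] k)))"
  using prune_relabel_Suc_iff[OF assms(1,3,2)] assms(3) tree_perms_subtree[OF assms(3)]
  by (auto simp: relabel_event_def)

lemma relabel_event_sets:
  "t \<in> trees \<Longrightarrow> x \<in> trees_upto n \<Longrightarrow> relabel_event t n x \<in> sets (perm_family t)"
proof (induction n arbitrary: t x)
  case 0 then show ?case using sets.top[of "perm_family t"] by (simp add: relabel_event_0)
next
  case (Suc n)
  let ?P = "perm_family t" and ?c = "root_degree x"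
  show ?case
  proof (cases "root_degree t = ?c")
    case False
    then have "relabel_event t (Suc n) x = {}"
      using relabel_event_Suc[OF Suc.prems] by (auto simp: relabel_event_def)
    then show ?thesis by simp
  next
    case True
    let ?S = "\<lambda>q k. (\<lambda>p v. p (k # v)) -` relabel_event (subtree t k) n (subtree x (q k)) \<inter> space ?P"
    have S: "?S q k \<in> sets ?P" if "q permutes {1..?c}" "k \<in> {1..?c}" for q k
    proof -
      have "(\<lambda>p v. p (k # v)) \<in> ?P \<rightarrow>\<^sub>M perm_family (subtree t k)"
        using measurable_shift[of k "perm_measure t"] by (simp add: perm_family_subtree)
      moreover have "relabel_event (subtree t k) n (subtree x (q k)) \<in> sets (perm_family (subtree t k))"
        using that True permutes_in_image[OF that(1)]
        by (intro Suc.IH subtree_in_trees[OF Suc.prems(1)] subtree_in_trees_upto[OF Suc.prems(2)]) auto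
      ultimately show ?thesis by (rule measurable_sets)
    qed
    have R: "(\<lambda>p. p []) -` {q} \<inter> space ?P \<in> sets ?P" if "q permutes {1..?c}" for q
      using that True
      by (intro measurable_sets[OF measurable_component_singleton])
         (auto simp: perm_measure_def sets_uniform_count_measure)
    \<comment> \<open>The target \<open>subtree x (q k)\<close> depends on the root permutation, so
      the event is cut into finitely many pieces on which that permutation is fixed.\<close>
    have "relabel_event t (Suc n) x = (\<Union>q\<in>{q. q permutes {1..?c}}. ((\<lambda>p. p []) -` {q} \<inter> space ?P) \<inter>
       (space ?P \<inter> (\<Inter>k\<in>{1..?c}. ?S q k)))" (is "_ = ?R")
    proof (intro set_eqI iffI)
      fix p assume p: "p \<in> relabel_event t (Suc n) x"
      then have "p \<in> tree_perms t" by (simp add: relabel_event_def)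
      moreover from this have "p [] permutes {1..?c}"
        unfolding True[symmetric] by (simp only: tree_perms_def mem_Collect_eq)
      ultimately show "p \<in> ?R"
        using p relabel_event_Suc[OF Suc.prems] by (auto simp: space_perm_family)
    next
      fix p assume "p \<in> ?R"
      then show "p \<in> relabel_event t (Suc n) x"
        using relabel_event_Suc[OF Suc.prems, of p] True by (auto simp: space_perm_family)
    qed
    also have "\<dots> \<in> sets ?P"
    proof (rule sets.finite_UN)
      show "finite {q. q permutes {1..?c}}" by (simp add: finite_permutations)
      fix q assume "q \<in> {q. q permutes {1..?c}}"
      then have q: "q permutes {1..?c}" by simp
      have "space ?P \<inter> (\<Inter>k\<in>{1..?c}. ?S q k) \<in> sets ?P"
      proof (cases "?c = 0")
        case True then show ?thesis by simp
      next
        case False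
        then show ?thesis by (intro sets.Int[OF sets.top sets.finite_INT] S[OF q]) auto
      qed
      then show "((\<lambda>p. p []) -` {q} \<inter> space ?P) \<inter> (space ?P \<inter> (\<Inter>k\<in>{1..?c}. ?S q k)) \<in> sets ?P"
        by (rule sets.Int[OF R[OF q]])
    qed
    finally show ?thesis .
  qed
qed

definition relabel_prob :: "nat \<Rightarrow> tree \<Rightarrow> tree \<Rightarrow> ennreal" where
  "relabel_prob n t x = emeasure (perm_family t) (relabel_event t n x)"

lemma relabel_prob_0: "t \<in> trees \<Longrightarrow> x \<in> trees_upto 0 \<Longrightarrow> relabel_prob 0 t x = 1"
  using prob_space.emeasure_space_1[OF prob_space_PiM[OF prob_space_perm_measure]]
  by (simp add: relabel_prob_def relabel_event_0)

lemma nn_integral_uniform_count_measure: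
  assumes "finite A"
  shows "(\<integral>\<^sup>+a. f a \<partial>uniform_count_measure A) = ennreal (1 / card A) * (\<Sum>a\<in>A. f a)"
  using assms by (simp add: uniform_count_measure_def nn_integral_point_measure_finite sum_distrib_left)

lemma relabel_prob_Suc:
  assumes t: "t \<in> trees" and x: "x \<in> trees_upto (Suc n)"
  shows "relabel_prob (Suc n) t x = (if root_degree t = root_degree x then
    ennreal (1 / fact (root_degree x)) * (\<Sum>q | q permutes {1..root_degree x}.
      \<Prod>k\<in>{1..root_degree x}. relabel_prob n (subtree t k) (subtree x (q k))) else 0)"
proof (cases "root_degree t = root_degree x")
  case False
  then have "relabel_event t (Suc n) x = {}"
    using relabel_event_Suc[OF t x] by (auto simp: relabel_event_def)
  then show ?thesis using False by (simp add: relabel_prob_def)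
next
  case True
  let ?c = "root_degree x"
  have ev: "relabel_event (subtree t k) n (subtree x (q k)) \<in> sets (perm_family (subtree t k))"
    if "q permutes {1..?c}" "k \<in> {1..?c}" for q k
    using that True permutes_in_image[OF that(1)]
    by (intro relabel_event_sets subtree_in_trees[OF t] subtree_in_trees_upto[OF x]) auto
  have "relabel_prob (Suc n) t x = (\<integral>\<^sup>+p. indicator (relabel_event t (Suc n) x) p \<partial>perm_family t)"
    by (simp add: relabel_prob_def relabel_event_sets[OF t x])
  also have "\<dots> = (\<integral>\<^sup>+q. 1 * (\<Prod>k\<in>{1..?c}. \<integral>\<^sup>+p. indicator (relabel_event (subtree t k) n (subtree x (q k))) p
        \<partial>Pi\<^sub>M UNIV (\<lambda>v. perm_measure t (k # v))) \<partial>perm_measure t [])"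
  proof (rule nn_integral_list_branch)
    show "indicator (relabel_event t (Suc n) x) \<in> borel_measurable (perm_family t)"
      using relabel_event_sets[OF t x] by simp
    show "indicator (relabel_event (subtree t k) n (subtree x (q k))) \<in> borel_measurable (Pi\<^sub>M UNIV (\<lambda>v. perm_measure t (k # v)))"
      if "q \<in> space (perm_measure t [])" "k \<in> {1..?c}" for q k
      using ev[of q k] that True by (simp add: perm_family_subtree space_perm_measure)
    fix q F assume q: "q \<in> space (perm_measure t [])"
      and F: "\<And>k. F k \<in> space (Pi\<^sub>M UNIV (\<lambda>v. perm_measure t (k # v)))"
    have "(graft q F) v permutes {1..offspring t v}" for v
      using q F[of "hd v"]
      by (cases v) (auto simp: space_perm_measure perm_family_subtree space_perm_family tree_perms_def offspring_subtree)
    then have "graft q F \<in> tree_perms t" by (simp add: tree_perms_def)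
    then show "indicator (relabel_event t (Suc n) x) (graft q F) = 1 *
       (\<Prod>k\<in>{1..?c}. indicator (relabel_event (subtree t k) n (subtree x (q k))) (F k) :: ennreal)"
      by (subst prob_indicator_prod) (auto simp: relabel_event_Suc[OF t x] True)
  qed (auto simp: prob_space_perm_measure)
  also have "\<dots> = (\<integral>\<^sup>+q. (\<Prod>k\<in>{1..?c}. relabel_prob n (subtree t k) (subtree x (q k))) \<partial>perm_measure t [])"
    using ev True
    by (intro nn_integral_cong) (auto simp: perm_family_subtree relabel_prob_def space_perm_measure intro!: prod.cong)
  also have "\<dots> = ennreal (1 / fact ?c) * (\<Sum>q | q permutes {1..?c}. \<Prod>k\<in>{1..?c}. relabel_prob n (subtree t k) (subtree x (q k)))"
    unfolding perm_measure_def True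
    by (subst nn_integral_uniform_count_measure) (auto simp: finite_permutations card_permutations)
  finally show ?thesis using True by simp
qed

text \<open>Relabeling preserves depth, so the pruned result is determined by the first
  \<open>n\<close> levels. This is what makes the relabeling a measurable kernel on
  \<open>tree_space\<close>, whose sigma-algebra is generated by prunings.\<close>

lemma relabel_prob_prune:
  "t \<in> trees \<Longrightarrow> x \<in> trees_upto n \<Longrightarrow> relabel_prob n (prune n t) x = relabel_prob n t x"
proof (induction n arbitrary: t x)
  case 0 then show ?case by (simp add: relabel_prob_0 prune_in_trees)
next
  case (Suc n)
  have "relabel_prob n (prune n (subtree t k)) (subtree x (q k)) = relabel_prob n (subtree t k) (subtree x (q k))"
    if "q permutes {1..root_degree x}" "k \<in> {1..root_degree x}" "root_degree t = root_degree x" for q k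
    using that permutes_in_image[OF that(1)] subtree_in_trees[OF Suc.prems(1)] subtree_in_trees_upto[OF Suc.prems(2)]
    by (intro Suc.IH) auto
  then show ?case
    unfolding relabel_prob_Suc[OF prune_in_trees[OF Suc.prems(1)] Suc.prems(2)] relabel_prob_Suc[OF Suc.prems]
      root_degree_prune subtree_prune
    by (auto intro!: arg_cong2[where f = "(*)"] sum.cong prod.cong)
qed

lemma aug_prob_prune:
  "t \<in> trees \<Longrightarrow> y \<in> trees_upto n \<Longrightarrow> aug_prob \<alpha> \<mu> n (prune n t) y = aug_prob \<alpha> \<mu> n t y"
proof (induction n arbitrary: t y)
  case 0 then show ?case by (simp add: aug_prob_0)
next
  case (Suc n)
  have "aug_prob \<alpha> \<mu> n (prune n (subtree t k)) (subtree y k) = aug_prob \<alpha> \<mu> n (subtree t k) (subtree y k)"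
    if "k \<in> {1..root_degree t}" "root_degree t \<le> root_degree y" for k
    using that subtree_in_trees[OF Suc.prems(1)] subtree_in_trees_upto[OF Suc.prems(2)]
    by (intro Suc.IH) auto
  then show ?case
    unfolding aug_prob_Suc[OF prune_in_trees[OF Suc.prems(1)] Suc.prems(2)] aug_prob_Suc[OF Suc.prems]
      root_degree_prune subtree_prune
    by (auto intro!: arg_cong2[where f = "(*)"] prod.cong)
qed

section \<open>Relabeling and augmentation as measurable kernels\<close>

lemma borel_measurable_tree_space:
  assumes "\<And>t. t \<in> trees \<Longrightarrow> f (prune n t) = f t"
  shows "(f :: tree \<Rightarrow> ennreal) \<in> borel_measurable tree_space"
proof -
  have "(\<lambda>t. f (prune n t)) \<in> borel_measurable tree_space"
    by (rule measurable_compose[OF measurable_prune]) simp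
  then show ?thesis by (subst measurable_cong[of _ _ "\<lambda>t. f (prune n t)"]) (simp_all add: assms)
qed

lemma measurable_tree_of: "tree_of \<in> poisson_family \<mu> \<rightarrow>\<^sub>M tree_space"
  using gw_event_sets by (intro measurable_tree_space) (auto simp: tree_of_in_trees gw_event_def)

lemma measurable_augment:
  assumes "t \<in> trees"
  shows "(\<lambda>(A, B). augment t A B) \<in> poisson_family \<alpha> \<Otimes>\<^sub>M poisson_family \<mu> \<rightarrow>\<^sub>M tree_space"
proof (rule measurable_tree_space)
  fix n x assume "x \<in> trees_upto n"
  from aug_event_sets[OF assms this, of \<alpha> \<mu>]
  show "{\<omega> \<in> space (poisson_family \<alpha> \<Otimes>\<^sub>M poisson_family \<mu>). prune n ((\<lambda>(A, B). augment t A B) \<omega>) = x}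
    \<in> sets (poisson_family \<alpha> \<Otimes>\<^sub>M poisson_family \<mu>)"
    by (simp add: space_pair_measure aug_event_def split_def)
qed (auto simp: augment_in_trees)

lemma measurable_relabel:
  assumes "t \<in> trees"
  shows "relabel t \<in> perm_family t \<rightarrow>\<^sub>M tree_space"
  using relabel_event_sets[OF assms]
  by (intro measurable_tree_space) (auto simp: relabel_in_trees[OF assms] space_perm_family relabel_event_def)

lemma uniform_relabeling_eq: "uniform_relabeling t = distr (perm_family t) tree_space (relabel t)"
  by (simp add: uniform_relabeling_def perm_measure_def[abs_def])

text \<open>Two pruning events are nested or disjoint, so together with the empty set they form an
  intersection-stable generator. Measurability of a kernel therefore only needs to be checked on
  them.\<close>

lemma tree_kernel:
  assumes K: "\<And>t. t \<in> trees \<Longrightarrow> prob_space (K t)" "\<And>t. t \<in> trees \<Longrightarrow> sets (K t) = sets tree_space"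
    and m: "\<And>n x. x \<in> trees_upto n \<Longrightarrow> (\<lambda>t. emeasure (K t) (tree_event n x)) \<in> borel_measurable tree_space"
  shows "K \<in> tree_space \<rightarrow>\<^sub>M prob_algebra tree_space"
proof (rule measurable_prob_algebra_generated)
  let ?G = "{{t \<in> trees. prune n t = x} | n x. x \<in> trees_upto n}"
  show "sets tree_space = sigma_sets trees (insert {} ?G)"
    unfolding sets_tree_space
    by (intro sigma_sets_eqI) (auto intro: sigma_sets.Basic sigma_sets.Empty)
  show "Int_stable (insert {} ?G)"
  proof (rule Int_stableI)
    have *: "{t \<in> trees. prune n t = x} \<inter> {t \<in> trees. prune m t = y} \<in> insert {} ?G"
      if "x \<in> trees_upto n" "y \<in> trees_upto m" "n \<le> m" for n m x y
    proof (cases "prune n y = x")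
      case True
      have "{t \<in> trees. prune n t = x} \<inter> {t \<in> trees. prune m t = y} = {t \<in> trees. prune m t = y}"
        using True \<open>n \<le> m\<close> by (auto simp: prune_prune min_def split: if_splits)
      then show ?thesis using that(2) by auto
    next
      case False
      then have "{t \<in> trees. prune n t = x} \<inter> {t \<in> trees. prune m t = y} = {}"
        using \<open>n \<le> m\<close> by (auto simp: prune_prune min_def split: if_splits)
      then show ?thesis by simp
    qed
    fix a b assume ab: "a \<in> insert {} ?G" "b \<in> insert {} ?G"
    show "a \<inter> b \<in> insert {} ?G"
    proof (cases "a = {} \<or> b = {}")
      case False
      with ab obtain n x m y where "a = {t \<in> trees. prune n t = x}" "x \<in> trees_upto n"
         "b = {t \<in> trees. prune m t = y}" "y \<in> trees_upto m" by auto
      then show ?thesis using *[of x n y m] *[of y m x n] by (metis (no_types, lifting) Int_commute linear)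
    qed auto
  qed
  show "insert {} ?G \<subseteq> Pow trees" by auto
  fix A assume "A \<in> insert {} ?G"
  then show "(\<lambda>a. emeasure (K a) A) \<in> borel_measurable tree_space"
    using m by (auto simp: tree_event_def)
qed (use K in auto)

lemma emeasure_uniform_relabeling:
  assumes "t \<in> trees" "x \<in> trees_upto n"
  shows "emeasure (uniform_relabeling t) (tree_event n x) = relabel_prob n t x"
  using measurable_relabel[OF assms(1)] tree_event_sets[OF assms(2)] unfolding uniform_relabeling_eq
  by (subst emeasure_distr)
     (auto simp: relabel_prob_def relabel_event_def tree_event_def space_perm_family relabel_in_trees[OF assms(1)]
       intro!: arg_cong[where f = "emeasure _"])

lemma uniform_relabeling_kernel: "uniform_relabeling \<in> tree_space \<rightarrow>\<^sub>M prob_algebra tree_space"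
proof (rule tree_kernel)
  show "prob_space (uniform_relabeling t)" if "t \<in> trees" for t
    unfolding uniform_relabeling_eq
    by (intro prob_space.prob_space_distr prob_space_PiM prob_space_perm_measure measurable_relabel[OF that])
  show "(\<lambda>t. emeasure (uniform_relabeling t) (tree_event n x)) \<in> borel_measurable tree_space" if "x \<in> trees_upto n" for n x
    using that
    by (intro borel_measurable_tree_space[of _ n])
       (auto simp: emeasure_uniform_relabeling relabel_prob_prune prune_in_trees)
qed (simp add: uniform_relabeling_def)

lemma emeasure_augmentation:
  assumes "t \<in> trees" "y \<in> trees_upto n"
  shows "emeasure (augmentation lam s t) (tree_event n y) = aug_prob (lam * (1 - s)) lam n t y"
  using measurable_augment[OF assms(1), of "lam * (1 - s)" lam] tree_event_sets[OF assms(2)] unfolding augmentation_def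
  by (subst emeasure_distr)
     (auto simp: aug_prob_def aug_event_def tree_event_def augment_in_trees space_pair_measure
       intro!: arg_cong[where f = "emeasure _"])

lemma augmentation_kernel: "augmentation lam s \<in> tree_space \<rightarrow>\<^sub>M prob_algebra tree_space"
proof (rule tree_kernel)
  show "prob_space (augmentation lam s t)" if "t \<in> trees" for t
    unfolding augmentation_def
    by (intro prob_space.prob_space_distr prob_space_pair_poisson measurable_augment[OF that])
  show "(\<lambda>t. emeasure (augmentation lam s t) (tree_event n x)) \<in> borel_measurable tree_space" if "x \<in> trees_upto n" for n x
    using that
    by (intro borel_measurable_tree_space[of _ n])
       (auto simp: emeasure_augmentation aug_prob_prune prune_in_trees)
qed (simp add: augmentation_def)

lemma GW_prob_algebra: "GW \<mu> \<in> space (prob_algebra tree_space)"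
  unfolding GW_def space_prob_algebra
  by (auto intro: prob_space.prob_space_distr prob_space_poisson_family measurable_tree_of)

lemma emeasure_GW: "x \<in> trees_upto n \<Longrightarrow> emeasure (GW \<mu>) (tree_event n x) = gw_prob \<mu> n x"
  unfolding GW_def
  by (subst emeasure_distr[OF measurable_tree_of tree_event_sets])
     (auto simp: gw_prob_def gw_event_def tree_event_def tree_of_in_trees intro!: arg_cong[where f = "emeasure _"])


text \<open>The pruned relabeling depends on the augmentation only through its own pruning
  \<open>y\<close>, which takes countably many values; conditioning on \<open>y\<close> turns the
  bind into a sum.\<close>

lemma emeasure_relabeled_augmentation:
  assumes t: "t \<in> trees" and x: "x \<in> trees_upto n"
  shows "emeasure (augmentation lam s t \<bind> uniform_relabeling) (tree_event n x) =
    (\<integral>\<^sup>+y. relabel_prob n y x * aug_prob (lam * (1 - s)) lam n t y \<partial>count_space (trees_upto n))"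
proof -
  let ?A = "augmentation lam s t"
  have A: "?A \<in> space (prob_algebra tree_space)"
    using measurable_space[OF augmentation_kernel] t by simp
  then have sA [simp]: "sets ?A = sets tree_space" and spA: "space ?A = trees"
    by (auto simp: space_prob_algebra dest: sets_eq_imp_space_eq)
  have "emeasure (?A \<bind> uniform_relabeling) (tree_event n x) =
      (\<integral>\<^sup>+t'. emeasure (uniform_relabeling t') (tree_event n x) \<partial>?A)"
    by (rule emeasure_bind_prob_algebra[OF A uniform_relabeling_kernel tree_event_sets[OF x]])
  also have "\<dots> = (\<integral>\<^sup>+t'. \<integral>\<^sup>+y. relabel_prob n y x * indicator (tree_event n y) t' \<partial>count_space (trees_upto n) \<partial>?A)"
  proof (rule nn_integral_cong)
    fix t' assume "t' \<in> space ?A"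
    then have t': "t' \<in> trees" by (simp add: spA)
    have "(\<integral>\<^sup>+y. relabel_prob n y x * indicator (tree_event n y) t' \<partial>count_space (trees_upto n)) =
      (\<integral>\<^sup>+y. relabel_prob n y x * indicator {prune n t'} y \<partial>count_space (trees_upto n))"
      using t' by (intro nn_integral_cong) (auto simp: tree_event_def indicator_def)
    also have "\<dots> = relabel_prob n (prune n t') x"
      using prune_in_trees_upto[OF t', of n] by (subst nn_integral_indicator_singleton) auto
    finally show "emeasure (uniform_relabeling t') (tree_event n x) =
       (\<integral>\<^sup>+y. relabel_prob n y x * indicator (tree_event n y) t' \<partial>count_space (trees_upto n))"
      by (simp add: emeasure_uniform_relabeling[OF t' x] relabel_prob_prune[OF t' x])
  qed
  also have "\<dots> = (\<integral>\<^sup>+y. \<integral>\<^sup>+t'. relabel_prob n y x * indicator (tree_event n y) t' \<partial>?A \<partial>count_space (trees_upto n))"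
    by (intro nn_integral_count_space_nn_integral[OF countable_trees_upto] borel_measurable_times_ennreal
        borel_measurable_const borel_measurable_indicator) (simp add: tree_event_sets)
  also have "\<dots> = (\<integral>\<^sup>+y. relabel_prob n y x * aug_prob (lam * (1 - s)) lam n t y \<partial>count_space (trees_upto n))"
    by (intro nn_integral_cong, subst nn_integral_cmult_indicator)
      (simp_all add: tree_event_sets emeasure_augmentation[OF t])
  finally show ?thesis .
qed

text \<open>Probability that two augmentations of one Galton--Watson tree of rate
  \<open>lam * s\<close>, drawn independently given that tree, prune to \<open>y\<close> and
  \<open>y'\<close>. The product under the integral is this conditional independence.\<close>

definition aug_pair_prob :: "real \<Rightarrow> real \<Rightarrow> nat \<Rightarrow> tree \<Rightarrow> tree \<Rightarrow> ennreal" where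
  "aug_pair_prob lam s n y y' = (\<integral>\<^sup>+N. aug_prob (lam * (1 - s)) lam n (tree_of N) y *
     aug_prob (lam * (1 - s)) lam n (tree_of N) y' \<partial>poisson_family (lam * s))"

lemma aug_prob_measurable: "y \<in> trees_upto n \<Longrightarrow> (\<lambda>t. aug_prob \<alpha> \<mu> n t y) \<in> borel_measurable tree_space"
  by (rule borel_measurable_tree_space[where n = n]) (simp add: aug_prob_prune)

text \<open>Given the common tree the two sides are independent. Expanding each over its
  augmentation before relabeling, and exchanging sums and integral, isolates
  \<open>aug_pair_prob\<close> as the only factor that couples the sides.\<close>

lemma P1_prob:
  assumes x: "x \<in> trees_upto n" and x': "x' \<in> trees_upto n"
  shows "emeasure (P1 lam s) (tree_event n x \<times> tree_event n x') =
    (\<integral>\<^sup>+y. \<integral>\<^sup>+y'. relabel_prob n y x * relabel_prob n y' x' * aug_pair_prob lam s n y y'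
       \<partial>count_space (trees_upto n) \<partial>count_space (trees_upto n))"
proof -
  let ?K = "\<lambda>t. augmentation lam s t \<bind> uniform_relabeling"
  let ?a = "aug_prob (lam * (1 - s)) lam n"
  let ?X = "count_space (trees_upto n)"
  have K: "?K \<in> tree_space \<rightarrow>\<^sub>M prob_algebra tree_space"
    by (rule measurable_bind_prob_space[OF augmentation_kernel uniform_relabeling_kernel])
  have KK: "(\<lambda>t. ?K t \<Otimes>\<^sub>M ?K t) \<in> tree_space \<rightarrow>\<^sub>M prob_algebra (tree_space \<Otimes>\<^sub>M tree_space)"
    by (rule measurable_pair_prob[OF K K])
  have sGW [simp]: "sets (GW \<mu>) = sets tree_space" "space (GW \<mu>) = trees" for \<mu>
    by (auto simp: GW_def)
  note [measurable] = aug_prob_measurable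
  have am [measurable]: "(\<lambda>t. ?a t y) \<in> borel_measurable (GW \<mu>)" if "y \<in> trees_upto n" for y \<mu>
    using aug_prob_measurable[OF that] by (simp cong: measurable_cong_sets)
  have "emeasure (P1 lam s) (tree_event n x \<times> tree_event n x') =
     (\<integral>\<^sup>+t. emeasure (?K t \<Otimes>\<^sub>M ?K t) (tree_event n x \<times> tree_event n x') \<partial>GW (lam * s))"
    unfolding P1_def
    by (rule emeasure_bind_prob_algebra[OF GW_prob_algebra KK]) (intro pair_measureI tree_event_sets x x')
  also have "\<dots> = (\<integral>\<^sup>+t. (\<integral>\<^sup>+y. relabel_prob n y x * ?a t y \<partial>?X) * (\<integral>\<^sup>+y'. relabel_prob n y' x' * ?a t y' \<partial>?X) \<partial>GW (lam * s))"
  proof (rule nn_integral_cong)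
    fix t assume "t \<in> space (GW (lam * s))"
    then have t: "t \<in> trees" by simp
    have Kt: "?K t \<in> space (prob_algebra tree_space)" using measurable_space[OF K] t by simp
    interpret Kt: prob_space "?K t" using Kt by (simp add: space_prob_algebra)
    have "sets (?K t) = sets tree_space" using Kt by (simp add: space_prob_algebra)
    then have "emeasure (?K t \<Otimes>\<^sub>M ?K t) (tree_event n x \<times> tree_event n x') =
       emeasure (?K t) (tree_event n x) * emeasure (?K t) (tree_event n x')"
      by (intro Kt.emeasure_pair_measure_Times) (simp_all add: tree_event_sets x x')
    then show "emeasure (?K t \<Otimes>\<^sub>M ?K t) (tree_event n x \<times> tree_event n x') =
      (\<integral>\<^sup>+y. relabel_prob n y x * ?a t y \<partial>?X) * (\<integral>\<^sup>+y'. relabel_prob n y' x' * ?a t y' \<partial>?X)"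
      by (simp add: emeasure_relabeled_augmentation[OF t x] emeasure_relabeled_augmentation[OF t x'])
  qed
  also have "\<dots> = (\<integral>\<^sup>+t. \<integral>\<^sup>+y. \<integral>\<^sup>+y'. relabel_prob n y x * relabel_prob n y' x' * (?a t y * ?a t y') \<partial>?X \<partial>?X \<partial>GW (lam * s))"
  proof (rule nn_integral_cong)
    fix t
    let ?f = "\<lambda>y. relabel_prob n y x * ?a t y" and ?g = "\<lambda>y'. relabel_prob n y' x' * ?a t y'"
    have "(\<integral>\<^sup>+y. ?f y \<partial>?X) * (\<integral>\<^sup>+y'. ?g y' \<partial>?X) = (\<integral>\<^sup>+y. ?f y * (\<integral>\<^sup>+y'. ?g y' \<partial>?X) \<partial>?X)"
      by (rule nn_integral_multc[symmetric]) simp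
    also have "\<dots> = (\<integral>\<^sup>+y. \<integral>\<^sup>+y'. ?f y * ?g y' \<partial>?X \<partial>?X)"
      by (intro nn_integral_cong nn_integral_cmult[symmetric]) simp
    finally show "(\<integral>\<^sup>+y. ?f y \<partial>?X) * (\<integral>\<^sup>+y'. ?g y' \<partial>?X) =
      (\<integral>\<^sup>+y. \<integral>\<^sup>+y'. relabel_prob n y x * relabel_prob n y' x' * (?a t y * ?a t y') \<partial>?X \<partial>?X)"
      by (simp add: mult_ac)
  qed
  also have "\<dots> = (\<integral>\<^sup>+y. \<integral>\<^sup>+t. \<integral>\<^sup>+y'. relabel_prob n y x * relabel_prob n y' x' * (?a t y * ?a t y') \<partial>?X \<partial>GW (lam * s) \<partial>?X)"
  proof (rule nn_integral_count_space_nn_integral[OF countable_trees_upto])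
    fix y assume y: "y \<in> trees_upto n"
    interpret X: sigma_finite_measure ?X
      by (rule sigma_finite_measure_count_space_countable[OF countable_trees_upto])
    let ?h = "\<lambda>t y'. relabel_prob n y x * relabel_prob n y' x' * (?a t y * ?a t y')"
    have "(\<lambda>z. ?h (fst z) (snd z)) \<in> borel_measurable (GW (lam * s) \<Otimes>\<^sub>M ?X)"
    proof (rule measurable_compose_countable'[where f = "\<lambda>y' z. ?h (fst z) y'" and g = snd and I = "trees_upto n"])
      fix y' assume "y' \<in> trees_upto n"
      then have "(\<lambda>t. ?h t y') \<in> borel_measurable (GW (lam * s))"
        using y by measurable
      then show "(\<lambda>z. ?h (fst z) y') \<in> borel_measurable (GW (lam * s) \<Otimes>\<^sub>M ?X)"
        by (rule measurable_compose[OF measurable_fst])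
    qed (auto intro: countable_trees_upto)
    then show "(\<lambda>t. \<integral>\<^sup>+y'. ?h t y' \<partial>?X) \<in> borel_measurable (GW (lam * s))"
      by (intro X.borel_measurable_nn_integral) (simp add: split_def)
  qed
  also have "\<dots> = (\<integral>\<^sup>+y. \<integral>\<^sup>+y'. \<integral>\<^sup>+t. relabel_prob n y x * relabel_prob n y' x' * (?a t y * ?a t y') \<partial>GW (lam * s) \<partial>?X \<partial>?X)"
    by (intro nn_integral_cong nn_integral_count_space_nn_integral[OF countable_trees_upto]) simp
  also have "\<dots> = (\<integral>\<^sup>+y. \<integral>\<^sup>+y'. relabel_prob n y x * relabel_prob n y' x' * (\<integral>\<^sup>+t. ?a t y * ?a t y' \<partial>GW (lam * s)) \<partial>?X \<partial>?X)"
    by (intro nn_integral_cong nn_integral_cmult) simp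
  also have "\<dots> = (\<integral>\<^sup>+y. \<integral>\<^sup>+y'. relabel_prob n y x * relabel_prob n y' x' * aug_pair_prob lam s n y y' \<partial>?X \<partial>?X)"
    unfolding aug_pair_prob_def GW_def
    by (intro nn_integral_cong arg_cong2[where f = "(*)"] refl nn_integral_distr measurable_tree_of)
       (auto intro!: borel_measurable_times_ennreal aug_prob_measurable)
  finally show ?thesis .
qed

lemma P0_prob:
  assumes x: "x \<in> trees_upto n" and x': "x' \<in> trees_upto n"
  shows "emeasure (P0 lam) (tree_event n x \<times> tree_event n x') = gw_prob lam n x * gw_prob lam n x'"
proof -
  interpret GW: prob_space "GW lam" using GW_prob_algebra by (simp add: space_prob_algebra)
  have "sets (GW lam) = sets tree_space" by (simp add: GW_def)
  then show ?thesis unfolding P0_def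
    by (subst GW.emeasure_pair_measure_Times) (simp_all add: tree_event_sets emeasure_GW x x')
qed

lemma emeasure_prune_law:
  assumes P: "sets P = sets (tree_space \<Otimes>\<^sub>M tree_space)" and S: "S \<subseteq> trees_upto n \<times> trees_upto n"
  shows "emeasure (prune_law n P) S =
    (\<integral>\<^sup>+z. emeasure P (tree_event n (fst z) \<times> tree_event n (snd z)) \<partial>count_space S)"
proof -
  let ?X = "trees_upto n \<times> trees_upto n"
  have cX: "countable ?X" by (intro countable_SIGMA countable_trees_upto)
  have cS: "countable S" by (rule countable_subset[OF S cX])
  have sp: "space P = trees \<times> trees" using sets_eq_imp_space_eq[OF P] by (simp add: space_pair_measure)
  have vim: "(\<lambda>(t, t'). (prune n t, prune n t')) -` {z} \<inter> space P = tree_event n (fst z) \<times> tree_event n (snd z)" for z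
    by (auto simp: sp tree_event_def)
  have ev: "tree_event n (fst z) \<times> tree_event n (snd z) \<in> sets P" if "z \<in> ?X" for z
    using that unfolding P by (intro pair_measureI tree_event_sets) auto
  have m: "(\<lambda>(t, t'). (prune n t, prune n t')) \<in> P \<rightarrow>\<^sub>M count_space ?X"
  proof (rule measurable_count_space_eq_countable[THEN iffD2, OF cX], intro conjI ballI)
    show "(\<lambda>(t, t'). (prune n t, prune n t')) \<in> space P \<rightarrow> ?X" by (auto simp: sp prune_in_trees_upto)
    show "(\<lambda>(t, t'). (prune n t, prune n t')) -` {z} \<inter> space P \<in> sets P" if "z \<in> ?X" for z
      using ev[OF that] by (simp add: vim)
  qed
  have "emeasure (prune_law n P) S = emeasure P (\<Union>z\<in>S. tree_event n (fst z) \<times> tree_event n (snd z))"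
    unfolding prune_law_def using S
    by (subst emeasure_distr[OF m]) (auto simp: vim[symmetric] intro!: arg_cong[where f = "emeasure P"])
  also have "\<dots> = (\<integral>\<^sup>+z. emeasure P (tree_event n (fst z) \<times> tree_event n (snd z)) \<partial>count_space S)"
    using S ev by (intro emeasure_UN_countable cS) (auto simp: disjoint_family_on_def tree_event_def)
  finally show ?thesis .
qed

lemma aug_pair_prob_0:
  assumes "y \<in> trees_upto 0" "y' \<in> trees_upto 0"
  shows "aug_pair_prob lam s 0 y y' = 1"
  using prob_space.emeasure_space_1[OF prob_space_poisson_family, of "lam * s"]
  by (simp add: aug_pair_prob_def aug_prob_0[OF assms(1)] aug_prob_0[OF assms(2)])

text \<open>Conditional probability of the pair \<open>y\<close>, \<open>y'\<close> when the root of
  the common tree has \<open>m\<close> children: these are the first \<open>m\<close> children on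
  each side, the others were added independently. \<open>D\<close> and \<open>g\<close> stand for
  the laws of pairs and of single trees one level down.\<close>

definition pair_weight :: "real \<Rightarrow> real \<Rightarrow> (tree \<Rightarrow> tree \<Rightarrow> ennreal) \<Rightarrow> (tree \<Rightarrow> ennreal) \<Rightarrow> tree \<Rightarrow> tree \<Rightarrow> nat \<Rightarrow> ennreal" where
  "pair_weight lam s D g y y' m = (if m \<le> root_degree y \<and> m \<le> root_degree y' then
      ennreal (pmf (poisson (lam * (1 - s))) (root_degree y - m)) *
      ennreal (pmf (poisson (lam * (1 - s))) (root_degree y' - m)) *
      (\<Prod>k\<in>{1..m}. D (subtree y k) (subtree y' k)) *
      (\<Prod>k\<in>{Suc m..root_degree y}. g (subtree y k)) *
      (\<Prod>k\<in>{Suc m..root_degree y'}. g (subtree y' k)) else 0)"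

lemma aug_pair_prob_Suc:
  assumes y: "y \<in> trees_upto (Suc n)" and y': "y' \<in> trees_upto (Suc n)"
  shows "aug_pair_prob lam s (Suc n) y y' =
    (\<integral>\<^sup>+m. pair_weight lam s (aug_pair_prob lam s n) (gw_prob lam n) y y' m \<partial>measure_pmf (poisson (lam * s)))"
proof -
  let ?al = "lam * (1 - s)"
  let ?c = "root_degree y" and ?c' = "root_degree y'"
  let ?w = "\<lambda>m. if m \<le> ?c \<and> m \<le> ?c' then
      ennreal (pmf (poisson ?al) (?c - m)) * ennreal (pmf (poisson ?al) (?c' - m)) *
      (\<Prod>k\<in>{Suc m..?c}. gw_prob lam n (subtree y k)) * (\<Prod>k\<in>{Suc m..?c'}. gw_prob lam n (subtree y' k)) else 0"
  let ?h = "\<lambda>k N. aug_prob ?al lam n (tree_of N) (subtree y k) * aug_prob ?al lam n (tree_of N) (subtree y' k)"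
  have meas: "(\<lambda>N. aug_prob ?al lam n (tree_of N) y) \<in> borel_measurable (poisson_family (lam * s))"
    if "y \<in> trees_upto n" for n y
    by (rule measurable_compose[OF measurable_tree_of aug_prob_measurable[OF that]])
  \<comment> \<open>The factors must belong to existing children of both trees, hence the cap on
    \<open>m\<close> in the index set; beyond the cap the weight is 0.\<close>
  have "aug_pair_prob lam s (Suc n) y y' =
    (\<integral>\<^sup>+m. ?w m * (\<Prod>k\<in>{1..min m (min ?c ?c')}. \<integral>\<^sup>+N. ?h k N \<partial>poisson_family (lam * s)) \<partial>measure_pmf (poisson (lam * s)))"
    unfolding aug_pair_prob_def poisson_family_def
  proof (rule nn_integral_list_branch)
    show "(\<lambda>N. aug_prob ?al lam (Suc n) (tree_of N) y * aug_prob ?al lam (Suc n) (tree_of N) y')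
      \<in> borel_measurable (Pi\<^sub>M UNIV (\<lambda>_. measure_pmf (poisson (lam * s))))"
      using meas[OF y] meas[OF y'] unfolding poisson_family_def by (rule borel_measurable_times_ennreal)
    show "?h k \<in> borel_measurable (Pi\<^sub>M UNIV (\<lambda>_. measure_pmf (poisson (lam * s))))"
      if "k \<in> {1..min m (min ?c ?c')}" for k m
      using meas[OF subtree_in_trees_upto[OF y, of k]] meas[OF subtree_in_trees_upto[OF y', of k]] that
      unfolding poisson_family_def by (intro borel_measurable_times_ennreal) auto
    fix m F
    show "aug_prob ?al lam (Suc n) (tree_of (graft m F)) y * aug_prob ?al lam (Suc n) (tree_of (graft m F)) y' =
      ?w m * (\<Prod>k\<in>{1..min m (min ?c ?c')}. ?h k (F k))"
    proof (cases "m \<le> ?c \<and> m \<le> ?c'")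
      case True
      have sub: "subtree (tree_of (graft m F)) k = tree_of (F k)" if "k \<in> {1..m}" for k
        using that subtree_tree_of[of k "graft m F"] by simp
      have "min m (min ?c ?c') = m" using True by simp
      then show ?thesis
        using True
        by (simp add: aug_prob_Suc[OF tree_of_in_trees] y y' root_degree_tree_of sub prod.distrib mult_ac)
    next
      case False
      then show ?thesis
        by (auto simp: aug_prob_Suc[OF tree_of_in_trees] y y' root_degree_tree_of)
    qed
  qed (auto simp: prob_space_measure_pmf)
  also have "\<dots> = (\<integral>\<^sup>+m. pair_weight lam s (aug_pair_prob lam s n) (gw_prob lam n) y y' m \<partial>measure_pmf (poisson (lam * s)))"
    by (intro nn_integral_cong) (auto simp: pair_weight_def aug_pair_prob_def min_def mult_ac)
  finally show ?thesis .
qed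

section \<open>Pairs of augmentations\<close>

text \<open>A pair of augmentations of a common tree, before relabeling. The three lists contain the common
  children of a node and those private to the first and to the second augmentation; the two
  augmentations are read off by \<open>children True\<close> and \<open>children False\<close>.\<close>

datatype ctree = CNode "ctree list" "ctree list" "ctree list"

primrec children :: "bool \<Rightarrow> ctree \<Rightarrow> ctree list" where
  "children b (CNode cs ls rs) = cs @ (if b then ls else rs)"

primrec common :: "ctree \<Rightarrow> ctree list" where
  "common (CNode cs ls rs) = cs"

primrec enc_mem :: "bool \<Rightarrow> nat list \<Rightarrow> ctree \<Rightarrow> bool" where
  "enc_mem b [] t = True"
| "enc_mem b (k # u) t = (k \<in> {1..length (children b t)} \<and> enc_mem b u (children b t ! (k - 1)))"

text \<open>Positions in the child lists, shifted by one, serve as labels. Common children come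
  first, as the original children do in \<open>augment\<close>.\<close>

definition enc :: "bool \<Rightarrow> ctree \<Rightarrow> tree" where
  "enc b t = {u. enc_mem b u t}"

primrec enc_node :: "bool \<Rightarrow> nat list \<Rightarrow> ctree \<Rightarrow> ctree" where
  "enc_node b [] t = t"
| "enc_node b (k # u) t = enc_node b u (children b t ! (k - 1))"

lemma enc_mem_snoc:
  "enc_mem b (u @ [k]) t \<longleftrightarrow> enc_mem b u t \<and> k \<in> {1..length (children b (enc_node b u t))}"
  by (induction u arbitrary: t) auto

lemma enc_in_trees: "enc b t \<in> trees"
  by (rule treesI[where c = "\<lambda>u. length (children b (enc_node b u t))"])
    (auto simp: enc_def enc_mem_snoc)

lemma root_degree_enc: "root_degree (enc b t) = length (children b t)"
  by (simp add: offspring_def enc_def card_Suc0_le)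

lemma subtree_enc: "k \<in> {1..length (children b t)} \<Longrightarrow> subtree (enc b t) k = enc b (children b t ! (k - 1))"
  by (simp add: subtree_def enc_def)

text \<open>A private child carries a pair of trees as well, although the root reads only one of
  them: that one has offspring rate \<open>lam\<close> by superposition, as required of an attached
  tree. Using the same law for all children matches the exploration of the union graph, where a
  private edge may be followed by edges of any type.\<close>

primrec ctree_pmf :: "real \<Rightarrow> real \<Rightarrow> nat \<Rightarrow> ctree pmf" where
  "ctree_pmf lam s 0 = return_pmf (CNode [] [] [])"
| "ctree_pmf lam s (Suc n) =
     bind_pmf (poisson (lam * s)) (\<lambda>m. bind_pmf (poisson (lam * (1 - s))) (\<lambda>a. bind_pmf (poisson (lam * (1 - s))) (\<lambda>b.
       bind_pmf (replicate_pmf m (ctree_pmf lam s n)) (\<lambda>cs. bind_pmf (replicate_pmf a (ctree_pmf lam s n)) (\<lambda>ls.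
         map_pmf (CNode cs ls) (replicate_pmf b (ctree_pmf lam s n)))))))"

lemma pmf_poisson:
  assumes "\<mu> \<ge> 0" shows "pmf (poisson \<mu>) k = exp (-\<mu>) * \<mu> ^ k / fact k"
proof (cases "\<mu> = 0")
  case True then show ?thesis by (cases k) (auto simp: poisson_def)
next
  case False then show ?thesis using assms by (simp add: poisson_def)
qed

lemma nn_integral_replicate_pmf_prod:
  "(\<integral>\<^sup>+xs. (\<Prod>k\<in>{1..m}. f k (xs ! (k - 1))) \<partial>measure_pmf (replicate_pmf m p)) = (\<Prod>k\<in>{1..m}. \<integral>\<^sup>+x. f k x \<partial>measure_pmf p)"
proof (induction m arbitrary: f)
  case (Suc m)
  have r: "(\<Prod>k\<in>{1..Suc m}. g k) = g 1 * (\<Prod>k\<in>{1..m}. g (Suc k))" for g :: "nat \<Rightarrow> ennreal"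
    unfolding One_nat_def using prod.atLeast_Suc_atMost[of "Suc 0" "Suc m" g]
      prod.atLeast_Suc_atMost_Suc_shift[of g "Suc 0" m] by (simp only: o_def)
  have "(\<integral>\<^sup>+xs. (\<Prod>k\<in>{1..Suc m}. f k (xs ! (k - 1))) \<partial>measure_pmf (replicate_pmf (Suc m) p)) =
    (\<integral>\<^sup>+x. \<integral>\<^sup>+xs. f 1 x * (\<Prod>k\<in>{1..m}. f (Suc k) (xs ! (k - 1))) \<partial>measure_pmf (replicate_pmf m p) \<partial>measure_pmf p)"
    unfolding r by (simp add: nth_Cons')
  also have "\<dots> = (\<integral>\<^sup>+x. f 1 x * (\<Prod>k\<in>{1..m}. \<integral>\<^sup>+x. f (Suc k) x \<partial>measure_pmf p) \<partial>measure_pmf p)"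
    by (subst Suc.IH[symmetric]) (simp add: nn_integral_cmult)
  also have "\<dots> = (\<Prod>k\<in>{1..Suc m}. \<integral>\<^sup>+x. f k x \<partial>measure_pmf p)"
    unfolding r by (simp add: nn_integral_multc)
  finally show ?case .
qed simp

lemma nn_integral_replicate_pmf_cong:
  assumes "\<And>xs. length xs = m \<Longrightarrow> set xs \<subseteq> set_pmf p \<Longrightarrow> f xs = g xs"
  shows "(\<integral>\<^sup>+xs. f xs \<partial>measure_pmf (replicate_pmf m p)) = (\<integral>\<^sup>+xs. g xs \<partial>measure_pmf (replicate_pmf m p))"
  using assms by (intro nn_integral_cong_AE) (auto simp: AE_measure_pmf_iff set_replicate_pmf lists_eq_set)

text \<open>Discrete counterpart of \<open>nn_integral_list_branch\<close>. The factors may depend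
  on all three list lengths, and the factorisation is only asked for when the subtrees lie in the
  support.\<close>

lemma nn_integral_ctree_pmf_branch:
  fixes lam s :: real
  defines "P \<equiv> poisson (lam * s)" and "P' \<equiv> poisson (lam * (1 - s))"
  assumes f: "\<And>cs ls rs. set cs \<union> set ls \<union> set rs \<subseteq> set_pmf (ctree_pmf lam s n) \<Longrightarrow>
    f (CNode cs ls rs) = w (length cs) (length ls) (length rs) *
      (\<Prod>k\<in>{1..length cs}. fc (length cs) (length ls) (length rs) k (cs ! (k - 1))) *
      (\<Prod>k\<in>{1..length ls}. fl (length cs) (length ls) (length rs) k (ls ! (k - 1))) *
      (\<Prod>k\<in>{1..length rs}. fr (length cs) (length ls) (length rs) k (rs ! (k - 1)))"
  shows "(\<integral>\<^sup>+t. f t \<partial>measure_pmf (ctree_pmf lam s (Suc n))) =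
    (\<integral>\<^sup>+m. \<integral>\<^sup>+a. \<integral>\<^sup>+b. w m a b *
      (\<Prod>k\<in>{1..m}. \<integral>\<^sup>+t. fc m a b k t \<partial>measure_pmf (ctree_pmf lam s n)) *
      (\<Prod>k\<in>{1..a}. \<integral>\<^sup>+t. fl m a b k t \<partial>measure_pmf (ctree_pmf lam s n)) *
      (\<Prod>k\<in>{1..b}. \<integral>\<^sup>+t. fr m a b k t \<partial>measure_pmf (ctree_pmf lam s n))
      \<partial>measure_pmf P' \<partial>measure_pmf P' \<partial>measure_pmf P)"
proof -
  let ?U = "ctree_pmf lam s n"
  have "(\<integral>\<^sup>+cs. \<integral>\<^sup>+ls. \<integral>\<^sup>+rs. f (CNode cs ls rs) \<partial>measure_pmf (replicate_pmf b ?U) \<partial>measure_pmf (replicate_pmf a ?U) \<partial>measure_pmf (replicate_pmf m ?U))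
   = w m a b * (\<Prod>k\<in>{1..m}. \<integral>\<^sup>+t. fc m a b k t \<partial>measure_pmf ?U) *
      (\<Prod>k\<in>{1..a}. \<integral>\<^sup>+t. fl m a b k t \<partial>measure_pmf ?U) * (\<Prod>k\<in>{1..b}. \<integral>\<^sup>+t. fr m a b k t \<partial>measure_pmf ?U)" for m a b
  proof -
    have "(\<integral>\<^sup>+cs. \<integral>\<^sup>+ls. \<integral>\<^sup>+rs. f (CNode cs ls rs) \<partial>measure_pmf (replicate_pmf b ?U) \<partial>measure_pmf (replicate_pmf a ?U) \<partial>measure_pmf (replicate_pmf m ?U)) =
      (\<integral>\<^sup>+cs. \<integral>\<^sup>+ls. \<integral>\<^sup>+rs. w m a b * (\<Prod>k\<in>{1..m}. fc m a b k (cs ! (k - 1))) * (\<Prod>k\<in>{1..a}. fl m a b k (ls ! (k - 1))) *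
      (\<Prod>k\<in>{1..b}. fr m a b k (rs ! (k - 1))) \<partial>measure_pmf (replicate_pmf b ?U) \<partial>measure_pmf (replicate_pmf a ?U) \<partial>measure_pmf (replicate_pmf m ?U))"
      by (intro nn_integral_replicate_pmf_cong) (simp add: f)
    then show ?thesis
      by (simp add: nn_integral_cmult nn_integral_multc nn_integral_replicate_pmf_prod[simplified])
  qed
  then show ?thesis by (simp add: P_def P'_def)
qed

lemma prod_split_append:
  fixes F :: "nat \<Rightarrow> ennreal"
  assumes "m \<le> c" shows "(\<Prod>k\<in>{1..c}. F k) = (\<Prod>k\<in>{1..m}. F k) * (\<Prod>k\<in>{Suc m..c}. F k)"
proof -
  have "{1..c} = {1..m} \<union> {Suc m..c}" using assms by auto
  then show ?thesis by (simp add: prod.union_disjoint)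
qed

lemma prod_shift: "(\<Prod>k\<in>{Suc m..m + a}. F k) = (\<Prod>k\<in>{1..a}. F (m + k) :: ennreal)"
  using prod.atLeastAtMost_shift_bounds[of F 1 m a] by (simp add: add.commute)

lemma prod_children:
  fixes F :: "nat \<Rightarrow> ctree \<Rightarrow> ennreal"
  shows "(\<Prod>k\<in>{1..length cs + length es}. F k ((cs @ es) ! (k - 1))) =
    (\<Prod>k\<in>{1..length cs}. F k (cs ! (k - 1))) * (\<Prod>k\<in>{1..length es}. F (length cs + k) (es ! (k - 1)))"
proof -
  have "(\<Prod>k\<in>{1..length cs + length es}. F k ((cs @ es) ! (k - 1))) =
    (\<Prod>k\<in>{1..length cs}. F k ((cs @ es) ! (k - 1))) * (\<Prod>k\<in>{1..length es}. F (length cs + k) ((cs @ es) ! (length cs + k - 1)))"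
    by (subst prod_split_append[of "length cs"]) (auto simp: prod_shift)
  also have "(\<Prod>k\<in>{1..length cs}. F k ((cs @ es) ! (k - 1))) = (\<Prod>k\<in>{1..length cs}. F k (cs ! (k - 1)))"
    by (intro prod.cong refl) (auto simp: nth_append)
  also have "(\<Prod>k\<in>{1..length es}. F (length cs + k) ((cs @ es) ! (length cs + k - 1))) = (\<Prod>k\<in>{1..length es}. F (length cs + k) (es ! (k - 1)))"
    by (intro prod.cong refl) (auto simp: nth_append)
  finally show ?thesis .
qed

lemma nn_integral_pmf_add:
  fixes c :: nat
  shows "(\<integral>\<^sup>+a. (if m + a = c then h a else 0) \<partial>measure_pmf p) = (if m \<le> c then ennreal (pmf p (c - m)) * h (c - m) else 0)"
proof (cases "m \<le> c")
  case True
  then have "m + a = c \<longleftrightarrow> a = c - m" for a by auto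
  then have "(\<integral>\<^sup>+a. (if m + a = c then h a else 0) \<partial>measure_pmf p) = (\<integral>\<^sup>+a. (if a = c - m then h (c - m) else 0) \<partial>measure_pmf p)"
    by (intro nn_integral_cong) simp
  then show ?thesis using True by (simp add: nn_integral_pmf_single)
qed simp

lemma nn_integral_pmf_atMost:
  fixes c :: nat
  shows "(\<integral>\<^sup>+m. (if m \<le> c then h m else 0) \<partial>measure_pmf p) = (\<Sum>m\<le>c. ennreal (pmf p m) * h m)"
proof -
  have "(\<integral>\<^sup>+m. (if m \<le> c then h m else 0) \<partial>measure_pmf p) = (\<integral>\<^sup>+m. (\<Sum>j\<le>c. if m = j then h j else 0) \<partial>measure_pmf p)"
    by (intro nn_integral_cong) (simp add: sum.delta')
  also have "\<dots> = (\<Sum>m\<le>c. ennreal (pmf p m) * h m)"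
    by (subst nn_integral_sum) (simp_all add: nn_integral_pmf_single)
  finally show ?thesis .
qed

text \<open>With the exponentials and \<open>1 / fact c\<close> extracted, the sum is a binomial
  expansion.\<close>

lemma poisson_superposition:
  assumes "\<mu> \<ge> 0" "\<nu> \<ge> 0"
  shows "(\<Sum>m\<le>c. pmf (poisson \<mu>) m * pmf (poisson \<nu>) (c - m)) = pmf (poisson (\<mu> + \<nu>)) c"
proof -
  have "(\<Sum>m\<le>c. pmf (poisson \<mu>) m * pmf (poisson \<nu>) (c - m)) =
    (\<Sum>m\<le>c. exp (-(\<mu> + \<nu>)) / fact c * (of_nat (c choose m) * \<mu> ^ m * \<nu> ^ (c - m)))"
    using assms by (intro sum.cong refl) (simp add: pmf_poisson exp_add[symmetric] binomial_fact field_simps)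
  also have "\<dots> = exp (-(\<mu> + \<nu>)) / fact c * (\<mu> + \<nu>) ^ c"
    by (simp only: binomial_ring sum_distrib_left)
  finally show ?thesis using assms by (simp add: pmf_poisson)
qed

section \<open>Laws of the two readings of a random \<open>ctree\<close>\<close>

context
  fixes lam s :: real
  assumes lam: "lam > 0" and s: "0 \<le> s" "s \<le> 1"
begin

lemma rates_nonneg: "lam * s \<ge> 0" "lam * (1 - s) \<ge> 0"
  using lam s by auto

lemma nn_integral_poisson_add:
  "(\<integral>\<^sup>+m. \<integral>\<^sup>+a. (if m + a = c then h else 0) \<partial>measure_pmf (poisson (lam * (1 - s))) \<partial>measure_pmf (poisson (lam * s)))
    = ennreal (pmf (poisson lam) c) * h"
proof -
  have "(\<integral>\<^sup>+m. \<integral>\<^sup>+a. (if m + a = c then h else 0) \<partial>measure_pmf (poisson (lam * (1 - s))) \<partial>measure_pmf (poisson (lam * s)))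
    = (\<Sum>m\<le>c. ennreal (pmf (poisson (lam * s)) m) * (ennreal (pmf (poisson (lam * (1 - s))) (c - m)) * h))"
    unfolding nn_integral_pmf_add nn_integral_pmf_atMost ..
  also have "\<dots> = (\<Sum>m\<le>c. ennreal (pmf (poisson (lam * s)) m * pmf (poisson (lam * (1 - s))) (c - m))) * h"
    by (simp add: sum_distrib_right ennreal_mult' mult.assoc)
  also have "(\<Sum>m\<le>c. ennreal (pmf (poisson (lam * s)) m * pmf (poisson (lam * (1 - s))) (c - m))) = ennreal (pmf (poisson lam) c)"
    using poisson_superposition[OF rates_nonneg, of c] by (subst sum_ennreal) (auto simp: algebra_simps)
  finally show ?thesis .
qed

text \<open>The rate \<open>lam\<close> is the superposition of common and private offspring.\<close>

lemma nn_integral_ctree_children: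
  assumes F: "\<And>t. t \<in> set_pmf (ctree_pmf lam s (Suc N)) \<Longrightarrow>
      f t = (if length (children b t) = c then \<Prod>k\<in>{1..c}. F k (children b t ! (k - 1)) else 0)"
  shows "(\<integral>\<^sup>+t. f t \<partial>measure_pmf (ctree_pmf lam s (Suc N))) =
    ennreal (pmf (poisson lam) c) * (\<Prod>k\<in>{1..c}. \<integral>\<^sup>+t. F k t \<partial>measure_pmf (ctree_pmf lam s N))"
proof -
  let ?U = "ctree_pmf lam s N"
  let ?e = "\<lambda>a a'. if b then a else a'"
  have "(\<integral>\<^sup>+t. f t \<partial>measure_pmf (ctree_pmf lam s (Suc N))) =
    (\<integral>\<^sup>+t. (if length (children b t) = c then \<Prod>k\<in>{1..c}. F k (children b t ! (k - 1)) else 0) \<partial>measure_pmf (ctree_pmf lam s (Suc N)))"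
    by (intro nn_integral_cong_AE) (auto simp: AE_measure_pmf_iff F)
  also have "\<dots> = (\<integral>\<^sup>+m. \<integral>\<^sup>+a. \<integral>\<^sup>+a'. (if m + ?e a a' = c then 1 else 0) *
      (\<Prod>k\<in>{1..m}. \<integral>\<^sup>+t. F k t \<partial>measure_pmf ?U) *
      (\<Prod>k\<in>{1..a}. \<integral>\<^sup>+t. (if b then F (m + k) t else 1) \<partial>measure_pmf ?U) *
      (\<Prod>k\<in>{1..a'}. \<integral>\<^sup>+t. (if b then 1 else F (m + k) t) \<partial>measure_pmf ?U)
      \<partial>measure_pmf (poisson (lam * (1 - s))) \<partial>measure_pmf (poisson (lam * (1 - s))) \<partial>measure_pmf (poisson (lam * s)))"
    by (rule nn_integral_ctree_pmf_branch) (auto simp: prod_children simp flip: One_nat_def)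
  also have "\<dots> = (\<integral>\<^sup>+m. \<integral>\<^sup>+a. \<integral>\<^sup>+a'. (if m + ?e a a' = c then \<Prod>k\<in>{1..c}. \<integral>\<^sup>+t. F k t \<partial>measure_pmf ?U else 0)
      \<partial>measure_pmf (poisson (lam * (1 - s))) \<partial>measure_pmf (poisson (lam * (1 - s))) \<partial>measure_pmf (poisson (lam * s)))"
  proof (intro nn_integral_cong)
    fix m a a'
    have "(\<Prod>k\<in>{1..c}. \<integral>\<^sup>+t. F k t \<partial>measure_pmf ?U) = (\<Prod>k\<in>{1..m}. \<integral>\<^sup>+t. F k t \<partial>measure_pmf ?U) * (\<Prod>k\<in>{1..?e a a'}. \<integral>\<^sup>+t. F (m + k) t \<partial>measure_pmf ?U)"
      if "m + ?e a a' = c"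
      unfolding that[symmetric] by (subst prod_split_append[of m]) (auto simp: prod_shift)
    then show "(if m + ?e a a' = c then 1 else 0) *
      (\<Prod>k\<in>{1..m}. \<integral>\<^sup>+t. F k t \<partial>measure_pmf ?U) *
      (\<Prod>k\<in>{1..a}. \<integral>\<^sup>+t. (if b then F (m + k) t else 1) \<partial>measure_pmf ?U) *
      (\<Prod>k\<in>{1..a'}. \<integral>\<^sup>+t. (if b then 1 else F (m + k) t) \<partial>measure_pmf ?U) =
      (if m + ?e a a' = c then \<Prod>k\<in>{1..c}. \<integral>\<^sup>+t. F k t \<partial>measure_pmf ?U else 0)"
      by (auto simp del: One_nat_def)
  qed
  also have "\<dots> = (\<integral>\<^sup>+m. \<integral>\<^sup>+a. (if m + a = c then \<Prod>k\<in>{1..c}. \<integral>\<^sup>+t. F k t \<partial>measure_pmf ?U else 0)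
      \<partial>measure_pmf (poisson (lam * (1 - s))) \<partial>measure_pmf (poisson (lam * s)))"
    by (cases b) simp_all
  finally show ?thesis unfolding nn_integral_poisson_add .
qed

text \<open>Each side by itself sees Poisson offspring of rate
  \<open>lam * s + lam * (1 - s) = lam\<close> at every node it reads. The sampled depth
  \<open>N\<close> only has to reach \<open>n\<close>.\<close>

lemma gw_prob_ctree:
  "n \<le> N \<Longrightarrow> x \<in> trees_upto n \<Longrightarrow>
    emeasure (measure_pmf (ctree_pmf lam s N)) {t. prune n (enc b t) = x} = gw_prob lam n x"
proof (induction n arbitrary: N x)
  case 0 then show ?case by (simp add: trees_upto_0 prune_0 enc_in_trees gw_prob_0)
next
  case (Suc n)
  then obtain N' where N: "N = Suc N'" "n \<le> N'" by (cases N) auto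
  let ?c = "root_degree x" and ?U = "ctree_pmf lam s N'"
  have "emeasure (measure_pmf (ctree_pmf lam s N)) {t. prune (Suc n) (enc b t) = x} =
     (\<integral>\<^sup>+t. indicator {t. prune (Suc n) (enc b t) = x} t \<partial>measure_pmf (ctree_pmf lam s (Suc N')))"
    unfolding N by (rule nn_integral_indicator[symmetric]) simp
  also have "\<dots> = ennreal (pmf (poisson lam) ?c) *
      (\<Prod>k\<in>{1..?c}. \<integral>\<^sup>+t. indicator {t. prune n (enc b t) = subtree x k} t \<partial>measure_pmf ?U)"
  proof (rule nn_integral_ctree_children)
    fix t
    show "indicator {t. prune (Suc n) (enc b t) = x} t = (if length (children b t) = ?c
      then \<Prod>k\<in>{1..?c}. indicator {t. prune n (enc b t) = subtree x k} (children b t ! (k - 1)) else 0 :: ennreal)"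
      by (subst prob_indicator_prod)
         (auto simp: indicator_def prune_Suc_eq_iff[OF enc_in_trees Suc.prems(2)] root_degree_enc subtree_enc)
  qed
  also have "\<dots> = gw_prob lam (Suc n) x"
    unfolding gw_prob_Suc[OF Suc.prems(2)] using Suc.IH[OF N(2) subtree_in_trees_upto[OF Suc.prems(2)]]
    by simp
  finally show ?case .
qed

text \<open>Common children carry pairs of the same law by induction; a private child is read by one
  side only and contributes a Galton--Watson factor. So the joint law of the two readings obeys the
  recursion of \<open>aug_pair_prob_Suc\<close>.\<close>

lemma aug_pair_prob_ctree:
  "n \<le> N \<Longrightarrow> y \<in> trees_upto n \<Longrightarrow> y' \<in> trees_upto n \<Longrightarrow>
    emeasure (measure_pmf (ctree_pmf lam s N)) {t. prune n (enc True t) = y \<and> prune n (enc False t) = y'} =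
      aug_pair_prob lam s n y y'"
proof (induction n arbitrary: N y y')
  case 0 then show ?case by (simp add: trees_upto_0 prune_0 enc_in_trees aug_pair_prob_0)
next
  case (Suc n)
  then obtain N' where N: "N = Suc N'" "n \<le> N'" by (cases N) auto
  let ?c = "root_degree y" and ?c' = "root_degree y'" and ?U = "ctree_pmf lam s N'"
  let ?E = "\<lambda>n y y'. {t. prune n (enc True t) = y \<and> prune n (enc False t) = y'}"
  let ?i = "\<lambda>b y. indicator {t. prune n (enc b t) = y} :: ctree \<Rightarrow> ennreal"
  have "emeasure (measure_pmf (ctree_pmf lam s N)) (?E (Suc n) y y') =
     (\<integral>\<^sup>+t. indicator (?E (Suc n) y y') t \<partial>measure_pmf (ctree_pmf lam s (Suc N')))"
    unfolding N by (rule nn_integral_indicator[symmetric]) simp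
  also have "\<dots> = (\<integral>\<^sup>+m. \<integral>\<^sup>+a. \<integral>\<^sup>+a'. (if m + a = ?c \<and> m + a' = ?c' then 1 else 0) *
      (\<Prod>k\<in>{1..m}. \<integral>\<^sup>+t. indicator (?E n (subtree y k) (subtree y' k)) t \<partial>measure_pmf ?U) *
      (\<Prod>k\<in>{1..a}. \<integral>\<^sup>+t. ?i True (subtree y (m + k)) t \<partial>measure_pmf ?U) *
      (\<Prod>k\<in>{1..a'}. \<integral>\<^sup>+t. ?i False (subtree y' (m + k)) t \<partial>measure_pmf ?U)
      \<partial>measure_pmf (poisson (lam * (1 - s))) \<partial>measure_pmf (poisson (lam * (1 - s))) \<partial>measure_pmf (poisson (lam * s)))"
  proof (rule nn_integral_ctree_pmf_branch)
    fix cs ls rs :: "ctree list"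
    let ?m = "length cs" and ?a = "length ls" and ?a' = "length rs"
    show "indicator (?E (Suc n) y y') (CNode cs ls rs) = (if ?m + ?a = ?c \<and> ?m + ?a' = ?c' then 1 else 0) *
      (\<Prod>k\<in>{1..?m}. indicator (?E n (subtree y k) (subtree y' k)) (cs ! (k - 1))) *
      (\<Prod>k\<in>{1..?a}. ?i True (subtree y (?m + k)) (ls ! (k - 1))) *
      (\<Prod>k\<in>{1..?a'}. ?i False (subtree y' (?m + k)) (rs ! (k - 1)))"
    proof (cases "?m + ?a = ?c \<and> ?m + ?a' = ?c'")
      case False then show ?thesis
        by (auto simp: indicator_def prune_Suc_eq_iff[OF enc_in_trees] Suc.prems root_degree_enc)
    next
      case True
      have i: "indicator {t. prune (Suc n) (enc b t) = z} (CNode cs ls rs) =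
        (\<Prod>k\<in>{1..length (children b (CNode cs ls rs))}. ?i b (subtree z k) (children b (CNode cs ls rs) ! (k - 1)))"
        if "z \<in> trees_upto (Suc n)" "length (children b (CNode cs ls rs)) = root_degree z" for b z
        using that by (subst prob_indicator_prod)
          (auto simp: indicator_def prune_Suc_eq_iff[OF enc_in_trees] root_degree_enc subtree_enc)
      have "indicator (?E (Suc n) y y') (CNode cs ls rs) = indicator {t. prune (Suc n) (enc True t) = y} (CNode cs ls rs) *
          (indicator {t. prune (Suc n) (enc False t) = y'} (CNode cs ls rs) :: ennreal)"
        by (simp add: indicator_def)
      also have "\<dots> = (\<Prod>k\<in>{1..?m + ?a}. ?i True (subtree y k) ((cs @ ls) ! (k - 1))) *
         (\<Prod>k\<in>{1..?m + ?a'}. ?i False (subtree y' k) ((cs @ rs) ! (k - 1)))"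
        using True by (subst (1 2) i) (auto simp: Suc.prems)
      also have "\<dots> = (\<Prod>k\<in>{1..?m}. ?i True (subtree y k) (cs ! (k - 1)) * ?i False (subtree y' k) (cs ! (k - 1))) *
        (\<Prod>k\<in>{1..?a}. ?i True (subtree y (?m + k)) (ls ! (k - 1))) *
      (\<Prod>k\<in>{1..?a'}. ?i False (subtree y' (?m + k)) (rs ! (k - 1)))"
        unfolding prod_children[where F = "\<lambda>k. ?i True (subtree y k)"]
          prod_children[where F = "\<lambda>k. ?i False (subtree y' k)"] prod.distrib by (simp only: mult_ac)
      also have "(\<Prod>k\<in>{1..?m}. ?i True (subtree y k) (cs ! (k - 1)) * ?i False (subtree y' k) (cs ! (k - 1))) =
         (\<Prod>k\<in>{1..?m}. indicator (?E n (subtree y k) (subtree y' k)) (cs ! (k - 1)))"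
        by (intro prod.cong refl) (simp add: indicator_def)
      finally show ?thesis using True by simp
    qed
  qed
  also have "\<dots> = (\<integral>\<^sup>+m. \<integral>\<^sup>+a. (if m + a = ?c then \<integral>\<^sup>+a'. (if m + a' = ?c' then
      (\<Prod>k\<in>{1..m}. aug_pair_prob lam s n (subtree y k) (subtree y' k)) *
      (\<Prod>k\<in>{Suc m..?c}. gw_prob lam n (subtree y k)) *
      (\<Prod>k\<in>{Suc m..?c'}. gw_prob lam n (subtree y' k)) else 0)
      \<partial>measure_pmf (poisson (lam * (1 - s))) else 0) \<partial>measure_pmf (poisson (lam * (1 - s))) \<partial>measure_pmf (poisson (lam * s)))"
  proof (intro nn_integral_cong)
    fix m a
    have A: "(\<Prod>k\<in>{1..m}. \<integral>\<^sup>+t. indicator (?E n (subtree y k) (subtree y' k)) t \<partial>measure_pmf ?U) =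
      (\<Prod>k\<in>{1..m}. aug_pair_prob lam s n (subtree y k) (subtree y' k))" if "m \<le> ?c" "m \<le> ?c'"
      using that subtree_in_trees_upto[OF Suc.prems(2)] subtree_in_trees_upto[OF Suc.prems(3)]
      by (intro prod.cong refl) (simp add: Suc.IH[OF N(2)])
    have B: "(\<Prod>k\<in>{1..a}. \<integral>\<^sup>+t. ?i b (subtree z (m + k)) t \<partial>measure_pmf ?U) =
      (\<Prod>k\<in>{Suc m..root_degree z}. gw_prob lam n (subtree z k))" if "m + a = root_degree z" "z \<in> trees_upto (Suc n)" for a b z
      unfolding that(1)[symmetric] prod_shift
      using that subtree_in_trees_upto[OF that(2)]
      by (intro prod.cong refl) (simp add: gw_prob_ctree[OF N(2)])
    have "(\<integral>\<^sup>+a'. (if m + a = ?c \<and> m + a' = ?c' then 1 else 0) *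
      (\<Prod>k\<in>{1..m}. \<integral>\<^sup>+t. indicator (?E n (subtree y k) (subtree y' k)) t \<partial>measure_pmf ?U) *
      (\<Prod>k\<in>{1..a}. \<integral>\<^sup>+t. ?i True (subtree y (m + k)) t \<partial>measure_pmf ?U) *
      (\<Prod>k\<in>{1..a'}. \<integral>\<^sup>+t. ?i False (subtree y' (m + k)) t \<partial>measure_pmf ?U) \<partial>measure_pmf (poisson (lam * (1 - s)))) =
      (\<integral>\<^sup>+a'. (if m + a = ?c then (if m + a' = ?c' then
      (\<Prod>k\<in>{1..m}. aug_pair_prob lam s n (subtree y k) (subtree y' k)) *
      (\<Prod>k\<in>{Suc m..?c}. gw_prob lam n (subtree y k)) *
      (\<Prod>k\<in>{Suc m..?c'}. gw_prob lam n (subtree y' k)) else 0) else 0)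
      \<partial>measure_pmf (poisson (lam * (1 - s))))"
    proof (intro nn_integral_cong)
      fix a'
      show "(if m + a = ?c \<and> m + a' = ?c' then 1 else 0) *
      (\<Prod>k\<in>{1..m}. \<integral>\<^sup>+t. indicator (?E n (subtree y k) (subtree y' k)) t \<partial>measure_pmf ?U) *
      (\<Prod>k\<in>{1..a}. \<integral>\<^sup>+t. ?i True (subtree y (m + k)) t \<partial>measure_pmf ?U) *
      (\<Prod>k\<in>{1..a'}. \<integral>\<^sup>+t. ?i False (subtree y' (m + k)) t \<partial>measure_pmf ?U) =
      (if m + a = ?c then (if m + a' = ?c' then
      (\<Prod>k\<in>{1..m}. aug_pair_prob lam s n (subtree y k) (subtree y' k)) *
      (\<Prod>k\<in>{Suc m..?c}. gw_prob lam n (subtree y k)) *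
      (\<Prod>k\<in>{Suc m..?c'}. gw_prob lam n (subtree y' k)) else 0) else 0)"
        using A B[of a y True] B[of a' y' False] Suc.prems by (auto simp del: One_nat_def)
    qed
    also have "\<dots> = (if m + a = ?c then \<integral>\<^sup>+a'. (if m + a' = ?c' then
      (\<Prod>k\<in>{1..m}. aug_pair_prob lam s n (subtree y k) (subtree y' k)) *
      (\<Prod>k\<in>{Suc m..?c}. gw_prob lam n (subtree y k)) *
      (\<Prod>k\<in>{Suc m..?c'}. gw_prob lam n (subtree y' k)) else 0)
      \<partial>measure_pmf (poisson (lam * (1 - s))) else 0)" by simp
    finally show "(\<integral>\<^sup>+a'. (if m + a = ?c \<and> m + a' = ?c' then 1 else 0) *
      (\<Prod>k\<in>{1..m}. \<integral>\<^sup>+t. indicator (?E n (subtree y k) (subtree y' k)) t \<partial>measure_pmf ?U) *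
      (\<Prod>k\<in>{1..a}. \<integral>\<^sup>+t. ?i True (subtree y (m + k)) t \<partial>measure_pmf ?U) *
      (\<Prod>k\<in>{1..a'}. \<integral>\<^sup>+t. ?i False (subtree y' (m + k)) t \<partial>measure_pmf ?U) \<partial>measure_pmf (poisson (lam * (1 - s)))) = \<dots>" .
  qed
  also have "\<dots> = aug_pair_prob lam s (Suc n) y y'"
    unfolding aug_pair_prob_Suc[OF Suc.prems(2,3)] nn_integral_pmf_add pair_weight_def
    by (intro nn_integral_cong) (auto simp: mult_ac)
  finally show ?case .
qed

end

section \<open>The likelihood ratio\<close>

lemma finite_injections: "finite S \<Longrightarrow> finite (injections m S)"
  unfolding injections_def by (rule finite_subset[of _ "{1..m} \<rightarrow>\<^sub>E S"]) (auto intro: finite_PiE)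

lemma injectionsD:
  assumes "\<sigma> \<in> injections m S" "k \<in> {1..m}"
  shows "\<sigma> k \<in> S"
  using assms by (auto simp: injections_def)

lemma injections_reindex:
  assumes \<pi>: "bij_betw \<pi> S S'"
  shows "bij_betw (\<lambda>\<sigma>. \<lambda>l\<in>{1..m}. \<pi> (\<sigma> l)) (injections m S) (injections m S')"
proof (rule bij_betw_byWitness[where f' = "\<lambda>\<sigma>. \<lambda>l\<in>{1..m}. the_inv_into S \<pi> (\<sigma> l)"])
  have inj: "inj_on \<pi> S" and im: "\<pi> ` S = S'" using \<pi> by (auto simp: bij_betw_def)
  have inv: "the_inv_into S \<pi> x \<in> S" "\<pi> (the_inv_into S \<pi> x) = x" if "x \<in> S'" for x
    using that the_inv_into_into[OF inj, of x S] f_the_inv_into_f[OF inj, of x] im by auto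
  show "\<forall>\<sigma>\<in>injections m S. (\<lambda>l\<in>{1..m}. the_inv_into S \<pi> ((\<lambda>l\<in>{1..m}. \<pi> (\<sigma> l)) l)) = \<sigma>"
    by (auto simp: injections_def the_inv_into_f_f[OF inj] PiE_iff extensional_def fun_eq_iff)
  show "\<forall>\<sigma>\<in>injections m S'. (\<lambda>l\<in>{1..m}. \<pi> ((\<lambda>l\<in>{1..m}. the_inv_into S \<pi> (\<sigma> l)) l)) = \<sigma>"
    using inv by (auto simp: injections_def PiE_iff extensional_def fun_eq_iff)
  show "(\<lambda>\<sigma>. \<lambda>l\<in>{1..m}. \<pi> (\<sigma> l)) ` injections m S \<subseteq> injections m S'"
  proof
    fix \<tau> assume "\<tau> \<in> (\<lambda>\<sigma>. \<lambda>l\<in>{1..m}. \<pi> (\<sigma> l)) ` injections m S"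
    then obtain \<sigma> where \<sigma>: "\<sigma> \<in> injections m S" "\<tau> = (\<lambda>l\<in>{1..m}. \<pi> (\<sigma> l))" by auto
    have "inj_on \<sigma> {1..m}" "\<sigma> ` {1..m} \<subseteq> S" using \<sigma>(1) by (auto simp: injections_def)
    then have "inj_on (\<pi> \<circ> \<sigma>) {1..m}"
      by (rule comp_inj_on[OF _ inj_on_subset[OF inj]])
    then have "inj_on \<tau> {1..m}" by (subst inj_on_cong[of _ _ "\<pi> \<circ> \<sigma>"]) (auto simp: \<sigma>(2))
    moreover have "\<tau> \<in> {1..m} \<rightarrow>\<^sub>E S'" using \<sigma> im by (auto simp: injections_def)
    ultimately show "\<tau> \<in> injections m S'" by (simp add: injections_def)
  qed
  show "(\<lambda>\<sigma>. \<lambda>l\<in>{1..m}. the_inv_into S \<pi> (\<sigma> l)) ` injections m S' \<subseteq> injections m S"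
  proof
    fix \<tau> assume "\<tau> \<in> (\<lambda>\<sigma>. \<lambda>l\<in>{1..m}. the_inv_into S \<pi> (\<sigma> l)) ` injections m S'"
    then obtain \<sigma> where \<sigma>: "\<sigma> \<in> injections m S'" "\<tau> = (\<lambda>l\<in>{1..m}. the_inv_into S \<pi> (\<sigma> l))" by auto
    have "inj_on \<tau> {1..m}"
    proof (rule inj_onI)
      fix i j assume ij: "i \<in> {1..m}" "j \<in> {1..m}" "\<tau> i = \<tau> j"
      have "the_inv_into S \<pi> (\<sigma> i) = the_inv_into S \<pi> (\<sigma> j)"
        using ij(3) ij(1,2) unfolding \<sigma>(2) by (simp only: restrict_apply')
      then have "\<sigma> i = \<sigma> j" using inv(2)[OF injectionsD[OF \<sigma>(1) ij(1)]] inv(2)[OF injectionsD[OF \<sigma>(1) ij(2)]] by metis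
      moreover have "inj_on \<sigma> {1..m}" using \<sigma>(1) by (simp add: injections_def)
      ultimately show "i = j" using ij(1,2) by (simp add: inj_on_eq_iff)
    qed
    moreover have "\<tau> \<in> {1..m} \<rightarrow>\<^sub>E S" using \<sigma> inv by (auto simp: injections_def)
    ultimately show "\<tau> \<in> injections m S" by (simp add: injections_def)
  qed
qed

text \<open>An injection of \<open>m\<close> points extends to one more point by any of the
  \<open>card S - m\<close> values not yet taken.\<close>

lemma sum_injections_Suc:
  fixes F :: "(nat \<Rightarrow> nat) \<Rightarrow> 'b :: comm_semiring_1"
  assumes S: "finite S"
  shows "(\<Sum>\<tau>\<in>injections (Suc m) S. F (restrict \<tau> {1..m})) = of_nat (card S - m) * (\<Sum>\<sigma>\<in>injections m S. F \<sigma>)"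
proof -
  let ?D = "SIGMA \<sigma>:injections m S. S - \<sigma> ` {1..m}"
  let ?h = "\<lambda>(\<sigma>, v). \<sigma>(Suc m := v)"
  have res: "restrict (\<sigma>(Suc m := v)) {1..m} = \<sigma>" if "\<sigma> \<in> injections m S" for \<sigma> v
  proof -
    have "restrict (\<sigma>(Suc m := v)) {1..m} = restrict \<sigma> {1..m}" by (auto simp: fun_eq_iff restrict_def)
    then show ?thesis using that by (auto simp: injections_def)
  qed
  have bij: "bij_betw ?h ?D (injections (Suc m) S)"
  proof (rule bij_betw_byWitness[where f' = "\<lambda>\<tau>. (restrict \<tau> {1..m}, \<tau> (Suc m))"])
    show "\<forall>x\<in>?D. (restrict (?h x) {1..m}, ?h x (Suc m)) = x"
      using res by auto
    show "\<forall>\<tau>\<in>injections (Suc m) S. ?h (restrict \<tau> {1..m}, \<tau> (Suc m)) = \<tau>"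
      by (auto simp: injections_def fun_eq_iff restrict_def PiE_iff extensional_def)
    show "?h ` ?D \<subseteq> injections (Suc m) S"
    proof
      fix \<tau> assume "\<tau> \<in> ?h ` ?D"
      then obtain \<sigma> v where \<sigma>: "\<sigma> \<in> injections m S" "v \<in> S" "v \<notin> \<sigma> ` {1..m}" "\<tau> = \<sigma>(Suc m := v)" by auto
      have i: "{1..Suc m} = insert (Suc m) {1..m}" by auto
      have "inj_on \<tau> {1..m}"
        using \<sigma>(1) by (subst inj_on_cong[of _ _ \<sigma>]) (auto simp: \<sigma>(4) injections_def)
      moreover have "\<tau> ` {1..m} = \<sigma> ` {1..m}" by (auto simp: \<sigma>(4))
      ultimately have "inj_on \<tau> {1..Suc m}"
        unfolding i using \<sigma>(3,4) by simp
      moreover have "\<tau> \<in> {1..Suc m} \<rightarrow>\<^sub>E S"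
        using \<sigma> by (auto simp: injections_def PiE_iff extensional_def)
      ultimately show "\<tau> \<in> injections (Suc m) S" by (simp add: injections_def)
    qed
    show "(\<lambda>\<tau>. (restrict \<tau> {1..m}, \<tau> (Suc m))) ` injections (Suc m) S \<subseteq> ?D"
    proof
      fix z assume "z \<in> (\<lambda>\<tau>. (restrict \<tau> {1..m}, \<tau> (Suc m))) ` injections (Suc m) S"
      then obtain \<tau> where \<tau>: "\<tau> \<in> injections (Suc m) S" "z = (restrict \<tau> {1..m}, \<tau> (Suc m))" by auto
      have inj: "inj_on \<tau> {1..Suc m}" using \<tau> by (simp add: injections_def)
      have "\<tau> (Suc m) \<noteq> \<tau> i" if "i \<in> {1..m}" for i
        using inj_onD[OF inj, of "Suc m" i] that by auto
      then have "\<tau> (Suc m) \<notin> restrict \<tau> {1..m} ` {1..m}" by (metis imageE restrict_apply')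
      moreover have "inj_on \<tau> {1..m}" by (rule inj_on_subset[OF inj]) auto
      then have "restrict \<tau> {1..m} \<in> injections m S" using \<tau>(1) by (auto simp: injections_def)
      moreover have "\<tau> (Suc m) \<in> S" using \<tau>(1) by (rule injectionsD) simp
      ultimately show "z \<in> ?D" unfolding \<tau>(2) by blast
    qed
  qed
  have "(\<Sum>\<tau>\<in>injections (Suc m) S. F (restrict \<tau> {1..m})) = (\<Sum>x\<in>?D. F (restrict (?h x) {1..m}))"
    by (rule sum.reindex_bij_betw[OF bij, symmetric])
  also have "\<dots> = (\<Sum>x\<in>?D. F (fst x))"
  proof (intro sum.cong refl arg_cong[where f = F])
    fix x assume "x \<in> ?D"
    then show "restrict (?h x) {1..m} = fst x" using res by auto
  qed
  also have "\<dots> = (\<Sum>\<sigma>\<in>injections m S. \<Sum>v\<in>S - \<sigma> ` {1..m}. F \<sigma>)"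
    using S by (subst sum.Sigma) (auto simp: finite_injections split_def)
  also have "\<dots> = (\<Sum>\<sigma>\<in>injections m S. of_nat (card S - m) * F \<sigma>)"
  proof (intro sum.cong refl)
    fix \<sigma> assume \<sigma>: "\<sigma> \<in> injections m S"
    then have "card (S - \<sigma> ` {1..m}) = card S - m"
      by (subst card_Diff_subset) (auto simp: injections_def card_image)
    then show "(\<Sum>v\<in>S - \<sigma> ` {1..m}. F \<sigma>) = of_nat (card S - m) * F \<sigma>" by simp
  qed
  finally show ?thesis by (simp add: sum_distrib_left)
qed

text \<open>Iterates the one-point extension. The factorials stay as factors on both sides instead
  of being divided, so that the identity holds in every commutative semiring, in particular in
  \<open>ennreal\<close>.\<close>

lemma sum_injections_add:
  fixes F :: "(nat \<Rightarrow> nat) \<Rightarrow> 'b :: comm_semiring_1"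
  assumes S: "finite S" and j: "m + j \<le> card S"
  shows "of_nat (fact (card S - m - j)) * (\<Sum>\<tau>\<in>injections (m + j) S. F (restrict \<tau> {1..m})) =
    of_nat (fact (card S - m)) * (\<Sum>\<sigma>\<in>injections m S. F \<sigma>)"
  using j
proof (induction j)
  case 0
  have "restrict \<tau> {1..m} = \<tau>" if "\<tau> \<in> injections m S" for \<tau>
    using that by (auto simp: injections_def)
  then show ?case by simp
next
  case (Suc j)
  have r: "restrict (restrict \<tau> {1..m + j}) {1..m} = restrict \<tau> {1..m}" for \<tau> :: "nat \<Rightarrow> nat"
    by (auto simp: fun_eq_iff restrict_def)
  have *: "fact (card S - m - j) = of_nat (card S - (m + j)) * (fact (card S - m - Suc j) :: nat)"
    using Suc.prems by (subst fact_reduce) (auto simp: diff_diff_add)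
  have "of_nat (fact (card S - m)) * (\<Sum>\<sigma>\<in>injections m S. F \<sigma>) =
    of_nat (fact (card S - m - j)) * (\<Sum>\<tau>\<in>injections (m + j) S. F (restrict \<tau> {1..m}))"
    using Suc.prems by (intro Suc.IH[symmetric]) simp
  also have "\<dots> = of_nat (fact (card S - m - Suc j)) * (of_nat (card S - (m + j)) * (\<Sum>\<tau>\<in>injections (m + j) S. F (restrict \<tau> {1..m})))"
    unfolding * by (simp add: mult_ac)
  also have "of_nat (card S - (m + j)) * (\<Sum>\<tau>\<in>injections (m + j) S. F (restrict \<tau> {1..m})) =
    (\<Sum>\<tau>\<in>injections (Suc (m + j)) S. F (restrict \<tau> {1..m}))"
    by (subst sum_injections_Suc[OF S, symmetric]) (simp add: r)
  finally show ?case unfolding add_Suc_right by (rule sym)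
qed

text \<open>Each injection of \<open>{1..m}\<close> into \<open>{1..c}\<close> extends to
  \<open>fact (c - m)\<close> permutations. This converts averages over uniform relabelings into the
  sums over injections that occur in the messages.\<close>

lemma sum_permutes_injections:
  fixes F :: "(nat \<Rightarrow> nat) \<Rightarrow> 'b :: comm_semiring_1"
  assumes m: "m \<le> c"
  shows "(\<Sum>\<pi> | \<pi> permutes {1..c}. F (restrict \<pi> {1..m})) = of_nat (fact (c - m)) * (\<Sum>\<sigma>\<in>injections m {1..c}. F \<sigma>)"
proof -
  have bij: "bij_betw (\<lambda>\<pi>. restrict \<pi> {1..c}) {\<pi>. \<pi> permutes {1..c}} (injections c {1..c})"
  proof (rule bij_betw_byWitness[where f' = "\<lambda>\<sigma> i. if i \<in> {1..c} then \<sigma> i else i"])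
    show "\<forall>\<pi>\<in>{\<pi>. \<pi> permutes {1..c}}. (\<lambda>i. if i \<in> {1..c} then restrict \<pi> {1..c} i else i) = \<pi>"
      by (auto simp: fun_eq_iff permutes_def)
    show "\<forall>\<sigma>\<in>injections c {1..c}. restrict (\<lambda>i. if i \<in> {1..c} then \<sigma> i else i) {1..c} = \<sigma>"
      by (auto simp: injections_def fun_eq_iff restrict_def PiE_iff extensional_def)
    show "(\<lambda>\<pi>. restrict \<pi> {1..c}) ` {\<pi>. \<pi> permutes {1..c}} \<subseteq> injections c {1..c}"
    proof
      fix \<sigma> assume "\<sigma> \<in> (\<lambda>\<pi>. restrict \<pi> {1..c}) ` {\<pi>. \<pi> permutes {1..c}}"
      then obtain \<pi> where \<pi>: "\<pi> permutes {1..c}" "\<sigma> = restrict \<pi> {1..c}" by auto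
      then show "\<sigma> \<in> injections c {1..c}"
        using permutes_in_image[OF \<pi>(1)] permutes_inj[OF \<pi>(1)]
        unfolding injections_def by (auto simp: inj_on_def Pi_iff dest: injD)
    qed
    show "(\<lambda>\<sigma> i. if i \<in> {1..c} then \<sigma> i else i) ` injections c {1..c} \<subseteq> {\<pi>. \<pi> permutes {1..c}}"
    proof
      fix \<pi> assume "\<pi> \<in> (\<lambda>\<sigma> i. if i \<in> {1..c} then \<sigma> i else i) ` injections c {1..c}"
      then obtain \<sigma> where \<sigma>: "\<sigma> \<in> injections c {1..c}" "\<pi> = (\<lambda>i. if i \<in> {1..c} then \<sigma> i else i)" by auto
      have "inj_on \<sigma> {1..c}" "\<sigma> ` {1..c} \<subseteq> {1..c}" using \<sigma> by (auto simp: injections_def)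
      then have "bij_betw \<sigma> {1..c} {1..c}" by (simp add: bij_betw_def endo_inj_surj)
      then have "bij_betw \<pi> {1..c} {1..c}" by (subst bij_betw_cong[of _ _ \<sigma>]) (auto simp: \<sigma>(2))
      then show "\<pi> \<in> {\<pi>. \<pi> permutes {1..c}}" using \<sigma>(2) by (auto intro: bij_imp_permutes)
    qed
  qed
  have r: "restrict (restrict \<pi> {1..c}) {1..m} = restrict \<pi> {1..m}" for \<pi> :: "nat \<Rightarrow> nat"
    using m by (auto simp: fun_eq_iff restrict_def)
  have "(\<Sum>\<pi> | \<pi> permutes {1..c}. F (restrict \<pi> {1..m})) = (\<Sum>\<sigma>\<in>injections c {1..c}. F (restrict \<sigma> {1..m}))"
    by (subst sum.reindex_bij_betw[OF bij, symmetric]) (simp only: r)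
  then show ?thesis
    using sum_injections_add[of "{1..c}" m "c - m" F] m by simp
qed

text \<open>This will be the likelihood ratio of \<open>P1\<close> to \<open>P0\<close> at depth \<open>n\<close>.\<close>

primrec tree_like :: "real \<Rightarrow> real \<Rightarrow> nat \<Rightarrow> tree \<Rightarrow> tree \<Rightarrow> real" where
  "tree_like lam s 0 = (\<lambda>x x'. 1)"
| "tree_like lam s (Suc n) = (\<lambda>x x'. \<Sum>m\<le>min (root_degree x) (root_degree x').
     psi lam s m (root_degree x) (root_degree x') *
     (\<Sum>\<sigma>\<in>injections m {1..root_degree x}. \<Sum>\<sigma>'\<in>injections m {1..root_degree x'}.
        \<Prod>l = 1..m. tree_like lam s n (subtree x (\<sigma> l)) (subtree x' (\<sigma>' l))))"

lemma tree_like_reindex: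
  assumes \<pi>: "bij_betw \<pi> {1..root_degree y} {1..root_degree x}" and \<pi>': "bij_betw \<pi>' {1..root_degree y'} {1..root_degree x'}"
    and eq: "\<And>k k'. k \<in> {1..root_degree y} \<Longrightarrow> k' \<in> {1..root_degree y'} \<Longrightarrow>
      tree_like lam s n (subtree x (\<pi> k)) (subtree x' (\<pi>' k')) = tree_like lam s n (subtree y k) (subtree y' k')"
  shows "tree_like lam s (Suc n) x x' = tree_like lam s (Suc n) y y'"
proof -
  have c: "root_degree y = root_degree x" "root_degree y' = root_degree x'"
    using bij_betw_same_card[OF \<pi>] bij_betw_same_card[OF \<pi>'] by auto
  have "(\<Sum>\<sigma>\<in>injections m {1..root_degree x}. \<Sum>\<sigma>'\<in>injections m {1..root_degree x'}.
        \<Prod>l = 1..m. tree_like lam s n (subtree x (\<sigma> l)) (subtree x' (\<sigma>' l))) =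
       (\<Sum>\<sigma>\<in>injections m {1..root_degree y}. \<Sum>\<sigma>'\<in>injections m {1..root_degree y'}.
        \<Prod>l = 1..m. tree_like lam s n (subtree y (\<sigma> l)) (subtree y' (\<sigma>' l)))" for m
  proof -
    have "(\<Sum>\<sigma>\<in>injections m {1..root_degree x}. \<Sum>\<sigma>'\<in>injections m {1..root_degree x'}.
        \<Prod>l = 1..m. tree_like lam s n (subtree x (\<sigma> l)) (subtree x' (\<sigma>' l))) =
      (\<Sum>\<sigma>\<in>injections m {1..root_degree y}. \<Sum>\<sigma>'\<in>injections m {1..root_degree y'}.
        \<Prod>l = 1..m. tree_like lam s n (subtree x ((\<lambda>l\<in>{1..m}. \<pi> (\<sigma> l)) l)) (subtree x' ((\<lambda>l\<in>{1..m}. \<pi>' (\<sigma>' l)) l)))"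
      by (subst sum.reindex_bij_betw[OF injections_reindex[OF \<pi>], symmetric],
          subst sum.reindex_bij_betw[OF injections_reindex[OF \<pi>'], symmetric]) (rule refl)
    also have "\<dots> = (\<Sum>\<sigma>\<in>injections m {1..root_degree y}. \<Sum>\<sigma>'\<in>injections m {1..root_degree y'}.
        \<Prod>l = 1..m. tree_like lam s n (subtree y (\<sigma> l)) (subtree y' (\<sigma>' l)))"
      by (intro sum.cong prod.cong refl) (simp add: eq injectionsD del: atLeastAtMost_iff)
    finally show ?thesis .
  qed
  then show ?thesis by (simp add: c)
qed

text \<open>A positive relabeling probability means that the trees are isomorphic down to depth
  \<open>n\<close>: some root permutation has only nonzero subtree factors. Reindexing the
  injections along the two root permutations leaves the recursion unchanged.\<close>

lemma tree_like_relabel: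
  assumes "t \<in> trees" "t' \<in> trees" "x \<in> trees_upto n" "x' \<in> trees_upto n"
    "relabel_prob n t x \<noteq> 0" "relabel_prob n t' x' \<noteq> 0"
  shows "tree_like lam s n x x' = tree_like lam s n t t'"
  using assms
proof (induction n arbitrary: t t' x x')
  case (Suc n)
  have ex: "\<exists>\<pi>. \<pi> permutes {1..root_degree x} \<and> root_degree t = root_degree x \<and>
      (\<forall>k\<in>{1..root_degree x}. relabel_prob n (subtree t k) (subtree x (\<pi> k)) \<noteq> 0)"
    if "t \<in> trees" "x \<in> trees_upto (Suc n)" "relabel_prob (Suc n) t x \<noteq> 0" for t x
  proof -
    have "root_degree t = root_degree x" using that by (auto simp: relabel_prob_Suc split: if_splits)
    moreover
    have "(\<Sum>q | q permutes {1..root_degree x}.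
      \<Prod>k\<in>{1..root_degree x}. relabel_prob n (subtree t k) (subtree x (q k))) \<noteq> 0"
      using that by (auto simp: relabel_prob_Suc split: if_splits)
    then obtain q where q: "q permutes {1..root_degree x}"
        "(\<Prod>k\<in>{1..root_degree x}. relabel_prob n (subtree t k) (subtree x (q k))) \<noteq> 0"
      by (rule sum.not_neutral_contains_not_neutral) auto
    have "relabel_prob n (subtree t k) (subtree x (q k)) \<noteq> 0" if "k \<in> {1..root_degree x}" for k
      using q(2) that by (metis finite_atLeastAtMost prod_zero)
    ultimately show ?thesis using q(1) by blast
  qed
  obtain \<pi> where \<pi>: "\<pi> permutes {1..root_degree x}" "root_degree t = root_degree x"
      "\<forall>k\<in>{1..root_degree x}. relabel_prob n (subtree t k) (subtree x (\<pi> k)) \<noteq> 0"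
    using ex[OF Suc.prems(1,3,5)] by blast
  obtain \<pi>' where \<pi>': "\<pi>' permutes {1..root_degree x'}" "root_degree t' = root_degree x'"
      "\<forall>k\<in>{1..root_degree x'}. relabel_prob n (subtree t' k) (subtree x' (\<pi>' k)) \<noteq> 0"
    using ex[OF Suc.prems(2,4,6)] by blast
  show ?case
  proof (rule tree_like_reindex)
    show "bij_betw \<pi> {1..root_degree t} {1..root_degree x}" "bij_betw \<pi>' {1..root_degree t'} {1..root_degree x'}"
      using \<pi> \<pi>' by (simp_all add: permutes_imp_bij)
    fix k k' assume k: "k \<in> {1..root_degree t}" "k' \<in> {1..root_degree t'}"
    then have "\<pi> k \<in> {1..root_degree x}" "\<pi>' k' \<in> {1..root_degree x'}"
      using permutes_in_image[OF \<pi>(1)] permutes_in_image[OF \<pi>'(1)] \<pi>(2) \<pi>'(2) by auto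
    then show "tree_like lam s n (subtree x (\<pi> k)) (subtree x' (\<pi>' k')) = tree_like lam s n (subtree t k) (subtree t' k')"
      using k \<pi> \<pi>' by (intro Suc.IH subtree_in_trees subtree_in_trees_upto Suc.prems) auto
  qed
qed simp

lemma psi_nonneg: "lam > 0 \<Longrightarrow> 0 \<le> s \<Longrightarrow> s \<le> 1 \<Longrightarrow> psi lam s m a b \<ge> 0"
  by (simp add: psi_def)

lemma tree_like_nonneg: "lam > 0 \<Longrightarrow> 0 \<le> s \<Longrightarrow> s \<le> 1 \<Longrightarrow> tree_like lam s n x x' \<ge> 0"
  by (induction n arbitrary: x x') (auto intro!: sum_nonneg mult_nonneg_nonneg prod_nonneg psi_nonneg)

context
  fixes lam s :: real
  assumes lam: "lam > 0" and s: "0 \<le> s" "s \<le> 1"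
begin

text \<open>The origin of \<open>psi\<close>. On the left stand the chances of \<open>m\<close>
  common and of \<open>c - m\<close> and \<open>c' - m\<close> private children, times the share of
  pairs of root relabelings that put the common children in prescribed positions; on the right, the
  law of two independent root degrees.\<close>

lemma psi_poisson:
  assumes "m \<le> c" "m \<le> c'"
  shows "pmf (poisson (lam * s)) m * pmf (poisson (lam * (1 - s))) (c - m) * pmf (poisson (lam * (1 - s))) (c' - m) *
     (fact (c - m) * fact (c' - m) / (fact c * fact c')) =
    psi lam s m c c' * pmf (poisson lam) c * pmf (poisson lam) c'"
proof -
  obtain a b where ab: "c = m + a" "c' = m + b" using assms by (auto simp: le_iff_add)
  have e: "exp (- (lam * s)) * exp (- (lam * (1 - s))) * exp (- (lam * (1 - s))) = exp (lam * s) * exp (- lam) * exp (- lam)"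
    unfolding exp_add[symmetric] by (simp add: algebra_simps)
  have p: "(lam * s) ^ m * (lam * (1 - s)) ^ a * (lam * (1 - s)) ^ b * lam ^ m = s ^ m * (1 - s) ^ (a + b) * lam ^ (m + a) * lam ^ (m + b)"
    by (simp add: power_mult_distrib power_add mult_ac)
  have q: "m + a + (m + b) - 2 * m = a + b" by simp
  have "pmf (poisson (lam * s)) m * pmf (poisson (lam * (1 - s))) (c - m) * pmf (poisson (lam * (1 - s))) (c' - m) *
     (fact (c - m) * fact (c' - m) / (fact c * fact c')) =
    (exp (- (lam * s)) * exp (- (lam * (1 - s))) * exp (- (lam * (1 - s)))) *
    ((lam * s) ^ m * (lam * (1 - s)) ^ a * (lam * (1 - s)) ^ b * lam ^ m) / (lam ^ m * fact m * fact c * fact c')"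
    using lam s by (simp add: pmf_poisson ab)
  also have "\<dots> = psi lam s m c c' * pmf (poisson lam) c * pmf (poisson lam) c'"
    unfolding e p using lam by (simp add: pmf_poisson psi_def q ab)
  finally show ?thesis .
qed

text \<open>Uniform relabeling preserves the Galton--Watson law: each root permutation merely
  reorders the product over the subtrees, and the number of equal terms cancels the factor
  \<open>1 / fact (root_degree x)\<close>.\<close>

lemma relabel_gw_prob:
  "n \<le> N \<Longrightarrow> x \<in> trees_upto n \<Longrightarrow>
    (\<integral>\<^sup>+t. relabel_prob n (enc b t) x \<partial>measure_pmf (ctree_pmf lam s N)) = gw_prob lam n x"
proof (induction n arbitrary: N x)
  case 0 then show ?case by (simp add: relabel_prob_0 enc_in_trees gw_prob_0)
next
  case (Suc n)
  then obtain N' where N: "N = Suc N'" "n \<le> N'" by (cases N) auto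
  let ?c = "root_degree x" and ?U = "ctree_pmf lam s N'"
  let ?S = "{q. q permutes {1..?c}}"
  have fS: "finite ?S" by (simp add: finite_permutations)
  have "(\<integral>\<^sup>+t. relabel_prob (Suc n) (enc b t) x \<partial>measure_pmf (ctree_pmf lam s N)) =
    (\<integral>\<^sup>+t. ennreal (1 / fact ?c) * (\<Sum>q\<in>?S. if length (children b t) = ?c then
       \<Prod>k\<in>{1..?c}. relabel_prob n (enc b (children b t ! (k - 1))) (subtree x (q k)) else 0) \<partial>measure_pmf (ctree_pmf lam s N))"
  proof (intro nn_integral_cong)
    fix t
    show "relabel_prob (Suc n) (enc b t) x = ennreal (1 / fact ?c) * (\<Sum>q\<in>?S. if length (children b t) = ?c then
       \<Prod>k\<in>{1..?c}. relabel_prob n (enc b (children b t ! (k - 1))) (subtree x (q k)) else 0)"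
      by (auto simp: relabel_prob_Suc[OF enc_in_trees Suc.prems(2)] root_degree_enc subtree_enc
          intro!: arg_cong2[where f = "(*)"] sum.cong prod.cong)
  qed
  also have "\<dots> = ennreal (1 / fact ?c) * (\<Sum>q\<in>?S. \<integral>\<^sup>+t. (if length (children b t) = ?c then
       \<Prod>k\<in>{1..?c}. relabel_prob n (enc b (children b t ! (k - 1))) (subtree x (q k)) else 0) \<partial>measure_pmf (ctree_pmf lam s (Suc N')))"
    unfolding N by (simp add: nn_integral_cmult nn_integral_sum)
  also have "\<dots> = ennreal (1 / fact ?c) * (\<Sum>q\<in>?S. ennreal (pmf (poisson lam) ?c) * (\<Prod>k\<in>{1..?c}. gw_prob lam n (subtree x k)))"
  proof (intro arg_cong2[where f = "(*)"] sum.cong refl)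
    fix q assume "q \<in> ?S"
    then have q: "q permutes {1..?c}" by simp
    have "(\<integral>\<^sup>+t. (if length (children b t) = ?c then
       \<Prod>k\<in>{1..?c}. relabel_prob n (enc b (children b t ! (k - 1))) (subtree x (q k)) else 0) \<partial>measure_pmf (ctree_pmf lam s (Suc N'))) =
      ennreal (pmf (poisson lam) ?c) * (\<Prod>k\<in>{1..?c}. \<integral>\<^sup>+t. relabel_prob n (enc b t) (subtree x (q k)) \<partial>measure_pmf ?U)"
      by (rule nn_integral_ctree_children[OF lam s]) simp
    also have "(\<Prod>k\<in>{1..?c}. \<integral>\<^sup>+t. relabel_prob n (enc b t) (subtree x (q k)) \<partial>measure_pmf ?U) = (\<Prod>k\<in>{1..?c}. gw_prob lam n (subtree x (q k)))"
      using permutes_in_image[OF q] subtree_in_trees_upto[OF Suc.prems(2)]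
      by (intro prod.cong refl Suc.IH[OF N(2)]) auto
    also have "\<dots> = (\<Prod>k\<in>{1..?c}. gw_prob lam n (subtree x k))"
      by (rule prod.permute[OF q, symmetric, unfolded o_def])
    finally show "(\<integral>\<^sup>+t. (if length (children b t) = ?c then
       \<Prod>k\<in>{1..?c}. relabel_prob n (enc b (children b t ! (k - 1))) (subtree x (q k)) else 0) \<partial>measure_pmf (ctree_pmf lam s (Suc N'))) =
      ennreal (pmf (poisson lam) ?c) * (\<Prod>k\<in>{1..?c}. gw_prob lam n (subtree x k))" .
  qed
  also have "\<dots> = ennreal (1 / fact ?c) * ennreal (fact ?c) * (ennreal (pmf (poisson lam) ?c) * (\<Prod>k\<in>{1..?c}. gw_prob lam n (subtree x k)))"
    by (simp add: card_permutations mult.assoc ennreal_of_nat_eq_real_of_nat)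
  also have "ennreal (1 / fact ?c) * ennreal (fact ?c) = 1"
    by (simp add: ennreal_mult[symmetric])
  finally show ?case by (simp add: gw_prob_Suc[OF Suc.prems(2)])
qed

end

text \<open>The two arguments may differ: the first is read on the side of the first graph, the
  second on the side of the second. On the diagonal this is the ratio of a correlated pair; off it,
  it models a message between two different vertices.\<close>

definition ctree_like :: "real \<Rightarrow> real \<Rightarrow> nat \<Rightarrow> ctree \<Rightarrow> ctree \<Rightarrow> real" where
  "ctree_like lam s n t t' = tree_like lam s n (enc True t) (enc False t')"

lemma sum_swap3:
  fixes f :: "_ \<Rightarrow> _ \<Rightarrow> _ \<Rightarrow> ennreal"
  shows "(\<Sum>a\<in>A. \<Sum>b\<in>B. \<Sum>c\<in>C. f a b c) = (\<Sum>c\<in>C. \<Sum>a\<in>A. \<Sum>b\<in>B. f a b c)"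
proof -
  have "(\<Sum>a\<in>A. \<Sum>b\<in>B. \<Sum>c\<in>C. f a b c) = (\<Sum>a\<in>A. \<Sum>c\<in>C. \<Sum>b\<in>B. f a b c)"
    by (intro sum.cong refl sum.swap)
  also have "\<dots> = (\<Sum>c\<in>C. \<Sum>a\<in>A. \<Sum>b\<in>B. f a b c)" by (rule sum.swap)
  finally show ?thesis .
qed

lemma sum_permutes_pair:
  fixes L :: "nat \<Rightarrow> nat \<Rightarrow> ennreal"
  assumes "m \<le> c" "m \<le> c'"
  shows "(\<Sum>q | q permutes {1..c}. \<Sum>q' | q' permutes {1..c'}. \<Prod>k\<in>{1..m}. L (q k) (q' k)) =
    ennreal (fact (c - m) * fact (c' - m)) * (\<Sum>\<sigma>\<in>injections m {1..c}. \<Sum>\<sigma>'\<in>injections m {1..c'}. \<Prod>k\<in>{1..m}. L (\<sigma> k) (\<sigma>' k))"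
proof -
  have "(\<Sum>q | q permutes {1..c}. \<Sum>q' | q' permutes {1..c'}. \<Prod>k\<in>{1..m}. L (q k) (q' k)) =
    (\<Sum>q | q permutes {1..c}. \<Sum>q' | q' permutes {1..c'}. \<Prod>k\<in>{1..m}. L (q k) ((restrict q' {1..m}) k))"
    by (intro sum.cong prod.cong refl) simp
  also have "\<dots> = (\<Sum>q | q permutes {1..c}. of_nat (fact (c' - m)) * (\<Sum>\<sigma>'\<in>injections m {1..c'}. \<Prod>k\<in>{1..m}. L ((restrict q {1..m}) k) (\<sigma>' k)))"
    by (intro sum.cong refl, subst sum_permutes_injections[OF assms(2)])
      (intro arg_cong2[where f = "(*)"] sum.cong prod.cong refl, simp)
  also have "\<dots> = of_nat (fact (c - m)) * (\<Sum>\<sigma>\<in>injections m {1..c}. of_nat (fact (c' - m)) * (\<Sum>\<sigma>'\<in>injections m {1..c'}. \<Prod>k\<in>{1..m}. L (\<sigma> k) (\<sigma>' k)))"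
    by (rule sum_permutes_injections[OF assms(1)])
  also have "\<dots> = ennreal (fact (c - m) * fact (c' - m)) * (\<Sum>\<sigma>\<in>injections m {1..c}. \<Sum>\<sigma>'\<in>injections m {1..c'}. \<Prod>k\<in>{1..m}. L (\<sigma> k) (\<sigma>' k))"
    by (simp add: sum_distrib_left ennreal_mult ennreal_of_nat_eq_real_of_nat mult.assoc)
  finally show ?thesis .
qed

lemma nn_integral_relabel_total:
  assumes t: "t \<in> trees"
  shows "(\<integral>\<^sup>+x. relabel_prob n t x \<partial>count_space (trees_upto n)) = 1"
proof -
  have "(\<integral>\<^sup>+x. relabel_prob n t x \<partial>count_space (trees_upto n)) = emeasure (perm_family t) (\<Union>x\<in>trees_upto n. relabel_event t n x)"
    unfolding relabel_prob_def using relabel_event_sets[OF t]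
    by (intro emeasure_UN_countable[symmetric] countable_trees_upto) (auto simp: disjoint_family_on_def relabel_event_def)
  also have "(\<Union>x\<in>trees_upto n. relabel_event t n x) = space (perm_family t)"
    by (auto simp: relabel_event_def space_perm_family prune_in_trees_upto relabel_in_trees[OF t])
  also have "emeasure (perm_family t) (space (perm_family t)) = 1"
    by (intro prob_space.emeasure_space_1 prob_space_PiM prob_space_perm_measure)
  finally show ?thesis .
qed

lemma gw_prob_total: "(\<integral>\<^sup>+x. gw_prob \<mu> n x \<partial>count_space (trees_upto n)) \<le> 1"
proof -
  have "(\<integral>\<^sup>+x. gw_prob \<mu> n x \<partial>count_space (trees_upto n)) = emeasure (poisson_family \<mu>) (\<Union>x\<in>trees_upto n. gw_event n x)"
    unfolding gw_prob_def using gw_event_sets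
    by (intro emeasure_UN_countable[symmetric] countable_trees_upto) (auto simp: disjoint_family_on_def gw_event_def)
  also have "\<dots> \<le> 1"
    using prob_space.emeasure_le_1[OF prob_space_poisson_family] .
  finally show ?thesis .
qed

context
  fixes lam s :: real
  assumes lam: "lam > 0" and s: "0 \<le> s" "s \<le> 1"
begin

lemma ennreal_tree_like_Suc:
  "ennreal (tree_like lam s (Suc n) x x') = (\<Sum>m\<le>min (root_degree x) (root_degree x').
     ennreal (psi lam s m (root_degree x) (root_degree x')) *
     (\<Sum>\<sigma>\<in>injections m {1..root_degree x}. \<Sum>\<sigma>'\<in>injections m {1..root_degree x'}.
        \<Prod>l = 1..m. ennreal (tree_like lam s n (subtree x (\<sigma> l)) (subtree x' (\<sigma>' l)))))"
  using psi_nonneg[OF lam s] tree_like_nonneg[OF lam s]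
  by (simp add: sum_ennreal[symmetric] prod_ennreal[symmetric] ennreal_mult sum_nonneg prod_nonneg
      del: sum_ennreal prod_ennreal)

lemma nn_integral_poisson_pair:
  "(\<integral>\<^sup>+m. \<integral>\<^sup>+a. \<integral>\<^sup>+a'. (if m + a = c \<and> m + a' = c' then Z m else 0)
      \<partial>measure_pmf (poisson (lam * (1 - s))) \<partial>measure_pmf (poisson (lam * (1 - s))) \<partial>measure_pmf (poisson (lam * s))) =
   (\<Sum>m\<le>min c c'. ennreal (pmf (poisson (lam * s)) m * pmf (poisson (lam * (1 - s))) (c - m) * pmf (poisson (lam * (1 - s))) (c' - m)) * Z m)"
proof -
  let ?P = "poisson (lam * (1 - s))"
  have "(\<integral>\<^sup>+m. \<integral>\<^sup>+a. \<integral>\<^sup>+a'. (if m + a = c \<and> m + a' = c' then Z m else 0) \<partial>measure_pmf ?P \<partial>measure_pmf ?P \<partial>measure_pmf (poisson (lam * s))) =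
    (\<integral>\<^sup>+m. \<integral>\<^sup>+a. (if m + a = c then (\<integral>\<^sup>+a'. (if m + a' = c' then Z m else 0) \<partial>measure_pmf ?P) else 0) \<partial>measure_pmf ?P \<partial>measure_pmf (poisson (lam * s)))"
  proof (intro nn_integral_cong)
    fix m a
    show "(\<integral>\<^sup>+a'. (if m + a = c \<and> m + a' = c' then Z m else 0) \<partial>measure_pmf ?P) =
      (if m + a = c then (\<integral>\<^sup>+a'. (if m + a' = c' then Z m else 0) \<partial>measure_pmf ?P) else 0)"
      by (cases "m + a = c") simp_all
  qed
  also have "\<dots> = (\<integral>\<^sup>+m. (if m \<le> min c c' then ennreal (pmf ?P (c - m)) * (ennreal (pmf ?P (c' - m)) * Z m) else 0) \<partial>measure_pmf (poisson (lam * s)))"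
    unfolding nn_integral_pmf_add by (intro nn_integral_cong) auto
  also have "\<dots> = (\<Sum>m\<le>min c c'. ennreal (pmf (poisson (lam * s)) m * pmf ?P (c - m) * pmf ?P (c' - m)) * Z m)"
    unfolding nn_integral_pmf_atMost by (simp add: ennreal_mult mult_ac)
  finally show ?thesis .
qed

text \<open>The heart of the likelihood computation. Given the root permutations and the number of
  common children, the factors \<open>gw_prob\<close> of all children assemble to those of two
  independent trees, and only the ratios of the common pairs remain. Summing over the permutations
  produces injections, and \<open>psi_poisson\<close> collects the constants into
  \<open>psi\<close>.\<close>

lemma relabel_pair_prob:
  "n \<le> N \<Longrightarrow> x \<in> trees_upto n \<Longrightarrow> x' \<in> trees_upto n \<Longrightarrow>
    (\<integral>\<^sup>+t. relabel_prob n (enc True t) x * relabel_prob n (enc False t) x' \<partial>measure_pmf (ctree_pmf lam s N)) =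
    ennreal (tree_like lam s n x x') * (gw_prob lam n x * gw_prob lam n x')"
proof (induction n arbitrary: N x x')
  case 0 then show ?case by (simp add: relabel_prob_0 enc_in_trees gw_prob_0)
next
  case (Suc n)
  then obtain N' where N: "N = Suc N'" "n \<le> N'" by (cases N) auto
  let ?c = "root_degree x" and ?c' = "root_degree x'" and ?U = "ctree_pmf lam s N'"
  let ?S = "{q. q permutes {1..?c}}" and ?S' = "{q. q permutes {1..?c'}}"
  let ?R = "\<lambda>b x t. relabel_prob n (enc b t) x"
  let ?L = "\<lambda>k k'. ennreal (tree_like lam s n (subtree x k) (subtree x' k'))"
  let ?g = "\<lambda>x. \<Prod>k\<in>{1..root_degree x}. gw_prob lam n (subtree x k)"
  let ?W = "ennreal (1 / fact ?c) * ennreal (1 / fact ?c')"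
  let ?K = "\<lambda>m. pmf (poisson (lam * s)) m * pmf (poisson (lam * (1 - s))) (?c - m) * pmf (poisson (lam * (1 - s))) (?c' - m)"
  let ?p = "\<lambda>b x q t. \<Prod>k\<in>{1..root_degree x}. ?R b (subtree x (q k)) (children b t ! (k - 1))"
  let ?G = "\<lambda>q q' t. if length (children True t) = ?c \<and> length (children False t) = ?c'
    then ?p True x q t * ?p False x' q' t else 0"
  have sub: "subtree x (q k) \<in> trees_upto n" if "x \<in> trees_upto (Suc n)" "q permutes {1..root_degree x}" "k \<in> {1..root_degree x}" for x q k
    using permutes_in_image[OF that(2)] that(3) subtree_in_trees_upto[OF that(1)] by auto
  have gperm: "(\<Prod>k\<in>{1..root_degree x}. gw_prob lam n (subtree x (q k))) = ?g x" if "q permutes {1..root_degree x}" for q x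
    by (rule prod.permute[OF that, symmetric, unfolded o_def])
  \<comment> \<open>With \<open>q\<close> and \<open>q'\<close> fixed, common child \<open>k\<close>
    sits at positions \<open>q k\<close> and \<open>q' k\<close>, so the induction hypothesis yields
    the ratio of that pair of subtrees; private children give factors \<open>gw_prob\<close> by
    \<open>relabel_gw_prob\<close>.\<close>
  have G: "(\<integral>\<^sup>+t. ?G q q' t \<partial>measure_pmf (ctree_pmf lam s (Suc N'))) =
      (\<Sum>m\<le>min ?c ?c'. ennreal (?K m) * ((\<Prod>k\<in>{1..m}. ?L (q k) (q' k)) * (?g x * ?g x')))"
    if q: "q permutes {1..?c}" and q': "q' permutes {1..?c'}" for q q'
  proof -
    have "(\<integral>\<^sup>+t. ?G q q' t \<partial>measure_pmf (ctree_pmf lam s (Suc N'))) =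
      (\<integral>\<^sup>+m. \<integral>\<^sup>+a. \<integral>\<^sup>+a'. (if m + a = ?c \<and> m + a' = ?c' then 1 else 0) *
      (\<Prod>k\<in>{1..m}. \<integral>\<^sup>+t. ?R True (subtree x (q k)) t * ?R False (subtree x' (q' k)) t \<partial>measure_pmf ?U) *
      (\<Prod>k\<in>{1..a}. \<integral>\<^sup>+t. ?R True (subtree x (q (m + k))) t \<partial>measure_pmf ?U) *
      (\<Prod>k\<in>{1..a'}. \<integral>\<^sup>+t. ?R False (subtree x' (q' (m + k))) t \<partial>measure_pmf ?U)
      \<partial>measure_pmf (poisson (lam * (1 - s))) \<partial>measure_pmf (poisson (lam * (1 - s))) \<partial>measure_pmf (poisson (lam * s)))"
    proof (rule nn_integral_ctree_pmf_branch)
      fix cs ls rs :: "ctree list"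
      let ?m = "length cs" and ?a = "length ls" and ?a' = "length rs"
      show "?G q q' (CNode cs ls rs) = (if ?m + ?a = ?c \<and> ?m + ?a' = ?c' then 1 else 0) *
        (\<Prod>k\<in>{1..?m}. ?R True (subtree x (q k)) (cs ! (k - 1)) * ?R False (subtree x' (q' k)) (cs ! (k - 1))) *
        (\<Prod>k\<in>{1..?a}. ?R True (subtree x (q (?m + k))) (ls ! (k - 1))) *
        (\<Prod>k\<in>{1..?a'}. ?R False (subtree x' (q' (?m + k))) (rs ! (k - 1)))"
      proof (cases "?m + ?a = ?c \<and> ?m + ?a' = ?c'")
        case True
        have "?p True x q (CNode cs ls rs) * ?p False x' q' (CNode cs ls rs) =
          (\<Prod>k\<in>{1..?m + ?a}. ?R True (subtree x (q k)) ((cs @ ls) ! (k - 1))) *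
          (\<Prod>k\<in>{1..?m + ?a'}. ?R False (subtree x' (q' k)) ((cs @ rs) ! (k - 1)))"
          using True by simp
        also have "\<dots> = (\<Prod>k\<in>{1..?m}. ?R True (subtree x (q k)) (cs ! (k - 1)) * ?R False (subtree x' (q' k)) (cs ! (k - 1))) *
        (\<Prod>k\<in>{1..?a}. ?R True (subtree x (q (?m + k))) (ls ! (k - 1))) *
        (\<Prod>k\<in>{1..?a'}. ?R False (subtree x' (q' (?m + k))) (rs ! (k - 1)))"
          unfolding prod_children[where F = "\<lambda>k. ?R True (subtree x (q k))"]
            prod_children[where F = "\<lambda>k. ?R False (subtree x' (q' k))"] prod.distrib by (simp only: mult_ac)
        finally show ?thesis using True by simp
      qed auto
    qed
    also have "\<dots> = (\<integral>\<^sup>+m. \<integral>\<^sup>+a. \<integral>\<^sup>+a'. (if m + a = ?c \<and> m + a' = ?c' then (\<Prod>k\<in>{1..m}. ?L (q k) (q' k)) * (?g x * ?g x') else 0)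
      \<partial>measure_pmf (poisson (lam * (1 - s))) \<partial>measure_pmf (poisson (lam * (1 - s))) \<partial>measure_pmf (poisson (lam * s)))"
    proof (intro nn_integral_cong)
      fix m a a'
      show "(if m + a = ?c \<and> m + a' = ?c' then 1 else 0) *
      (\<Prod>k\<in>{1..m}. \<integral>\<^sup>+t. ?R True (subtree x (q k)) t * ?R False (subtree x' (q' k)) t \<partial>measure_pmf ?U) *
      (\<Prod>k\<in>{1..a}. \<integral>\<^sup>+t. ?R True (subtree x (q (m + k))) t \<partial>measure_pmf ?U) *
      (\<Prod>k\<in>{1..a'}. \<integral>\<^sup>+t. ?R False (subtree x' (q' (m + k))) t \<partial>measure_pmf ?U) =
      (if m + a = ?c \<and> m + a' = ?c' then (\<Prod>k\<in>{1..m}. ?L (q k) (q' k)) * (?g x * ?g x') else 0)"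
      proof (cases "m + a = ?c \<and> m + a' = ?c'")
        case True
        have A: "(\<Prod>k\<in>{1..m}. \<integral>\<^sup>+t. ?R True (subtree x (q k)) t * ?R False (subtree x' (q' k)) t \<partial>measure_pmf ?U) =
          (\<Prod>k\<in>{1..m}. ?L (q k) (q' k) * (gw_prob lam n (subtree x (q k)) * gw_prob lam n (subtree x' (q' k))))"
          using True by (intro prod.cong refl Suc.IH[OF N(2)] sub[OF Suc.prems(2) q] sub[OF Suc.prems(3) q']) auto
        have B: "(\<Prod>k\<in>{1..a}. \<integral>\<^sup>+t. ?R b (subtree z (q (m + k))) t \<partial>measure_pmf ?U) =
          (\<Prod>k\<in>{Suc m..root_degree z}. gw_prob lam n (subtree z (q k)))"
          if "m + a = root_degree z" "z \<in> trees_upto (Suc n)" "q permutes {1..root_degree z}" for z b q a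
          unfolding that(1)[symmetric] prod_shift
          using that(1) by (intro prod.cong refl relabel_gw_prob[OF lam s N(2)] sub[OF that(2,3)]) auto
        have C: "?g z = (\<Prod>k\<in>{1..m}. gw_prob lam n (subtree z (q k))) * (\<Prod>k\<in>{Suc m..root_degree z}. gw_prob lam n (subtree z (q k)))"
          if "m + a = root_degree z" "q permutes {1..root_degree z}" for z q a
          using that(1) by (subst gperm[OF that(2), symmetric], subst prod_split_append[of m]) auto
        have c: "m + a = ?c" "m + a' = ?c'" using True by auto
        show ?thesis
          unfolding A prod.distrib B[OF c(1) Suc.prems(2) q] B[OF c(2) Suc.prems(3) q'] C[OF c(1) q] C[OF c(2) q']
          using True by (simp add: mult_ac)
      qed auto
    qed
    finally show ?thesis unfolding nn_integral_poisson_pair .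
  qed
  have "(\<integral>\<^sup>+t. relabel_prob (Suc n) (enc True t) x * relabel_prob (Suc n) (enc False t) x' \<partial>measure_pmf (ctree_pmf lam s N)) =
    (\<integral>\<^sup>+t. ?W * (\<Sum>q\<in>?S. \<Sum>q'\<in>?S'. ?G q q' t) \<partial>measure_pmf (ctree_pmf lam s N))"
  proof (intro nn_integral_cong)
    fix t
    have e: "relabel_prob (Suc n) (enc b t) x = (if length (children b t) = root_degree x then
      ennreal (1 / fact (root_degree x)) * (\<Sum>q | q permutes {1..root_degree x}. ?p b x q t) else 0)"
      if "x \<in> trees_upto (Suc n)" for b x
      by (auto simp: relabel_prob_Suc[OF enc_in_trees that] root_degree_enc subtree_enc
          intro!: arg_cong2[where f = "(*)"] sum.cong prod.cong)
    show "relabel_prob (Suc n) (enc True t) x * relabel_prob (Suc n) (enc False t) x' = ?W * (\<Sum>q\<in>?S. \<Sum>q'\<in>?S'. ?G q q' t)"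
    proof (cases "length (children True t) = ?c \<and> length (children False t) = ?c'")
      case True
      then have "(\<Sum>q\<in>?S. \<Sum>q'\<in>?S'. ?G q q' t) = (\<Sum>q\<in>?S. ?p True x q t) * (\<Sum>q'\<in>?S'. ?p False x' q' t)"
        by (simp add: sum_product del: One_nat_def)
      then show ?thesis
        unfolding e[OF Suc.prems(2)] e[OF Suc.prems(3)] if_P[OF conjunct1[OF True]] if_P[OF conjunct2[OF True]]
        by (simp only: mult_ac)
    qed (auto simp: e Suc.prems)
  qed
  also have "\<dots> = ?W * (\<Sum>q\<in>?S. \<Sum>q'\<in>?S'. \<integral>\<^sup>+t. ?G q q' t \<partial>measure_pmf (ctree_pmf lam s N))"
    by (simp add: nn_integral_cmult nn_integral_sum)
  also have "(\<Sum>q\<in>?S. \<Sum>q'\<in>?S'. \<integral>\<^sup>+t. ?G q q' t \<partial>measure_pmf (ctree_pmf lam s N)) =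
    (\<Sum>q\<in>?S. \<Sum>q'\<in>?S'. \<Sum>m\<le>min ?c ?c'. ennreal (?K m) * ((\<Prod>k\<in>{1..m}. ?L (q k) (q' k)) * (?g x * ?g x')))"
    unfolding N by (intro sum.cong refl G) auto
  also have "\<dots> = (\<Sum>m\<le>min ?c ?c'. \<Sum>q\<in>?S. \<Sum>q'\<in>?S'. ennreal (?K m) * ((\<Prod>k\<in>{1..m}. ?L (q k) (q' k)) * (?g x * ?g x')))"
    by (rule sum_swap3)
  also have "\<dots> = (\<Sum>m\<le>min ?c ?c'. ennreal (?K m) * ((\<Sum>q\<in>?S. \<Sum>q'\<in>?S'. \<Prod>k\<in>{1..m}. ?L (q k) (q' k)) * (?g x * ?g x')))"
    by (simp only: sum_distrib_left sum_distrib_right)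
  also have "?W * \<dots> = (\<Sum>m\<le>min ?c ?c'. ennreal (psi lam s m ?c ?c') *
      (\<Sum>\<sigma>\<in>injections m {1..?c}. \<Sum>\<sigma>'\<in>injections m {1..?c'}. \<Prod>l = 1..m. ?L (\<sigma> l) (\<sigma>' l)) *
      (ennreal (pmf (poisson lam) ?c) * ?g x * (ennreal (pmf (poisson lam) ?c') * ?g x')))"
  proof (subst sum_distrib_left, intro sum.cong refl)
    fix m assume "m \<in> {..min ?c ?c'}"
    then have m: "m \<le> ?c" "m \<le> ?c'" by auto
    let ?I = "\<Sum>\<sigma>\<in>injections m {1..?c}. \<Sum>\<sigma>'\<in>injections m {1..?c'}. \<Prod>l = 1..m. ?L (\<sigma> l) (\<sigma>' l)"
    have k: "?W * ennreal (?K m) * ennreal (fact (?c - m) * fact (?c' - m)) =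
      ennreal (psi lam s m ?c ?c') * (ennreal (pmf (poisson lam) ?c) * ennreal (pmf (poisson lam) ?c'))"
      using psi_poisson[OF lam s m] psi_nonneg[OF lam s, of m ?c ?c']
      by (simp add: ennreal_mult[symmetric] mult_ac)
    have "?W * (ennreal (?K m) * ((\<Sum>q\<in>?S. \<Sum>q'\<in>?S'. \<Prod>k\<in>{1..m}. ?L (q k) (q' k)) * (?g x * ?g x'))) =
       (?W * ennreal (?K m) * ennreal (fact (?c - m) * fact (?c' - m))) * ?I * (?g x * ?g x')"
      unfolding sum_permutes_pair[OF m, where L = ?L] by (simp only: mult_ac)
    then show "?W * (ennreal (?K m) * ((\<Sum>q\<in>?S. \<Sum>q'\<in>?S'. \<Prod>k\<in>{1..m}. ?L (q k) (q' k)) * (?g x * ?g x'))) =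
      ennreal (psi lam s m ?c ?c') * ?I * (ennreal (pmf (poisson lam) ?c) * ?g x * (ennreal (pmf (poisson lam) ?c') * ?g x'))"
      unfolding k by (simp only: mult_ac)
  qed
  also have "\<dots> = ennreal (tree_like lam s (Suc n) x x') * (gw_prob lam (Suc n) x * gw_prob lam (Suc n) x')"
    unfolding ennreal_tree_like_Suc gw_prob_Suc[OF Suc.prems(2)] gw_prob_Suc[OF Suc.prems(3)] sum_distrib_right ..
  finally show ?case .
qed

text \<open>Integrating against the two relabelings first turns an expectation of a function of the likelihood ratio into a sum over the canonical trees.\<close>

lemma nn_integral_ctree_like:
  assumes n: "n \<le> N"
  shows "(\<integral>\<^sup>+t. h (ctree_like lam s n t t) \<partial>measure_pmf (ctree_pmf lam s N)) =
    (\<integral>\<^sup>+x. \<integral>\<^sup>+x'. h (tree_like lam s n x x') * (ennreal (tree_like lam s n x x') * (gw_prob lam n x * gw_prob lam n x'))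
      \<partial>count_space (trees_upto n) \<partial>count_space (trees_upto n))"
proof -
  let ?X = "count_space (trees_upto n)" and ?U = "measure_pmf (ctree_pmf lam s N)"
  let ?R = "\<lambda>b x t. relabel_prob n (enc b t) x"
  have "(\<integral>\<^sup>+t. h (ctree_like lam s n t t) \<partial>?U) =
    (\<integral>\<^sup>+t. \<integral>\<^sup>+x. \<integral>\<^sup>+x'. h (tree_like lam s n x x') * (?R True x t * ?R False x' t) \<partial>?X \<partial>?X \<partial>?U)"
  proof (intro nn_integral_cong)
    fix t
    have "(\<integral>\<^sup>+x. \<integral>\<^sup>+x'. h (tree_like lam s n x x') * (?R True x t * ?R False x' t) \<partial>?X \<partial>?X) =
      (\<integral>\<^sup>+x. \<integral>\<^sup>+x'. h (ctree_like lam s n t t) * (?R True x t * ?R False x' t) \<partial>?X \<partial>?X)"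
    proof (intro nn_integral_cong)
      fix x x' assume x: "x \<in> space ?X" "x' \<in> space ?X"
      show "h (tree_like lam s n x x') * (?R True x t * ?R False x' t) = h (ctree_like lam s n t t) * (?R True x t * ?R False x' t)"
      proof (cases "?R True x t = 0 \<or> ?R False x' t = 0")
        case False
        then have "tree_like lam s n x x' = ctree_like lam s n t t"
          unfolding ctree_like_def using x by (intro tree_like_relabel enc_in_trees) auto
        then show ?thesis by simp
      qed auto
    qed
    also have "\<dots> = h (ctree_like lam s n t t) * ((\<integral>\<^sup>+x. ?R True x t \<partial>?X) * (\<integral>\<^sup>+x'. ?R False x' t \<partial>?X))"
      by (simp add: nn_integral_cmult nn_integral_multc)
    also have "\<dots> = h (ctree_like lam s n t t)" by (simp add: nn_integral_relabel_total enc_in_trees)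
    finally show "h (ctree_like lam s n t t) = (\<integral>\<^sup>+x. \<integral>\<^sup>+x'. h (tree_like lam s n x x') * (?R True x t * ?R False x' t) \<partial>?X \<partial>?X)"
      by simp
  qed
  also have "\<dots> = (\<integral>\<^sup>+x. \<integral>\<^sup>+t. \<integral>\<^sup>+x'. h (tree_like lam s n x x') * (?R True x t * ?R False x' t) \<partial>?X \<partial>?U \<partial>?X)"
    by (rule nn_integral_count_space_nn_integral[OF countable_trees_upto]) simp
  also have "\<dots> = (\<integral>\<^sup>+x. \<integral>\<^sup>+x'. \<integral>\<^sup>+t. h (tree_like lam s n x x') * (?R True x t * ?R False x' t) \<partial>?U \<partial>?X \<partial>?X)"
    by (intro nn_integral_cong nn_integral_count_space_nn_integral[OF countable_trees_upto]) simp
  also have "\<dots> = (\<integral>\<^sup>+x. \<integral>\<^sup>+x'. h (tree_like lam s n x x') * (ennreal (tree_like lam s n x x') * (gw_prob lam n x * gw_prob lam n x')) \<partial>?X \<partial>?X)"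
    by (intro nn_integral_cong) (simp add: nn_integral_cmult relabel_pair_prob[OF n])
  finally show ?thesis .
qed

text \<open>Weighting by the ratio turns the correlated law into the independent one, so the inverse
  cancels the weight and what remains is at most the total mass of two independent trees. This bound
  pays for the nodes with a small ratio.\<close>

lemma nn_integral_inverse_ctree_like:
  assumes n: "n \<le> N"
  shows "(\<integral>\<^sup>+t. inverse (ennreal (ctree_like lam s n t t)) \<partial>measure_pmf (ctree_pmf lam s N)) \<le> 1"
proof -
  let ?X = "count_space (trees_upto n)"
  \<comment> \<open>At a zero ratio the inverse is infinite, but its product with 0 is 0 in
    \<open>ennreal\<close>.\<close>
  have i: "inverse (ennreal r) * (ennreal r * z) \<le> z" for r z
  proof (cases "r > 0")
    case True
    then have "inverse (ennreal r) * ennreal r = 1" by (simp add: inverse_ennreal ennreal_mult[symmetric])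
    then show ?thesis by (simp add: mult.assoc[symmetric])
  qed (simp add: ennreal_neg)
  have "(\<integral>\<^sup>+t. inverse (ennreal (ctree_like lam s n t t)) \<partial>measure_pmf (ctree_pmf lam s N)) \<le>
    (\<integral>\<^sup>+x. \<integral>\<^sup>+x'. gw_prob lam n x * gw_prob lam n x' \<partial>?X \<partial>?X)"
    unfolding nn_integral_ctree_like[OF n, of "\<lambda>r. inverse (ennreal r)"] by (intro nn_integral_mono i)
  also have "\<dots> = (\<integral>\<^sup>+x. gw_prob lam n x \<partial>?X) * (\<integral>\<^sup>+x'. gw_prob lam n x' \<partial>?X)"
    by (simp add: nn_integral_cmult nn_integral_multc)
  also have "\<dots> \<le> 1 * 1" by (intro mult_mono gw_prob_total) auto
  finally show ?thesis by simp
qed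

text \<open>Carries \<open>relabel_pair_prob\<close> over to the tree model:
  \<open>aug_pair_prob\<close> is rewritten as the joint law of the two readings, and the sum over
  pairs before relabeling then collapses to the pruned readings themselves.\<close>

lemma P1_likelihood:
  assumes x: "x \<in> trees_upto n" and x': "x' \<in> trees_upto n"
  shows "emeasure (P1 lam s) (tree_event n x \<times> tree_event n x') =
    ennreal (tree_like lam s n x x') * emeasure (P0 lam) (tree_event n x \<times> tree_event n x')"
proof -
  let ?X = "count_space (trees_upto n)" and ?U = "measure_pmf (ctree_pmf lam s n)"
  let ?E = "\<lambda>y y'. {t. prune n (enc True t) = y \<and> prune n (enc False t) = y'}"
  let ?R = "relabel_prob n"
  have pr: "prune n (enc b t) \<in> trees_upto n" for b t by (rule prune_in_trees_upto[OF enc_in_trees])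
  have "emeasure (P1 lam s) (tree_event n x \<times> tree_event n x') =
    (\<integral>\<^sup>+y. \<integral>\<^sup>+y'. \<integral>\<^sup>+t. ?R y x * ?R y' x' * indicator (?E y y') t \<partial>?U \<partial>?X \<partial>?X)"
    unfolding P1_prob[OF x x']
    by (intro nn_integral_cong) (simp add: nn_integral_cmult aug_pair_prob_ctree[OF lam s, of n n, symmetric])
  also have "\<dots> = (\<integral>\<^sup>+y. \<integral>\<^sup>+t. \<integral>\<^sup>+y'. ?R y x * ?R y' x' * indicator (?E y y') t \<partial>?X \<partial>?U \<partial>?X)"
    by (intro nn_integral_cong nn_integral_count_space_nn_integral[OF countable_trees_upto, symmetric]) simp
  also have "\<dots> = (\<integral>\<^sup>+t. \<integral>\<^sup>+y. \<integral>\<^sup>+y'. ?R y x * ?R y' x' * indicator (?E y y') t \<partial>?X \<partial>?X \<partial>?U)"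
    by (rule nn_integral_count_space_nn_integral[OF countable_trees_upto, symmetric]) simp
  also have "\<dots> = (\<integral>\<^sup>+t. ?R (enc True t) x * ?R (enc False t) x' \<partial>?U)"
  proof (intro nn_integral_cong)
    fix t
    have "(\<integral>\<^sup>+y. \<integral>\<^sup>+y'. ?R y x * ?R y' x' * indicator (?E y y') t \<partial>?X \<partial>?X) =
      (\<integral>\<^sup>+y. \<integral>\<^sup>+y'. (?R y x * ?R y' x' * indicator {prune n (enc True t)} y) * indicator {prune n (enc False t)} y' \<partial>?X \<partial>?X)"
      by (intro nn_integral_cong) (auto simp: indicator_def)
    also have "\<dots> = (\<integral>\<^sup>+y. (?R y x * ?R (prune n (enc False t)) x') * indicator {prune n (enc True t)} y \<partial>?X)"
      using pr by (intro nn_integral_cong, subst nn_integral_indicator_singleton) auto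
    also have "\<dots> = ?R (prune n (enc True t)) x * ?R (prune n (enc False t)) x'"
      using pr by (subst nn_integral_indicator_singleton) auto
    finally show "(\<integral>\<^sup>+y. \<integral>\<^sup>+y'. ?R y x * ?R y' x' * indicator (?E y y') t \<partial>?X \<partial>?X) = ?R (enc True t) x * ?R (enc False t) x'"
      by (simp add: relabel_prob_prune enc_in_trees x x')
  qed
  also have "\<dots> = ennreal (tree_like lam s n x x') * (gw_prob lam n x * gw_prob lam n x')"
    by (rule relabel_pair_prob[OF order_refl x x'])
  finally show ?thesis by (simp add: P0_prob[OF x x'])
qed

end

section \<open>Growth of the likelihood ratio\<close>

text \<open>The Stein--Chen identity, from the ratio of consecutive Poisson masses. With
  \<open>f m = 1\<close> and \<open>f m = m - 1\<close> it gives the mean and the second factorial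
  moment.\<close>

lemma nn_integral_poisson_size_bias:
  assumes "\<mu> \<ge> 0"
  shows "(\<integral>\<^sup>+m. of_nat m * f m \<partial>measure_pmf (poisson \<mu>)) = ennreal \<mu> * (\<integral>\<^sup>+m. f (Suc m) \<partial>measure_pmf (poisson \<mu>))"
proof -
  have p: "ennreal (pmf (poisson \<mu>) (Suc i)) * of_nat (Suc i) = ennreal \<mu> * ennreal (pmf (poisson \<mu>) i)" for i
  proof -
    have "exp (-\<mu>) * \<mu> ^ Suc i / fact (Suc i) * real (Suc i) = \<mu> * (exp (-\<mu>) * \<mu> ^ i / fact i)"
      by simp
    then show ?thesis
      unfolding pmf_poisson[OF assms] ennreal_of_nat_eq_real_of_nat
      using assms by (subst (1 2) ennreal_mult[symmetric]) auto
  qed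
  have "(\<integral>\<^sup>+m. of_nat m * f m \<partial>measure_pmf (poisson \<mu>)) = (\<Sum>i. ennreal (pmf (poisson \<mu>) i) * (of_nat i * f i))"
    by (simp add: nn_integral_measure_pmf nn_integral_count_space_nat)
  also have "\<dots> = (\<Sum>i. ennreal (pmf (poisson \<mu>) (Suc i)) * (of_nat (Suc i) * f (Suc i)))"
    by (subst suminf_offset[where i = 1]) auto
  also have "\<dots> = (\<Sum>i. ennreal \<mu> * (ennreal (pmf (poisson \<mu>) i) * f (Suc i)))"
    by (simp only: mult.assoc[symmetric] p)
  also have "\<dots> = ennreal \<mu> * (\<integral>\<^sup>+m. f (Suc m) \<partial>measure_pmf (poisson \<mu>))"
    by (simp add: nn_integral_measure_pmf nn_integral_count_space_nat)
  finally show ?thesis .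
qed

lemma nn_integral_poisson_mean:
  "\<mu> \<ge> 0 \<Longrightarrow> (\<integral>\<^sup>+m. of_nat m \<partial>measure_pmf (poisson \<mu>)) = ennreal \<mu>"
  using nn_integral_poisson_size_bias[of \<mu> "\<lambda>_. 1"] by simp

lemma nn_integral_poisson_factorial_moment:
  "\<mu> \<ge> 0 \<Longrightarrow> (\<integral>\<^sup>+m. of_nat (m * (m - 1)) \<partial>measure_pmf (poisson \<mu>)) = ennreal (\<mu>\<^sup>2)"
  using nn_integral_poisson_size_bias[of \<mu> "\<lambda>m. of_nat (m - 1)"]
  by (simp add: nn_integral_poisson_mean power2_eq_square ennreal_mult)

lemma nn_integral_replicate_sum_list:
  fixes f :: "_ \<Rightarrow> ennreal"
  shows "(\<integral>\<^sup>+xs. sum_list (map f xs) \<partial>measure_pmf (replicate_pmf m p)) = of_nat m * (\<integral>\<^sup>+x. f x \<partial>measure_pmf p)"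
  by (induction m) (simp_all add: nn_integral_add algebra_simps)

lemma nn_integral_replicate_sum_list_sq:
  fixes f :: "_ \<Rightarrow> ennreal"
  shows "(\<integral>\<^sup>+xs. (sum_list (map f xs))\<^sup>2 \<partial>measure_pmf (replicate_pmf m p)) =
    of_nat m * (\<integral>\<^sup>+x. (f x)\<^sup>2 \<partial>measure_pmf p) + of_nat (m * (m - 1)) * (\<integral>\<^sup>+x. f x \<partial>measure_pmf p)\<^sup>2"
proof (induction m)
  case (Suc m)
  let ?e = "\<integral>\<^sup>+x. f x \<partial>measure_pmf p" and ?v = "\<integral>\<^sup>+x. (f x)\<^sup>2 \<partial>measure_pmf p"
  have sq: "(a + b)\<^sup>2 = a\<^sup>2 + (2 * (a * b) + b\<^sup>2)" for a b :: ennreal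
    by (simp add: power2_sum mult_ac add_ac)
  have "(\<integral>\<^sup>+xs. (sum_list (map f xs))\<^sup>2 \<partial>measure_pmf (replicate_pmf (Suc m) p)) =
    (\<integral>\<^sup>+x. \<integral>\<^sup>+xs. (f x)\<^sup>2 + (2 * (f x * sum_list (map f xs)) + (sum_list (map f xs))\<^sup>2) \<partial>measure_pmf (replicate_pmf m p) \<partial>measure_pmf p)"
    by (simp add: sq)
  also have "\<dots> = ?v + (2 * (?e * (of_nat m * ?e)) + (of_nat m * ?v + of_nat (m * (m - 1)) * ?e\<^sup>2))"
    by (simp add: nn_integral_add nn_integral_cmult nn_integral_multc nn_integral_replicate_sum_list Suc.IH)
  also have "\<dots> = of_nat (Suc m) * ?v + of_nat (2 * m + m * (m - 1)) * ?e\<^sup>2"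
    by (simp add: power2_eq_square distrib_left distrib_right mult_ac add_ac)
  also have "2 * m + m * (m - 1) = Suc m * (Suc m - 1)" by (cases m) auto
  finally show ?case .
qed simp

lemma nn_integral_ctree_pmf_Suc:
  "(\<integral>\<^sup>+t. f t \<partial>measure_pmf (ctree_pmf lam s (Suc n))) =
    (\<integral>\<^sup>+m. \<integral>\<^sup>+a. \<integral>\<^sup>+b. \<integral>\<^sup>+cs. \<integral>\<^sup>+ls. \<integral>\<^sup>+rs. f (CNode cs ls rs)
      \<partial>measure_pmf (replicate_pmf b (ctree_pmf lam s n)) \<partial>measure_pmf (replicate_pmf a (ctree_pmf lam s n))
      \<partial>measure_pmf (replicate_pmf m (ctree_pmf lam s n))
      \<partial>measure_pmf (poisson (lam * (1 - s))) \<partial>measure_pmf (poisson (lam * (1 - s))) \<partial>measure_pmf (poisson (lam * s)))"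
  by simp

lemma nn_integral_ctree_common:
  assumes "\<And>cs ls rs. f (CNode cs ls rs) = h cs"
  shows "(\<integral>\<^sup>+t. f t \<partial>measure_pmf (ctree_pmf lam s (Suc n))) =
    (\<integral>\<^sup>+m. \<integral>\<^sup>+cs. h cs \<partial>measure_pmf (replicate_pmf m (ctree_pmf lam s n)) \<partial>measure_pmf (poisson (lam * s)))"
  by (simp add: assms)

text \<open>Generation \<open>k\<close> of the branching process of common nodes, thinned by the
  property \<open>P\<close> of the tree below each node.\<close>

primrec good_count :: "(ctree \<Rightarrow> bool) \<Rightarrow> nat \<Rightarrow> ctree \<Rightarrow> nat" where
  "good_count P 0 = (\<lambda>t. if P t then 1 else 0)"
| "good_count P (Suc k) = (\<lambda>t. sum_list (map (good_count P k) (common t)))"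

text \<open>Bounds the loss in the logarithm of the likelihood ratio when only the matching of every common
  child with itself is kept; \<open>f\<close> is the loss incurred at depth \<open>k\<close>.\<close>

primrec path_cost :: "(ctree \<Rightarrow> ennreal) \<Rightarrow> real \<Rightarrow> nat \<Rightarrow> ctree \<Rightarrow> ennreal" where
  "path_cost f \<kappa> 0 = f"
| "path_cost f \<kappa> (Suc k) = (\<lambda>t. case t of CNode cs ls rs \<Rightarrow>
     ennreal \<kappa> * of_nat (length cs + length ls + length rs) + sum_list (map (path_cost f \<kappa> k) cs))"

lemma ennreal_of_nat_sum_list: "(of_nat (sum_list (map f xs)) :: ennreal) = sum_list (map (\<lambda>x. of_nat (f x)) xs)"
  by (induction xs) auto

section \<open>Moments of good nodes and of the cost\<close>

context
  fixes lam s :: real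
  assumes lam: "lam > 0" and s: "0 \<le> s" "s \<le> 1"
begin

lemma good_count_mean:
  assumes p: "\<And>N. N \<ge> n0 \<Longrightarrow> emeasure (measure_pmf (ctree_pmf lam s N)) {t. P t} = ennreal p" and p0: "p \<ge> 0"
  shows "N \<ge> n0 + k \<Longrightarrow> (\<integral>\<^sup>+t. of_nat (good_count P k t) \<partial>measure_pmf (ctree_pmf lam s N)) = ennreal (p * (lam * s) ^ k)"
proof (induction k arbitrary: N)
  case 0
  have "(\<integral>\<^sup>+t. of_nat (good_count P 0 t) \<partial>measure_pmf (ctree_pmf lam s N)) =
    (\<integral>\<^sup>+t. indicator {t. P t} t \<partial>measure_pmf (ctree_pmf lam s N))"
    by (intro nn_integral_cong) (simp add: indicator_def)
  then show ?case using p[of N] 0 by simp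
next
  case (Suc k)
  then obtain N' where N: "N = Suc N'" "N' \<ge> n0 + k" by (cases N) auto
  have "(\<integral>\<^sup>+t. of_nat (good_count P (Suc k) t) \<partial>measure_pmf (ctree_pmf lam s N)) =
    (\<integral>\<^sup>+m. \<integral>\<^sup>+cs. sum_list (map (\<lambda>t. of_nat (good_count P k t)) cs) \<partial>measure_pmf (replicate_pmf m (ctree_pmf lam s N')) \<partial>measure_pmf (poisson (lam * s)))"
    unfolding N by (rule nn_integral_ctree_common) (simp add: ennreal_of_nat_sum_list)
  also have "\<dots> = ennreal (lam * s) * ennreal (p * (lam * s) ^ k)"
    using rates_nonneg[OF lam s]
    by (simp add: nn_integral_replicate_sum_list Suc.IH[OF N(2)] nn_integral_multc nn_integral_poisson_mean)
  also have "\<dots> = ennreal (p * (lam * s) ^ Suc k)"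
    using rates_nonneg[OF lam s] p0 by (simp add: ennreal_mult[symmetric] mult_ac)
  finally show ?case .
qed

text \<open>The second moments satisfy \<open>v (k + 1) = \<mu> * v k + \<mu>^2 * e k^2\<close> with
  \<open>\<mu> = lam * s\<close> and means \<open>e k \<le> \<mu>^k\<close>. The constant
  \<open>C\<close> solves \<open>\<mu> * C + \<mu>^2 = C * \<mu>^2\<close>, which closes the
  induction and needs \<open>\<mu> > 1\<close>. So the second moment has the order of the squared
  mean.\<close>

lemma good_count_second_moment:
  assumes p: "\<And>N. N \<ge> n0 \<Longrightarrow> emeasure (measure_pmf (ctree_pmf lam s N)) {t. P t} = ennreal p"
    and p0: "0 \<le> p" "p \<le> 1" and mu: "lam * s > 1"
  defines "C \<equiv> lam * s / (lam * s - 1)"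
  shows "N \<ge> n0 + k \<Longrightarrow> (\<integral>\<^sup>+t. (of_nat (good_count P k t))\<^sup>2 \<partial>measure_pmf (ctree_pmf lam s N)) \<le> ennreal (C * (lam * s) ^ (2 * k))"
proof (induction k arbitrary: N)
  case 0
  have "(\<integral>\<^sup>+t. (of_nat (good_count P 0 t))\<^sup>2 \<partial>measure_pmf (ctree_pmf lam s N)) =
    (\<integral>\<^sup>+t. indicator {t. P t} t \<partial>measure_pmf (ctree_pmf lam s N))"
    by (intro nn_integral_cong) (simp add: indicator_def)
  also have "\<dots> = ennreal p" using p[of N] 0 by simp
  also have "ennreal p \<le> ennreal C"
  proof -
    have "1 \<le> C" using mu by (simp add: C_def le_divide_eq)
    then show ?thesis using p0 by (simp add: ennreal_leI)
  qed
  finally show ?case by simp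
next
  case (Suc k)
  let ?mu = "lam * s"
  obtain N' where N: "N = Suc N'" "N' \<ge> n0 + k" using Suc.prems by (cases N) auto
  let ?v = "\<integral>\<^sup>+t. (of_nat (good_count P k t))\<^sup>2 \<partial>measure_pmf (ctree_pmf lam s N')"
  let ?e = "ennreal (p * ?mu ^ k)"
  have "(\<integral>\<^sup>+t. (of_nat (good_count P (Suc k) t))\<^sup>2 \<partial>measure_pmf (ctree_pmf lam s N)) =
    (\<integral>\<^sup>+m. \<integral>\<^sup>+cs. (sum_list (map (\<lambda>t. of_nat (good_count P k t)) cs))\<^sup>2 \<partial>measure_pmf (replicate_pmf m (ctree_pmf lam s N')) \<partial>measure_pmf (poisson ?mu))"
    unfolding N by (rule nn_integral_ctree_common) (simp add: ennreal_of_nat_sum_list)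
  also have "\<dots> = ennreal ?mu * ?v + ennreal (?mu\<^sup>2) * ?e\<^sup>2"
  proof -
    have e: "(\<integral>\<^sup>+t. of_nat (good_count P k t) \<partial>measure_pmf (ctree_pmf lam s N')) = ?e"
      by (rule good_count_mean[OF p p0(1) N(2)])
    have fm: "(\<integral>\<^sup>+m. of_nat (m * (m - Suc 0)) \<partial>measure_pmf (poisson ?mu)) = ennreal (?mu\<^sup>2)"
      using nn_integral_poisson_factorial_moment[OF rates_nonneg(1)[OF lam s]] by (simp only: One_nat_def)
    show ?thesis
      unfolding nn_integral_replicate_sum_list_sq e
      using rates_nonneg[OF lam s]
      by (simp add: nn_integral_add nn_integral_multc nn_integral_poisson_mean
          fm del: of_nat_mult)
  qed
  also have "\<dots> \<le> ennreal ?mu * ennreal (C * ?mu ^ (2 * k)) + ennreal (?mu\<^sup>2) * ennreal ((?mu ^ k)\<^sup>2)"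
  proof (intro add_mono mult_left_mono Suc.IH[OF N(2)])
    have "p * ?mu ^ k \<le> ?mu ^ k" using p0 mu by (simp add: mult_le_cancel_right1)
    then have "(p * ?mu ^ k)\<^sup>2 \<le> (?mu ^ k)\<^sup>2" using p0 mu by (intro power_mono) auto
    then show "?e\<^sup>2 \<le> ennreal ((?mu ^ k)\<^sup>2)" using p0 mu by (subst ennreal_power) (auto intro: ennreal_leI)
  qed auto
  also have "\<dots> = ennreal (?mu * (C * ?mu ^ (2 * k)) + ?mu\<^sup>2 * (?mu ^ k)\<^sup>2)"
  proof -
    have "C \<ge> 0" using mu by (simp add: C_def)
    then show ?thesis using mu by (simp add: ennreal_mult[symmetric] ennreal_plus[symmetric] del: ennreal_plus)
  qed
  also have "?mu * (C * ?mu ^ (2 * k)) + ?mu\<^sup>2 * (?mu ^ k)\<^sup>2 = (?mu * C + ?mu\<^sup>2) * ?mu ^ (2 * k)"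
  proof -
    have "(?mu ^ k)\<^sup>2 = ?mu ^ (2 * k)" by (metis power_mult mult.commute)
    then show ?thesis by (simp add: algebra_simps)
  qed
  also have "?mu * C + ?mu\<^sup>2 = C * ?mu\<^sup>2"
    using mu unfolding C_def by (simp add: divide_simps power2_eq_square) (simp add: algebra_simps)
  also have "C * ?mu\<^sup>2 * ?mu ^ (2 * k) = C * ?mu ^ (2 * Suc k)" by (simp add: power2_eq_square)
  finally show ?case .
qed

text \<open>A node has \<open>lam * (2 - s)\<close> children on average, so the mean cost satisfies
  \<open>y (k + 1) = \<kappa> * lam * (2 - s) + lam * s * y k\<close>. Subtracting the constant
  \<open>C\<close>, for which \<open>C * (lam * s - 1)\<close> is the inhomogeneous term, makes the
  bound reproduce itself. The cost thus grows no faster than the number of common nodes.\<close>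

lemma path_cost_mean:
  assumes f: "\<And>N. N \<ge> n0 \<Longrightarrow> (\<integral>\<^sup>+t. f t \<partial>measure_pmf (ctree_pmf lam s N)) \<le> 1"
    and \<kappa>: "\<kappa> \<ge> 0" and mu: "lam * s > 1"
  defines "C \<equiv> \<kappa> * (lam * (2 - s)) / (lam * s - 1)"
  shows "N \<ge> n0 + k \<Longrightarrow> (\<integral>\<^sup>+t. path_cost f \<kappa> k t \<partial>measure_pmf (ctree_pmf lam s N)) \<le> ennreal ((1 + C) * (lam * s) ^ k - C)"
proof (induction k arbitrary: N)
  case 0 then show ?case using f[of N] by simp
next
  case (Suc k)
  let ?mu = "lam * s" and ?al = "lam * (1 - s)"
  obtain N' where N: "N = Suc N'" "N' \<ge> n0 + k" using Suc.prems by (cases N) auto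
  let ?y = "\<integral>\<^sup>+t. path_cost f \<kappa> k t \<partial>measure_pmf (ctree_pmf lam s N')"
  have C: "C \<ge> 0" using lam s \<kappa> mu by (simp add: C_def)
  have len: "(\<integral>\<^sup>+xs. F (length xs) \<partial>measure_pmf (replicate_pmf m p)) = F m" for F :: "nat \<Rightarrow> ennreal" and p :: "ctree pmf" and m
    using nn_integral_replicate_pmf_cong[of m p "\<lambda>xs. F (length xs)" "\<lambda>_. F m"] by simp
  have len': "(\<integral>\<^sup>+xs. F (length xs) + sum_list (map h xs) \<partial>measure_pmf (replicate_pmf m p)) = F m + of_nat m * (\<integral>\<^sup>+x. h x \<partial>measure_pmf p)"
    for F :: "nat \<Rightarrow> ennreal" and p :: "ctree pmf" and m h
    by (simp add: nn_integral_add len nn_integral_replicate_sum_list)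
  have "(\<integral>\<^sup>+t. path_cost f \<kappa> (Suc k) t \<partial>measure_pmf (ctree_pmf lam s N)) =
    (\<integral>\<^sup>+m. \<integral>\<^sup>+a. \<integral>\<^sup>+b. ennreal \<kappa> * of_nat (m + a + b) + of_nat m * ?y
      \<partial>measure_pmf (poisson ?al) \<partial>measure_pmf (poisson ?al) \<partial>measure_pmf (poisson ?mu))"
  proof -
    have "(\<integral>\<^sup>+cs. \<integral>\<^sup>+ls. \<integral>\<^sup>+rs. path_cost f \<kappa> (Suc k) (CNode cs ls rs)
      \<partial>measure_pmf (replicate_pmf b (ctree_pmf lam s N')) \<partial>measure_pmf (replicate_pmf a (ctree_pmf lam s N'))
      \<partial>measure_pmf (replicate_pmf m (ctree_pmf lam s N'))) = ennreal \<kappa> * of_nat (m + a + b) + of_nat m * ?y" for m a b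
    proof -
      have "(\<integral>\<^sup>+rs. path_cost f \<kappa> (Suc k) (CNode cs ls rs) \<partial>measure_pmf (replicate_pmf b (ctree_pmf lam s N'))) =
         ennreal \<kappa> * of_nat (length cs + length ls + b) + sum_list (map (path_cost f \<kappa> k) cs)" for cs ls
        using len[where F = "\<lambda>r. ennreal \<kappa> * of_nat (length cs + length ls + r) + sum_list (map (path_cost f \<kappa> k) cs)"]
        by simp
      moreover have "(\<integral>\<^sup>+ls. ennreal \<kappa> * of_nat (length cs + length ls + b) + sum_list (map (path_cost f \<kappa> k) cs) \<partial>measure_pmf (replicate_pmf a (ctree_pmf lam s N'))) =
         ennreal \<kappa> * of_nat (length cs + a + b) + sum_list (map (path_cost f \<kappa> k) cs)" for cs
        by (rule len[where F = "\<lambda>r. ennreal \<kappa> * of_nat (length cs + r + b) + sum_list (map (path_cost f \<kappa> k) cs)"])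
      moreover have "(\<integral>\<^sup>+cs. ennreal \<kappa> * of_nat (length cs + a + b) + sum_list (map (path_cost f \<kappa> k) cs) \<partial>measure_pmf (replicate_pmf m (ctree_pmf lam s N'))) =
         ennreal \<kappa> * of_nat (m + a + b) + of_nat m * ?y"
        by (rule len'[where F = "\<lambda>r. ennreal \<kappa> * of_nat (r + a + b)"])
      ultimately show ?thesis by presburger
    qed
    then show ?thesis unfolding N nn_integral_ctree_pmf_Suc by presburger
  qed
  also have "\<dots> = ennreal \<kappa> * (ennreal ?mu + (ennreal ?al + ennreal ?al)) + ennreal ?mu * ?y"
    using rates_nonneg[OF lam s]
    by (simp add: nn_integral_add nn_integral_cmult nn_integral_multc nn_integral_poisson_mean distrib_left add_ac)
  also have "\<dots> \<le> ennreal \<kappa> * (ennreal ?mu + (ennreal ?al + ennreal ?al)) + ennreal ?mu * ennreal ((1 + C) * ?mu ^ k - C)"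
    by (intro add_left_mono mult_left_mono Suc.IH[OF N(2)]) auto
  also have "\<dots> = ennreal (\<kappa> * (?mu + (?al + ?al)) + ?mu * ((1 + C) * ?mu ^ k - C))"
  proof -
    have "(1 + C) * ?mu ^ k \<ge> (1 + C) * 1" using C mu by (intro mult_left_mono) auto
    then have "(1 + C) * ?mu ^ k - C \<ge> 0" by simp
    then show ?thesis using rates_nonneg[OF lam s] \<kappa> by (simp add: ennreal_mult[symmetric] ennreal_plus[symmetric] del: ennreal_plus)
  qed
  also have "\<kappa> * (?mu + (?al + ?al)) + ?mu * ((1 + C) * ?mu ^ k - C) = (1 + C) * ?mu ^ Suc k - C"
  proof -
    have "\<kappa> * (?mu + (?al + ?al)) = \<kappa> * (lam * (2 - s))" by (simp add: algebra_simps)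
    also have "\<dots> = C * (?mu - 1)" using mu by (simp add: C_def)
    finally have "\<kappa> * (?mu + (?al + ?al)) = C * (?mu - 1)" .
    then show ?thesis by (simp add: algebra_simps)
  qed
  finally show ?case .
qed

end

text \<open>Instead of the Cauchy--Schwarz inequality, a pointwise bound is integrated: below
  \<open>e / 2\<close> it is trivial, above it follows from
  \<open>X \<le> X^2 / (2 * b) + b / 2\<close>.\<close>

lemma nn_paley_zygmund:
  fixes X :: "'a \<Rightarrow> real" and M :: "'a pmf"
  assumes X: "\<And>t. X t \<ge> 0" and e: "e > 0" and v: "v > 0"
    and E: "(\<integral>\<^sup>+t. ennreal (X t) \<partial>measure_pmf M) = ennreal e"
    and V: "(\<integral>\<^sup>+t. ennreal ((X t)\<^sup>2) \<partial>measure_pmf M) \<le> ennreal v"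
  shows "measure_pmf.prob M {t. X t \<ge> e / 2} \<ge> e\<^sup>2 / (4 * v)"
proof -
  \<comment> \<open>Chosen so that the second-moment term contributes at most \<open>e / 4\<close>,
    leaving another \<open>e / 4\<close> for the event.\<close>
  define b where "b = 2 * v / e"
  have b: "b > 0" using e v by (simp add: b_def)
  let ?P = "measure_pmf.prob M {t. X t \<ge> e / 2}"
  have pt: "ennreal (X t) \<le> ennreal (e / 2) + (ennreal (1 / (2 * b)) * ennreal ((X t)\<^sup>2) + ennreal (b / 2) * indicator {t. X t \<ge> e / 2} t)" for t
  proof (cases "X t \<ge> e / 2")
    case True
    have "0 \<le> (X t - b)\<^sup>2 / (2 * b)" using b by simp
    then have "X t \<le> 1 / (2 * b) * (X t)\<^sup>2 + b / 2"
      using b by (simp add: power2_eq_square field_simps)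
    then have "ennreal (X t) \<le> ennreal (1 / (2 * b) * (X t)\<^sup>2 + b / 2)" by (rule ennreal_leI)
    also have "\<dots> = ennreal (1 / (2 * b)) * ennreal ((X t)\<^sup>2) + ennreal (b / 2) * indicator {t. X t \<ge> e / 2} t"
      using True b by (simp add: ennreal_mult ennreal_plus del: times_divide_eq_left)
    finally show ?thesis by (rule order_trans) simp
  next
    case False
    then have "ennreal (X t) \<le> ennreal (e / 2)" by (intro ennreal_leI) simp
    then show ?thesis by (rule order_trans) simp
  qed
  have "ennreal e \<le> (\<integral>\<^sup>+t. ennreal (e / 2) + (ennreal (1 / (2 * b)) * ennreal ((X t)\<^sup>2) + ennreal (b / 2) * indicator {t. X t \<ge> e / 2} t) \<partial>measure_pmf M)"
    unfolding E[symmetric] by (intro nn_integral_mono pt)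
  also have "\<dots> = ennreal (e / 2) + (ennreal (1 / (2 * b)) * (\<integral>\<^sup>+t. ennreal ((X t)\<^sup>2) \<partial>measure_pmf M) + ennreal (b / 2) * ennreal ?P)"
    by (simp add: nn_integral_add nn_integral_cmult measure_pmf.emeasure_eq_measure)
  also have "\<dots> \<le> ennreal (e / 2) + (ennreal (1 / (2 * b)) * ennreal v + ennreal (b / 2) * ennreal ?P)"
    by (intro add_mono mult_left_mono V) auto
  also have "\<dots> = ennreal (e / 2 + (1 / (2 * b) * v + b / 2 * ?P))"
    using e v b by (simp add: ennreal_mult ennreal_plus del: times_divide_eq_left times_divide_eq_right)
  finally have "e \<le> e / 2 + (1 / (2 * b) * v + b / 2 * ?P)"
    using e v b by (subst (asm) ennreal_le_iff) auto
  also have "1 / (2 * b) * v = e / 4" using e v by (simp add: b_def)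
  also have "b / 2 = v / e" by (simp add: b_def)
  finally have "e / 4 \<le> v / e * ?P" by linarith
  then show ?thesis using e v by (simp add: field_simps power2_eq_square)
qed

lemma nn_integral_count_space_prod:
  assumes "countable A" "countable B"
  shows "(\<integral>\<^sup>+z. f z \<partial>count_space (A \<times> B)) = (\<integral>\<^sup>+x. \<integral>\<^sup>+y. f (x, y) \<partial>count_space B \<partial>count_space A)"
proof -
  interpret B: sigma_finite_measure "count_space B" by (rule sigma_finite_measure_count_space_countable[OF assms(2)])
  have "(\<integral>\<^sup>+z. f z \<partial>(count_space A \<Otimes>\<^sub>M count_space B)) = (\<integral>\<^sup>+x. \<integral>\<^sup>+y. f (x, y) \<partial>count_space B \<partial>count_space A)"
    by (rule B.nn_integral_fst[symmetric]) (simp add: pair_measure_countable[OF assms])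
  then show ?thesis by (simp add: pair_measure_countable[OF assms])
qed

lemma nn_integral_count_space_subset:
  "A \<subseteq> B \<Longrightarrow> (\<integral>\<^sup>+x. f x \<partial>count_space A) \<le> (\<integral>\<^sup>+x. f x \<partial>count_space B)"
  by (subst (1 2) nn_integral_count_space_indicator) (auto intro!: nn_integral_mono simp: indicator_def)

lemma prod_list_pos:
  fixes xs :: "real list"
  shows "(\<And>x. x \<in> set xs \<Longrightarrow> x > 0) \<Longrightarrow> prod_list xs > 0"
  by (induction xs) auto

lemma real_sum_list: "real (sum_list (map f xs)) = sum_list (map (\<lambda>x. real (f x)) xs)"
  by (induction xs) auto

lemma poisson_zero: "set_pmf (poisson 0) = {0}"
  by (simp add: poisson_def)

lemma ctree_pmf_cases:
  assumes "t \<in> set_pmf (ctree_pmf lam s (Suc N))"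
  obtains cs ls rs where "t = CNode cs ls rs" "set cs \<union> set ls \<union> set rs \<subseteq> set_pmf (ctree_pmf lam s N)"
    "s = 1 \<Longrightarrow> ls = [] \<and> rs = []"
proof -
  obtain cs ls rs where "t = CNode cs ls rs" "set cs \<union> set ls \<union> set rs \<subseteq> set_pmf (ctree_pmf lam s N)"
    and len: "length ls \<in> set_pmf (poisson (lam * (1 - s)))" "length rs \<in> set_pmf (poisson (lam * (1 - s)))"
    using assms by (auto simp: set_bind_pmf set_replicate_pmf lists_eq_set)
  moreover have "ls = [] \<and> rs = []" if "s = 1" using len that by (simp add: poisson_zero)
  ultimately show ?thesis using that by blast
qed

section \<open>From a one-sided test to a large likelihood ratio\<close>

context
  fixes lam s :: real
  assumes lam: "lam > 0" and s: "0 \<le> s" "s \<le> 1"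
begin

text \<open>Where the ratio is at most \<open>M\<close>, the mass under \<open>P1\<close> is at most
  \<open>M\<close> times that under \<open>P0\<close>; the rest of \<open>S\<close> is bounded by
  the probability that the ratio of a correlated pair exceeds \<open>M\<close>, expressed through
  \<open>ctree_pmf\<close>.\<close>

lemma P1_event_le:
  assumes M: "M \<ge> 0" and S: "S \<subseteq> trees_upto n \<times> trees_upto n" and n: "n \<le> N"
  shows "emeasure (prune_law n (P1 lam s)) S \<le>
    ennreal M * emeasure (prune_law n (P0 lam)) S +
    emeasure (measure_pmf (ctree_pmf lam s N)) {t. ctree_like lam s n t t > M}"
proof -
  let ?X = "trees_upto n"
  let ?L = "\<lambda>z. ennreal (tree_like lam s n (fst z) (snd z))"
  let ?E = "\<lambda>z. tree_event n (fst z) \<times> tree_event n (snd z)"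
  let ?p = "\<lambda>z. emeasure (P0 lam) (?E z)"
  let ?I = "\<lambda>z. indicator {M<..} (tree_like lam s n (fst z) (snd z)) :: ennreal"
  have sets0: "sets (P0 lam) = sets (tree_space \<Otimes>\<^sub>M tree_space)"
    unfolding P0_def by (rule sets_pair_measure_cong) (simp_all add: GW_def)
  have K: "(\<lambda>t. augmentation lam s t \<bind> uniform_relabeling) \<in> tree_space \<rightarrow>\<^sub>M prob_algebra tree_space"
    by (rule measurable_bind_prob_space[OF augmentation_kernel uniform_relabeling_kernel])
  have sets1: "sets (P1 lam s) = sets (tree_space \<Otimes>\<^sub>M tree_space)"
    unfolding P1_def by (rule sets_bind'[OF GW_prob_algebra measurable_pair_prob[OF K K]])
  have "emeasure (prune_law n (P1 lam s)) S = (\<integral>\<^sup>+z. ?L z * ?p z \<partial>count_space S)"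
    unfolding emeasure_prune_law[OF sets1 S]
    using S by (intro nn_integral_cong) (auto simp: P1_likelihood[OF lam s])
  also have "\<dots> \<le> (\<integral>\<^sup>+z. ennreal M * ?p z + ?I z * (?L z * ?p z) \<partial>count_space S)"
  proof (intro nn_integral_mono)
    fix z
    show "?L z * ?p z \<le> ennreal M * ?p z + ?I z * (?L z * ?p z)"
    proof (cases "tree_like lam s n (fst z) (snd z) > M")
      case False
      then have "?L z * ?p z \<le> ennreal M * ?p z" by (intro mult_right_mono ennreal_leI) auto
      then show ?thesis by (rule order_trans) simp
    qed simp
  qed
  also have "\<dots> = ennreal M * emeasure (prune_law n (P0 lam)) S + (\<integral>\<^sup>+z. ?I z * (?L z * ?p z) \<partial>count_space S)"
    unfolding emeasure_prune_law[OF sets0 S] by (simp add: nn_integral_add nn_integral_cmult)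
  also have "(\<integral>\<^sup>+z. ?I z * (?L z * ?p z) \<partial>count_space S) \<le> (\<integral>\<^sup>+z. ?I z * (?L z * ?p z) \<partial>count_space (?X \<times> ?X))"
    using S by (intro nn_integral_count_space_subset)
  also have "\<dots> = (\<integral>\<^sup>+x. \<integral>\<^sup>+x'. ?I (x, x') * (?L (x, x') * ?p (x, x')) \<partial>count_space ?X \<partial>count_space ?X)"
    by (rule nn_integral_count_space_prod[OF countable_trees_upto countable_trees_upto])
  also have "\<dots> = (\<integral>\<^sup>+t. indicator {M<..} (ctree_like lam s n t t) \<partial>measure_pmf (ctree_pmf lam s N))"
    unfolding nn_integral_ctree_like[OF lam s n] by (intro nn_integral_cong) (simp add: P0_prob)
  also have "\<dots> = (\<integral>\<^sup>+t. indicator {t. ctree_like lam s n t t > M} t \<partial>measure_pmf (ctree_pmf lam s N))"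
    by (intro nn_integral_cong) (simp add: indicator_def)
  also have "\<dots> = emeasure (measure_pmf (ctree_pmf lam s N)) {t. ctree_like lam s n t t > M}"
    by simp
  finally show ?thesis by (simp add: add_left_mono)
qed

lemma prune_law_P0_le:
  assumes S: "S \<subseteq> trees_upto n \<times> trees_upto n" shows "emeasure (prune_law n (P0 lam)) S \<le> 1"
proof -
  let ?X = "trees_upto n"
  have sets0: "sets (P0 lam) = sets (tree_space \<Otimes>\<^sub>M tree_space)"
    unfolding P0_def by (rule sets_pair_measure_cong) (simp_all add: GW_def)
  have "emeasure (prune_law n (P0 lam)) S \<le>
    (\<integral>\<^sup>+z. emeasure (P0 lam) (tree_event n (fst z) \<times> tree_event n (snd z)) \<partial>count_space (?X \<times> ?X))"
    unfolding emeasure_prune_law[OF sets0 S] by (rule nn_integral_count_space_subset[OF S])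
  also have "\<dots> = (\<integral>\<^sup>+x. \<integral>\<^sup>+x'. gw_prob lam n x * gw_prob lam n x' \<partial>count_space ?X \<partial>count_space ?X)"
    unfolding nn_integral_count_space_prod[OF countable_trees_upto countable_trees_upto]
    by (intro nn_integral_cong) (simp add: P0_prob)
  also have "\<dots> = (\<integral>\<^sup>+x. gw_prob lam n x \<partial>count_space ?X) * (\<integral>\<^sup>+x. gw_prob lam n x \<partial>count_space ?X)"
    by (simp add: nn_integral_cmult nn_integral_multc)
  also have "\<dots> \<le> 1 * 1" by (intro mult_mono gw_prob_total) auto
  finally show ?thesis by simp
qed

text \<open>For fixed \<open>M\<close>, the error \<open>M * P0 (T = 1)\<close> tends to 0 while
  \<open>P1 (T = 1)\<close> stays above some \<open>z\<close>, so the ratio exceeds \<open>M\<close>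
  with probability at least \<open>z / 2\<close> at a suitable depth. The depth depends on
  \<open>M\<close>, the bound \<open>p0\<close> does not; the later choice of constants rests on
  this.\<close>

lemma one_sided_test_likelihood:
  assumes T: "one_sided_test lam s T"
  obtains p0 where "p0 > 0" "\<And>M. M \<ge> 0 \<Longrightarrow> \<exists>n. \<forall>N\<ge>n. measure_pmf.prob (ctree_pmf lam s N) {t. ctree_like lam s n t t > M} \<ge> p0"
proof -
  let ?S = "\<lambda>n. {x \<in> trees_upto n \<times> trees_upto n. T n x = 1}"
  let ?p0 = "\<lambda>n. measure (prune_law n (P0 lam)) (?S n)" and ?p1 = "\<lambda>n. measure (prune_law n (P1 lam s)) (?S n)"
  have lim0: "?p0 \<longlonglongrightarrow> 0" and lim1: "liminf (\<lambda>n. ereal (?p1 n)) > 0"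
    using T unfolding one_sided_test_def by blast+
  obtain z where z: "0 < ereal z" "ereal z < liminf (\<lambda>n. ereal (?p1 n))" using ereal_dense2[OF lim1] by blast
  have z0: "z > 0" using z(1) by simp
  have ev1: "eventually (\<lambda>n. z < ?p1 n) sequentially" using less_LiminfD[OF z(2)] by simp
  have "\<exists>n. \<forall>N\<ge>n. measure_pmf.prob (ctree_pmf lam s N) {t. ctree_like lam s n t t > M} \<ge> z / 2" if M: "M \<ge> 0" for M
  proof -
    have "(\<lambda>n. M * ?p0 n) \<longlonglongrightarrow> M * 0" by (intro tendsto_mult_left lim0)
    then have "eventually (\<lambda>n. M * ?p0 n < z / 2) sequentially"
      by (rule order_tendstoD(2)) (use z0 in simp)
    with ev1 have "eventually (\<lambda>n. z < ?p1 n \<and> M * ?p0 n < z / 2) sequentially" by eventually_elim simp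
    then obtain n where n: "z < ?p1 n" "M * ?p0 n < z / 2" by (auto simp: eventually_sequentially)
    have "measure_pmf.prob (ctree_pmf lam s N) {t. ctree_like lam s n t t > M} \<ge> z / 2" if "N \<ge> n" for N
    proof -
      let ?q = "measure_pmf.prob (ctree_pmf lam s N) {t. ctree_like lam s n t t > M}"
      have S: "?S n \<subseteq> trees_upto n \<times> trees_upto n" by auto
      have e0: "emeasure (prune_law n (P0 lam)) (?S n) = ennreal (?p0 n)"
        using prune_law_P0_le[OF S] by (intro emeasure_eq_ennreal_measure) (auto simp: top_unique)
      \<comment> \<open>An infinite value would be read as 0 by \<open>measure\<close>, so the
        inequality holds without finiteness.\<close>
      have "ennreal (?p1 n) \<le> emeasure (prune_law n (P1 lam s)) (?S n)"
        unfolding measure_def by (simp add: ennreal_enn2real_if)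
      also have "\<dots> \<le> ennreal M * ennreal (?p0 n) + ennreal ?q"
        using P1_event_le[OF M S that] unfolding e0 measure_pmf.emeasure_eq_measure .
      also have "\<dots> = ennreal (M * ?p0 n + ?q)" using M by (simp add: ennreal_mult ennreal_plus)
      finally have "?p1 n \<le> M * ?p0 n + ?q" using M by (subst (asm) ennreal_le_iff) auto
      then show ?thesis using n by simp
    qed
    then show ?thesis by blast
  qed
  then show ?thesis using z0 that[of "z / 2"] by simp
qed

text \<open>In the recursion only the term with \<open>m = length cs\<close> is kept, and in it only
  the pairs of equal injections into the common children. There are \<open>fact m\<close> of them,
  which cancels the factorial in \<open>psi\<close>.\<close>

lemma ctree_like_step:
  assumes s0: "s > 0"
  shows "ctree_like lam s (Suc n) (CNode cs ls rs) (CNode cs ls rs) \<ge>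
    exp (lam * s) * (s / lam) ^ length cs * (1 - s) ^ (length ls + length rs) * prod_list (map (\<lambda>c. ctree_like lam s n c c) cs)"
proof -
  let ?t = "CNode cs ls rs" and ?m = "length cs"
  let ?x = "enc True ?t" and ?x' = "enc False ?t"
  let ?L = "\<lambda>k k'. tree_like lam s n (subtree ?x k) (subtree ?x' k')"
  have d: "root_degree ?x = ?m + length ls" "root_degree ?x' = ?m + length rs" by (simp_all add: root_degree_enc)
  have nn: "tree_like lam s n x x' \<ge> 0" for x x' by (rule tree_like_nonneg[OF lam s])
  let ?P = "\<lambda>\<sigma> \<sigma>'. \<Prod>l = 1..?m. ?L (\<sigma> l) (\<sigma>' l)"
  \<comment> \<open>Using one injection on both sides matches every common child with itself; the
    injection merely reorders the product, so all diagonal terms are equal.\<close>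
  have prod: "?P \<sigma> \<sigma> = prod_list (map (\<lambda>c. ctree_like lam s n c c) cs)" if "\<sigma> \<in> injections ?m {1..?m}" for \<sigma>
  proof -
    have "inj_on \<sigma> {1..?m}" "\<sigma> ` {1..?m} \<subseteq> {1..?m}" using that by (auto simp: injections_def)
    then have bij: "bij_betw \<sigma> {1..?m} {1..?m}" by (simp add: bij_betw_def endo_inj_surj)
    have "?P \<sigma> \<sigma> = (\<Prod>k\<in>{1..?m}. ?L k k)"
      by (rule prod.reindex_bij_betw[OF bij])
    also have "\<dots> = (\<Prod>k\<in>{1..?m}. (\<lambda>c. ctree_like lam s n c c) (cs ! (k - 1)))"
      by (intro prod.cong refl) (auto simp: subtree_enc ctree_like_def nth_append)
    also have "\<dots> = (\<Prod>i<?m. (\<lambda>c. ctree_like lam s n c c) (cs ! i))"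
      by (rule prod.reindex_bij_witness[of _ Suc "\<lambda>k. k - 1"]) auto
    also have "\<dots> = prod_list (map (\<lambda>c. ctree_like lam s n c c) cs)"
      by (simp add: prod.list_conv_set_nth atLeast0LessThan)
    finally show ?thesis .
  qed
  have sub: "injections ?m {1..?m} \<subseteq> injections ?m {1..?m + j}" for j
    by (fastforce simp: injections_def PiE_iff)
  have fin: "finite (injections ?m {1..j})" for j by (simp add: finite_injections)
  have card: "real (card (injections ?m {1..?m})) = fact ?m"
    using sum_permutes_injections[of ?m ?m "\<lambda>_. 1 :: real"] by (simp add: card_permutations)
  have "fact ?m * prod_list (map (\<lambda>c. ctree_like lam s n c c) cs) = (\<Sum>\<sigma>\<in>injections ?m {1..?m}. prod_list (map (\<lambda>c. ctree_like lam s n c c) cs))"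
    using card by simp
  also have "\<dots> = (\<Sum>\<sigma>\<in>injections ?m {1..?m}. ?P \<sigma> \<sigma>)"
    by (intro sum.cong refl prod[symmetric])
  also have "\<dots> \<le> (\<Sum>\<sigma>\<in>injections ?m {1..?m}. \<Sum>\<sigma>'\<in>injections ?m {1..root_degree ?x'}. ?P \<sigma> \<sigma>')"
  proof (intro sum_mono)
    fix \<sigma> assume "\<sigma> \<in> injections ?m {1..?m}"
    then have "\<sigma> \<in> injections ?m {1..root_degree ?x'}" using sub unfolding d by blast
    then show "?P \<sigma> \<sigma> \<le> (\<Sum>\<sigma>'\<in>injections ?m {1..root_degree ?x'}. ?P \<sigma> \<sigma>')"
      using fin by (intro member_le_sum prod_nonneg) (auto intro: nn)
  qed
  also have "\<dots> \<le> (\<Sum>\<sigma>\<in>injections ?m {1..root_degree ?x}. \<Sum>\<sigma>'\<in>injections ?m {1..root_degree ?x'}. ?P \<sigma> \<sigma>')"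
    using fin sub unfolding d by (intro sum_mono2 sum_nonneg prod_nonneg) (auto intro: nn)
  finally have main: "fact ?m * prod_list (map (\<lambda>c. ctree_like lam s n c c) cs) \<le> \<dots>" .
  have psi: "psi lam s ?m (root_degree ?x) (root_degree ?x') * fact ?m = exp (lam * s) * (s / lam) ^ ?m * (1 - s) ^ (length ls + length rs)"
  proof -
    have "?m + length ls + (?m + length rs) - 2 * ?m = length ls + length rs" by simp
    then show ?thesis unfolding psi_def d by (simp add: power_divide)
  qed
  have "exp (lam * s) * (s / lam) ^ ?m * (1 - s) ^ (length ls + length rs) * prod_list (map (\<lambda>c. ctree_like lam s n c c) cs) =
     psi lam s ?m (root_degree ?x) (root_degree ?x') * (fact ?m * prod_list (map (\<lambda>c. ctree_like lam s n c c) cs))"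
    unfolding psi[symmetric] by simp
  also have "\<dots> \<le> psi lam s ?m (root_degree ?x) (root_degree ?x') *
     (\<Sum>\<sigma>\<in>injections ?m {1..root_degree ?x}. \<Sum>\<sigma>'\<in>injections ?m {1..root_degree ?x'}. ?P \<sigma> \<sigma>')"
    by (intro mult_left_mono main psi_nonneg[OF lam s])
  also have "\<dots> \<le> tree_like lam s (Suc n) ?x ?x'"
    unfolding tree_like.simps
    by (rule member_le_sum[of ?m]) (auto simp: d intro!: mult_nonneg_nonneg psi_nonneg[OF lam s] sum_nonneg prod_nonneg nn)
  finally show ?thesis by (simp add: ctree_like_def)
qed

text \<open>The lower bound of \<open>ctree_like_step\<close> is positive on the support: for
  \<open>s = 1\<close> the factor \<open>1 - s\<close> vanishes, but then there are no private
  children and its exponent is 0.\<close>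

lemma ctree_like_pos:
  assumes s0: "s > 0"
  shows "n \<le> N \<Longrightarrow> t \<in> set_pmf (ctree_pmf lam s N) \<Longrightarrow> ctree_like lam s n t t > 0"
proof (induction n arbitrary: N t)
  case 0 then show ?case by (simp add: ctree_like_def)
next
  case (Suc n)
  then obtain N' where N: "N = Suc N'" "n \<le> N'" by (cases N) auto
  obtain cs ls rs where t: "t = CNode cs ls rs" "set cs \<union> set ls \<union> set rs \<subseteq> set_pmf (ctree_pmf lam s N')"
      "s = 1 \<Longrightarrow> ls = [] \<and> rs = []"
    using ctree_pmf_cases[OF Suc.prems(2)[unfolded N(1)]] by metis
  have "prod_list (map (\<lambda>c. ctree_like lam s n c c) cs) > 0"
    using Suc.IH[OF N(2)] t(2) by (intro prod_list_pos) auto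
  moreover have "(1 - s) ^ (length ls + length rs) > 0" using t(3) s by (cases "s = 1") auto
  ultimately have "exp (lam * s) * (s / lam) ^ length cs * (1 - s) ^ (length ls + length rs) * prod_list (map (\<lambda>c. ctree_like lam s n c c) cs) > 0"
    using lam s0 by simp
  then show ?case using ctree_like_step[OF s0, of cs ls rs n] unfolding t(1) by linarith
qed

lemma ln_prod_list:
  fixes xs :: "real list"
  shows "(\<And>x. x \<in> set xs \<Longrightarrow> x > 0) \<Longrightarrow> ln (prod_list xs) = sum_list (map ln xs)"
proof (induction xs)
  case (Cons x xs)
  then have "prod_list xs > 0" by (intro prod_list_pos) auto
  moreover have "x > 0" using Cons.prems by simp
  ultimately show ?case using Cons by (simp add: ln_mult_pos)
qed simp

text \<open>The logarithm of \<open>ctree_like_step\<close> is a sum over the common children, minus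
  at most \<open>\<kappa>\<close> for every child; the term \<open>lam * s\<close> only helps.
  Finiteness of the cost is proved along with the bound because \<open>enn2real\<close> would send
  an infinite cost to 0.\<close>

lemma ln_ctree_like_ge:
  fixes n0 :: nat and M :: real
  assumes s0: "s > 0" and M: "M \<ge> 1"
  defines "P \<equiv> \<lambda>t. ctree_like lam s n0 t t > M"
    and "f \<equiv> \<lambda>t. inverse (ennreal (ctree_like lam s n0 t t))"
    and "\<kappa> \<equiv> \<bar>ln (s / lam)\<bar> + \<bar>ln (1 - s)\<bar>"
  shows "n0 + k \<le> N \<Longrightarrow> t \<in> set_pmf (ctree_pmf lam s N) \<Longrightarrow> path_cost f \<kappa> k t < \<top> \<and>
    ln M * real (good_count P k t) \<le> ln (ctree_like lam s (n0 + k) t t) + enn2real (path_cost f \<kappa> k t)"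
proof (induction k arbitrary: N t)
  case 0
  let ?L = "ctree_like lam s n0 t t"
  have L: "?L > 0" using ctree_like_pos[OF s0 _ 0(2)] 0(1) by simp
  then have f: "f t = ennreal (1 / ?L)" by (simp add: f_def inverse_ennreal inverse_eq_divide)
  have "ln (1 / ?L) \<le> 1 / ?L - 1" using L by (intro ln_le_minus_one) simp
  \<comment> \<open>This handles the nodes that are not good: however small their ratio is, the cost
    \<open>1 / ?L\<close> makes up for its negative logarithm.\<close>
  then have l: "ln ?L \<ge> - (1 / ?L)" using L by (simp add: ln_div)
  have "ln M * real (good_count P 0 t) \<le> ln ?L + 1 / ?L"
  proof (cases "?L > M")
    case True
    then have "ln M \<le> ln ?L" using M by simp
    then show ?thesis using True L by (simp add: P_def) (meson add_increasing2 le_numeral_extra(1) zero_le_divide_1_iff less_imp_le)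
  next
    case False
    then show ?thesis using l by (simp add: P_def)
  qed
  then show ?case using L by (simp add: f enn2real_ennreal)
next
  case (Suc k)
  then obtain N' where N: "N = Suc N'" "n0 + k \<le> N'" by (cases N) auto
  obtain cs ls rs where t: "t = CNode cs ls rs" "set cs \<union> set ls \<union> set rs \<subseteq> set_pmf (ctree_pmf lam s N')"
      "s = 1 \<Longrightarrow> ls = [] \<and> rs = []"
    using ctree_pmf_cases[OF Suc.prems(2)[unfolded N(1)]] by metis
  let ?l = "\<lambda>c. ctree_like lam s (n0 + k) c c" and ?c = "path_cost f \<kappa> k"
  let ?m = "length cs" and ?e = "length ls + length rs"
  have IH: "?c c < \<top>" "ln M * real (good_count P k c) \<le> ln (?l c) + enn2real (?c c)" "?l c > 0" if "c \<in> set cs" for c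
    using Suc.IH[OF N(2), of c] ctree_like_pos[OF s0 N(2), of c] that t(2) by auto
  have cost: "sum_list (map ?c xs) < \<top> \<and> enn2real (sum_list (map ?c xs)) = sum_list (map (\<lambda>c. enn2real (?c c)) xs)"
    if "set xs \<subseteq> set cs" for xs
    using that IH(1) by (induction xs) (auto simp: enn2real_plus ennreal_add_less_top)
  have cost': "path_cost f \<kappa> (Suc k) t < \<top>"
    "enn2real (path_cost f \<kappa> (Suc k) t) = \<kappa> * real (?m + ?e) + sum_list (map (\<lambda>c. enn2real (?c c)) cs)"
  proof -
    have e: "ennreal \<kappa> * of_nat (?m + length ls + length rs) = ennreal (\<kappa> * real (?m + ?e))"
      by (simp add: ennreal_of_nat_eq_real_of_nat ennreal_mult \<kappa>_def add.assoc del: of_nat_add)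
    show "path_cost f \<kappa> (Suc k) t < \<top>"
      unfolding t(1) path_cost.simps ctree.case e using cost[of cs] by (simp add: ennreal_add_less_top)
    show "enn2real (path_cost f \<kappa> (Suc k) t) = \<kappa> * real (?m + ?e) + sum_list (map (\<lambda>c. enn2real (?c c)) cs)"
      unfolding t(1) path_cost.simps ctree.case e using cost[of cs]
      by (subst enn2real_plus) (auto simp: \<kappa>_def simp del: of_nat_add)
  qed
  have pl: "prod_list (map ?l cs) > 0" using IH(3) by (intro prod_list_pos) auto
  have e1: "(1 - s) ^ ?e > 0" using t(3) s by (cases "s = 1") auto
  let ?R = "exp (lam * s) * (s / lam) ^ ?m * (1 - s) ^ ?e * prod_list (map ?l cs)"
  have "ln ?R = lam * s + real ?m * ln (s / lam) + ln ((1 - s) ^ ?e) + ln (prod_list (map ?l cs))"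
  proof -
    have "(s / lam) ^ ?m > 0" using lam s0 by simp
    then have "ln ?R = ln (exp (lam * s)) + ln ((s / lam) ^ ?m) + ln ((1 - s) ^ ?e) + ln (prod_list (map ?l cs))"
      using e1 pl by (simp add: ln_mult_pos del: zero_less_power_eq)
    then show ?thesis using lam s0 by (simp add: ln_realpow)
  qed
  also have "ln ((1 - s) ^ ?e) = real ?e * ln (1 - s)"
    using t(3) s by (cases "s = 1") (auto simp: ln_realpow)
  also have "ln (prod_list (map ?l cs)) = sum_list (map (\<lambda>c. ln (?l c)) cs)"
    using IH(3) by (subst ln_prod_list) (auto simp: o_def)
  finally have R: "ln ?R = lam * s + real ?m * ln (s / lam) + real ?e * ln (1 - s) + sum_list (map (\<lambda>c. ln (?l c)) cs)" .
  have "real ?m * ln (s / lam) \<ge> - (\<kappa> * real ?m)"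
  proof -
    have "- \<kappa> \<le> ln (s / lam)" unfolding \<kappa>_def by simp
    from mult_left_mono[OF this, of "real ?m"] show ?thesis by (simp add: mult.commute)
  qed
  moreover have "real ?e * ln (1 - s) \<ge> - (\<kappa> * real ?e)"
  proof -
    have "- \<kappa> \<le> ln (1 - s)" unfolding \<kappa>_def by simp
    from mult_left_mono[OF this, of "real ?e"] show ?thesis by (simp add: mult.commute)
  qed
  moreover have "lam * s \<ge> 0" using lam s0 by simp
  ultimately have R': "ln ?R \<ge> - (\<kappa> * real (?m + ?e)) + sum_list (map (\<lambda>c. ln (?l c)) cs)"
    unfolding R of_nat_add[of ?m ?e] distrib_left[of \<kappa>] by linarith
  have "ln ?R \<le> ln (ctree_like lam s (n0 + Suc k) t t)"
    using ctree_like_step[OF s0, of cs ls rs "n0 + k"] lam s0 e1 pl unfolding t(1) by (simp add: ln_mono)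
  moreover have "sum_list (map (\<lambda>c. ln M * real (good_count P k c)) cs) \<le> sum_list (map (\<lambda>c. ln (?l c) + enn2real (?c c)) cs)"
    by (intro sum_list_mono IH(2))
  moreover have "ln M * real (good_count P (Suc k) t) = sum_list (map (\<lambda>c. ln M * real (good_count P k c)) cs)"
    unfolding t(1) by (simp add: sum_list_const_mult real_sum_list)
  ultimately have "ln M * real (good_count P (Suc k) t) \<le> ln (ctree_like lam s (n0 + Suc k) t t) + enn2real (path_cost f \<kappa> (Suc k) t)"
    using R' unfolding cost'(2) by (simp add: sum_list_addf)
  then show ?case using cost'(1) by blast
qed

end

definition good_tree :: "real \<Rightarrow> real \<Rightarrow> nat \<Rightarrow> real \<Rightarrow> ctree \<Rightarrow> bool" where
  "good_tree lam s k \<beta> t \<longleftrightarrow> (\<exists>a1 a2 a3 b1 b2 b3.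
     distinct [a1, a2, a3] \<and> {a1, a2, a3} \<subseteq> {..<length (children True t)} \<and>
     distinct [b1, b2, b3] \<and> {b1, b2, b3} \<subseteq> {..<length (children False t)} \<and>
     ctree_like lam s k (children True t ! a1) (children False t ! b1) > \<beta> \<and>
     ctree_like lam s k (children True t ! a2) (children False t ! b2) > \<beta> \<and>
     ctree_like lam s k (children True t ! a3) (children False t ! b3) > \<beta>)"

lemma good_treeI:
  assumes "length cs = 3" "\<And>c. c \<in> set cs \<Longrightarrow> ctree_like lam s k c c > \<beta>"
  shows "good_tree lam s k \<beta> (CNode cs ls rs)"
proof -
  have "cs ! 0 \<in> set cs" "cs ! 1 \<in> set cs" "cs ! 2 \<in> set cs" using assms(1) by (auto intro: nth_mem)
  then have "ctree_like lam s k (cs ! 0) (cs ! 0) > \<beta>" "ctree_like lam s k (cs ! 1) (cs ! 1) > \<beta>"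
    "ctree_like lam s k (cs ! 2) (cs ! 2) > \<beta>" using assms(2) by auto
  then show ?thesis
    unfolding good_tree_def using assms(1)
    by (intro exI[of _ 0] exI[of _ 1] exI[of _ 2]) (auto simp: nth_append)
qed

section \<open>Accepted roots and uniform growth\<close>

context
  fixes lam s :: real
  assumes lam: "lam > 0" and s: "0 \<le> s" "s \<le> 1"
begin

text \<open>Suffices the case of exactly three common children, each matched with itself and each
  having a ratio above the threshold; these three events are independent.\<close>

lemma good_tree_prob:
  "measure_pmf.prob (ctree_pmf lam s (Suc N)) {t. good_tree lam s k \<beta> t} \<ge>
    pmf (poisson (lam * s)) 3 * (measure_pmf.prob (ctree_pmf lam s N) {t. ctree_like lam s k t t > \<beta>}) ^ 3"
proof -
  let ?q = "measure_pmf.prob (ctree_pmf lam s N) {t. ctree_like lam s k t t > \<beta>}"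
  let ?i = "\<lambda>t. indicator {t. ctree_like lam s k t t > \<beta>} t :: ennreal"
  let ?f = "\<lambda>t. (if length (common t) = 3 then 1 else 0) * (\<Prod>j\<in>{1..length (common t)}. ?i (common t ! (j - 1)))"
  have "ennreal (pmf (poisson (lam * s)) 3 * ?q ^ 3) = (\<integral>\<^sup>+m. (if m = 3 then ennreal ?q ^ 3 else 0) \<partial>measure_pmf (poisson (lam * s)))"
    by (simp add: nn_integral_pmf_single ennreal_mult ennreal_power)
  also have "\<dots> = (\<integral>\<^sup>+m. \<integral>\<^sup>+a. \<integral>\<^sup>+b. (if m = 3 then 1 else 0) * (\<Prod>j\<in>{1..m}. \<integral>\<^sup>+t. ?i t \<partial>measure_pmf (ctree_pmf lam s N)) *
      (\<Prod>j\<in>{1..a}. \<integral>\<^sup>+t. 1 \<partial>measure_pmf (ctree_pmf lam s N)) * (\<Prod>j\<in>{1..b}. \<integral>\<^sup>+t. 1 \<partial>measure_pmf (ctree_pmf lam s N))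
      \<partial>measure_pmf (poisson (lam * (1 - s))) \<partial>measure_pmf (poisson (lam * (1 - s))) \<partial>measure_pmf (poisson (lam * s)))"
    by (intro nn_integral_cong) (simp add: measure_pmf.emeasure_eq_measure)
  also have "\<dots> = (\<integral>\<^sup>+t. ?f t \<partial>measure_pmf (ctree_pmf lam s (Suc N)))"
    by (rule nn_integral_ctree_pmf_branch[symmetric]) simp
  also have "\<dots> \<le> (\<integral>\<^sup>+t. indicator {t. good_tree lam s k \<beta> t} t \<partial>measure_pmf (ctree_pmf lam s (Suc N)))"
  proof (intro nn_integral_mono)
    fix t :: ctree
    obtain cs ls rs where t: "t = CNode cs ls rs" by (cases t)
    show "?f t \<le> indicator {t. good_tree lam s k \<beta> t} t"
    proof (cases "length cs = 3 \<and> (\<forall>j\<in>{1..length cs}. ctree_like lam s k (cs ! (j - 1)) (cs ! (j - 1)) > \<beta>)")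
      case True
      have "ctree_like lam s k c c > \<beta>" if "c \<in> set cs" for c
      proof -
        obtain i where "i < length cs" "c = cs ! i" using \<open>c \<in> set cs\<close> by (auto simp: in_set_conv_nth)
        then show ?thesis using True[THEN conjunct2, rule_format, of "Suc i"] by simp
      qed
      then have "good_tree lam s k \<beta> t" unfolding t using True by (intro good_treeI) auto
      then show ?thesis by (subst prob_indicator_prod) (auto simp: indicator_def)
    next
      case False
      then have "?f t = 0" unfolding t by (subst prob_indicator_prod) auto
      then show ?thesis by (rule ord_eq_le_trans) simp
    qed
  qed
  also have "\<dots> = ennreal (measure_pmf.prob (ctree_pmf lam s (Suc N)) {t. good_tree lam s k \<beta> t})"
    by (simp add: measure_pmf.emeasure_eq_measure del: ctree_pmf.simps)
  finally show ?thesis by (simp del: ctree_pmf.simps)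
qed

text \<open>Two facts are combined: the number of good nodes in generation \<open>k\<close> is of
  order \<open>(lam * s) ^ k\<close> with probability at least \<open>p1\<close>, and the cost
  exceeds \<open>B * (lam * s) ^ k\<close> with probability at most \<open>p1 / 2\<close>. When only
  the first happens, the gain \<open>ln M\<close> per good node outweighs the cost.\<close>

lemma ctree_like_growth:
  assumes mu: "lam * s > 1" and T: "one_sided_test lam s T"
  obtains p n0 where "p > 0" "\<And>k N. n0 + k \<le> N \<Longrightarrow>
    measure_pmf.prob (ctree_pmf lam s N) {t. ctree_like lam s (n0 + k) t t \<ge> exp ((lam * s) ^ k)} \<ge> p"
proof -
  let ?mu = "lam * s"
  have s0: "s > 0" using mu lam by (metis mult_pos_pos less_trans not_less_iff_gr_or_eq zero_less_mult_iff zero_less_one s(1) order_less_le)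
  obtain p0 where p0: "p0 > 0" and test: "\<And>M. M \<ge> 0 \<Longrightarrow> \<exists>n. \<forall>N\<ge>n. measure_pmf.prob (ctree_pmf lam s N) {t. ctree_like lam s n t t > M} \<ge> p0"
    using one_sided_test_likelihood[OF lam s T] by blast
  \<comment> \<open>\<open>p1\<close> is the Paley--Zygmund bound for the good nodes,
    \<open>B\<close> makes Markov's inequality for the cost give \<open>p1 / 2\<close>, and
    \<open>M\<close> satisfies \<open>ln M * p0 / 2 = B + 1\<close>, so that one unit remains after
    the cost. None of \<open>C\<close>, \<open>C'\<close>, \<open>p1\<close>, \<open>B\<close>
    involves \<open>M\<close> or \<open>n0\<close>, which avoids circularity.\<close>
  define C where "C = ?mu / (?mu - 1)"
  define \<kappa> where "\<kappa> = \<bar>ln (s / lam)\<bar> + \<bar>ln (1 - s)\<bar>"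
  define C' where "C' = \<kappa> * (lam * (2 - s)) / (?mu - 1)"
  define p1 where "p1 = p0\<^sup>2 / (4 * C)"
  define B where "B = 2 * (1 + C') / p1"
  define M where "M = exp (2 * (B + 1) / p0)"
  have C: "C > 0" using mu by (simp add: C_def)
  have C': "C' \<ge> 0" using mu lam s by (simp add: C'_def \<kappa>_def)
  have p1: "p1 > 0" using p0 C by (simp add: p1_def)
  have B: "B > 0" using C' p1 by (simp add: B_def)
  have M: "M \<ge> 1" using B p0 by (simp add: M_def)
  obtain n0 where n0: "\<And>N. N \<ge> n0 \<Longrightarrow> measure_pmf.prob (ctree_pmf lam s N) {t. ctree_like lam s n0 t t > M} \<ge> p0"
    using test[of M] M by auto
  define P where "P t \<longleftrightarrow> ctree_like lam s n0 t t > M" for t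
  define f where "f t = inverse (ennreal (ctree_like lam s n0 t t))" for t
  define p where "p = measure_pmf.prob (ctree_pmf lam s n0) {t. P t}"
  \<comment> \<open>The ratio at depth \<open>n0\<close> has the same law for every sampled depth
    \<open>N \<ge> n0\<close>, because the sum in \<open>nn_integral_ctree_like\<close> does not
    contain \<open>N\<close>.\<close>
  have pN: "emeasure (measure_pmf (ctree_pmf lam s N)) {t. P t} = ennreal p" if "N \<ge> n0" for N
  proof -
    have eq: "emeasure (measure_pmf (ctree_pmf lam s N)) {t. P t} = (\<integral>\<^sup>+t. indicator {M<..} (ctree_like lam s n0 t t) \<partial>measure_pmf (ctree_pmf lam s N))" for N
    proof -
      have "(\<integral>\<^sup>+t. indicator {M<..} (ctree_like lam s n0 t t) \<partial>measure_pmf (ctree_pmf lam s N)) =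
        (\<integral>\<^sup>+t. indicator {t. P t} t \<partial>measure_pmf (ctree_pmf lam s N))"
        by (intro nn_integral_cong) (simp add: P_def indicator_def)
      then show ?thesis by (simp only: nn_integral_indicator sets_measure_pmf UNIV_I Pow_UNIV sets_count_space)
    qed
    have "emeasure (measure_pmf (ctree_pmf lam s N)) {t. P t} = emeasure (measure_pmf (ctree_pmf lam s n0)) {t. P t}"
      unfolding eq nn_integral_ctree_like[OF lam s that] nn_integral_ctree_like[OF lam s order_refl[of n0]] ..
    then show ?thesis by (simp add: p_def measure_pmf.emeasure_eq_measure)
  qed
  have p: "p0 \<le> p" "p \<le> 1" using n0[of n0] by (auto simp: p_def P_def)
  have fN: "(\<integral>\<^sup>+t. f t \<partial>measure_pmf (ctree_pmf lam s N)) \<le> 1" if "N \<ge> n0" for N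
    unfolding f_def by (rule nn_integral_inverse_ctree_like[OF lam s that])
  have main: "measure_pmf.prob (ctree_pmf lam s N) {t. ctree_like lam s (n0 + k) t t \<ge> exp (?mu ^ k)} \<ge> p1 / 2"
    if N: "n0 + k \<le> N" for k N
  proof -
    let ?U = "ctree_pmf lam s N"
    let ?X = "\<lambda>t. real (good_count P k t)" and ?Y = "path_cost f \<kappa> k"
    have mk: "?mu ^ k > 0" using mu by simp
    have E: "(\<integral>\<^sup>+t. ennreal (?X t) \<partial>measure_pmf ?U) = ennreal (p * ?mu ^ k)"
      using good_count_mean[OF lam s, of n0 P p k N, OF pN _ N] p p0 by (simp add: ennreal_of_nat_eq_real_of_nat)
    have V: "(\<integral>\<^sup>+t. ennreal ((?X t)\<^sup>2) \<partial>measure_pmf ?U) \<le> ennreal (C * ?mu ^ (2 * k))"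
      using good_count_second_moment[OF lam s, of n0 P p k N, OF pN _ p(2) mu N] p p0
      by (simp add: ennreal_of_nat_eq_real_of_nat ennreal_power C_def)
    have "(p * ?mu ^ k)\<^sup>2 / (4 * (C * ?mu ^ (2 * k))) \<le> measure_pmf.prob ?U {t. ?X t \<ge> p * ?mu ^ k / 2}"
    proof (rule nn_paley_zygmund[OF _ _ _ E V])
      have "?mu ^ (2 * k) > 0" using mu by simp
      then show "C * ?mu ^ (2 * k) > 0" using C by simp
    qed (use p p0 mk in auto)
    moreover have "(p * ?mu ^ k)\<^sup>2 / (4 * (C * ?mu ^ (2 * k))) = p\<^sup>2 / (4 * C)"
    proof -
      have "(p * a)\<^sup>2 / (4 * (C * a\<^sup>2)) = p\<^sup>2 / (4 * C)" if "a > 0" for a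
        using that C by (simp add: power2_eq_square)
      moreover have "?mu ^ (2 * k) = (?mu ^ k)\<^sup>2" by (metis power_mult mult.commute)
      ultimately show ?thesis using mk by simp
    qed
    moreover have "p1 \<le> p\<^sup>2 / (4 * C)" unfolding p1_def using C p p0 by (intro divide_right_mono power_mono) auto
    ultimately have X: "measure_pmf.prob ?U {t. ?X t \<ge> p * ?mu ^ k / 2} \<ge> p1" by simp
    have Y: "measure_pmf.prob ?U {t. ?Y t \<ge> ennreal (B * ?mu ^ k)} \<le> p1 / 2"
    proof -
      have "(\<integral>\<^sup>+t. ?Y t \<partial>measure_pmf ?U) \<le> ennreal ((1 + C') * ?mu ^ k - C')"
        unfolding C'_def by (rule path_cost_mean[OF lam s fN _ mu N]) (auto simp: \<kappa>_def)
      also have "\<dots> \<le> ennreal ((1 + C') * ?mu ^ k)" using C' by (intro ennreal_leI) simp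
      finally have Y1: "(\<integral>\<^sup>+t. ?Y t \<partial>measure_pmf ?U) \<le> ennreal ((1 + C') * ?mu ^ k)" .
      have "ennreal (B * ?mu ^ k) * emeasure (measure_pmf ?U) {t. ?Y t \<ge> ennreal (B * ?mu ^ k)} =
        (\<integral>\<^sup>+t. ennreal (B * ?mu ^ k) * indicator {t. ?Y t \<ge> ennreal (B * ?mu ^ k)} t \<partial>measure_pmf ?U)"
        by (simp add: nn_integral_cmult)
      also have "\<dots> \<le> (\<integral>\<^sup>+t. ?Y t \<partial>measure_pmf ?U)"
        by (intro nn_integral_mono) (simp add: indicator_def)
      also note Y1
      finally have "ennreal (B * ?mu ^ k * measure_pmf.prob ?U {t. ?Y t \<ge> ennreal (B * ?mu ^ k)}) \<le> ennreal ((1 + C') * ?mu ^ k)"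
        using B mk by (simp add: measure_pmf.emeasure_eq_measure ennreal_mult)
      then have "B * ?mu ^ k * measure_pmf.prob ?U {t. ?Y t \<ge> ennreal (B * ?mu ^ k)} \<le> (1 + C') * ?mu ^ k"
        using C' mk by (subst (asm) ennreal_le_iff) auto
      then have "B * measure_pmf.prob ?U {t. ?Y t \<ge> ennreal (B * ?mu ^ k)} \<le> 1 + C'"
        using mk by (simp add: mult.commute mult.left_commute)
      then have "measure_pmf.prob ?U {t. ?Y t \<ge> ennreal (B * ?mu ^ k)} \<le> (1 + C') / B"
        using B by (simp add: field_simps)
      also have "(1 + C') / B = p1 / 2"
      proof -
        have "a / (2 * a / p1) = p1 / 2" if "a > 0" for a :: real
          using that p1 by (simp add: field_simps)
        then show ?thesis using C' unfolding B_def by (metis add_pos_nonneg zero_less_one)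
      qed
      finally show ?thesis .
    qed
    have imp: "ctree_like lam s (n0 + k) t t \<ge> exp (?mu ^ k)"
      if t: "t \<in> set_pmf ?U" and x: "?X t \<ge> p * ?mu ^ k / 2" and y: "\<not> ?Y t \<ge> ennreal (B * ?mu ^ k)" for t
    proof -
      let ?L = "ctree_like lam s (n0 + k) t t"
      have c: "?Y t < \<top>" "ln M * ?X t \<le> ln ?L + enn2real (?Y t)"
        using ln_ctree_like_ge[OF lam s s0 M N t] unfolding P_def[abs_def] f_def[abs_def] \<kappa>_def by auto
      have L: "?L > 0" by (rule ctree_like_pos[OF lam s s0 N t])
      have yr: "enn2real (?Y t) \<le> B * ?mu ^ k"
        using y B mk by (intro enn2real_leI) (auto simp: not_le intro: less_imp_le)
      have lm: "ln M = 2 * (B + 1) / p0" by (simp add: M_def)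
      have "(B + 1) * ?mu ^ k = ln M * (p0 * ?mu ^ k / 2)" using p0 by (simp add: lm)
      also have "\<dots> \<le> ln M * (p * ?mu ^ k / 2)" using M p mk by (intro mult_left_mono) auto
      also have "\<dots> \<le> ln M * ?X t" using M x by (intro mult_left_mono) auto
      finally have "?mu ^ k \<le> ln ?L" using c(2) yr by (simp add: distrib_right)
      then show ?thesis using L by (simp add: ln_ge_iff)
    qed
    have "measure_pmf.prob ?U {t. ?X t \<ge> p * ?mu ^ k / 2} \<le>
      measure_pmf.prob ?U ({t. ctree_like lam s (n0 + k) t t \<ge> exp (?mu ^ k)} \<union> {t. ?Y t \<ge> ennreal (B * ?mu ^ k)})"
      using imp by (intro measure_pmf.finite_measure_mono_AE) (auto simp: AE_measure_pmf_iff)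
    also have "\<dots> \<le> measure_pmf.prob ?U {t. ctree_like lam s (n0 + k) t t \<ge> exp (?mu ^ k)} + measure_pmf.prob ?U {t. ?Y t \<ge> ennreal (B * ?mu ^ k)}"
      by (rule measure_Un_le) auto
    finally show ?thesis using X Y by simp
  qed
  show ?thesis by (rule that[of "p1 / 2" n0]) (use p1 main in auto)
qed

end

section \<open>Exploration of the correlated graphs\<close>

type_synonym edge_types = "nat \<Rightarrow> nat \<Rightarrow> bool \<times> bool"

definition typed_nbrs :: "edge_types \<Rightarrow> nat \<Rightarrow> nat set \<Rightarrow> bool \<times> bool \<Rightarrow> nat set" where
  "typed_nbrs w j W x = {v \<in> W. w j v = x}"

text \<open>Depth-first exploration. The pairs \<open>(j, k)\<close> in the list are discovered vertices whose neighbourhood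
  is to be revealed up to depth \<open>k\<close>, the vertices in \<open>D\<close> are discovered but will not be explored,
  the vertices in \<open>W\<close> are undiscovered. The exploration succeeds if no revealed edge closes a cycle,
  and the last argument records the discovered trees.\<close>

inductive explores :: "edge_types \<Rightarrow> (nat \<times> nat) list \<Rightarrow> nat set \<Rightarrow> nat set \<Rightarrow> ctree list \<Rightarrow> bool" for w where
  explores_Nil: "explores w [] D W []"
| explores_0: "explores w q (insert j D) W ts \<Longrightarrow> explores w ((j, 0) # q) D W (CNode [] [] [] # ts)"
| explores_Suc: "\<forall>v\<in>fst ` set q \<union> D. w j v = (False, False) \<Longrightarrow>
    C = typed_nbrs w j W (True, True) \<Longrightarrow> L = typed_nbrs w j W (True, False) \<Longrightarrow> R = typed_nbrs w j W (False, True) \<Longrightarrow>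
    card C = length cs \<Longrightarrow> card L = length ls \<Longrightarrow> card R = length rs \<Longrightarrow>
    explores w (map (\<lambda>v. (v, k)) (sorted_list_of_set C @ sorted_list_of_set L @ sorted_list_of_set R) @ q)
      D (W - C - L - R) (cs @ ls @ rs @ ts) \<Longrightarrow>
    explores w ((j, Suc k) # q) D W (CNode cs ls rs # ts)"

inductive_cases explores_NilE: "explores w [] D W ts"
inductive_cases explores_0E: "explores w ((j, 0) # q) D W ts"
inductive_cases explores_SucE: "explores w ((j, Suc k) # q) D W ts"

text \<open>The head of the queue and \<open>w\<close> determine the next step. Uniqueness makes the
  events of different outcomes disjoint, so that their probabilities can be added.\<close>

lemma explores_unique: "explores w q D W ts \<Longrightarrow> explores w q D W ts' \<Longrightarrow> ts = ts'"
proof (induction arbitrary: ts' rule: explores.induct)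
  case (explores_Nil D W)
  show ?case by (rule explores_NilE[OF explores_Nil.prems]) simp
next
  case (explores_0 q j D W ts)
  obtain ts'' where "ts' = CNode [] [] [] # ts''" "explores w q (insert j D) W ts''"
    by (rule explores_0E[OF explores_0.prems]) blast
  then show ?case using explores_0.IH[of ts''] by simp
next
  case (explores_Suc q D j C W L R cs ls rs k ts)
  obtain cs' ls' rs' ts'' where t: "ts' = CNode cs' ls' rs' # ts''"
    "card C = length cs'" "card L = length ls'" "card R = length rs'"
    "explores w (map (\<lambda>v. (v, k)) (sorted_list_of_set C @ sorted_list_of_set L @ sorted_list_of_set R) @ q)
      D (W - C - L - R) (cs' @ ls' @ rs' @ ts'')"
    unfolding explores_Suc.hyps(2-4) map_append append_assoc by (rule explores_SucE[OF explores_Suc.prems]) blast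
  have "cs @ ls @ rs @ ts = cs' @ ls' @ rs' @ ts''" by (rule explores_Suc.IH[OF t(5)])
  then show ?case using t(1-4) explores_Suc.hyps(5-7) by auto
qed

lemma typed_nbrs_cong: "(\<And>v. v \<in> W \<Longrightarrow> w j v = w' j v) \<Longrightarrow> typed_nbrs w j W x = typed_nbrs w' j W x"
  by (auto simp: typed_nbrs_def)

lemma explores_cong_imp:
  assumes "explores w q D W ts" "finite W" and "\<And>u v. u \<in> fst ` set q \<union> D \<union> W \<Longrightarrow> v \<in> fst ` set q \<union> D \<union> W \<Longrightarrow> w u v = w' u v"
  shows "explores w' q D W ts"
  using assms
proof (induction rule: explores.induct)
  case (explores_Nil D W) show ?case by (rule explores.explores_Nil)
next
  case (explores_0 q j D W ts)
  show ?case by (rule explores.explores_0, rule explores_0.IH) (use explores_0.prems in auto)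
next
  case (explores_Suc q D j C W L R cs ls rs k ts)
  have agree: "w j v = w' j v" if "v \<in> fst ` set q \<union> D \<union> W" for v
    using that explores_Suc.prems(2)[of j v] by auto
  have sub: "C \<subseteq> W" "L \<subseteq> W" "R \<subseteq> W" using explores_Suc.hyps(2-4) by (auto simp: typed_nbrs_def)
  then have fin: "finite C" "finite L" "finite R" using explores_Suc.prems(1) by (auto intro: finite_subset)
  show ?case
  proof (rule explores.explores_Suc)
    show "\<forall>v\<in>fst ` set q \<union> D. w' j v = (False, False)" using explores_Suc.hyps(1) agree by auto
    show "C = typed_nbrs w' j W (True, True)" "L = typed_nbrs w' j W (True, False)" "R = typed_nbrs w' j W (False, True)"
      unfolding explores_Suc.hyps(2-4) using agree by (intro typed_nbrs_cong; simp)+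
    show "explores w' (map (\<lambda>v. (v, k)) (sorted_list_of_set C @ sorted_list_of_set L @ sorted_list_of_set R) @ q)
      D (W - C - L - R) (cs @ ls @ rs @ ts)"
    proof (rule explores_Suc.IH)
      show "finite (W - C - L - R)" using explores_Suc.prems(1) by simp
      fix u v
      let ?V = "fst ` set (map (\<lambda>v. (v, k)) (sorted_list_of_set C @ sorted_list_of_set L @ sorted_list_of_set R) @ q) \<union> D \<union> (W - C - L - R)"
      assume uv: "u \<in> ?V" "v \<in> ?V"
      have "?V \<subseteq> fst ` set ((j, Suc k) # q) \<union> D \<union> W" using sub fin by auto
      then show "w u v = w' u v" using uv by (intro explores_Suc.prems(2)) blast+
    qed
  qed (use explores_Suc.hyps in auto)
qed

text \<open>Only edges among queued, set-aside and undiscovered vertices are read. A vertex explored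
  at positive depth leaves all three sets, so the rest of the exploration is independent of the
  edges at it.\<close>

lemma explores_cong:
  assumes "finite W" and "\<And>u v. u \<in> fst ` set q \<union> D \<union> W \<Longrightarrow> v \<in> fst ` set q \<union> D \<union> W \<Longrightarrow> w u v = w' u v"
  shows "explores w q D W ts \<longleftrightarrow> explores w' q D W ts"
  using explores_cong_imp[of w q D W ts w'] explores_cong_imp[of w' q D W ts w] assms by metis

section \<open>Probabilities of trees and of edge configurations\<close>

primrec nodes :: "ctree \<Rightarrow> nat" where
  "nodes (CNode cs ls rs) = Suc (sum_list (map nodes cs) + sum_list (map nodes ls) + sum_list (map nodes rs))"

abbreviation forest_nodes :: "ctree list \<Rightarrow> nat" where
  "forest_nodes ts \<equiv> sum_list (map nodes ts)"

lemma nodes_pos: "nodes t \<ge> 1" by (cases t) simp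

lemma forest_nodes_ge: "forest_nodes ts \<ge> length ts"
proof (induction ts)
  case (Cons t ts) then show ?case using nodes_pos[of t] by simp
qed simp

lemma pmf_ctree_pmf_Suc:
  "pmf (ctree_pmf lam s (Suc k)) (CNode cs ls rs) =
    pmf (poisson (lam * s)) (length cs) * pmf (poisson (lam * (1 - s))) (length ls) * pmf (poisson (lam * (1 - s))) (length rs) *
    prod_list (map (pmf (ctree_pmf lam s k)) (cs @ ls @ rs))"
proof -
  let ?U = "ctree_pmf lam s k" and ?P' = "poisson (lam * (1 - s))"
  let ?m = "length cs" and ?a = "length ls" and ?b = "length rs"
  have list_eq: "(if length xs = length ys then 1 else 0) * (\<Prod>j\<in>{1..length xs}. indicator {ys ! (j - 1)} (xs ! (j - 1)) :: ennreal) = (if xs = ys then 1 else 0)"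
    for xs ys :: "ctree list"
  proof (cases "xs = ys")
    case False
    show ?thesis
    proof (cases "length xs = length ys")
      case True
      then obtain i where "i < length xs" "xs ! i \<noteq> ys ! i" using False by (auto simp: list_eq_iff_nth_eq)
      then have "\<not> (\<forall>j\<in>{1..length xs}. xs ! (j - 1) \<in> {ys ! (j - 1)})" by (auto intro!: bexI[of _ "Suc i"])
      then show ?thesis using False by (subst prob_indicator_prod) auto
    qed (use False in auto)
  qed (subst prob_indicator_prod, auto)
  have pl: "(\<Prod>j\<in>{1..length xs}. ennreal (pmf ?U (xs ! (j - 1)))) = ennreal (prod_list (map (pmf ?U) xs))" for xs
  proof -
    have "(\<Prod>j\<in>{1..length xs}. ennreal (pmf ?U (xs ! (j - 1)))) = (\<Prod>i<length xs. ennreal (pmf ?U (xs ! i)))"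
      by (rule prod.reindex_bij_witness[of _ Suc "\<lambda>k. k - 1"]) auto
    also have "\<dots> = ennreal (\<Prod>i<length xs. pmf ?U (xs ! i))" by (rule prod_ennreal) simp
    also have "(\<Prod>i<length xs. pmf ?U (xs ! i)) = prod_list (map (pmf ?U) xs)"
      by (simp add: prod.list_conv_set_nth atLeast0LessThan)
    finally show ?thesis .
  qed
  have pn: "prod_list (map (pmf ?U) xs) \<ge> 0" for xs by (induction xs) auto
  have "ennreal (pmf (ctree_pmf lam s (Suc k)) (CNode cs ls rs)) = (\<integral>\<^sup>+t. indicator {CNode cs ls rs} t \<partial>measure_pmf (ctree_pmf lam s (Suc k)))"
    by (simp add: emeasure_pmf_single del: ctree_pmf.simps)
  also have "\<dots> = (\<integral>\<^sup>+m. \<integral>\<^sup>+a. \<integral>\<^sup>+b. (if m = ?m \<and> a = ?a \<and> b = ?b then 1 else 0) *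
      (\<Prod>j\<in>{1..m}. \<integral>\<^sup>+t. indicator {cs ! (j - 1)} t \<partial>measure_pmf ?U) *
      (\<Prod>j\<in>{1..a}. \<integral>\<^sup>+t. indicator {ls ! (j - 1)} t \<partial>measure_pmf ?U) *
      (\<Prod>j\<in>{1..b}. \<integral>\<^sup>+t. indicator {rs ! (j - 1)} t \<partial>measure_pmf ?U)
      \<partial>measure_pmf ?P' \<partial>measure_pmf ?P' \<partial>measure_pmf (poisson (lam * s)))"
  proof (rule nn_integral_ctree_pmf_branch)
    fix cs' ls' rs' :: "ctree list"
    have "indicator {CNode cs ls rs} (CNode cs' ls' rs') = (if cs' = cs then 1 else 0) * (if ls' = ls then 1 else 0) * (if rs' = rs then 1 else 0 :: ennreal)"
      by (auto simp: indicator_def)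
    also have "\<dots> = (if length cs' = ?m \<and> length ls' = ?a \<and> length rs' = ?b then 1 else 0) *
      (\<Prod>j\<in>{1..length cs'}. indicator {cs ! (j - 1)} (cs' ! (j - 1))) *
      (\<Prod>j\<in>{1..length ls'}. indicator {ls ! (j - 1)} (ls' ! (j - 1))) *
      (\<Prod>j\<in>{1..length rs'}. indicator {rs ! (j - 1)} (rs' ! (j - 1)))"
      unfolding list_eq[symmetric] by auto
    finally show "indicator {CNode cs ls rs} (CNode cs' ls' rs') = \<dots>" .
  qed
  also have "\<dots> = (\<integral>\<^sup>+m. \<integral>\<^sup>+a. \<integral>\<^sup>+b. (if m = ?m then 1 else 0) * (if a = ?a then 1 else 0) * (if b = ?b then
      (\<Prod>j\<in>{1..?m}. ennreal (pmf ?U (cs ! (j - 1)))) * (\<Prod>j\<in>{1..?a}. ennreal (pmf ?U (ls ! (j - 1)))) * (\<Prod>j\<in>{1..?b}. ennreal (pmf ?U (rs ! (j - 1)))) else 0)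
      \<partial>measure_pmf ?P' \<partial>measure_pmf ?P' \<partial>measure_pmf (poisson (lam * s)))"
    by (intro nn_integral_cong) (auto simp: emeasure_pmf_single)
  also have "\<dots> = (\<integral>\<^sup>+m. (if m = ?m then (\<integral>\<^sup>+a. (if a = ?a then (\<integral>\<^sup>+b. (if b = ?b then
      (\<Prod>j\<in>{1..?m}. ennreal (pmf ?U (cs ! (j - 1)))) * (\<Prod>j\<in>{1..?a}. ennreal (pmf ?U (ls ! (j - 1)))) * (\<Prod>j\<in>{1..?b}. ennreal (pmf ?U (rs ! (j - 1)))) else 0)
      \<partial>measure_pmf ?P') else 0) \<partial>measure_pmf ?P') else 0) \<partial>measure_pmf (poisson (lam * s)))"
    by (intro nn_integral_cong) (auto intro!: nn_integral_cong)
  also have "\<dots> = ennreal (pmf (poisson (lam * s)) ?m) * (ennreal (pmf ?P' ?a) * (ennreal (pmf ?P' ?b) *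
     ((\<Prod>j\<in>{1..?m}. ennreal (pmf ?U (cs ! (j - 1)))) * (\<Prod>j\<in>{1..?a}. ennreal (pmf ?U (ls ! (j - 1)))) * (\<Prod>j\<in>{1..?b}. ennreal (pmf ?U (rs ! (j - 1)))))))"
    unfolding nn_integral_pmf_single ..
  also have "\<dots> = ennreal (pmf (poisson (lam * s)) ?m * pmf ?P' ?a * pmf ?P' ?b * prod_list (map (pmf ?U) (cs @ ls @ rs)))"
    unfolding pl using pn by (simp add: ennreal_mult[symmetric] mult_ac)
  finally show ?thesis
    using pn[of "cs @ ls @ rs"] by (subst (asm) ennreal_inj) auto
qed

lemma prob_pair_pmf_Times:
  "measure_pmf.prob (pair_pmf M N) (A \<times> B) = measure_pmf.prob M A * measure_pmf.prob N B"
proof -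
  have "ennreal (measure_pmf.prob (pair_pmf M N) (A \<times> B)) = (\<integral>\<^sup>+z. indicator (A \<times> B) z \<partial>measure_pmf (pair_pmf M N))"
    by (simp add: measure_pmf.emeasure_eq_measure)
  also have "\<dots> = (\<integral>\<^sup>+a. \<integral>\<^sup>+b. indicator A a * indicator B b \<partial>measure_pmf N \<partial>measure_pmf M)"
    by (simp add: nn_integral_pair_pmf' indicator_times)
  also have "\<dots> = ennreal (measure_pmf.prob M A * measure_pmf.prob N B)"
    by (simp add: nn_integral_cmult nn_integral_multc measure_pmf.emeasure_eq_measure ennreal_mult)
  finally show ?thesis by (subst (asm) ennreal_inj) auto
qed

lemma Pi_pmf_indep:
  assumes fin: "finite E" and J: "J \<subseteq> E"
    and X: "\<And>f g. (\<And>x. x \<in> J \<Longrightarrow> f x = g x) \<Longrightarrow> f \<in> X \<longleftrightarrow> g \<in> X"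
    and Y: "\<And>f g. (\<And>x. x \<in> E - J \<Longrightarrow> f x = g x) \<Longrightarrow> f \<in> Y \<longleftrightarrow> g \<in> Y"
  shows "measure_pmf.prob (Pi_pmf E dflt p) (X \<inter> Y) = measure_pmf.prob (Pi_pmf E dflt p) X * measure_pmf.prob (Pi_pmf E dflt p) Y"
proof -
  let ?h = "\<lambda>(f, g) x. if x \<in> J then f x else g x"
  have "Pi_pmf E dflt p = Pi_pmf (J \<union> (E - J)) dflt p" using J by (simp add: Un_absorb1)
  also have "\<dots> = map_pmf ?h (pair_pmf (Pi_pmf J dflt p) (Pi_pmf (E - J) dflt p))"
    using fin J by (intro Pi_pmf_union) (auto intro: finite_subset)
  finally have eq: "Pi_pmf E dflt p = map_pmf ?h (pair_pmf (Pi_pmf J dflt p) (Pi_pmf (E - J) dflt p))" .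
  have hX: "?h z \<in> X \<longleftrightarrow> fst z \<in> X" for z by (rule X) (auto simp: split_beta)
  have hY: "?h z \<in> Y \<longleftrightarrow> snd z \<in> Y" for z by (rule Y) (auto simp: split_beta)
  have XY: "measure_pmf.prob (Pi_pmf E dflt p) (S1 \<inter> S2) = measure_pmf.prob (Pi_pmf J dflt p) T1 * measure_pmf.prob (Pi_pmf (E - J) dflt p) T2"
    if "\<And>z. ?h z \<in> S1 \<inter> S2 \<longleftrightarrow> z \<in> T1 \<times> T2" for S1 S2 T1 T2
  proof -
    have "?h -` (S1 \<inter> S2) = T1 \<times> T2" using that by blast
    then show ?thesis unfolding eq measure_map_pmf by (simp add: prob_pair_pmf_Times)
  qed
  have "measure_pmf.prob (Pi_pmf E dflt p) (X \<inter> Y) = measure_pmf.prob (Pi_pmf J dflt p) X * measure_pmf.prob (Pi_pmf (E - J) dflt p) Y"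
    by (rule XY) (auto simp: hX hY mem_Times_iff)
  moreover have "measure_pmf.prob (Pi_pmf E dflt p) (X \<inter> UNIV) = measure_pmf.prob (Pi_pmf J dflt p) X * measure_pmf.prob (Pi_pmf (E - J) dflt p) UNIV"
    by (rule XY) (auto simp: hX mem_Times_iff)
  moreover have "measure_pmf.prob (Pi_pmf E dflt p) (UNIV \<inter> Y) = measure_pmf.prob (Pi_pmf J dflt p) UNIV * measure_pmf.prob (Pi_pmf (E - J) dflt p) Y"
    by (rule XY) (auto simp: hY mem_Times_iff)
  ultimately show ?thesis by simp
qed

lemma pmf_edge_pmf:
  assumes "lam > 0" "0 \<le> s" "s \<le> 1" "n > 0" "lam * (2 - s) \<le> real n"
  shows "pmf (edge_pmf lam s n) x = (if x = (True, True) then lam * s / real n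
     else if x = (True, False) \<or> x = (False, True) then lam * (1 - s) / real n else 1 - lam * (2 - s) / real n)"
  unfolding edge_pmf_def
proof (rule pmf_embed_pmf)
  let ?f = "\<lambda>x. if x = (True, True) then lam * s / real n
     else if x = (True, False) \<or> x = (False, True) then lam * (1 - s) / real n else 1 - lam * (2 - s) / real n"
  show nn: "0 \<le> ?f x" for x using assms by (simp add: field_simps)
  have U: "UNIV = {(True, True), (True, False), (False, True), (False, False)}" by auto
  have "(\<integral>\<^sup>+x. ennreal (?f x) \<partial>count_space UNIV) = (\<Sum>x\<in>UNIV. ennreal (?f x))"
    by (rule nn_integral_count_space_finite) simp
  also have "\<dots> = ennreal (\<Sum>x\<in>UNIV. ?f x)" by (rule sum_ennreal) (rule nn)
  also have "(\<Sum>x\<in>UNIV. ?f x) = 1" unfolding U using assms by (simp add: field_simps)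
  finally show "(\<integral>\<^sup>+x. ennreal (?f x) \<partial>count_space UNIV) = 1" by simp
qed

text \<open>The right-hand side is a falling factorial with \<open>m\<close> factors, each of them
  at least \<open>w - m\<close>.\<close>

lemma choose_fact_ge:
  assumes "0 \<le> x" "x + real m \<le> real w"
  shows "x ^ m \<le> real (w choose m) * fact m"
  using assms
proof (induction m)
  case (Suc m)
  have "x ^ Suc m \<le> real (w choose m) * fact m * (real w - real m)"
    using Suc by (simp add: mult.commute[of x]) (intro mult_mono, auto)
  also have "\<dots> = real (w choose Suc m) * fact (Suc m)"
  proof -
    have "Suc m * (w choose Suc m) = (w - m) * (w choose m)"
      using binomial_absorb_comp[of w m] by (metis binomial_absorption diff_Suc_1 mult.commute binomial_eq_0 le_less_linear mult_0_right nat_le_linear)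
    then have "real (Suc m) * real (w choose Suc m) = (real w - real m) * real (w choose m)"
      using Suc.prems by (metis of_nat_diff of_nat_mult of_nat_le_iff add_le_imp_le_right le_add_same_cancel2 order_trans Suc_leD of_nat_0_le_iff)
    then show ?thesis by (simp add: mult_ac)
  qed
  finally show ?case .
qed simp

definition edge_set :: "nat \<Rightarrow> (nat \<times> nat) set" where
  "edge_set n = {(i, j). i \<in> {1..n} \<and> j \<in> {1..n} \<and> i < j}"

definition edge_types_of :: "(nat \<times> nat \<Rightarrow> bool \<times> bool) \<Rightarrow> edge_types" where
  "edge_types_of e i j = (if i = j then (False, False) else e (min i j, max i j))"

lemma finite_edge_set: "finite (edge_set n)"
  by (rule finite_subset[of _ "{1..n} \<times> {1..n}"]) (auto simp: edge_set_def)

definition edges_pmf :: "real \<Rightarrow> real \<Rightarrow> nat \<Rightarrow> (nat \<times> nat \<Rightarrow> bool \<times> bool) pmf" where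
  "edges_pmf lam s n = Pi_pmf (edge_set n) (False, False) (\<lambda>_. edge_pmf lam s n)"

lemma star_prob:
  assumes j: "j \<in> {1..n}" and V: "V \<subseteq> {1..n} - {j}"
  shows "measure_pmf.prob (edges_pmf lam s n) {e. \<forall>v\<in>V. edge_types_of e j v = \<tau> v} = (\<Prod>v\<in>V. pmf (edge_pmf lam s n) (\<tau> v))"
proof -
  let ?pr = "\<lambda>v. (min j v, max j v)" and ?E = "edge_set n"
  let ?B = "\<lambda>x. {y. \<forall>v\<in>V. x = ?pr v \<longrightarrow> y = \<tau> v}"
  have prE: "?pr v \<in> ?E" if "v \<in> V" for v using that V j by (auto simp: edge_set_def min_def max_def)
  have inj: "inj_on ?pr V" using V by (auto simp: inj_on_def min_def max_def split: if_splits)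
  have fV: "finite V" using V finite_subset by blast
  have "{e. \<forall>v\<in>V. edge_types_of e j v = \<tau> v} = Pi ?E ?B"
    using V prE by (auto simp: edge_types_of_def Pi_iff)
  then have "measure_pmf.prob (edges_pmf lam s n) {e. \<forall>v\<in>V. edge_types_of e j v = \<tau> v} =
    (\<Prod>x\<in>?E. measure_pmf.prob (edge_pmf lam s n) (?B x))"
    unfolding edges_pmf_def by (simp only: measure_Pi_pmf_Pi[OF finite_edge_set])
  also have "\<dots> = (\<Prod>x\<in>?pr ` V. measure_pmf.prob (edge_pmf lam s n) (?B x))"
  proof (rule prod.mono_neutral_right)
    show "\<forall>x\<in>?E - ?pr ` V. measure_pmf.prob (edge_pmf lam s n) (?B x) = 1"
    proof
      fix x assume "x \<in> ?E - ?pr ` V"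
      then have "?B x = UNIV" by auto
      then show "measure_pmf.prob (edge_pmf lam s n) (?B x) = 1" by simp
    qed
  qed (use finite_edge_set prE in auto)
  also have "\<dots> = (\<Prod>v\<in>V. measure_pmf.prob (edge_pmf lam s n) (?B (?pr v)))"
    by (simp add: prod.reindex[OF inj] o_def)
  also have "\<dots> = (\<Prod>v\<in>V. pmf (edge_pmf lam s n) (\<tau> v))"
  proof (intro prod.cong refl)
    fix v assume v: "v \<in> V"
    have "?B (?pr v) = {\<tau> v}" using inj v by (auto simp: inj_on_def)
    then show "measure_pmf.prob (edge_pmf lam s n) (?B (?pr v)) = pmf (edge_pmf lam s n) (\<tau> v)"
      by (simp add: measure_pmf_single)
  qed
  finally show ?thesis .
qed

definition nbr_choices :: "nat set \<Rightarrow> nat \<Rightarrow> nat \<Rightarrow> nat \<Rightarrow> (nat set \<times> nat set \<times> nat set) set" where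
  "nbr_choices W m a b = (SIGMA C:{C. C \<subseteq> W \<and> card C = m}. SIGMA L:{L. L \<subseteq> W - C \<and> card L = a}. {R. R \<subseteq> W - C - L \<and> card R = b})"

lemma nbr_choices:
  assumes W: "finite W"
  shows "finite (nbr_choices W m a b)"
    and "card (nbr_choices W m a b) = (card W choose m) * ((card W - m) choose a) * ((card W - m - a) choose b)"
proof -
  have fin: "finite {C. C \<subseteq> S \<and> card C = i}" if "finite S" for S :: "nat set" and i
    using that by simp
  have cL: "card (SIGMA L:{L. L \<subseteq> W - C \<and> card L = a}. {R. R \<subseteq> W - C - L \<and> card R = b}) =
      ((card W - m) choose a) * ((card W - m - a) choose b)" if C: "C \<subseteq> W" "card C = m" for C
  proof -
    have cWC: "card (W - C) = card W - m" using C W by (simp add: card_Diff_subset finite_subset)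
    have "card {R. R \<subseteq> W - C - L \<and> card R = b} = ((card W - m - a) choose b)" if "L \<subseteq> W - C" "card L = a" for L
    proof -
      have "card (W - C - L) = card W - m - a" using that W by (simp add: card_Diff_subset finite_subset cWC)
      then show ?thesis using W n_subsets[of "W - C - L" b] by simp
    qed
    then have "card (SIGMA L:{L. L \<subseteq> W - C \<and> card L = a}. {R. R \<subseteq> W - C - L \<and> card R = b}) =
       (\<Sum>L\<in>{L. L \<subseteq> W - C \<and> card L = a}. ((card W - m - a) choose b))"
      using W by (subst card_SigmaI) auto
    also have "\<dots> = ((card W - m) choose a) * ((card W - m - a) choose b)"
      using W n_subsets[of "W - C" a] by (simp add: cWC)
    finally show ?thesis .
  qed
  show "finite (nbr_choices W m a b)" unfolding nbr_choices_def using W by (intro finite_SigmaI) auto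
  have "card (nbr_choices W m a b) = (\<Sum>C\<in>{C. C \<subseteq> W \<and> card C = m}.
      card (SIGMA L:{L. L \<subseteq> W - C \<and> card L = a}. {R. R \<subseteq> W - C - L \<and> card R = b}))"
    unfolding nbr_choices_def using W by (intro card_SigmaI ballI finite_SigmaI) auto
  also have "\<dots> = (\<Sum>C\<in>{C. C \<subseteq> W \<and> card C = m}. ((card W - m) choose a) * ((card W - m - a) choose b))"
    by (intro sum.cong refl cL) auto
  also have "\<dots> = (card W choose m) * ((card W - m) choose a) * ((card W - m - a) choose b)"
    using W n_subsets[of W m] by simp
  finally show "card (nbr_choices W m a b) = \<dots>" .
qed

lemma map2_append_same:
  "length xs = length ys \<Longrightarrow> map2 f (xs @ xs') (ys @ ys') = map2 f xs ys @ map2 f xs' ys'"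
  by simp

text \<open>\<open>h\<close> compares the probability of no edge in \<open>n\<close> trials with its
  Poisson limit. With \<open>x = r / n\<close>, the upper bound is
  \<open>1 - x \<le> exp (- x)\<close>; the lower one is
  \<open>1 - x^2 \<le> (1 - x) * exp x\<close> followed by Bernoulli's inequality.\<close>

lemma exp_correction_bounds:
  fixes r :: real
  assumes n: "n > 0" and r: "0 \<le> r" "r \<le> real n"
  defines "h \<equiv> (1 - r / real n) ^ n * exp r"
  shows "0 \<le> h" "h \<le> 1" "1 - r\<^sup>2 / real n \<le> h"
proof -
  let ?x = "r / real n"
  have x: "0 \<le> ?x" "?x \<le> 1" using n r by auto
  have e: "exp r = exp ?x ^ n" using n by (simp add: exp_of_nat_mult[symmetric])
  have h: "h = ((1 - ?x) * exp ?x) ^ n" unfolding h_def e by (simp add: power_mult_distrib)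
  show "0 \<le> h" unfolding h using x by simp
  have "1 - ?x \<le> exp (- ?x)" using exp_ge_add_one_self[of "- ?x"] by simp
  then have "(1 - ?x) * exp ?x \<le> exp (- ?x) * exp ?x" by (intro mult_right_mono) auto
  then show "h \<le> 1" unfolding h using x by (intro power_le_one) (auto simp: exp_minus)
  have "1 - ?x\<^sup>2 = (1 - ?x) * (1 + ?x)" by (simp add: algebra_simps power2_eq_square)
  also have "\<dots> \<le> (1 - ?x) * exp ?x" using x by (intro mult_left_mono exp_ge_add_one_self) auto
  finally have l: "1 - ?x\<^sup>2 \<le> (1 - ?x) * exp ?x" .
  have x2: "0 \<le> 1 - ?x\<^sup>2" using x by (simp add: power_le_one)
  have "1 - r\<^sup>2 / real n = 1 + real n * (- (?x\<^sup>2))" using n by (simp add: power2_eq_square)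
  also have "\<dots> \<le> (1 + - (?x\<^sup>2)) ^ n" using x2 by (intro Bernoulli_inequality) simp
  also have "\<dots> \<le> ((1 - ?x) * exp ?x) ^ n" using l x2 by (intro power_mono) auto
  finally show "1 - r\<^sup>2 / real n \<le> h" unfolding h .
qed

section \<open>Lower bound for the probability of an exploration\<close>

context
  fixes lam s :: real and n :: nat
  assumes lam: "lam > 0" and s: "0 \<le> s" "s \<le> 1" and n: "n > 0" and rho: "lam * (2 - s) \<le> real n"
begin

text \<open>The absent edges number at most \<open>n\<close>; raising their probability to the power
  \<open>n\<close> only lowers the product and removes the dependence on \<open>V\<close>.\<close>

lemma star_choice_prob:
  assumes j: "j \<in> {1..n}" and V: "V \<subseteq> {1..n} - {j}" and c: "C \<subseteq> V" "L \<subseteq> V - C" "R \<subseteq> V - C - L"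
  shows "measure_pmf.prob (edges_pmf lam s n) {e. \<forall>v\<in>V. edge_types_of e j v =
      (if v \<in> C then (True, True) else if v \<in> L then (True, False) else if v \<in> R then (False, True) else (False, False))}
    \<ge> (lam * s / real n) ^ card C * (lam * (1 - s) / real n) ^ (card L + card R) * (1 - lam * (2 - s) / real n) ^ n"
proof -
  let ?\<tau> = "\<lambda>v. if v \<in> C then (True, True) else if v \<in> L then (True, False) else if v \<in> R then (False, True) else (False, False)"
  let ?p = "edge_pmf lam s n" and ?p3 = "1 - lam * (2 - s) / real n"
  have fV: "finite V" using V finite_subset by blast
  have fin: "finite C" "finite L" "finite R" using c fV by (meson Diff_subset finite_Diff finite_subset)+
  have dec: "V = (C \<union> L \<union> R) \<union> (V - C - L - R)" using c by auto
  have p3: "0 \<le> ?p3" "?p3 \<le> 1" using lam s n rho by (auto simp: field_simps)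
  note pm = pmf_edge_pmf[OF lam s n rho]
  have "(\<Prod>v\<in>V. pmf ?p (?\<tau> v)) = (\<Prod>v\<in>(C \<union> L \<union> R) \<union> (V - C - L - R). pmf ?p (?\<tau> v))"
    using dec by (rule prod.cong) simp
  also have "\<dots> = (\<Prod>v\<in>C \<union> L \<union> R. pmf ?p (?\<tau> v)) * (\<Prod>v\<in>V - C - L - R. pmf ?p (?\<tau> v))"
    using fV fin by (intro prod.union_disjoint) auto
  also have "(\<Prod>v\<in>C \<union> L \<union> R. pmf ?p (?\<tau> v)) = (\<Prod>v\<in>C \<union> L. pmf ?p (?\<tau> v)) * (\<Prod>v\<in>R. pmf ?p (?\<tau> v))"
    using fin c by (intro prod.union_disjoint) auto
  also have "(\<Prod>v\<in>C \<union> L. pmf ?p (?\<tau> v)) = (\<Prod>v\<in>C. pmf ?p (?\<tau> v)) * (\<Prod>v\<in>L. pmf ?p (?\<tau> v))"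
    using fin c by (intro prod.union_disjoint) auto
  also have "(\<Prod>v\<in>C. pmf ?p (?\<tau> v)) = (\<Prod>v\<in>C. lam * s / real n)" by (intro prod.cong refl) (simp add: pm)
  also have "(\<Prod>v\<in>L. pmf ?p (?\<tau> v)) = (\<Prod>v\<in>L. lam * (1 - s) / real n)" using c by (intro prod.cong refl) (auto simp: pm)
  also have "(\<Prod>v\<in>R. pmf ?p (?\<tau> v)) = (\<Prod>v\<in>R. lam * (1 - s) / real n)" using c by (intro prod.cong refl) (auto simp: pm)
  also have "(\<Prod>v\<in>V - C - L - R. pmf ?p (?\<tau> v)) = (\<Prod>v\<in>V - C - L - R. ?p3)" by (intro prod.cong refl) (auto simp: pm)
  finally have eq: "(\<Prod>v\<in>V. pmf ?p (?\<tau> v)) = (lam * s / real n) ^ card C * (lam * (1 - s) / real n) ^ card L *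
     (lam * (1 - s) / real n) ^ card R * ?p3 ^ card (V - C - L - R)" by simp
  have "card (V - C - L - R) \<le> card {1..n}" using V by (intro card_mono) auto
  then have "?p3 ^ n \<le> ?p3 ^ card (V - C - L - R)" using p3 by (intro power_decreasing) auto
  then have "(lam * s / real n) ^ card C * (lam * (1 - s) / real n) ^ (card L + card R) * ?p3 ^ n \<le> (\<Prod>v\<in>V. pmf ?p (?\<tau> v))"
    unfolding eq power_add mult.assoc[symmetric] using lam s by (intro mult_left_mono) auto
  then show ?thesis unfolding star_prob[OF j V] .
qed

text \<open>Binomial coefficients dominate powers of \<open>x\<close> divided by factorials,
  provided that \<open>x\<close> undiscovered vertices remain after all choices. What is left over
  are the Poisson weights, a depletion factor \<open>x / n\<close> per chosen neighbour and one
  correction for the absent edges.\<close>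

lemma poisson_choice_bound:
  assumes x: "0 \<le> x" "x + real (m + a + b) \<le> real w"
  shows "(x / real n) ^ (m + a + b) * ((1 - lam * (2 - s) / real n) ^ n * exp (lam * (2 - s))) *
     (pmf (poisson (lam * s)) m * pmf (poisson (lam * (1 - s))) a * pmf (poisson (lam * (1 - s))) b) \<le>
    real ((w choose m) * ((w - m) choose a) * ((w - m - a) choose b)) *
     ((lam * s / real n) ^ m * (lam * (1 - s) / real n) ^ (a + b) * (1 - lam * (2 - s) / real n) ^ n)"
proof -
  let ?p3 = "1 - lam * (2 - s) / real n" and ?al = "lam * (1 - s)"
  have p3: "0 \<le> ?p3" using lam s n rho by (auto simp: field_simps)
  have al: "?al \<ge> 0" "lam * s \<ge> 0" using lam s by auto
  have "x ^ m * x ^ a * x ^ b \<le> (real (w choose m) * fact m) * (real ((w - m) choose a) * fact a) * (real ((w - m - a) choose b) * fact b)"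
  proof (intro mult_mono)
    show "x ^ m \<le> real (w choose m) * fact m" using x by (intro choose_fact_ge) auto
    show "x ^ a \<le> real ((w - m) choose a) * fact a" using x by (intro choose_fact_ge) (auto simp: of_nat_diff)
    show "x ^ b \<le> real ((w - m - a) choose b) * fact b" using x by (intro choose_fact_ge) (auto simp: of_nat_diff)
  qed (use x in auto)
  then have X: "x ^ (m + a + b) / (fact m * fact a * fact b) \<le> real ((w choose m) * ((w - m) choose a) * ((w - m - a) choose b))"
    by (simp add: power_add divide_le_eq mult_ac)
  have e: "exp (lam * (2 - s)) * (exp (- (lam * s)) * exp (- ?al) * exp (- ?al)) = 1"
    unfolding exp_add[symmetric] by (simp add: algebra_simps)
  have "(x / real n) ^ (m + a + b) * (?p3 ^ n * exp (lam * (2 - s))) * (pmf (poisson (lam * s)) m * pmf (poisson ?al) a * pmf (poisson ?al) b) =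
    (exp (lam * (2 - s)) * (exp (- (lam * s)) * exp (- ?al) * exp (- ?al))) *
    (x ^ (m + a + b) / (fact m * fact a * fact b) * ((lam * s / real n) ^ m * (?al / real n) ^ (a + b) * ?p3 ^ n))"
    unfolding pmf_poisson[OF al(1)] pmf_poisson[OF al(2)] power_divide power_add
    by (simp add: field_simps)
  also have "\<dots> = x ^ (m + a + b) / (fact m * fact a * fact b) * ((lam * s / real n) ^ m * (?al / real n) ^ (a + b) * ?p3 ^ n)"
    unfolding e by simp
  also have "\<dots> \<le> real ((w choose m) * ((w - m) choose a) * ((w - m - a) choose b)) * ((lam * s / real n) ^ m * (?al / real n) ^ (a + b) * ?p3 ^ n)"
    using al p3 by (intro mult_right_mono X) auto
  finally show ?thesis .
qed

text \<open>Every node of the forest costs a factor \<open>h\<close>, and every vertex still to be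
  discovered a factor \<open>g\<close> for depletion. The cardinality hypothesis says that the
  vertices outside \<open>W\<close> plus those still to be discovered number at most
  \<open>N\<close>, so at least \<open>n - N\<close> vertices remain undiscovered throughout. The
  induction is on the number of nodes; the sum over all choices of neighbours of the first queued
  vertex makes up the Poisson weights.\<close>

lemma explores_prob:
  assumes N: "N \<le> n"
  defines "h \<equiv> (1 - lam * (2 - s) / real n) ^ n * exp (lam * (2 - s))" and "g \<equiv> 1 - real N / real n"
  shows "distinct (map fst q) \<Longrightarrow> fst ` set q \<union> D \<union> W \<subseteq> {1..n} \<Longrightarrow>
    fst ` set q \<inter> D = {} \<Longrightarrow> fst ` set q \<inter> W = {} \<Longrightarrow> D \<inter> W = {} \<Longrightarrow> length q = length ts \<Longrightarrow>
    n + forest_nodes ts \<le> card W + N + length q \<Longrightarrow>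
    prod_list (map2 (\<lambda>z t. pmf (ctree_pmf lam s (snd z)) t) q ts) * g ^ (forest_nodes ts - length q) * h ^ forest_nodes ts
    \<le> measure_pmf.prob (edges_pmf lam s n) {e. explores (edge_types_of e) q D W ts}"
proof (induction "forest_nodes ts" arbitrary: q D W ts rule: less_induct)
  case less
  let ?u = "\<lambda>q ts. prod_list (map2 (\<lambda>z t. pmf (ctree_pmf lam s (snd z)) t) q ts)"
  let ?Pr = "measure_pmf.prob (edges_pmf lam s n)"
  let ?p3 = "1 - lam * (2 - s) / real n"
  have u_nonneg: "?u q ts \<ge> 0" for q ts by (intro prod_list_nonneg) (auto simp: set_zip)
  have g: "0 \<le> g" using N n by (simp add: g_def)
  have p3: "0 \<le> ?p3" using lam s n rho by (auto simp: field_simps)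
  have "0 \<le> lam * (2 - s)" using lam s by simp
  note h = exp_correction_bounds(1,2)[OF n this rho, folded h_def]
  show ?case
  proof (cases q)
    case Nil
    then show ?thesis using less.prems by (simp add: explores_Nil)
  next
    case (Cons z q')
    obtain j k where z: "z = (j, k)" by (cases z)
    obtain t ts' where ts: "ts = t # ts'" using less.prems(6) Cons by (cases ts) auto
    show ?thesis
    proof (cases k)
      case 0
      show ?thesis
      proof (cases "t = CNode [] [] []")
        case False
        then have "?u q ts = 0" by (simp add: Cons z ts 0)
        then show ?thesis by simp
      next
        case True
        have ev: "{e. explores (edge_types_of e) q D W ts} = {e. explores (edge_types_of e) q' (insert j D) W ts'}"
          unfolding Cons z ts 0 True by (auto intro: explores_0 elim: explores_0E)
        \<comment> \<open>At remaining depth 0 no edge is revealed; the surplus factor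
          \<open>h\<close> is dropped because it is at most 1.\<close>
        have "?u q ts * g ^ (forest_nodes ts - length q) * h ^ forest_nodes ts =
          (?u q' ts' * g ^ (forest_nodes ts' - length q') * h ^ forest_nodes ts') * h"
          by (simp add: Cons z ts 0 True)
        also have "\<dots> \<le> ?u q' ts' * g ^ (forest_nodes ts' - length q') * h ^ forest_nodes ts'"
          using h g by (intro mult_left_le mult_nonneg_nonneg u_nonneg) auto
        also have "\<dots> \<le> ?Pr {e. explores (edge_types_of e) q' (insert j D) W ts'}"
          using less.prems unfolding Cons z ts True by (intro less.hyps) (auto simp: ts True)
        finally show ?thesis unfolding ev .
      qed
    next
      case (Suc k')
      obtain cs ls rs where t: "t = CNode cs ls rs" by (cases t)
      let ?m = "length cs" and ?a = "length ls" and ?b = "length rs"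
      let ?K = "?m + ?a + ?b" and ?ts = "cs @ ls @ rs @ ts'"
      let ?Ch = "nbr_choices W ?m ?a ?b"
      let ?V = "W \<union> fst ` set q' \<union> D"
      let ?q = "\<lambda>(C, L, R). map (\<lambda>v. (v, k')) (sorted_list_of_set C @ sorted_list_of_set L @ sorted_list_of_set R) @ q'"
      let ?W = "\<lambda>(C, L, R). W - C - L - R"
      let ?\<tau> = "\<lambda>(C, L, R) v. if v \<in> C then (True, True) else if v \<in> L then (True, False) else if v \<in> R then (False, True) else (False, False)"
      let ?S = "\<lambda>c. {e. \<forall>v\<in>?V. edge_types_of e j v = ?\<tau> c v}"
      let ?Y = "\<lambda>c. {e. explores (edge_types_of e) (?q c) D (?W c) ?ts}"
      let ?pS = "(lam * s / real n) ^ ?m * (lam * (1 - s) / real n) ^ (?a + ?b) * ?p3 ^ n"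
      let ?w = "prod_list (map (pmf (ctree_pmf lam s k')) (cs @ ls @ rs))"
      let ?lb = "?w * ?u q' ts' * g ^ (forest_nodes ?ts - (?K + length q')) * h ^ forest_nodes ?ts"
      have fn: "forest_nodes ts = Suc (forest_nodes ?ts)" by (simp add: ts t)
      have fn2: "?K + length q' \<le> forest_nodes ?ts" using forest_nodes_ge[of ?ts] less.prems(6) by (simp add: ts Cons)
      have finW: "finite W" using less.prems(2) finite_subset by blast
      have j: "j \<in> {1..n}" "j \<notin> ?V" using less.prems(1-5) by (auto simp: Cons z)
      have V: "?V \<subseteq> {1..n} - {j}" using less.prems(2) j by (auto simp: Cons)
      \<comment> \<open>The hypothesis of \<open>poisson_choice_bound\<close> for
        \<open>x = n - N\<close>: even after the \<open>?K\<close> children of \<open>j\<close> are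
        removed, \<open>n - N\<close> vertices are left.\<close>
      have wN: "real n - real N + real ?K \<le> real (card W)"
        using less.prems(7) fn fn2 N by (simp add: Cons of_nat_diff)
      have ch: "C \<subseteq> W" "L \<subseteq> W - C" "R \<subseteq> W - C - L" "card C = ?m" "card L = ?a" "card R = ?b"
        if "(C, L, R) \<in> ?Ch" for C L R
        using that by (auto simp: nbr_choices_def)
      have fin: "finite C" "finite L" "finite R" if "(C, L, R) \<in> ?Ch" for C L R
        using ch(1-3)[OF that] finW by (meson Diff_subset finite_Diff finite_subset)+
      have PS: "?Pr (?S c) \<ge> ?pS" if "c \<in> ?Ch" for c
      proof -
        obtain C L R where c: "c = (C, L, R)" by (cases c)
        note cc = ch[OF that[unfolded c]]
        have "?pS = (lam * s / real n) ^ card C * (lam * (1 - s) / real n) ^ (card L + card R) * ?p3 ^ n" using cc by simp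
        also have "\<dots> \<le> ?Pr (?S c)" unfolding c prod.case
          using cc by (intro star_choice_prob j(1) V) auto
        finally show ?thesis .
      qed
      have PY: "?Pr (?Y c) \<ge> ?lb" if "c \<in> ?Ch" for c
      proof -
        obtain C L R where c: "c = (C, L, R)" by (cases c)
        note cc = ch[OF that[unfolded c]] and ff = fin[OF that[unfolded c]]
        have lq: "length (map (\<lambda>v. (v, k')) (sorted_list_of_set C @ sorted_list_of_set L @ sorted_list_of_set R)) = ?K"
          using cc by simp
        have "map2 (\<lambda>z t. pmf (ctree_pmf lam s (snd z)) t) (map (\<lambda>v. (v, k')) vs) xs = map (pmf (ctree_pmf lam s k')) xs"
          if "length vs = length xs" for vs :: "nat list" and xs
          using that by (induction vs xs rule: list_induct2) auto
        then have uq: "?u (?q c) ?ts = ?w * ?u q' ts'"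
          unfolding c prod.case append_assoc[symmetric]
          by (subst map2_append_same) (use cc in auto)
        have "length (?q c) = ?K + length q'" using lq unfolding c prod.case length_append[of _ q'] by presburger
        then have "?lb = ?u (?q c) ?ts * g ^ (forest_nodes ?ts - length (?q c)) * h ^ forest_nodes ?ts"
          by (simp only: uq)
        also have "\<dots> \<le> ?Pr (?Y c)"
        proof (rule less.hyps)
          show "forest_nodes ?ts < forest_nodes ts" by (simp add: fn)
          have d: "fst ` set (?q c) = C \<union> L \<union> R \<union> fst ` set q'" unfolding c using ff by (auto simp: image_Un image_image)
          have m: "map fst (?q c) = (sorted_list_of_set C @ sorted_list_of_set L @ sorted_list_of_set R) @ map fst q'"
            unfolding c by (simp add: o_def)
          show "distinct (map fst (?q c))"
            unfolding m using cc ff less.prems(1,4) by (auto simp: Cons z)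
          show "fst ` set (?q c) \<union> D \<union> ?W c \<subseteq> {1..n}" unfolding d using cc less.prems(2) by (auto simp: c Cons)
          show "fst ` set (?q c) \<inter> D = {}" unfolding d using cc less.prems(3,5) by (auto simp: Cons)
          show "fst ` set (?q c) \<inter> ?W c = {}" unfolding d using cc less.prems(4) by (auto simp: c Cons)
          show "D \<inter> ?W c = {}" using less.prems(5) by (auto simp: c)
          show "length (?q c) = length ?ts" using lq less.prems(6) by (simp add: c Cons ts)
          have "card (?W c) = card W - ?m - ?a - ?b"
            unfolding c prod.case using cc ff finW
            by (subst card_Diff_subset, simp, blast, subst card_Diff_subset, simp, blast, subst card_Diff_subset) auto
          then have "card (?W c) + ?K = card W" using wN N by linarith
          then show "n + forest_nodes ?ts \<le> card (?W c) + N + length (?q c)"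
            using less.prems(7) fn lq by (simp add: c Cons)
        qed
        finally show ?thesis .
      qed
      \<comment> \<open>The first event concerns only pairs containing \<open>j\<close>, the second
        only pairs avoiding \<open>j\<close>.\<close>
      have ind: "?Pr (?S c \<inter> ?Y c) = ?Pr (?S c) * ?Pr (?Y c)" if "c \<in> ?Ch" for c
        unfolding edges_pmf_def
      proof (rule Pi_pmf_indep[OF finite_edge_set, where J = "(\<lambda>v. (min j v, max j v)) ` ?V"])
        obtain C L R where c: "c = (C, L, R)" by (cases c)
        note cc = ch[OF that[unfolded c]] and ff = fin[OF that[unfolded c]]
        show "(\<lambda>v. (min j v, max j v)) ` ?V \<subseteq> edge_set n"
        proof (rule image_subsetI)
          fix v assume "v \<in> ?V"
          then have "v \<in> {1..n}" "v \<noteq> j" using V by blast+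
          then show "(min j v, max j v) \<in> edge_set n" using j(1) by (auto simp: edge_set_def min_def max_def)
        qed
        show "e \<in> ?S c \<longleftrightarrow> e' \<in> ?S c" if "\<And>x. x \<in> (\<lambda>v. (min j v, max j v)) ` ?V \<Longrightarrow> e x = e' x" for e e'
        proof -
          have "edge_types_of e j v = edge_types_of e' j v" if v: "v \<in> ?V" for v
            unfolding edge_types_of_def using \<open>\<And>x. x \<in> (\<lambda>v. (min j v, max j v)) ` ?V \<Longrightarrow> e x = e' x\<close>[OF imageI[OF v]] by simp
          then show ?thesis by simp
        qed
        show "e \<in> ?Y c \<longleftrightarrow> e' \<in> ?Y c" if ag: "\<And>x. x \<in> edge_set n - (\<lambda>v. (min j v, max j v)) ` ?V \<Longrightarrow> e x = e' x" for e e'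
        proof -
          have "explores (edge_types_of e) (?q c) D (?W c) ?ts \<longleftrightarrow> explores (edge_types_of e') (?q c) D (?W c) ?ts"
          proof (rule explores_cong)
            show "finite (?W c)" using finW by (simp add: c)
            let ?V' = "fst ` set (?q c) \<union> D \<union> ?W c"
            have sub: "?V' \<subseteq> ?V" using cc ff by (auto simp: c)
            fix u v assume "u \<in> ?V'" "v \<in> ?V'"
            then have uv: "u \<in> ?V" "v \<in> ?V" using sub by blast+
            show "edge_types_of e u v = edge_types_of e' u v"
            proof (cases "u = v")
              case False
              have "(min u v, max u v) \<in> edge_set n"
              proof -
                have "u \<in> {1..n}" "v \<in> {1..n}" using V uv by blast+
                then show ?thesis using False by (auto simp: edge_set_def min_def max_def)
              qed
              moreover have "(min u v, max u v) \<notin> (\<lambda>v. (min j v, max j v)) ` ?V"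
              proof
                assume "(min u v, max u v) \<in> (\<lambda>v. (min j v, max j v)) ` ?V"
                then obtain x where "(min u v, max u v) = (min j x, max j x)" by (elim imageE)
                then have "j = u \<or> j = v" by (auto simp: min_def max_def split: if_splits)
                then show False using j(2) uv by blast
              qed
              ultimately show ?thesis using ag[of "(min u v, max u v)"] by (simp add: edge_types_of_def)
            qed (simp add: edge_types_of_def)
          qed
          then show ?thesis by simp
        qed
      qed
      have nbrs: "C = typed_nbrs (edge_types_of e) j W (True, True)" "L = typed_nbrs (edge_types_of e) j W (True, False)"
          "R = typed_nbrs (edge_types_of e) j W (False, True)"
        if "(C, L, R) \<in> ?Ch" "e \<in> ?S (C, L, R)" for C L R e
        using that(2) ch(1-3)[OF that(1)] by (auto simp: typed_nbrs_def split: if_splits)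
      have sub: "(\<Union>c\<in>?Ch. ?S c \<inter> ?Y c) \<subseteq> {e. explores (edge_types_of e) q D W ts}"
      proof
        fix e assume "e \<in> (\<Union>c\<in>?Ch. ?S c \<inter> ?Y c)"
        then obtain C L R where c: "(C, L, R) \<in> ?Ch" "e \<in> ?S (C, L, R)" "e \<in> ?Y (C, L, R)" by auto
        have "explores (edge_types_of e) ((j, Suc k') # q') D W (CNode cs ls rs # ts')"
        proof (rule explores_Suc[OF _ nbrs[OF c(1,2)]])
          show "\<forall>v\<in>fst ` set q' \<union> D. edge_types_of e j v = (False, False)"
          proof
            fix v assume v: "v \<in> fst ` set q' \<union> D"
            then have "v \<notin> W" using less.prems(4,5) by (auto simp: Cons)
            then show "edge_types_of e j v = (False, False)"
              using c(2) v ch(1-3)[OF c(1)] by auto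
          qed
        qed (use c(3) ch(4-6)[OF c(1)] in auto)
        then show "e \<in> {e. explores (edge_types_of e) q D W ts}" by (simp add: Cons z Suc ts t)
      qed
      \<comment> \<open>The chosen sets are recovered from the edges as the typed neighbourhoods of
        \<open>j\<close>, so two choices cannot occur together.\<close>
      have disj: "disjoint_family_on (\<lambda>c. ?S c \<inter> ?Y c) ?Ch"
      proof (unfold disjoint_family_on_def, intro ballI impI)
        fix c c' assume cc: "c \<in> ?Ch" "c' \<in> ?Ch" "c \<noteq> c'"
        obtain C L R C' L' R' where c: "c = (C, L, R)" "c' = (C', L', R')" by (cases c, cases c')
        show "(?S c \<inter> ?Y c) \<inter> (?S c' \<inter> ?Y c') = {}"
        proof (rule equals0I)
          fix e assume e: "e \<in> (?S c \<inter> ?Y c) \<inter> (?S c' \<inter> ?Y c')"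
          note S = IntD1[OF IntD1[OF e[unfolded c]]] IntD1[OF IntD2[OF e[unfolded c]]]
          have "C = C'" by (rule trans[OF nbrs(1)[OF cc(1)[unfolded c] S(1)] nbrs(1)[OF cc(2)[unfolded c] S(2), symmetric]])
          moreover have "L = L'" by (rule trans[OF nbrs(2)[OF cc(1)[unfolded c] S(1)] nbrs(2)[OF cc(2)[unfolded c] S(2), symmetric]])
          moreover have "R = R'" by (rule trans[OF nbrs(3)[OF cc(1)[unfolded c] S(1)] nbrs(3)[OF cc(2)[unfolded c] S(2), symmetric]])
          ultimately show False using cc(3) by (simp add: c)
        qed
      qed
      have lb: "?lb \<ge> 0" using g h u_nonneg by (intro mult_nonneg_nonneg prod_list_nonneg) auto
      have pS: "?pS \<ge> 0" using lam s p3 by simp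
      have "?u q ts * g ^ (forest_nodes ts - length q) * h ^ forest_nodes ts =
        (g ^ ?K * h * (pmf (poisson (lam * s)) ?m * pmf (poisson (lam * (1 - s))) ?a * pmf (poisson (lam * (1 - s))) ?b)) * ?lb"
      proof -
        have "forest_nodes ts - length q = ?K + (forest_nodes ?ts - (?K + length q'))" using fn fn2 by (simp add: Cons)
        then have "g ^ (forest_nodes ts - length q) = g ^ ?K * g ^ (forest_nodes ?ts - (?K + length q'))" by (simp only: power_add)
        moreover have "?u q ts = (pmf (poisson (lam * s)) ?m * pmf (poisson (lam * (1 - s))) ?a * pmf (poisson (lam * (1 - s))) ?b) * ?w * ?u q' ts'"
          unfolding Cons z ts t Suc by (simp add: pmf_ctree_pmf_Suc mult_ac del: ctree_pmf.simps)
        ultimately show ?thesis unfolding fn by (simp only: power_Suc mult_ac)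
      qed
      also have "\<dots> \<le> (real (card ?Ch) * ?pS) * ?lb"
      proof (rule mult_right_mono[OF _ lb])
        have "(real n - real N) / real n = g" using n by (simp add: g_def diff_divide_distrib)
        then show "g ^ ?K * h * (pmf (poisson (lam * s)) ?m * pmf (poisson (lam * (1 - s))) ?a * pmf (poisson (lam * (1 - s))) ?b) \<le> real (card ?Ch) * ?pS"
          using poisson_choice_bound[of "real n - real N" ?m ?a ?b "card W"] wN N
          unfolding nbr_choices(2)[OF finW] h_def by simp
      qed
      also have "\<dots> = (\<Sum>c\<in>?Ch. ?pS * ?lb)" by (simp add: mult.assoc)
      also have "\<dots> \<le> (\<Sum>c\<in>?Ch. ?Pr (?S c \<inter> ?Y c))"
      proof (rule sum_mono)
        fix c assume c: "c \<in> ?Ch"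
        show "?pS * ?lb \<le> ?Pr (?S c \<inter> ?Y c)" unfolding ind[OF c] by (rule mult_mono[OF PS[OF c] PY[OF c] _ lb]) simp
      qed
      also have "\<dots> = ?Pr (\<Union>c\<in>?Ch. ?S c \<inter> ?Y c)"
        by (rule measure_pmf.finite_measure_finite_Union[symmetric, OF nbr_choices(1)[OF finW] _ disj]) auto
      also have "\<dots> \<le> ?Pr {e. explores (edge_types_of e) q D W ts}"
        by (rule measure_pmf.finite_measure_mono[OF sub]) simp
      finally show ?thesis .
    qed
  qed
qed

end

section \<open>Messages in explored neighbourhoods\<close>

text \<open>A local description: seen from \<open>j\<close> with the parent \<open>p\<close>
  removed, \<open>w\<close> looks like \<open>t\<close> for \<open>k\<close> levels. Unlike
  \<open>explores\<close> it mentions no queue, and the order of the children is left open; this is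
  the shape needed for the message recursion.\<close>

primrec realizes :: "nat \<Rightarrow> edge_types \<Rightarrow> nat set \<Rightarrow> nat \<Rightarrow> nat \<Rightarrow> ctree \<Rightarrow> bool" where
  "realizes 0 w V p j t = True"
| "realizes (Suc k) w V p j t = (case t of CNode cs ls rs \<Rightarrow> \<exists>vc vl vr.
     distinct (vc @ vl @ vr) \<and> p \<notin> set (vc @ vl @ vr) \<and>
     typed_nbrs w j (V - {p}) (True, True) = set vc \<and>
     typed_nbrs w j (V - {p}) (True, False) = set vl \<and>
     typed_nbrs w j (V - {p}) (False, True) = set vr \<and>
     list_all2 (realizes k w V j) vc cs \<and> list_all2 (realizes k w V j) vl ls \<and> list_all2 (realizes k w V j) vr rs)"

lemma realizes_Suc_imp: "realizes (Suc k) w V p j t \<Longrightarrow> realizes k w V p j t"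
proof (induction k arbitrary: p j t)
  case (Suc k)
  obtain cs ls rs where t: "t = CNode cs ls rs" by (cases t)
  obtain vc vl vr where v: "distinct (vc @ vl @ vr)" "p \<notin> set (vc @ vl @ vr)"
    "typed_nbrs w j (V - {p}) (True, True) = set vc" "typed_nbrs w j (V - {p}) (True, False) = set vl"
    "typed_nbrs w j (V - {p}) (False, True) = set vr"
    "list_all2 (realizes (Suc k) w V j) vc cs" "list_all2 (realizes (Suc k) w V j) vl ls" "list_all2 (realizes (Suc k) w V j) vr rs"
    using Suc.prems[unfolded realizes.simps(2)[of "Suc k"] t ctree.case] by blast
  have "list_all2 (realizes k w V j) vc cs" "list_all2 (realizes k w V j) vl ls" "list_all2 (realizes k w V j) vr rs"
    using v(6-8) by (auto intro: list_all2_mono Suc.IH)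
  then show ?case using v(1-5) unfolding realizes.simps(2)[of k] t ctree.case by blast
qed simp

lemma realizes_mono: "k \<le> k' \<Longrightarrow> realizes k' w V p j t \<Longrightarrow> realizes k w V p j t"
proof (induction rule: inc_induct)
  case (step m) then show ?case using realizes_Suc_imp by blast
qed

text \<open>Vertices of \<open>V\<close> outside the queue, \<open>D\<close> and \<open>W\<close>
  are finished. The invariant is that a queued vertex has no edge to a finished one other than its
  parent, and an undiscovered vertex has none at all. Hence the neighbours of \<open>j\<close> apart
  from its parent are exactly those found in \<open>W\<close>.\<close>

lemma explores_realizes:
  assumes "explores w q D W ts" and sym: "\<And>u v. w u v = w v u" and irr: "\<And>u. w u u = (False, False)"
    and "finite W" "distinct (map fst q)" "fst ` set q \<inter> W = {}" "D \<inter> W = {}" "fst ` set q \<inter> D = {}" "fst ` set q \<union> D \<union> W \<subseteq> V"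
    and "\<And>j v. j \<in> fst ` set q \<Longrightarrow> v \<in> V - (fst ` set q \<union> D \<union> W) \<Longrightarrow> v \<noteq> par j \<Longrightarrow> w j v = (False, False)"
    and "\<And>j v. j \<in> W \<Longrightarrow> v \<in> V - (fst ` set q \<union> D \<union> W) \<Longrightarrow> w j v = (False, False)"
    and "\<And>j. j \<in> fst ` set q \<Longrightarrow> par j \<notin> W"
  shows "list_all2 (\<lambda>z t. realizes (snd z) w V (par (fst z)) (fst z) t) q ts"
  using assms(1,4-)
proof (induction arbitrary: par rule: explores.induct)
  case (explores_Nil D W) show ?case by simp
next
  case (explores_0 q j D W ts)
  have "list_all2 (\<lambda>z t. realizes (snd z) w V (par (fst z)) (fst z) t) q ts"
  proof (rule explores_0.IH)
    have eq: "fst ` set q \<union> insert j D \<union> W = fst ` set ((j, 0) # q) \<union> D \<union> W" by auto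
    show "w i v = (False, False)" if "i \<in> fst ` set q" "v \<in> V - (fst ` set q \<union> insert j D \<union> W)" "v \<noteq> par i" for i v
      using explores_0.prems(7)[of i v] that unfolding eq by simp
    show "w i v = (False, False)" if "i \<in> W" "v \<in> V - (fst ` set q \<union> insert j D \<union> W)" for i v
      using explores_0.prems(8)[of i v] that unfolding eq by simp
  qed (use explores_0.prems in auto)
  then show ?case by simp
next
  case (explores_Suc q D j C W L R cs ls rs k ts)
  let ?vs = "sorted_list_of_set C @ sorted_list_of_set L @ sorted_list_of_set R"
  let ?q = "map (\<lambda>v. (v, k)) ?vs @ q" and ?W = "W - C - L - R"
  let ?Q = "fst ` set ((j, Suc k) # q) \<union> D \<union> W"
  \<comment> \<open>The newly discovered vertices get \<open>j\<close> as parent; \<open>j\<close>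
    itself becomes finished.\<close>
  define par' where "par' v = (if v \<in> C \<union> L \<union> R then j else par v)" for v
  have sub: "C \<subseteq> W" "L \<subseteq> W" "R \<subseteq> W" and dj: "C \<inter> L = {}" "C \<inter> R = {}" "L \<inter> R = {}"
    unfolding explores_Suc.hyps(2-4) by (auto simp: typed_nbrs_def)
  have fin: "finite C" "finite L" "finite R" using sub explores_Suc.prems(1) by (auto intro: finite_subset)
  have q: "fst ` set ?q = C \<union> L \<union> R \<union> fst ` set q" using fin by (auto simp: image_Un image_image)
  have jn: "j \<notin> fst ` set q" "j \<notin> D" "j \<notin> W" using explores_Suc.prems by auto
  have Q: "fst ` set ?q \<union> D \<union> ?W = ?Q - {j}" unfolding q using sub jn by auto
  have nonbr: "w v j = (False, False)" if "v \<in> ?W" for v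
  proof -
    have "v \<in> W" "w j v \<noteq> (True, True)" "w j v \<noteq> (True, False)" "w j v \<noteq> (False, True)"
      using that unfolding explores_Suc.hyps(2-4) by (auto simp: typed_nbrs_def)
    then show ?thesis unfolding sym[of v j] by (cases "w j v") auto
  qed
  have qW: "fst ` set q \<inter> W = {}" using explores_Suc.prems(3) by auto
  have IH: "list_all2 (\<lambda>z t. realizes (snd z) w V (par' (fst z)) (fst z) t) ?q (cs @ ls @ rs @ ts)"
  proof (rule explores_Suc.IH)
    show "finite ?W" using explores_Suc.prems(1) by simp
    have "map fst ?q = ?vs @ map fst q" by (simp add: o_def)
    then show "distinct (map fst ?q)" using dj fin sub qW explores_Suc.prems(2) by auto
    show "fst ` set ?q \<inter> ?W = {}" unfolding q using qW by auto
    show "D \<inter> ?W = {}" using explores_Suc.prems(4) by auto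
    show "fst ` set ?q \<inter> D = {}" unfolding q using sub explores_Suc.prems(4,5) by auto
    show "fst ` set ?q \<union> D \<union> ?W \<subseteq> V" unfolding Q using explores_Suc.prems(6) by blast
    fix i v assume v: "v \<in> V - (fst ` set ?q \<union> D \<union> ?W)"
    then have v': "v = j \<or> v \<in> V - ?Q" unfolding Q by blast
    show "w i v = (False, False)" if i: "i \<in> fst ` set ?q" "v \<noteq> par' i"
    proof (cases "i \<in> C \<union> L \<union> R")
      case True
      then have "v \<noteq> j" "i \<in> W" using i(2) sub by (auto simp: par'_def)
      then show ?thesis using explores_Suc.prems(8)[of i v] v' by blast
    next
      case False
      then have iq: "i \<in> fst ` set q" "v \<noteq> par i" using i(1)[unfolded q] i(2) by (auto simp: par'_def)
      show ?thesis
      proof (cases "v = j")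
        case True
        then show ?thesis using explores_Suc.hyps(1) iq(1) sym[of i j] by auto
      next
        case False
        then show ?thesis using explores_Suc.prems(7)[of i v] v' iq by auto
      qed
    qed
    show "w i v = (False, False)" if "i \<in> ?W"
      using v' nonbr[OF that] explores_Suc.prems(8)[of i v] that by blast
  next
    fix i assume "i \<in> fst ` set ?q"
    then show "par' i \<notin> ?W" using explores_Suc.prems(9)[of i] jn unfolding q par'_def by auto
  qed
  have lens: "length (map (\<lambda>v. (v, k)) (sorted_list_of_set C)) = length cs" "length (map (\<lambda>v. (v, k)) (sorted_list_of_set L)) = length ls"
    "length (map (\<lambda>v. (v, k)) (sorted_list_of_set R)) = length rs"
    using explores_Suc.hyps(5-7) by auto
  let ?P = "\<lambda>z t. realizes (snd z) w V (par' (fst z)) (fst z) t"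
  have parts: "list_all2 ?P (map (\<lambda>v. (v, k)) (sorted_list_of_set C)) cs" "list_all2 ?P (map (\<lambda>v. (v, k)) (sorted_list_of_set L)) ls"
    "list_all2 ?P (map (\<lambda>v. (v, k)) (sorted_list_of_set R)) rs" "list_all2 ?P q ts"
    using IH unfolding map_append append_assoc using lens by (simp_all add: list_all2_append)
  have child: "list_all2 (realizes k w V j) (sorted_list_of_set S) xs"
    if "list_all2 ?P (map (\<lambda>v. (v, k)) (sorted_list_of_set S)) xs" "S \<subseteq> C \<union> L \<union> R" for S xs
  proof -
    have fS: "finite S" using that(2) fin by (meson finite_Un finite_subset)
    show ?thesis
    proof (rule list.rel_mono_strong)
      show "list_all2 (\<lambda>v t. realizes k w V (par' v) v t) (sorted_list_of_set S) xs"
        using that(1) unfolding list_all2_map1 by simp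
      fix v t assume "v \<in> set (sorted_list_of_set S)" and r: "realizes k w V (par' v) v t"
      then have "v \<in> S" using fS by simp
      then have "par' v = j" using that(2) unfolding par'_def by (metis subsetD)
      then show "realizes k w V j v t" using r by simp
    qed
  qed
  have nb: "typed_nbrs w j (V - {par j}) x = typed_nbrs w j W x" if x: "x \<noteq> (False, False)" for x
  proof -
    have "v \<in> W" if v: "v \<in> V - {par j}" "w j v = x" for v
    proof (rule ccontr)
      assume "v \<notin> W"
      then consider "v = j" | "v \<in> fst ` set q \<union> D" | "v \<in> V - ?Q" using v by auto
      then have "w j v = (False, False)"
      proof cases
        case 1 then show ?thesis by (simp add: irr)
      next
        case 2 then show ?thesis using explores_Suc.hyps(1) by auto
      next
        case 3 then show ?thesis using explores_Suc.prems(7)[of j v] v by auto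
      qed
      then show False using v x by simp
    qed
    moreover have "v \<in> V - {par j}" if "v \<in> W" for v
      using that explores_Suc.prems(6) explores_Suc.prems(9)[of j] by auto
    ultimately show ?thesis unfolding typed_nbrs_def by blast
  qed
  have "realizes (Suc k) w V (par j) j (CNode cs ls rs)"
    unfolding realizes.simps ctree.case
  proof (intro exI conjI)
    show "distinct (sorted_list_of_set C @ sorted_list_of_set L @ sorted_list_of_set R)" using dj fin by auto
    show "par j \<notin> set (sorted_list_of_set C @ sorted_list_of_set L @ sorted_list_of_set R)"
      using fin sub explores_Suc.prems(9)[of j] by auto
    show "typed_nbrs w j (V - {par j}) (True, True) = set (sorted_list_of_set C)"
      "typed_nbrs w j (V - {par j}) (True, False) = set (sorted_list_of_set L)"
      "typed_nbrs w j (V - {par j}) (False, True) = set (sorted_list_of_set R)"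
      using fin by (simp_all add: nb explores_Suc.hyps(2-4)[symmetric])
  qed (use child parts in auto)
  moreover have "list_all2 (\<lambda>z t. realizes (snd z) w V (par (fst z)) (fst z) t) q ts"
  proof (rule list.rel_mono_strong)
    show "list_all2 ?P q ts" by (rule parts(4))
    fix z t assume "z \<in> set q" "?P z t"
    moreover from this have "fst z \<notin> C \<union> L \<union> R" using sub qW by auto
    ultimately show "realizes (snd z) w V (par (fst z)) (fst z) t" by (simp add: par'_def)
  qed
  ultimately show ?case by simp
qed

text \<open>The rank of a vertex is the depth to which it remains to be explored, and \<open>par\<close> is its parent.\<close>

lemma explores_rank:
  assumes "explores w q D W ts" and sym: "\<And>u v. w u v = w v u" and irr: "\<And>u. w u u = (False, False)"
    and "finite W" "distinct (map fst q)" "fst ` set q \<inter> W = {}" "D \<inter> W = {}" "fst ` set q \<inter> D = {}"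
    and "\<And>j k. (j, k) \<in> set q \<Longrightarrow> rk j = k" and "\<And>j. j \<in> D \<Longrightarrow> rk j = 0"
  shows "\<exists>rk' par'. (\<forall>v. v \<notin> W \<longrightarrow> rk' v = rk v \<and> par' v = par v) \<and>
    (\<forall>v\<in>fst ` set q \<union> D \<union> W. \<forall>u\<in>fst ` set q \<union> D \<union> W. rk' v \<ge> 1 \<longrightarrow> w v u \<noteq> (False, False) \<longrightarrow>
      (u \<in> W \<and> par' u = v \<and> rk' v = Suc (rk' u)) \<or> (v \<in> W \<and> u = par' v \<and> rk' u = Suc (rk' v)))"
  using assms(1,4-)
proof (induction arbitrary: rk par rule: explores.induct)
  case (explores_Nil D W)
  show ?case
    by (rule exI[of _ "\<lambda>v. if v \<in> W then 0 else rk v"], rule exI[of _ par]) (use explores_Nil.prems in auto)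
next
  case (explores_0 q j D W ts)
  have eq: "fst ` set ((j, 0) # q) \<union> D \<union> W = fst ` set q \<union> insert j D \<union> W" by auto
  show ?case unfolding eq
    by (rule explores_0.IH) (use explores_0.prems in auto)
next
  case (explores_Suc q D j C W L R cs ls rs k ts)
  let ?vs = "sorted_list_of_set C @ sorted_list_of_set L @ sorted_list_of_set R"
  let ?q = "map (\<lambda>v. (v, k)) ?vs @ q" and ?W = "W - C - L - R"
  let ?Q = "fst ` set ((j, Suc k) # q) \<union> D \<union> W"
  let ?Ch = "C \<union> L \<union> R"
  define rk1 where "rk1 v = (if v \<in> ?Ch then k else rk v)" for v
  define par1 where "par1 v = (if v \<in> ?Ch then j else par v)" for v
  have sub: "?Ch \<subseteq> W" and dj: "C \<inter> L = {}" "C \<inter> R = {}" "L \<inter> R = {}"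
    unfolding explores_Suc.hyps(2-4) by (auto simp: typed_nbrs_def)
  have fin: "finite C" "finite L" "finite R" using sub explores_Suc.prems(1) by (auto intro: finite_subset)
  have q: "fst ` set ?q = ?Ch \<union> fst ` set q" using fin by (auto simp: image_Un image_image)
  have jn: "j \<notin> fst ` set q" "j \<notin> D" "j \<notin> W" using explores_Suc.prems by auto
  have Q: "fst ` set ?q \<union> D \<union> ?W = ?Q - {j}" unfolding q using sub jn by auto
  have qW: "fst ` set q \<inter> W = {}" using explores_Suc.prems(3) by auto
  have nbr: "v \<in> ?Ch" if "v \<in> ?Q" "w j v \<noteq> (False, False)" for v
  proof -
    have "v \<noteq> j" using that irr by auto
    moreover have "v \<notin> fst ` set q \<union> D" using that explores_Suc.hyps(1) by auto
    ultimately have "v \<in> W" using that(1) by auto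
    then show ?thesis using that(2) unfolding explores_Suc.hyps(2-4) by (cases "w j v") (auto simp: typed_nbrs_def)
  qed
  have "\<exists>rk' par'. (\<forall>v. v \<notin> ?W \<longrightarrow> rk' v = rk1 v \<and> par' v = par1 v) \<and>
    (\<forall>v\<in>fst ` set ?q \<union> D \<union> ?W. \<forall>u\<in>fst ` set ?q \<union> D \<union> ?W. rk' v \<ge> 1 \<longrightarrow> w v u \<noteq> (False, False) \<longrightarrow>
      (u \<in> ?W \<and> par' u = v \<and> rk' v = Suc (rk' u)) \<or> (v \<in> ?W \<and> u = par' v \<and> rk' u = Suc (rk' v)))"
  proof (rule explores_Suc.IH)
    show "finite ?W" using explores_Suc.prems(1) by simp
    have "map fst ?q = ?vs @ map fst q" by (simp add: o_def)
    then show "distinct (map fst ?q)" using dj fin sub qW explores_Suc.prems(2) by auto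
    show "fst ` set ?q \<inter> ?W = {}" unfolding q using qW by auto
    show "D \<inter> ?W = {}" using explores_Suc.prems(4) by auto
    show "fst ` set ?q \<inter> D = {}" unfolding q using sub explores_Suc.prems(4,5) by auto
    show "rk1 i = l" if "(i, l) \<in> set ?q" for i l
    proof (cases "(i, l) \<in> set q")
      case True
      then have "i \<in> fst ` set q" by (rule image_eqI[rotated]) simp
      then have "i \<notin> ?Ch" using sub qW by blast
      then show ?thesis using explores_Suc.prems(6)[of i l] True by (simp add: rk1_def)
    next
      case False
      then have "(i, l) \<in> set (map (\<lambda>v. (v, k)) ?vs)" using that by (simp only: set_append Un_iff) blast
      then have "i \<in> set ?vs" "l = k" by auto
      moreover have "set ?vs = ?Ch" using fin by (auto simp only: set_append set_sorted_list_of_set)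
      ultimately show ?thesis by (simp only: rk1_def if_True)
    qed
    show "rk1 i = 0" if "i \<in> D" for i
    proof -
      have "i \<notin> ?Ch" using that sub explores_Suc.prems(4) by auto
      then show ?thesis using explores_Suc.prems(7)[OF that] by (simp add: rk1_def)
    qed
  qed
  then obtain rk' par' where o: "\<forall>v. v \<notin> ?W \<longrightarrow> rk' v = rk1 v \<and> par' v = par1 v"
    and i: "\<forall>v\<in>fst ` set ?q \<union> D \<union> ?W. \<forall>u\<in>fst ` set ?q \<union> D \<union> ?W. rk' v \<ge> 1 \<longrightarrow> w v u \<noteq> (False, False) \<longrightarrow>
      (u \<in> ?W \<and> par' u = v \<and> rk' v = Suc (rk' u)) \<or> (v \<in> ?W \<and> u = par' v \<and> rk' u = Suc (rk' v))"
    by (elim exE conjE) (rule that)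
  note out = o[rule_format] and ins = i[unfolded Q, rule_format]
  have "j \<notin> ?W" "j \<notin> ?Ch" using jn(3) sub by blast+
  then have rj: "rk' j = Suc k" using out[of j] explores_Suc.prems(6)[of j "Suc k"] by (simp add: rk1_def)
  have ch: "rk' v = k" "par' v = j" "v \<in> W" if "v \<in> ?Ch" for v
    using out[of v] that sub by (auto simp: rk1_def par1_def)
  show ?case
  proof (intro exI conjI allI ballI impI)
    fix v assume "v \<notin> W"
    then have "v \<notin> ?W" "v \<notin> ?Ch" using sub by auto
    then show "rk' v = rk v" "par' v = par v" using out[of v] by (auto simp: rk1_def par1_def)
  next
    fix v u assume vu: "v \<in> ?Q" "u \<in> ?Q" "1 \<le> rk' v" "w v u \<noteq> (False, False)"
    show "(u \<in> W \<and> par' u = v \<and> rk' v = Suc (rk' u)) \<or> (v \<in> W \<and> u = par' v \<and> rk' u = Suc (rk' v))"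
    proof (cases "v = j")
      case True
      then have "u \<in> ?Ch" using vu nbr by blast
      then show ?thesis using ch[of u] rj True by simp
    next
      case vj: False
      show ?thesis
      proof (cases "u = j")
        case True
        then have "v \<in> ?Ch" using vu nbr[of v] sym[of v u] by auto
        then show ?thesis using ch[of v] rj True by simp
      next
        case False
        then have "v \<in> ?Q - {j}" "u \<in> ?Q - {j}" using vu(1,2) vj by blast+
        from ins[OF this vu(3,4)] show ?thesis by blast
      qed
    qed
  qed
qed

text \<open>A vertex of minimal rank on a cycle would have two different parents.\<close>

lemma rank_ball_acyclic:
  assumes G: "\<And>u v. G u v \<Longrightarrow> u \<in> V \<and> v \<in> V" "\<And>u v. G u v \<Longrightarrow> G v u"
    and rk: "\<And>u v. G v u \<Longrightarrow> rk v \<ge> 1 \<Longrightarrow> rk v = Suc (rk u) \<or> (u = par v \<and> rk u = Suc (rk v))"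
    and i: "rk i = Suc d"
  shows "ball_acyclic G d i"
  unfolding ball_acyclic_def
proof
  \<comment> \<open>Along an edge the rank drops by at most one, so every vertex of the ball has
    rank at least 1 and all of its edges fall under the dichotomy for \<open>rk\<close>.\<close>
  have ball: "(G ^^ k) i v \<Longrightarrow> k \<le> d \<Longrightarrow> rk v + k \<ge> Suc d" for k v
  proof (induction k arbitrary: v)
    case 0 then show ?case using i by simp
  next
    case (Suc k)
    then obtain u where u: "(G ^^ k) i u" "G u v" by auto
    then have "rk u + k \<ge> Suc d" using Suc by auto
    then show ?case using rk[OF u(2)] Suc.prems(2) by auto
  qed
  assume "\<exists>xs. is_cycle G xs \<and> set xs \<subseteq> graph_ball G d i"
  then obtain xs where xs: "3 \<le> length xs" "distinct xs" "successively G xs" "G (last xs) (hd xs)" "set xs \<subseteq> graph_ball G d i"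
    by (auto simp: is_cycle_def)
  have pos: "rk v \<ge> 1" if "v \<in> set xs" for v
  proof -
    have "v \<in> graph_ball G d i" using \<open>v \<in> set xs\<close> xs(5) by (rule subsetD[rotated])
    then have "\<exists>k\<le>d. (G ^^ k) i v" by (simp only: graph_ball_def mem_Collect_eq)
    then obtain k where "k \<le> d" "(G ^^ k) i v" by (elim exE conjE) (rule that)
    then show ?thesis using ball[of k v] by linarith
  qed
  let ?n = "length xs"
  have nxt: "G (xs ! r) (xs ! (Suc r mod ?n))" if "r < ?n" for r
  proof (cases "Suc r < ?n")
    case True
    then show ?thesis using xs(3) by (simp add: successively_conv_nth)
  next
    case False
    then have r: "r = ?n - 1" "Suc r mod ?n = 0" using \<open>r < ?n\<close> by (auto simp: not_less le_Suc_eq)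
    have "xs \<noteq> []" using xs(1) by auto
    then show ?thesis unfolding r using xs(4) by (simp add: last_conv_nth hd_conv_nth)
  qed
  have "set xs \<noteq> {}" using xs(1) by auto
  then have "Min (rk ` set xs) \<in> rk ` set xs" by (intro Min_in) auto
  then obtain v where "v \<in> set xs" "rk v = Min (rk ` set xs)" by auto
  then have v: "v \<in> set xs" "rk v \<le> rk u" if "u \<in> set xs" for u using that by auto
  have vin: "v \<in> set xs" by fact
  then obtain r where r: "r < ?n" "v = xs ! r" by (auto simp: in_set_conv_nth)
  define r1 where "r1 = Suc r mod ?n"
  define r2 where "r2 = (if r = 0 then ?n - 1 else r - 1)"
  have r1: "r1 < ?n" unfolding r1_def using xs(1) by (intro mod_less_divisor) linarith
  have r2: "r2 < ?n" "Suc r2 mod ?n = r" using xs(1) r by (auto simp: r2_def)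
  have "r1 \<noteq> r2"
    using xs(1) r(1) by (auto simp: r1_def r2_def mod_Suc split: if_splits)
  then have ne: "xs ! r1 \<noteq> xs ! r2" using r1 r2 xs(2) by (simp add: nth_eq_iff_index_eq)
  have "G v (xs ! r1)" using nxt[OF r(1)] by (simp add: r r1_def)
  moreover have "G v (xs ! r2)" using nxt[OF r2(1)] r2(2) G(2) by (simp add: r)
  ultimately have "xs ! r1 = par v" "xs ! r2 = par v"
    using rk[of v "xs ! r1"] rk[of v "xs ! r2"] pos[OF vin] v(2)[of "xs ! r1"] v(2)[of "xs ! r2"] r1 r2 by auto
  then show False using ne by simp
qed

section \<open>Messages as likelihood ratios\<close>

lemma realizes_children:
  assumes r: "realizes (Suc k) w V p x t" and nb: "\<And>v. v \<in> N \<longleftrightarrow> v \<in> V \<and> (if b then fst (w x v) else snd (w x v))"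
  obtains vs where "distinct vs" "set vs = N - {p}" "list_all2 (realizes k w V x) vs (children b t)"
proof -
  obtain cs ls rs where t: "t = CNode cs ls rs" by (cases t)
  obtain vc vl vr where v: "distinct (vc @ vl @ vr)" "p \<notin> set (vc @ vl @ vr)"
    "typed_nbrs w x (V - {p}) (True, True) = set vc" "typed_nbrs w x (V - {p}) (True, False) = set vl"
    "typed_nbrs w x (V - {p}) (False, True) = set vr"
    "list_all2 (realizes k w V x) vc cs" "list_all2 (realizes k w V x) vl ls" "list_all2 (realizes k w V x) vr rs"
    using r[unfolded realizes.simps t ctree.case] by blast
  have "set (vc @ (if b then vl else vr)) = N - {p}"
  proof (rule set_eqI)
    fix u
    show "u \<in> set (vc @ (if b then vl else vr)) \<longleftrightarrow> u \<in> N - {p}"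
      unfolding set_append if_distrib[of set] v(3-5)[symmetric] using nb[of u]
      by (cases "w x u"; cases b) (auto simp: typed_nbrs_def)
  qed
  moreover have "distinct (vc @ (if b then vl else vr))" using v(1) by auto
  moreover have "list_all2 (realizes k w V x) (vc @ (if b then vl else vr)) (children b t)"
    unfolding t children.simps using v(6-8) by (intro list_all2_appendI) auto
  ultimately show ?thesis using that by blast
qed

lemma bij_betw_list_index:
  assumes "distinct vs"
  shows "bij_betw (\<lambda>l. vs ! (l - 1)) {1..length vs} (set vs)"
proof (rule bij_betw_imageI)
  show "inj_on (\<lambda>l. vs ! (l - 1)) {1..length vs}"
    using assms by (auto simp: inj_on_def nth_eq_iff_index_eq)
  show "(\<lambda>l. vs ! (l - 1)) ` {1..length vs} = set vs"
  proof
    show "set vs \<subseteq> (\<lambda>l. vs ! (l - 1)) ` {1..length vs}"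
    proof
      fix v assume "v \<in> set vs"
      then obtain i where "i < length vs" "v = vs ! i" by (auto simp: in_set_conv_nth)
      then show "v \<in> (\<lambda>l. vs ! (l - 1)) ` {1..length vs}" by (intro image_eqI[of _ _ "Suc i"]) auto
    qed
  qed auto
qed

text \<open>The message recursion at \<open>x\<close> and \<open>y\<close> runs over their
  neighbours other than the receivers \<open>p\<close> and \<open>p'\<close>, which are the children
  in the two trees; indexing them by list positions turns one recursion into the other. Degrees
  exceed numbers of children by one, which accounts for the subtractions in
  \<open>msg\<close>.\<close>

lemma msg_eq_ctree_like:
  assumes V: "finite V" and sym: "\<And>u v. w u v = w v u"
    and A: "\<And>u v. A u v \<longleftrightarrow> u \<in> V \<and> v \<in> V \<and> fst (w u v)" and B: "\<And>u v. B u v \<longleftrightarrow> u \<in> V \<and> v \<in> V \<and> snd (w u v)"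
  shows "realizes k w V p x t \<Longrightarrow> realizes k w V p' y t' \<Longrightarrow> A x p \<Longrightarrow> B y p' \<Longrightarrow>
    msg lam s A B k x p y p' = ctree_like lam s k t t'"
proof (induction k arbitrary: p x t p' y t')
  case 0 then show ?case by (simp add: ctree_like_def)
next
  case (Suc k)
  have nA: "v \<in> nbrs A x \<longleftrightarrow> v \<in> V \<and> (if True then fst (w x v) else snd (w x v))" for v
    using Suc.prems(3) by (auto simp: nbrs_def A)
  have nB: "v \<in> nbrs B y \<longleftrightarrow> v \<in> V \<and> (if False then fst (w y v) else snd (w y v))" for v
    using Suc.prems(4) by (auto simp: nbrs_def B)
  obtain vs where vs: "distinct vs" "set vs = nbrs A x - {p}" "list_all2 (realizes k w V x) vs (children True t)"
    by (rule realizes_children[OF Suc.prems(1) nA])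
  obtain us where us: "distinct us" "set us = nbrs B y - {p'}" "list_all2 (realizes k w V y) us (children False t')"
    by (rule realizes_children[OF Suc.prems(2) nB])
  let ?c = "length (children True t)" and ?c' = "length (children False t')"
  have lv: "length vs = ?c" "length us = ?c'" using vs(3) us(3) by (auto dest: list_all2_lengthD)
  have fn: "finite (nbrs A x)" "finite (nbrs B y)" using V by (auto simp: nbrs_def A B)
  have card: "card (nbrs A x) = Suc ?c" "card (nbrs B y) = Suc ?c'"
  proof -
    have "p \<in> nbrs A x" "p' \<in> nbrs B y" using Suc.prems by (auto simp: nbrs_def)
    then show "card (nbrs A x) = Suc ?c" "card (nbrs B y) = Suc ?c'"
      using distinct_card[OF vs(1)] distinct_card[OF us(1)] card_Suc_Diff1[of "nbrs A x" p] card_Suc_Diff1[of "nbrs B y" p'] fn lv vs(2) us(2)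
      by auto
  qed
  have bij: "bij_betw (\<lambda>l. vs ! (l - 1)) {1..?c} (nbrs A x - {p})" "bij_betw (\<lambda>l. us ! (l - 1)) {1..?c'} (nbrs B y - {p'})"
    using bij_betw_list_index[OF vs(1)] bij_betw_list_index[OF us(1)] lv vs(2) us(2) by auto
  have m: "msg lam s A B k (vs ! (i - 1)) x (us ! (i' - 1)) y = tree_like lam s k (subtree (enc True t) i) (subtree (enc False t') i')"
    if i: "i \<in> {1..?c}" "i' \<in> {1..?c'}" for i i'
  proof -
    have "msg lam s A B k (vs ! (i - 1)) x (us ! (i' - 1)) y = ctree_like lam s k (children True t ! (i - 1)) (children False t' ! (i' - 1))"
    proof (rule Suc.IH)
      show "realizes k w V x (vs ! (i - 1)) (children True t ! (i - 1))"
        using i lv by (intro list_all2_nthD[OF vs(3)]) auto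
      show "realizes k w V y (us ! (i' - 1)) (children False t' ! (i' - 1))"
        using i lv by (intro list_all2_nthD[OF us(3)]) auto
      have "vs ! (i - 1) \<in> set vs" "us ! (i' - 1) \<in> set us" using i lv by (auto intro!: nth_mem)
      then have "A x (vs ! (i - 1))" "B y (us ! (i' - 1))" using vs(2) us(2) by (auto simp: nbrs_def)
      then show "A (vs ! (i - 1)) x" "B (us ! (i' - 1)) y" unfolding A B using sym by auto
    qed
    then show ?thesis using i by (simp add: ctree_like_def subtree_enc)
  qed
  have inner: "(\<Sum>\<sigma>\<in>injections r (nbrs A x - {p}). \<Sum>\<sigma>'\<in>injections r (nbrs B y - {p'}). \<Prod>l = 1..r. msg lam s A B k (\<sigma> l) x (\<sigma>' l) y) =
    (\<Sum>\<sigma>\<in>injections r {1..?c}. \<Sum>\<sigma>'\<in>injections r {1..?c'}. \<Prod>l = 1..r. tree_like lam s k (subtree (enc True t) (\<sigma> l)) (subtree (enc False t') (\<sigma>' l)))" for r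
  proof -
    have "(\<Sum>\<sigma>\<in>injections r (nbrs A x - {p}). \<Sum>\<sigma>'\<in>injections r (nbrs B y - {p'}). \<Prod>l = 1..r. msg lam s A B k (\<sigma> l) x (\<sigma>' l) y) =
      (\<Sum>\<sigma>\<in>injections r {1..?c}. \<Sum>\<sigma>'\<in>injections r {1..?c'}. \<Prod>l = 1..r.
         msg lam s A B k ((\<lambda>l\<in>{1..r}. vs ! (\<sigma> l - 1)) l) x ((\<lambda>l\<in>{1..r}. us ! (\<sigma>' l - 1)) l) y)"
      by (subst sum.reindex_bij_betw[OF injections_reindex[OF bij(1)], symmetric],
          subst sum.reindex_bij_betw[OF injections_reindex[OF bij(2)], symmetric]) (rule refl)
    also have "\<dots> = (\<Sum>\<sigma>\<in>injections r {1..?c}. \<Sum>\<sigma>'\<in>injections r {1..?c'}. \<Prod>l = 1..r. tree_like lam s k (subtree (enc True t) (\<sigma> l)) (subtree (enc False t') (\<sigma>' l)))"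
      by (intro sum.cong prod.cong refl) (simp add: m injectionsD del: atLeastAtMost_iff One_nat_def)
    finally show ?thesis .
  qed
  show ?case
    unfolding msg.simps ctree_like_def tree_like.simps root_degree_enc inner card by (simp add: atLeast0AtMost)
qed

definition graph1 :: "(nat \<times> nat \<Rightarrow> bool \<times> bool) \<Rightarrow> graph" where
  "graph1 e = sym_ext (fst \<circ> e)"

definition graph2 :: "(nat \<times> nat \<Rightarrow> bool \<times> bool) \<Rightarrow> graph" where
  "graph2 e = sym_ext (snd \<circ> e)"

lemma ex_three_nth:
  assumes "distinct vs" "distinct us"
  shows "(\<exists>j1 j2 j3 v1 v2 v3. distinct [j1, j2, j3] \<and> {j1, j2, j3} \<subseteq> set vs \<and> distinct [v1, v2, v3] \<and> {v1, v2, v3} \<subseteq> set us \<and>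
      P j1 v1 \<and> P j2 v2 \<and> P j3 v3) \<longleftrightarrow>
    (\<exists>a1 a2 a3 b1 b2 b3. distinct [a1, a2, a3] \<and> {a1, a2, a3} \<subseteq> {..<length vs} \<and> distinct [b1, b2, b3] \<and> {b1, b2, b3} \<subseteq> {..<length us} \<and>
      P (vs ! a1) (us ! b1) \<and> P (vs ! a2) (us ! b2) \<and> P (vs ! a3) (us ! b3))" (is "?l \<longleftrightarrow> ?r")
proof
  assume ?l
  then obtain j1 j2 j3 v1 v2 v3 where *: "distinct [j1, j2, j3]" "j1 \<in> set vs" "j2 \<in> set vs" "j3 \<in> set vs"
    "distinct [v1, v2, v3]" "v1 \<in> set us" "v2 \<in> set us" "v3 \<in> set us" "P j1 v1" "P j2 v2" "P j3 v3" by auto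
  obtain a1 a2 a3 where a: "a1 < length vs" "vs ! a1 = j1" "a2 < length vs" "vs ! a2 = j2" "a3 < length vs" "vs ! a3 = j3"
    using *(2-4) by (auto simp: in_set_conv_nth)
  obtain b1 b2 b3 where b: "b1 < length us" "us ! b1 = v1" "b2 < length us" "us ! b2 = v2" "b3 < length us" "us ! b3 = v3"
    using *(6-8) by (auto simp: in_set_conv_nth)
  show ?r
    by (rule exI[of _ a1], rule exI[of _ a2], rule exI[of _ a3], rule exI[of _ b1], rule exI[of _ b2], rule exI[of _ b3])
      (use * a b in auto)
next
  assume ?r
  then obtain a1 a2 a3 b1 b2 b3 where *: "distinct [a1, a2, a3]" "a1 < length vs" "a2 < length vs" "a3 < length vs"
    "distinct [b1, b2, b3]" "b1 < length us" "b2 < length us" "b3 < length us"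
    "P (vs ! a1) (us ! b1)" "P (vs ! a2) (us ! b2)" "P (vs ! a3) (us ! b3)" by auto
  show ?l
    by (rule exI[of _ "vs ! a1"], rule exI[of _ "vs ! a2"], rule exI[of _ "vs ! a3"],
        rule exI[of _ "us ! b1"], rule exI[of _ "us ! b2"], rule exI[of _ "us ! b3"])
      (use * assms in \<open>auto simp: nth_eq_iff_index_eq\<close>)
qed

text \<open>Exploring to depth \<open>d + 1\<close> gives every vertex within distance
  \<open>d\<close> of a root a positive rank, so all of its edges are revealed and the balls of
  radius \<open>d\<close> are acyclic in both graphs. The messages of level \<open>d - 1\<close> at
  the children lie within the explored depth.\<close>

lemma explores_MPAlign_iff:
  assumes e: "\<And>x. x \<notin> edge_set n \<Longrightarrow> e x = (False, False)"
    and roots: "distinct roots" "set roots \<subseteq> {1..n}" and r: "r < length roots"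
    and ex: "explores (edge_types_of e) (map (\<lambda>i. (i, Suc d)) roots) {} ({1..n} - set roots) ts"
  shows "(roots ! r, roots ! r) \<in> MPAlign lam s n (graph1 e) (graph2 e) d \<beta> \<longleftrightarrow> good_tree lam s (d - 1) \<beta> (ts ! r)"
proof -
  let ?w = "edge_types_of e" and ?V = "{1..n}" and ?A = "graph1 e" and ?B = "graph2 e" and ?i = "roots ! r" and ?t = "ts ! r"
  let ?q = "map (\<lambda>i. (i, Suc d)) roots" and ?W = "{1..n} - set roots"
  have sym: "?w u v = ?w v u" for u v by (simp add: edge_types_of_def min.commute max.commute)
  have irr: "?w u u = (False, False)" for u by (simp add: edge_types_of_def)
  have out: "?w u v = (False, False)" if "\<not> (u \<in> ?V \<and> v \<in> ?V)" for u v
    using that by (auto simp: edge_types_of_def edge_set_def min_def max_def intro!: e)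
  have diag: "e (u, u) = (False, False)" for u by (rule e) (simp add: edge_set_def)
  have A: "?A u v \<longleftrightarrow> u \<in> ?V \<and> v \<in> ?V \<and> fst (?w u v)" for u v
  proof -
    have "?A u v = fst (?w u v)" using diag[of u] by (cases "u = v") (simp_all add: graph1_def sym_ext_def edge_types_of_def)
    then show ?thesis using out[of u v] by (cases "u \<in> ?V \<and> v \<in> ?V") simp_all
  qed
  have B: "?B u v \<longleftrightarrow> u \<in> ?V \<and> v \<in> ?V \<and> snd (?w u v)" for u v
  proof -
    have "?B u v = snd (?w u v)" using diag[of u] by (cases "u = v") (simp_all add: graph2_def sym_ext_def edge_types_of_def)
    then show ?thesis using out[of u v] by (cases "u \<in> ?V \<and> v \<in> ?V") simp_all
  qed
  have q: "fst ` set ?q = set roots" "map fst ?q = roots" by (auto simp: image_image o_def)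
  have i1: "?i \<in> set roots" using r by simp
  have i: "?i \<in> set roots" "?i \<in> ?V" by (rule i1, rule subsetD[OF roots(2) i1])
  \<comment> \<open>A root has no parent; 0 is not a vertex and serves as a dummy.\<close>
  have "list_all2 (\<lambda>z t. realizes (snd z) ?w ?V 0 (fst z) t) ?q ts"
    by (rule explores_realizes[OF ex sym irr, where par = "\<lambda>_. 0"]) (use roots in \<open>auto simp: image_image o_def\<close>)
  then have real: "realizes (Suc d) ?w ?V 0 ?i ?t"
    using r by (auto simp: list_all2_conv_all_nth)
  obtain rk par where rk0: "\<forall>v. v \<notin> ?W \<longrightarrow> rk v = Suc d \<and> par v = (0::nat)"
    and rk: "\<forall>v\<in>fst ` set ?q \<union> {} \<union> ?W. \<forall>u\<in>fst ` set ?q \<union> {} \<union> ?W. rk v \<ge> 1 \<longrightarrow> ?w v u \<noteq> (False, False) \<longrightarrow>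
      (u \<in> ?W \<and> par u = v \<and> rk v = Suc (rk u)) \<or> (v \<in> ?W \<and> u = par v \<and> rk u = Suc (rk v))"
  proof -
    have "\<exists>rk' par'. (\<forall>v. v \<notin> ?W \<longrightarrow> rk' v = Suc d \<and> par' v = (0::nat)) \<and>
      (\<forall>v\<in>fst ` set ?q \<union> {} \<union> ?W. \<forall>u\<in>fst ` set ?q \<union> {} \<union> ?W. rk' v \<ge> 1 \<longrightarrow> ?w v u \<noteq> (False, False) \<longrightarrow>
      (u \<in> ?W \<and> par' u = v \<and> rk' v = Suc (rk' u)) \<or> (v \<in> ?W \<and> u = par' v \<and> rk' u = Suc (rk' v)))"
      by (rule explores_rank[OF ex sym irr, where rk = "\<lambda>_. Suc d" and par = "\<lambda>_. 0"]) (use roots in \<open>auto simp: o_def\<close>)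
    then show ?thesis by (elim exE conjE) (rule that)
  qed
  have V: "fst ` set ?q \<union> {} \<union> ?W = ?V" unfolding q using roots by auto
  note rk' = rk[unfolded V, rule_format]
  have ri: "rk ?i = Suc d" using rk0 i by auto
  have acyc: "ball_acyclic G d ?i" if G: "\<And>u v. G u v \<Longrightarrow> u \<in> ?V \<and> v \<in> ?V \<and> ?w u v \<noteq> (False, False)" and Gs: "\<And>u v. G u v \<Longrightarrow> G v u" for G
  proof (rule rank_ball_acyclic[where V = ?V and rk = rk and par = par])
    show "u \<in> ?V \<and> v \<in> ?V" if "G u v" for u v using G[OF that] by blast
    show "rk v = Suc (rk u) \<or> u = par v \<and> rk u = Suc (rk v)" if "G v u" "1 \<le> rk v" for u v
      using rk'[of v u] G[OF that(1)] that(2) by blast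
  qed (use Gs ri in auto)
  have acA: "ball_acyclic ?A d ?i" by (rule acyc) (auto simp: A sym)
  have acB: "ball_acyclic ?B d ?i" by (rule acyc) (auto simp: B sym)
  have nA: "v \<in> nbrs ?A ?i \<longleftrightarrow> v \<in> ?V \<and> (if True then fst (?w ?i v) else snd (?w ?i v))" for v
    using i by (auto simp: nbrs_def A)
  have nB: "v \<in> nbrs ?B ?i \<longleftrightarrow> v \<in> ?V \<and> (if False then fst (?w ?i v) else snd (?w ?i v))" for v
    using i by (auto simp: nbrs_def B)
  obtain vs where vs: "distinct vs" "set vs = nbrs ?A ?i - {0}" "list_all2 (realizes d ?w ?V ?i) vs (children True ?t)"
    by (rule realizes_children[OF real nA])
  obtain us where us: "distinct us" "set us = nbrs ?B ?i - {0}" "list_all2 (realizes d ?w ?V ?i) us (children False ?t)"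
    by (rule realizes_children[OF real nB])
  have sv: "nbrs ?A ?i = set vs" "nbrs ?B ?i = set us" unfolding vs(2) us(2) by (auto simp: nbrs_def A B)
  have lv: "length vs = length (children True ?t)" "length us = length (children False ?t)"
    using vs(3) us(3) by (auto dest: list_all2_lengthD)
  have msg: "msg lam s ?A ?B (d - 1) (vs ! a) ?i (us ! b) ?i = ctree_like lam s (d - 1) (children True ?t ! a) (children False ?t ! b)"
    if "a < length vs" "b < length us" for a b
  proof (rule msg_eq_ctree_like[OF _ sym A B])
    show "realizes (d - 1) ?w ?V ?i (vs ! a) (children True ?t ! a)"
      by (rule realizes_mono[of _ d]) (use that list_all2_nthD[OF vs(3)] in auto)
    show "realizes (d - 1) ?w ?V ?i (us ! b) (children False ?t ! b)"
      by (rule realizes_mono[of _ d]) (use that list_all2_nthD[OF us(3)] in auto)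
    have "vs ! a \<in> nbrs ?A ?i" "us ! b \<in> nbrs ?B ?i" using that sv by auto
    then show "?A (vs ! a) ?i" "?B (us ! b) ?i" unfolding nbrs_def mem_Collect_eq A B using sym by auto
  qed simp
  have "(?i, ?i) \<in> MPAlign lam s n ?A ?B d \<beta> \<longleftrightarrow> (\<exists>j1 j2 j3 v1 v2 v3. distinct [j1, j2, j3] \<and> {j1, j2, j3} \<subseteq> set vs \<and> distinct [v1, v2, v3] \<and> {v1, v2, v3} \<subseteq> set us \<and>
      msg lam s ?A ?B (d - 1) j1 ?i v1 ?i > \<beta> \<and> msg lam s ?A ?B (d - 1) j2 ?i v2 ?i > \<beta> \<and> msg lam s ?A ?B (d - 1) j3 ?i v3 ?i > \<beta>)"
    unfolding MPAlign_def using i acA acB by (simp add: sv)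
  also have "\<dots> \<longleftrightarrow> (\<exists>a1 a2 a3 b1 b2 b3. distinct [a1, a2, a3] \<and> {a1, a2, a3} \<subseteq> {..<length vs} \<and> distinct [b1, b2, b3] \<and> {b1, b2, b3} \<subseteq> {..<length us} \<and>
      msg lam s ?A ?B (d - 1) (vs ! a1) ?i (us ! b1) ?i > \<beta> \<and> msg lam s ?A ?B (d - 1) (vs ! a2) ?i (us ! b2) ?i > \<beta> \<and> msg lam s ?A ?B (d - 1) (vs ! a3) ?i (us ! b3) ?i > \<beta>)"
    by (rule ex_three_nth[OF vs(1) us(1)])
  also have "\<dots> \<longleftrightarrow> good_tree lam s (d - 1) \<beta> ?t"
    unfolding good_tree_def lv[symmetric]
    by (intro ex_cong1 conj_cong refl) (auto simp: msg simp del: One_nat_def)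
  finally show ?thesis .
qed

section \<open>Equivariance under relabeling of the second graph\<close>

lemma msg_permute:
  assumes \<sigma>: "\<sigma> permutes S"
  shows "msg lam s G (\<lambda>u v. B (inv \<sigma> u) (inv \<sigma> v)) k i j (\<sigma> u) (\<sigma> v) = msg lam s G B k i j u v"
proof (induction k arbitrary: i j u v)
  case (Suc k)
  let ?B = "\<lambda>u v. B (inv \<sigma> u) (inv \<sigma> v)"
  have inj: "inj \<sigma>" by (rule permutes_inj[OF \<sigma>])
  have nb: "nbrs ?B (\<sigma> u) = \<sigma> ` nbrs B u"
    using permutes_inverses(2,1)[OF \<sigma>] by (auto simp: nbrs_def image_iff) metis
  have nb': "nbrs ?B (\<sigma> u) - {\<sigma> v} = \<sigma> ` (nbrs B u - {v})" unfolding nb using inj by (auto simp: inj_eq)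
  have card: "card (nbrs ?B (\<sigma> u)) = card (nbrs B u)" unfolding nb using inj by (simp add: card_image inj_on_subset)
  have bij: "bij_betw \<sigma> (nbrs B u - {v}) (nbrs ?B (\<sigma> u) - {\<sigma> v})"
    unfolding nb' using inj by (intro bij_betw_imageI) (auto intro: inj_on_subset)
  have "(\<Sum>\<tau>'\<in>injections m (nbrs ?B (\<sigma> u) - {\<sigma> v}). \<Prod>l = 1..m. msg lam s G ?B k (\<tau> l) i (\<tau>' l) (\<sigma> u)) =
    (\<Sum>\<tau>'\<in>injections m (nbrs B u - {v}). \<Prod>l = 1..m. msg lam s G B k (\<tau> l) i (\<tau>' l) u)" for m \<tau>
  proof -
    have "(\<Sum>\<tau>'\<in>injections m (nbrs ?B (\<sigma> u) - {\<sigma> v}). \<Prod>l = 1..m. msg lam s G ?B k (\<tau> l) i (\<tau>' l) (\<sigma> u)) =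
      (\<Sum>\<tau>'\<in>injections m (nbrs B u - {v}). \<Prod>l = 1..m. msg lam s G ?B k (\<tau> l) i ((\<lambda>l\<in>{1..m}. \<sigma> (\<tau>' l)) l) (\<sigma> u))"
      by (rule sum.reindex_bij_betw[OF injections_reindex[OF bij], symmetric])
    also have "\<dots> = (\<Sum>\<tau>'\<in>injections m (nbrs B u - {v}). \<Prod>l = 1..m. msg lam s G B k (\<tau> l) i (\<tau>' l) u)"
      by (intro sum.cong prod.cong refl) (simp add: Suc.IH)
    finally show ?thesis .
  qed
  then show ?case by (simp add: card)
qed simp

lemma ball_acyclic_permute:
  assumes \<sigma>: "\<sigma> permutes S"
  shows "ball_acyclic (\<lambda>u v. B (inv \<sigma> u) (inv \<sigma> v)) d (\<sigma> i) \<longleftrightarrow> ball_acyclic B d i"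
proof -
  let ?B = "\<lambda>u v. B (inv \<sigma> u) (inv \<sigma> v)"
  have inj: "inj \<sigma>" by (rule permutes_inj[OF \<sigma>])
  note inv = permutes_inverses(2,1)[OF \<sigma>]
  have pow: "(?B ^^ k) (\<sigma> i) (\<sigma> j) \<longleftrightarrow> (B ^^ k) i j" for k j
  proof (induction k arbitrary: j)
    case 0 then show ?case using inj by (simp add: inj_eq)
  next
    case (Suc k)
    have "(?B ^^ Suc k) (\<sigma> i) (\<sigma> j) \<longleftrightarrow> (\<exists>x. (?B ^^ k) (\<sigma> i) (\<sigma> x) \<and> ?B (\<sigma> x) (\<sigma> j))"
      unfolding relpowp.simps relcompp_apply using inv(2) by metis
    also have "\<dots> \<longleftrightarrow> (B ^^ Suc k) i j" unfolding relpowp.simps relcompp_apply by (simp add: Suc.IH inv)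
    finally show ?case .
  qed
  have ball: "\<sigma> j \<in> graph_ball ?B d (\<sigma> i) \<longleftrightarrow> j \<in> graph_ball B d i" for j
    unfolding graph_ball_def by (simp add: pow)
  have io: "inj_on \<sigma> X" for X by (rule inj_on_subset[OF inj]) simp
  have cyc: "is_cycle ?B (map \<sigma> xs) \<longleftrightarrow> is_cycle B xs" for xs
  proof (cases "xs = []")
    case False
    then show ?thesis
      unfolding is_cycle_def
      by (simp add: distinct_map io successively_map inv last_map hd_map)
  qed (simp add: is_cycle_def)
  have "(\<exists>xs. is_cycle ?B xs \<and> set xs \<subseteq> graph_ball ?B d (\<sigma> i)) \<longleftrightarrow> (\<exists>xs. is_cycle B xs \<and> set xs \<subseteq> graph_ball B d i)"
  proof
    assume "\<exists>xs. is_cycle ?B xs \<and> set xs \<subseteq> graph_ball ?B d (\<sigma> i)"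
    then obtain xs where xs: "is_cycle ?B xs" "set xs \<subseteq> graph_ball ?B d (\<sigma> i)" by blast
    have m: "map \<sigma> (map (inv \<sigma>) xs) = xs" by (simp add: inv(2) o_def)
    have "is_cycle B (map (inv \<sigma>) xs)" using xs(1) cyc[of "map (inv \<sigma>) xs"] unfolding m by simp
    moreover have "set (map (inv \<sigma>) xs) \<subseteq> graph_ball B d i"
      using xs(2) ball[of "inv \<sigma> _"] inv(2) by auto
    ultimately show "\<exists>xs. is_cycle B xs \<and> set xs \<subseteq> graph_ball B d i" by blast
  next
    assume "\<exists>xs. is_cycle B xs \<and> set xs \<subseteq> graph_ball B d i"
    then obtain xs where "is_cycle B xs" "set xs \<subseteq> graph_ball B d i" by blast
    then have "is_cycle ?B (map \<sigma> xs)" "set (map \<sigma> xs) \<subseteq> graph_ball ?B d (\<sigma> i)" using cyc ball by auto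
    then show "\<exists>xs. is_cycle ?B xs \<and> set xs \<subseteq> graph_ball ?B d (\<sigma> i)" by blast
  qed
  then show ?thesis by (simp add: ball_acyclic_def)
qed

text \<open>Degrees, messages and cycles are unchanged when the vertices of the second graph are
  renamed. Planted pairs thus become diagonal pairs of the two graphs before the permutation is
  applied.\<close>

lemma MPAlign_permute:
  assumes \<sigma>: "\<sigma> permutes {1..n}"
  shows "(i, \<sigma> i) \<in> MPAlign lam s n G (\<lambda>u v. B (inv \<sigma> u) (inv \<sigma> v)) d \<beta> \<longleftrightarrow> (i, i) \<in> MPAlign lam s n G B d \<beta>"
proof -
  let ?B = "\<lambda>u v. B (inv \<sigma> u) (inv \<sigma> v)"
  have inj: "inj \<sigma>" by (rule permutes_inj[OF \<sigma>])
  note inv = permutes_inverses(2,1)[OF \<sigma>]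
  have nb: "v \<in> nbrs ?B (\<sigma> i) \<longleftrightarrow> inv \<sigma> v \<in> nbrs B i" for v by (simp add: nbrs_def inv)
  let ?P = "\<lambda>f. \<exists>j1 j2 j3 v1 v2 v3. distinct [j1, j2, j3] \<and> {j1, j2, j3} \<subseteq> nbrs G i \<and> distinct [v1, v2, v3] \<and> {f v1, f v2, f v3} \<subseteq> nbrs B i \<and>
        msg lam s G B (d - 1) j1 i (f v1) i > \<beta> \<and> msg lam s G B (d - 1) j2 i (f v2) i > \<beta> \<and> msg lam s G B (d - 1) j3 i (f v3) i > \<beta>"
  have m: "msg lam s G ?B k j i v (\<sigma> i) = msg lam s G B k j i (inv \<sigma> v) i" for k j v
    using msg_permute[OF \<sigma>, of lam s G B k j i "inv \<sigma> v" i] by (simp add: inv)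
  have "?P (inv \<sigma>) \<longleftrightarrow> ?P (\<lambda>v. v)"
  proof
    assume "?P (inv \<sigma>)"
    then obtain j1 j2 j3 v1 v2 v3 where *: "distinct [j1, j2, j3]" "{j1, j2, j3} \<subseteq> nbrs G i" "distinct [v1, v2, v3]"
      "{inv \<sigma> v1, inv \<sigma> v2, inv \<sigma> v3} \<subseteq> nbrs B i"
      "msg lam s G B (d - 1) j1 i (inv \<sigma> v1) i > \<beta>" "msg lam s G B (d - 1) j2 i (inv \<sigma> v2) i > \<beta>" "msg lam s G B (d - 1) j3 i (inv \<sigma> v3) i > \<beta>"
      by (elim exE conjE) (rule that)
    have "inv \<sigma> v = inv \<sigma> v' \<longleftrightarrow> v = v'" for v v' using inv(2) by metis
    then have d: "distinct [inv \<sigma> v1, inv \<sigma> v2, inv \<sigma> v3]" using *(3) by simp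
    show "?P (\<lambda>v. v)"
      by (rule exI[of _ j1], rule exI[of _ j2], rule exI[of _ j3], rule exI[of _ "inv \<sigma> v1"], rule exI[of _ "inv \<sigma> v2"], rule exI[of _ "inv \<sigma> v3"])
        (intro conjI * d)
  next
    assume "?P (\<lambda>v. v)"
    then obtain j1 j2 j3 v1 v2 v3 where *: "distinct [j1, j2, j3]" "{j1, j2, j3} \<subseteq> nbrs G i" "distinct [v1, v2, v3]"
      "{v1, v2, v3} \<subseteq> nbrs B i"
      "msg lam s G B (d - 1) j1 i v1 i > \<beta>" "msg lam s G B (d - 1) j2 i v2 i > \<beta>" "msg lam s G B (d - 1) j3 i v3 i > \<beta>"
      by (elim exE conjE) (rule that)
    show "?P (inv \<sigma>)"
      by (rule exI[of _ j1], rule exI[of _ j2], rule exI[of _ j3], rule exI[of _ "\<sigma> v1"], rule exI[of _ "\<sigma> v2"], rule exI[of _ "\<sigma> v3"])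
        (use * in \<open>simp add: inv inj_eq[OF inj]\<close>)
  qed
  moreover have "(i, \<sigma> i) \<in> MPAlign lam s n G ?B d \<beta> \<longleftrightarrow>
      i \<in> {1..n} \<and> ball_acyclic G d i \<and> ball_acyclic B d i \<and> ?P (inv \<sigma>)"
    unfolding MPAlign_def mem_Collect_eq prod.case ball_acyclic_permute[OF \<sigma>] m permutes_in_image[OF \<sigma>]
    by (simp add: nb cong: conj_cong)
  moreover have "(i, i) \<in> MPAlign lam s n G B d \<beta> \<longleftrightarrow>
      i \<in> {1..n} \<and> ball_acyclic G d i \<and> ball_acyclic B d i \<and> ?P (\<lambda>v. v)"
    unfolding MPAlign_def by (simp cong: conj_cong)
  ultimately show ?thesis by (simp only:)
qed

section \<open>The second moment\<close>

text \<open>The tree with all three kinds of children is a branching process of mean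
  \<open>lam * s + 2 * lam * (1 - s) = lam * (2 - s)\<close>, the mean degree of the union graph;
  hence its role in the condition on \<open>c\<close>.\<close>

lemma nodes_mean:
  assumes lam: "lam > 0" and s: "0 \<le> s" "s \<le> 1"
  shows "(\<integral>\<^sup>+t. of_nat (nodes t) \<partial>measure_pmf (ctree_pmf lam s k)) = ennreal (\<Sum>i\<le>k. (lam * (2 - s)) ^ i)"
proof (induction k)
  case (Suc k)
  let ?U = "ctree_pmf lam s k" and ?x = "\<Sum>i\<le>k. (lam * (2 - s)) ^ i"
  have r: "lam * s \<ge> 0" "lam * (1 - s) \<ge> 0" using lam s by auto
  have x: "?x \<ge> 0" using lam s by (intro sum_nonneg) auto
  have "(\<integral>\<^sup>+t. of_nat (nodes t) \<partial>measure_pmf (ctree_pmf lam s (Suc k))) =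
    (\<integral>\<^sup>+m. \<integral>\<^sup>+a. \<integral>\<^sup>+b. 1 + of_nat m * ennreal ?x + of_nat a * ennreal ?x + of_nat b * ennreal ?x
      \<partial>measure_pmf (poisson (lam * (1 - s))) \<partial>measure_pmf (poisson (lam * (1 - s))) \<partial>measure_pmf (poisson (lam * s)))"
    unfolding nn_integral_ctree_pmf_Suc
    by (simp add: ennreal_of_nat_sum_list nn_integral_add nn_integral_replicate_sum_list Suc.IH add.assoc)
  also have "\<dots> = 1 + ennreal (lam * s) * ennreal ?x + ennreal (lam * (1 - s)) * ennreal ?x + ennreal (lam * (1 - s)) * ennreal ?x"
    using r by (simp add: nn_integral_add nn_integral_multc nn_integral_poisson_mean)
  also have "\<dots> = ennreal (1 + lam * s * ?x + lam * (1 - s) * ?x + lam * (1 - s) * ?x)"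
    using r x by (simp add: ennreal_mult[symmetric] flip: ennreal_plus ennreal_1)
  also have "1 + lam * s * ?x + lam * (1 - s) * ?x + lam * (1 - s) * ?x = 1 + lam * (2 - s) * ?x"
    by (simp add: algebra_simps)
  also have "\<dots> = (\<Sum>i\<le>Suc k. (lam * (2 - s)) ^ i)"
    unfolding sum.atMost_Suc_shift by (simp add: sum_distrib_left)
  finally show ?case .
qed simp

text \<open>Markov's inequality. The factor 2 is there because two explorations share the budget
  \<open>N\<close>, half of it for each.\<close>

lemma nodes_tail:
  assumes lam: "lam > 0" and s: "0 \<le> s" "s \<le> 1" and N: "N > 0"
  shows "measure_pmf.prob (ctree_pmf lam s k) {t. N < 2 * nodes t} \<le> 2 * (\<Sum>i\<le>k. (lam * (2 - s)) ^ i) / real N"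
proof -
  let ?U = "ctree_pmf lam s k" and ?A = "{t. N < 2 * nodes t}" and ?x = "\<Sum>i\<le>k. (lam * (2 - s)) ^ i"
  have x: "?x \<ge> 0" using lam s by (intro sum_nonneg) auto
  have "ennreal (real N * measure_pmf.prob ?U ?A) = (\<integral>\<^sup>+t. of_nat N * indicator ?A t \<partial>measure_pmf ?U)"
    by (simp add: nn_integral_cmult measure_pmf.emeasure_eq_measure ennreal_mult ennreal_of_nat_eq_real_of_nat)
  also have "\<dots> \<le> (\<integral>\<^sup>+t. 2 * of_nat (nodes t) \<partial>measure_pmf ?U)"
  proof (rule nn_integral_mono)
    show "of_nat N * indicator ?A t \<le> 2 * (of_nat (nodes t) :: ennreal)" for t
    proof (cases "t \<in> ?A")
      case True
      then have "(of_nat N :: ennreal) \<le> of_nat (2 * nodes t)" by (intro of_nat_mono) simp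
      then show ?thesis using True by simp
    qed simp
  qed
  also have "\<dots> = ennreal (2 * ?x)" using x by (simp add: nn_integral_cmult nodes_mean[OF lam s] ennreal_mult)
  finally have "real N * measure_pmf.prob ?U ?A \<le> 2 * ?x" using x by simp
  then show ?thesis using N by (simp add: field_simps)
qed

text \<open>Chebyshev's inequality around \<open>p\<close> instead of the unknown mean of the
  indicators. Here \<open>p\<close> is the probability in the tree model, \<open>c\<close> the
  coupling factor and \<open>\<delta>\<close> the loss from oversized trees.\<close>

lemma second_moment_prob:
  fixes M :: "'a pmf" and Y :: "nat \<Rightarrow> 'a \<Rightarrow> bool"
  assumes n: "n > 0" and p: "0 < p" "p \<le> 1" and c: "0 \<le> c" "c \<le> 1" and \<delta>: "0 \<le> \<delta>"
    and P1: "\<And>i. i \<in> {1..n} \<Longrightarrow> measure_pmf.prob M {e. Y i e} \<ge> c * (p - \<delta>)"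
    and P2: "\<And>i j. i \<in> {1..n} \<Longrightarrow> j \<in> {1..n} \<Longrightarrow> i \<noteq> j \<Longrightarrow>
      measure_pmf.prob M {e. Y i e \<and> Y j e} \<le> 1 - c * (1 - p\<^sup>2 - 2 * \<delta>)"
  shows "measure_pmf.prob M {e. 1 / real n * (\<Sum>i = 1..n. of_bool (Y i e)) < p / 2} \<le> 4 / p\<^sup>2 * (1 / real n + 2 * (1 - c) + 4 * \<delta>)"
proof -
  let ?y = "\<lambda>i e. of_bool (Y i e) :: real" and ?I = "{1..n}"
  let ?X = "\<lambda>e. 1 / real n * (\<Sum>i = 1..n. ?y i e)" and ?E = "measure_pmf.expectation M"
  define \<epsilon> where "\<epsilon> = 2 * (1 - c) + 4 * \<delta>"
  have int: "integrable (measure_pmf M) (\<lambda>e. (?y i e - p) * (?y j e - p))" for i j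
    by (rule measure_pmf.integrable_const_bound[where B = 1])
      (use p in \<open>auto simp: abs_mult intro!: AE_pmfI mult_le_one\<close>)
  have int': "integrable (measure_pmf M) (?y i)" "integrable (measure_pmf M) (\<lambda>e. of_bool (Y i e \<and> Y j e) :: real)" for i j
    by (rule measure_pmf.integrable_const_bound[where B = 1]; auto)+
  have ind: "?E (\<lambda>e. of_bool (Q e) :: real) = measure_pmf.prob M {e. Q e}" for Q
  proof -
    have "(\<lambda>e. of_bool (Q e) :: real) = indicator {e. Q e}" by (auto simp: indicator_def)
    then show ?thesis by simp
  qed
  have cov: "?E (\<lambda>e. (?y i e - p) * (?y j e - p)) \<le> of_bool (i = j) + \<epsilon>" if ij: "i \<in> ?I" "j \<in> ?I" for i j
  proof (cases "i = j")
    case True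
    have "?E (\<lambda>e. (?y i e - p) * (?y j e - p)) \<le> ?E (\<lambda>e. 1)"
      by (rule integral_mono[OF int]) (use p in \<open>auto simp: True intro!: mult_le_one\<close>)
    then show ?thesis using True c \<delta> by (simp add: \<epsilon>_def)
  next
    case False
    have "(\<lambda>e. (?y i e - p) * (?y j e - p)) = (\<lambda>e. of_bool (Y i e \<and> Y j e) - p * ?y i e - p * ?y j e + p\<^sup>2)"
      by (intro ext) (auto simp: algebra_simps power2_eq_square)
    then have "?E (\<lambda>e. (?y i e - p) * (?y j e - p)) =
      measure_pmf.prob M {e. Y i e \<and> Y j e} - p * measure_pmf.prob M {e. Y i e} - p * measure_pmf.prob M {e. Y j e} + p\<^sup>2"
      by (simp add: int' ind)
    \<comment> \<open>Single events enter with a negative sign and joint events with a positive one,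
      so the available lower and upper bounds point in the right direction.\<close>
    also have "\<dots> \<le> (1 - c * (1 - p\<^sup>2 - 2 * \<delta>)) - p * (c * (p - \<delta>)) - p * (c * (p - \<delta>)) + p\<^sup>2"
      using P1[OF ij(1)] P1[OF ij(2)] P2[OF ij False] p by (intro add_mono diff_mono mult_left_mono) auto
    also have "\<dots> = (1 - c) * (1 + p\<^sup>2) + 2 * (c * \<delta> * (1 + p))" by (simp add: algebra_simps power2_eq_square)
    also have "\<dots> \<le> (1 - c) * 2 + 2 * (1 * \<delta> * 2)"
    proof -
      have "p\<^sup>2 \<le> 1" using p by (simp add: power_le_one)
      then show ?thesis using c p \<delta> by (intro add_mono mult_mono) auto
    qed
    finally show ?thesis using False by (simp add: \<epsilon>_def)
  qed
  have sq: "(?X e - p)\<^sup>2 = (\<Sum>i\<in>?I. \<Sum>j\<in>?I. (?y i e - p) * (?y j e - p)) / (real n)\<^sup>2" for e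
  proof -
    have "?X e - p = (\<Sum>i\<in>?I. ?y i e - p) / real n" using n by (simp add: sum_subtractf field_simps)
    then show ?thesis by (simp add: power_divide power2_eq_square sum_product)
  qed
  have intX: "integrable (measure_pmf M) (\<lambda>e. (?X e - p)\<^sup>2)" unfolding sq using int by auto
  have "?E (\<lambda>e. (?X e - p)\<^sup>2) = (\<Sum>i\<in>?I. \<Sum>j\<in>?I. ?E (\<lambda>e. (?y i e - p) * (?y j e - p))) / (real n)\<^sup>2"
    unfolding sq using int by simp
  also have "\<dots> \<le> (\<Sum>i\<in>?I. \<Sum>j\<in>?I. of_bool (i = j) + \<epsilon>) / (real n)\<^sup>2"
    by (intro divide_right_mono sum_mono cov) auto
  also have "(\<Sum>i\<in>?I. \<Sum>j\<in>?I. of_bool (i = j) + \<epsilon>) = real n + (real n)\<^sup>2 * \<epsilon>"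
    by (simp add: sum.distrib of_bool_def power2_eq_square algebra_simps)
  also have "(real n + (real n)\<^sup>2 * \<epsilon>) / (real n)\<^sup>2 = 1 / real n + \<epsilon>" using n by (simp add: field_simps power2_eq_square)
  finally have EX: "?E (\<lambda>e. (?X e - p)\<^sup>2) \<le> 1 / real n + \<epsilon>" .
  have "measure_pmf.prob M {e. ?X e < p / 2} \<le> measure_pmf.prob M {e \<in> space (measure_pmf M). (?X e - p)\<^sup>2 \<ge> p\<^sup>2 / 4}"
  proof (rule measure_pmf.finite_measure_mono)
    show "{e. ?X e < p / 2} \<subseteq> {e \<in> space (measure_pmf M). (?X e - p)\<^sup>2 \<ge> p\<^sup>2 / 4}"
    proof
      fix e assume "e \<in> {e. ?X e < p / 2}"
      then have "?X e < p / 2" by (rule CollectD)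
      then have "p / 2 \<le> \<bar>?X e - p\<bar>" by linarith
      then have "(p / 2)\<^sup>2 \<le> \<bar>?X e - p\<bar>\<^sup>2" using p by (intro power_mono) auto
      then show "e \<in> {e \<in> space (measure_pmf M). (?X e - p)\<^sup>2 \<ge> p\<^sup>2 / 4}" by (simp add: power_divide)
    qed
  qed simp
  also have "\<dots> \<le> ?E (\<lambda>e. (?X e - p)\<^sup>2) / (p\<^sup>2 / 4)"
    by (rule integral_Markov_inequality_measure[where A = "{}", OF intX]) (use p in auto)
  also have "\<dots> \<le> (1 / real n + \<epsilon>) / (p\<^sup>2 / 4)" by (rule divide_right_mono[OF EX]) simp
  finally show ?thesis by (simp add: \<epsilon>_def mult_ac add_ac)
qed

lemma set_edges_pmfD: "e \<in> set_pmf (edges_pmf lam s n) \<Longrightarrow> x \<notin> edge_set n \<Longrightarrow> e x = (False, False)"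
  using set_Pi_pmf_subset[OF finite_edge_set, of n "(False, False)" "\<lambda>_. edge_pmf lam s n"]
  unfolding edges_pmf_def by (cases x) auto

section \<open>Coupling of one or two explorations with independent trees\<close>

context
  fixes lam s :: real and n N :: nat
  assumes lam: "lam > 0" and s: "0 \<le> s" "s \<le> 1" and n: "n > 0" and rho: "lam * (2 - s) \<le> real n" and N: "N \<le> n"
begin

text \<open>The two factors account for the depletion of the undiscovered vertices and for the passage from
  binomial to Poisson offspring.\<close>

abbreviation coupling_bound :: real where
  "coupling_bound \<equiv> ((1 - real N / real n) * ((1 - lam * (2 - s) / real n) ^ n * exp (lam * (2 - s)))) ^ N"

text \<open>Bernoulli's inequality bounds the loss of \<open>N\<close> steps by \<open>N\<close>
  times that of one step, which is at most \<open>N / n\<close> for depletion plus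
  \<open>(lam * (2 - s))^2 / n\<close> for the Poisson approximation. The total is small when
  \<open>N\<close> is far below \<open>sqrt n\<close>.\<close>

lemma coupling_bound: "0 \<le> coupling_bound" "coupling_bound \<le> 1"
  "1 - coupling_bound \<le> real N * (real N + (lam * (2 - s))\<^sup>2) / real n"
proof -
  let ?g = "1 - real N / real n" and ?h = "(1 - lam * (2 - s) / real n) ^ n * exp (lam * (2 - s))" and ?r = "lam * (2 - s)"
  have g: "0 \<le> ?g" "?g \<le> 1" using n N by auto
  have r: "0 \<le> ?r" using lam s by simp
  note h = exp_correction_bounds[OF n r rho]
  show "0 \<le> coupling_bound" "coupling_bound \<le> 1" using g h by (auto intro!: power_le_one mult_le_one)
  have "1 - ?g * ?h = (1 - ?g) * ?h + (1 - ?h)" by (simp add: algebra_simps)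
  also have "\<dots> \<le> (1 - ?g) * 1 + ?r\<^sup>2 / real n" using g h by (intro add_mono mult_left_mono) auto
  finally have gh: "1 - ?g * ?h \<le> (real N + ?r\<^sup>2) / real n" by (simp add: add_divide_distrib)
  have "1 + real N * (?g * ?h - 1) \<le> (1 + (?g * ?h - 1)) ^ N"
    using g h by (intro Bernoulli_inequality) (simp add: order_trans[of "-1" 0])
  then have "1 - coupling_bound \<le> real N * (1 - ?g * ?h)" by (simp add: algebra_simps)
  also have "\<dots> \<le> real N * ((real N + ?r\<^sup>2) / real n)" by (intro mult_left_mono gh) simp
  finally show "1 - coupling_bound \<le> real N * (real N + ?r\<^sup>2) / real n" by simp
qed

text \<open>Sums \<open>explores_prob\<close> over the outcomes in \<open>H\<close>.
  \<open>F\<close> lists the trees contained in an outcome, so that one root and a pair of roots are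
  covered at once; injectivity of \<open>F\<close> keeps different outcomes disjoint.\<close>

lemma explores_event_prob:
  assumes roots: "distinct roots" "set roots \<subseteq> {1..n}" and F: "inj F"
    and H: "\<And>x. x \<in> H \<Longrightarrow> length (F x) = length roots \<and> forest_nodes (F x) \<le> N \<and>
      pmf M x = prod_list (map (pmf (ctree_pmf lam s k)) (F x))"
  shows "coupling_bound * measure_pmf.prob M H \<le>
    measure_pmf.prob (edges_pmf lam s n) {e. \<exists>x\<in>H. explores (edge_types_of e) (map (\<lambda>i. (i, k)) roots) {} ({1..n} - set roots) (F x)}"
proof -
  let ?q = "map (\<lambda>i. (i, k)) roots" and ?W = "{1..n} - set roots" and ?\<mu> = "edges_pmf lam s n"
  \<comment> \<open>Intersecting \<open>H\<close> with the support makes the index set countable and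
    keeps all of its mass.\<close>
  let ?E = "\<lambda>x. {e. explores (edge_types_of e) ?q {} ?W (F x)}" and ?H = "H \<inter> set_pmf M"
  let ?g = "1 - real N / real n" and ?h = "(1 - lam * (2 - s) / real n) ^ n * exp (lam * (2 - s))"
  have g: "0 \<le> ?g" "?g \<le> 1" using n N by auto
  have r: "0 \<le> lam * (2 - s)" using lam s by simp
  note h = exp_correction_bounds(1,2)[OF n r rho]
  have E: "coupling_bound * pmf M x \<le> measure_pmf.prob ?\<mu> (?E x)" if x: "x \<in> H" for x
  proof -
    have l: "length (F x) = length roots" and fn: "forest_nodes (F x) \<le> N" using H[OF x] by auto
    have "map2 (\<lambda>z t. pmf (ctree_pmf lam s (snd z)) t) (map (\<lambda>i. (i, k)) is) ts = map (pmf (ctree_pmf lam s k)) ts"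
      if "length is = length ts" for "is" :: "nat list" and ts
      using that by (induction "is" ts rule: list_induct2) auto
    then have u: "prod_list (map2 (\<lambda>z t. pmf (ctree_pmf lam s (snd z)) t) ?q (F x)) = pmf M x"
      using H[OF x] by simp
    have "coupling_bound * pmf M x = pmf M x * ?g ^ N * ?h ^ N" by (simp only: power_mult_distrib mult_ac)
    also have "\<dots> \<le> pmf M x * ?g ^ (forest_nodes (F x) - length ?q) * ?h ^ forest_nodes (F x)"
      using fn by (intro mult_mono order.refl power_decreasing mult_nonneg_nonneg zero_le_power pmf_nonneg g h) auto
    also have "\<dots> \<le> measure_pmf.prob ?\<mu> (?E x)"
      unfolding u[symmetric]
    proof (rule explores_prob[OF lam s n rho N])
      have c: "card ?W = n - length roots" using roots by (simp add: card_Diff_subset distinct_card)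
      have "length roots \<le> n" using roots card_mono[of "{1..n}" "set roots"] by (simp add: distinct_card)
      then show "n + forest_nodes (F x) \<le> card ?W + N + length ?q" using fn c by simp
    qed (use roots l in \<open>auto simp: o_def image_image\<close>)
    finally show ?thesis .
  qed
  have disj: "disjoint_family_on ?E ?H"
    unfolding disjoint_family_on_def using injD[OF F] explores_unique by blast
  have "ennreal (coupling_bound * measure_pmf.prob M H) = ennreal coupling_bound * emeasure (measure_pmf M) ?H"
    using coupling_bound(1) by (simp add: measure_pmf.emeasure_eq_measure measure_Int_set_pmf ennreal_mult)
  also have "\<dots> = (\<integral>\<^sup>+x. ennreal coupling_bound * ennreal (pmf M x) \<partial>count_space ?H)"
    by (simp add: nn_integral_cmult nn_integral_pmf)
  also have "\<dots> \<le> (\<integral>\<^sup>+x. emeasure (measure_pmf ?\<mu>) (?E x) \<partial>count_space ?H)"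
  proof (rule nn_integral_mono)
    fix x assume "x \<in> space (count_space ?H)"
    then have "coupling_bound * pmf M x \<le> measure_pmf.prob ?\<mu> (?E x)" by (intro E) simp
    then have "ennreal (coupling_bound * pmf M x) \<le> emeasure (measure_pmf ?\<mu>) (?E x)"
      unfolding measure_pmf.emeasure_eq_measure by (intro ennreal_leI)
    then show "ennreal coupling_bound * ennreal (pmf M x) \<le> emeasure (measure_pmf ?\<mu>) (?E x)"
      using coupling_bound(1) by (simp only: ennreal_mult pmf_nonneg)
  qed
  also have "\<dots> = emeasure (measure_pmf ?\<mu>) (\<Union>x\<in>?H. ?E x)"
    by (rule emeasure_UN_countable[symmetric]) (use disj in auto)
  also have "\<dots> \<le> emeasure (measure_pmf ?\<mu>) {e. \<exists>x\<in>H. explores (edge_types_of e) ?q {} ?W (F x)}"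
    by (rule emeasure_mono) auto
  finally show ?thesis unfolding measure_pmf.emeasure_eq_measure by simp
qed

text \<open>Trees with more than \<open>N / 2\<close> nodes are discarded, at a cost
  \<open>\<delta>\<close> per root; for the remaining ones the exploration succeeds and decides
  acceptance through \<open>good_tree\<close>. Two roots are compared with two independent trees,
  which is why \<open>p\<close> appears squared.\<close>

lemma MPAlign_pair_probs:
  fixes d :: nat and \<beta> :: real
  defines "p \<equiv> measure_pmf.prob (ctree_pmf lam s (Suc d)) {t. good_tree lam s (d - 1) \<beta> t}"
    and "\<delta> \<equiv> measure_pmf.prob (ctree_pmf lam s (Suc d)) {t. N < 2 * nodes t}"
    and "A \<equiv> \<lambda>i e. (i, i) \<in> MPAlign lam s n (graph1 e) (graph2 e) d \<beta>"
  shows "i \<in> {1..n} \<Longrightarrow> measure_pmf.prob (edges_pmf lam s n) {e. A i e} \<ge> coupling_bound * (p - \<delta>)" (is "_ \<Longrightarrow> ?one")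
    and "i \<in> {1..n} \<Longrightarrow> j \<in> {1..n} \<Longrightarrow> i \<noteq> j \<Longrightarrow>
      measure_pmf.prob (edges_pmf lam s n) {e. A i e \<and> A j e} \<le> 1 - coupling_bound * (1 - p\<^sup>2 - 2 * \<delta>)" (is "_ \<Longrightarrow> _ \<Longrightarrow> _ \<Longrightarrow> ?two")
proof -
  let ?U = "ctree_pmf lam s (Suc d)" and ?G = "{t. good_tree lam s (d - 1) \<beta> t}" and ?B = "{t. N < 2 * nodes t}"
  let ?\<mu> = "edges_pmf lam s n" and ?V = "{1..n}"
  have A: "A (roots ! r) e \<longleftrightarrow> ts ! r \<in> ?G"
    if "e \<in> set_pmf ?\<mu>" "distinct roots" "set roots \<subseteq> ?V" "r < length roots"
      "explores (edge_types_of e) (map (\<lambda>i. (i, Suc d)) roots) {} (?V - set roots) ts" for e roots r ts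
    unfolding A_def using explores_MPAlign_iff[OF set_edges_pmfD[OF that(1)] that(2-5)] by simp
  show ?one if i: "i \<in> ?V"
  proof -
    let ?H = "?G - ?B"
    have "p \<le> measure_pmf.prob ?U (?H \<union> ?B)" unfolding p_def by (rule measure_pmf.finite_measure_mono) auto
    also have "\<dots> \<le> measure_pmf.prob ?U ?H + \<delta>" unfolding \<delta>_def by (rule measure_Un_le) auto
    finally have "coupling_bound * (p - \<delta>) \<le> coupling_bound * measure_pmf.prob ?U ?H"
      by (intro mult_left_mono coupling_bound(1)) simp
    also have "\<dots> \<le> measure_pmf.prob ?\<mu> {e. \<exists>t\<in>?H. explores (edge_types_of e) (map (\<lambda>i. (i, Suc d)) [i]) {} (?V - set [i]) [t]}"
      by (rule explores_event_prob) (use i in \<open>auto intro: injI\<close>)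
    also have "\<dots> \<le> measure_pmf.prob ?\<mu> {e. A i e}"
    proof (rule measure_pmf.finite_measure_mono_AE, rule AE_pmfI, rule impI)
      fix e assume e: "e \<in> set_pmf ?\<mu>"
        "e \<in> {e. \<exists>t\<in>?H. explores (edge_types_of e) (map (\<lambda>i. (i, Suc d)) [i]) {} (?V - set [i]) [t]}"
      then obtain t where "t \<in> ?H" "explores (edge_types_of e) (map (\<lambda>i. (i, Suc d)) [i]) {} (?V - set [i]) [t]" by blast
      then show "e \<in> {e. A i e}" using A[OF e(1), of "[i]" 0 "[t]"] i by simp
    qed simp
    finally show ?thesis .
  qed
  \<comment> \<open>Explorations have only been bounded from below, so the complementary event is estimated.\<close>
  show ?two if ij: "i \<in> ?V" "j \<in> ?V" "i \<noteq> j"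
  proof -
    let ?P = "pair_pmf ?U ?U" and ?E = "\<lambda>x. [fst x, snd x]"
    let ?H = "- (?G \<times> ?G \<union> (?B \<times> UNIV \<union> UNIV \<times> ?B))"
    have "measure_pmf.prob ?P (?G \<times> ?G \<union> (?B \<times> UNIV \<union> UNIV \<times> ?B)) \<le>
      measure_pmf.prob ?P (?G \<times> ?G) + (measure_pmf.prob ?P (?B \<times> UNIV) + measure_pmf.prob ?P (UNIV \<times> ?B))"
      by (intro order.trans[OF measure_Un_le] add_left_mono measure_Un_le) auto
    also have "\<dots> = p\<^sup>2 + 2 * \<delta>" unfolding prob_pair_pmf_Times by (simp add: p_def \<delta>_def power2_eq_square)
    finally have "1 - p\<^sup>2 - 2 * \<delta> \<le> measure_pmf.prob ?P ?H"
      using measure_pmf.prob_compl[of "?G \<times> ?G \<union> (?B \<times> UNIV \<union> UNIV \<times> ?B)" ?P] by (simp add: Compl_eq_Diff_UNIV)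
    then have "coupling_bound * (1 - p\<^sup>2 - 2 * \<delta>) \<le> coupling_bound * measure_pmf.prob ?P ?H"
      by (intro mult_left_mono coupling_bound(1))
    also have "\<dots> \<le> measure_pmf.prob ?\<mu> {e. \<exists>x\<in>?H. explores (edge_types_of e) (map (\<lambda>i. (i, Suc d)) [i, j]) {} (?V - set [i, j]) (?E x)}"
    proof (rule explores_event_prob)
      show "inj ?E" by (auto intro: injI prod_eqI)
      fix x assume "x \<in> ?H"
      then show "length (?E x) = length [i, j] \<and> forest_nodes (?E x) \<le> N \<and> pmf ?P x = prod_list (map (pmf ?U) (?E x))"
        by (cases x) (auto simp: pmf_pair)
    qed (use ij in auto)
    also have "\<dots> \<le> measure_pmf.prob ?\<mu> (- {e. A i e \<and> A j e})"
    proof (rule measure_pmf.finite_measure_mono_AE, rule AE_pmfI, rule impI)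
      fix e assume e: "e \<in> set_pmf ?\<mu>"
        "e \<in> {e. \<exists>x\<in>?H. explores (edge_types_of e) (map (\<lambda>i. (i, Suc d)) [i, j]) {} (?V - set [i, j]) (?E x)}"
      then obtain x where x: "x \<in> ?H" "explores (edge_types_of e) (map (\<lambda>i. (i, Suc d)) [i, j]) {} (?V - set [i, j]) (?E x)" by blast
      have "\<not> (fst x \<in> ?G \<and> snd x \<in> ?G)" using x(1) by (auto simp: mem_Times_iff)
      then show "e \<in> - {e. A i e \<and> A j e}" using A[OF e(1) _ _ _ x(2), of 0] A[OF e(1) _ _ _ x(2), of 1] ij by auto
    qed simp
    also have "\<dots> = 1 - measure_pmf.prob ?\<mu> {e. A i e \<and> A j e}"
      using measure_pmf.prob_compl[of "{e. A i e \<and> A j e}" ?\<mu>] by (simp add: Compl_eq_Diff_UNIV)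
    finally show ?thesis by simp
  qed
qed

end

text \<open>The edges are independent of the planted permutation, and by
  \<open>MPAlign_permute\<close> the event does not depend on it. Leaving \<open>Q\<close> arbitrary
  makes this applicable to the overlap.\<close>

lemma correlated_graphs_prob:
  "measure_pmf.prob (correlated_graphs lam s n)
      {(G, G', \<sigma>). Q (\<lambda>i. (i, \<sigma> i) \<in> MPAlign lam s n G G' d \<beta>)} =
    measure_pmf.prob (edges_pmf lam s n) {e. Q (\<lambda>i. (i, i) \<in> MPAlign lam s n (graph1 e) (graph2 e) d \<beta>)}"
proof -
  let ?\<mu> = "edges_pmf lam s n" and ?S = "pmf_of_set {\<sigma>. \<sigma> permutes {1..n}}"
  let ?F = "\<lambda>(e, \<sigma>). (graph1 e, (\<lambda>u v. graph2 e (inv \<sigma> u) (inv \<sigma> v)), \<sigma>)"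
  let ?A = "{(G, G', \<sigma>). Q (\<lambda>i. (i, \<sigma> i) \<in> MPAlign lam s n G G' d \<beta>)}"
  let ?B = "{e. Q (\<lambda>i. (i, i) \<in> MPAlign lam s n (graph1 e) (graph2 e) d \<beta>)}"
  have S: "set_pmf ?S = {\<sigma>. \<sigma> permutes {1..n}}"
    by (intro set_pmf_of_set finite_permutations) (auto intro: permutes_id)
  have "correlated_graphs lam s n = map_pmf ?F (pair_pmf ?\<mu> ?S)"
    by (simp add: correlated_graphs_def edges_pmf_def edge_set_def graph1_def graph2_def)
  then have "measure_pmf.prob (correlated_graphs lam s n) ?A = measure_pmf.prob (pair_pmf ?\<mu> ?S) (?F -` ?A)"
    by (simp only: measure_map_pmf)
  also have "\<dots> = measure_pmf.prob (pair_pmf ?\<mu> ?S) (?B \<times> UNIV)"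
  proof (rule measure_pmf.finite_measure_eq_AE, rule AE_pmfI)
    fix z assume z: "z \<in> set_pmf (pair_pmf ?\<mu> ?S)"
    obtain e \<sigma> where e: "z = (e, \<sigma>)" by (cases z)
    then have \<sigma>: "\<sigma> permutes {1..n}" using z S by auto
    show "z \<in> ?F -` ?A \<longleftrightarrow> z \<in> ?B \<times> UNIV" by (simp add: e MPAlign_permute[OF \<sigma>])
  qed auto
  also have "\<dots> = measure_pmf.prob ?\<mu> ?B" by (simp add: prob_pair_pmf_Times)
  finally show ?thesis .
qed

text \<open>The acceptance probability \<open>p'\<close> varies with \<open>d\<close> and is only
  known to be at least \<open>p\<close>. The second moment is taken around \<open>p'\<close> and
  weakened to \<open>p\<close> afterwards, both in the threshold and in the prefactor.\<close>

lemma MPAlign_overlap_prob: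
  fixes n N d :: nat and \<beta> :: real
  assumes lam: "lam > 0" and s: "0 \<le> s" "s \<le> 1" and n: "n > 0" and rho: "lam * (2 - s) \<le> real n" "lam * (2 - s) > 1"
    and N: "0 < N" "N \<le> n"
    and p: "p > 0" "p \<le> measure_pmf.prob (ctree_pmf lam s (Suc d)) {t. good_tree lam s (d - 1) \<beta> t}"
  shows "measure_pmf.prob (edges_pmf lam s n) {e. 1 / real n * (\<Sum>i = 1..n. of_bool ((i, i) \<in> MPAlign lam s n (graph1 e) (graph2 e) d \<beta>)) < p / 2}
    \<le> 4 / p\<^sup>2 * (1 / real n + 2 * (real N * (real N + (lam * (2 - s))\<^sup>2) / real n) +
      8 * ((lam * (2 - s)) ^ (d + 2) / (lam * (2 - s) - 1)) / real N)"
proof -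
  let ?X = "\<lambda>e. 1 / real n * (\<Sum>i = 1..n. of_bool ((i, i) \<in> MPAlign lam s n (graph1 e) (graph2 e) d \<beta>)) :: real"
  let ?r = "lam * (2 - s)"
  define p' where "p' = measure_pmf.prob (ctree_pmf lam s (Suc d)) {t. good_tree lam s (d - 1) \<beta> t}"
  define \<delta> where "\<delta> = measure_pmf.prob (ctree_pmf lam s (Suc d)) {t. N < 2 * nodes t}"
  let ?c = "coupling_bound lam s n N"
  note c = coupling_bound[OF lam s n rho(1) N(2)]
  have p': "p \<le> p'" "p' \<le> 1" using p by (auto simp: p'_def)
  have \<delta>: "0 \<le> \<delta>" by (simp add: \<delta>_def)
  have "(\<Sum>i\<le>Suc d. ?r ^ i) = (?r ^ (d + 2) - 1) / (?r - 1)"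
    using rho(2) geometric_sum[of ?r "d + 2"] by (simp add: lessThan_Suc_atMost)
  also have "\<dots> \<le> ?r ^ (d + 2) / (?r - 1)" using rho(2) by (intro divide_right_mono) auto
  finally have geo: "(\<Sum>i\<le>Suc d. ?r ^ i) \<le> ?r ^ (d + 2) / (?r - 1)" .
  have "\<delta> \<le> 2 * (\<Sum>i\<le>Suc d. ?r ^ i) / real N" unfolding \<delta>_def by (rule nodes_tail[OF lam s N(1)])
  also have "\<dots> \<le> 2 * (?r ^ (d + 2) / (?r - 1)) / real N" by (intro divide_right_mono mult_left_mono geo) auto
  finally have \<delta>': "4 * \<delta> \<le> 8 * (?r ^ (d + 2) / (?r - 1)) / real N" by simp
  have "measure_pmf.prob (edges_pmf lam s n) {e. ?X e < p / 2} \<le> measure_pmf.prob (edges_pmf lam s n) {e. ?X e < p' / 2}"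
    using p' by (intro measure_pmf.finite_measure_mono) auto
  also have "\<dots> \<le> 4 / p'\<^sup>2 * (1 / real n + 2 * (1 - ?c) + 4 * \<delta>)"
    using MPAlign_pair_probs[OF lam s n rho(1) N(2), where d = d and \<beta> = \<beta>, folded p'_def \<delta>_def] p p' c \<delta>
    by (intro second_moment_prob[OF n]) auto
  also have "\<dots> \<le> 4 / p\<^sup>2 * (1 / real n + 2 * (1 - ?c) + 4 * \<delta>)"
  proof (rule mult_right_mono)
    have "p\<^sup>2 \<le> p'\<^sup>2" using p p' by (intro power_mono) auto
    then show "4 / p'\<^sup>2 \<le> 4 / p\<^sup>2" using p(1) p'(1) by (intro divide_left_mono) auto
  qed (use c(2) \<delta> in simp)
  also have "\<dots> \<le> 4 / p\<^sup>2 * (1 / real n + 2 * (real N * (real N + ?r\<^sup>2) / real n) + 8 * (?r ^ (d + 2) / (?r - 1)) / real N)"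
    using c(3) \<delta>' by (intro mult_left_mono add_mono order.refl) auto
  finally show ?thesis .
qed

text \<open>With \<open>d n - 1 = n0 + k\<close>, the ratio reaches
  \<open>exp ((lam * s) ^ k)\<close> with probability at least \<open>p0\<close>. Up to a constant
  factor \<open>(lam * s) ^ k\<close> is \<open>n\<close> to the power
  \<open>c * ln (lam * s)\<close>, and so it eventually exceeds \<open>n\<close> to the power
  \<open>\<gamma>\<close>.\<close>

lemma good_tree_prob_eventually:
  assumes lam: "lam > 0" and s: "0 \<le> s" "s \<le> 1" and T: "one_sided_test lam s T"
    and mu: "lam * s > 1" and c: "c > 0" and \<gamma>: "\<gamma> < c * ln (lam * s)"
  defines "d \<equiv> \<lambda>n. nat \<lfloor>c * ln (real n)\<rfloor>"
  obtains p where "p > 0"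
    "\<forall>\<^sub>F n in sequentially. p \<le> measure_pmf.prob (ctree_pmf lam s (Suc (d n))) {t. good_tree lam s (d n - 1) (exp (real n powr \<gamma>)) t}"
proof -
  obtain p0 n0 where p0: "p0 > 0" and growth: "\<And>k N. n0 + k \<le> N \<Longrightarrow>
      measure_pmf.prob (ctree_pmf lam s N) {t. ctree_like lam s (n0 + k) t t \<ge> exp ((lam * s) ^ k)} \<ge> p0"
    using ctree_like_growth[OF lam s mu T] by blast
  \<comment> \<open>\<open>n0 + 2\<close> generations do not contribute to the growth:
    \<open>n0\<close> for the test, one for passing to the children and at most one lost in the
    floor. \<open>?C\<close> is their share of the exponent.\<close>
  let ?q = "pmf (poisson (lam * s)) 3" and ?C = "(real n0 + 2) * ln (lam * s)"
  have q: "?q > 0" using mu by (auto simp: poisson_def)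
  have lnmu: "ln (lam * s) > 0" using mu by simp
  have ln: "filterlim (\<lambda>n. ln (real n)) at_top sequentially"
    by (rule filterlim_compose[OF ln_at_top filterlim_real_sequentially])
  have e1: "\<forall>\<^sub>F n in sequentially. ln (real n) > ?C / (c * ln (lam * s) - \<gamma>)"
    by (rule filterlim_at_top_dense[THEN iffD1, rule_format, OF ln])
  have e2: "\<forall>\<^sub>F n in sequentially. ln (real n) > (real n0 + 2) / c"
    by (rule filterlim_at_top_dense[THEN iffD1, rule_format, OF ln])
  have "\<forall>\<^sub>F n in sequentially. ?q * p0 ^ 3 \<le> measure_pmf.prob (ctree_pmf lam s (Suc (d n))) {t. good_tree lam s (d n - 1) (exp (real n powr \<gamma>)) t}"
    using e1 e2 eventually_gt_at_top[of 0]
  proof eventually_elim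
    case (elim n)
    let ?D = "d n"
    have a: "?C < (c * ln (lam * s) - \<gamma>) * ln (real n)" and b: "real n0 + 2 < c * ln (real n)"
      using elim(1,2) \<gamma> c by (simp_all add: field_simps)
    have D: "real ?D > c * ln (real n) - 1" using b unfolding d_def by linarith
    then have D': "n0 + 1 \<le> ?D" using b by linarith
    define k where "k = ?D - 1 - n0"
    have k: "?D - 1 = n0 + k" "real k = real ?D - 1 - real n0" using D' by (auto simp: k_def)
    have "real n powr \<gamma> = exp (\<gamma> * ln (real n))" using elim(3) by (simp add: powr_def)
    also have "\<dots> < exp (real k * ln (lam * s))"
    proof -
      have "(c * ln (real n) - 2 - real n0) * ln (lam * s) \<le> real k * ln (lam * s)"
        using D lnmu unfolding k(2) by (intro mult_right_mono) auto
      then show ?thesis using a by (simp add: algebra_simps)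
    qed
    also have "\<dots> = (lam * s) ^ k" using mu by (simp add: exp_of_nat_mult)
    finally have \<beta>: "exp (real n powr \<gamma>) < exp ((lam * s) ^ k)" by simp
    have "p0 \<le> measure_pmf.prob (ctree_pmf lam s ?D) {t. ctree_like lam s (n0 + k) t t \<ge> exp ((lam * s) ^ k)}"
      by (rule growth) (use k(1) in linarith)
    also have "\<dots> \<le> measure_pmf.prob (ctree_pmf lam s ?D) {t. ctree_like lam s (?D - 1) t t > exp (real n powr \<gamma>)}"
      unfolding k(1) by (rule measure_pmf.finite_measure_mono) (use order.strict_trans2[OF \<beta>] in auto)
    finally have "?q * p0 ^ 3 \<le> ?q * measure_pmf.prob (ctree_pmf lam s ?D) {t. ctree_like lam s (?D - 1) t t > exp (real n powr \<gamma>)} ^ 3"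
      using p0 q by (intro mult_left_mono power_mono) auto
    also have "\<dots> \<le> measure_pmf.prob (ctree_pmf lam s (Suc ?D)) {t. good_tree lam s (?D - 1) (exp (real n powr \<gamma>)) t}"
      by (rule good_tree_prob[OF lam s])
    finally show ?case .
  qed
  then show ?thesis using that[of "?q * p0 ^ 3"] p0 q by simp
qed

theorem theorem7:
  fixes lam s c \<gamma> :: real
  assumes "lam > 0" and "s \<in> {0..1}"
    and "\<exists>T. one_sided_test lam s T"
    and "c > 0" and "c * ln (lam * (2 - s)) < 1 / 2"
    and "\<gamma> \<in> {0<..<c * ln (lam * s)}"
  shows "\<exists>\<alpha>>0. (\<lambda>n. measure_pmf.prob (correlated_graphs lam s n)
           {(G, G', \<sigma>). 1 / real n *
              (\<Sum>i = 1..n. of_bool ((i, \<sigma> i) \<in>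
                 MPAlign lam s n G G' (nat \<lfloor>c * ln (real n)\<rfloor>) (exp (real n powr \<gamma>)))) \<ge> \<alpha>})
         \<longlonglongrightarrow> 1"
proof -
  have lam: "lam > 0" and s: "0 \<le> s" "s \<le> 1" and \<gamma>: "\<gamma> < c * ln (lam * s)" using assms by auto
  obtain T where T: "one_sided_test lam s T" using assms(3) by blast
  \<comment> \<open>The interval containing \<open>\<gamma>\<close> is nonempty, so the logarithm is
    positive; since \<open>ln 0 = 0\<close>, this also excludes \<open>lam * s = 0\<close>.\<close>
  have "ln (lam * s) > 0" using assms(4,6) by (auto simp: zero_less_mult_iff dest: less_trans)
  moreover have "lam * s \<ge> 0" using lam s by simp
  ultimately have mu: "lam * s > 1" by (cases "lam * s = 0") auto
  let ?r = "lam * (2 - s)" and ?d = "\<lambda>n. nat \<lfloor>c * ln (real n)\<rfloor>" and ?\<beta> = "\<lambda>n. exp (real n powr \<gamma>)"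
  have "lam * s \<le> ?r" using lam s by (intro mult_left_mono) auto
  then have r: "?r > 1" using mu by linarith
  obtain p where p: "p > 0" and ev: "\<forall>\<^sub>F n in sequentially.
      p \<le> measure_pmf.prob (ctree_pmf lam s (Suc (?d n))) {t. good_tree lam s (?d n - 1) (?\<beta> n) t}"
    by (rule good_tree_prob_eventually[OF lam s T mu assms(4) \<gamma>])
  \<comment> \<open>Trees of depth \<open>d + 1\<close> have mean size of order at most
    \<open>n powr \<theta>\<close>, and the coupling is accurate for far fewer than
    \<open>sqrt n\<close> vertices. The exponent \<open>\<eta>\<close> of the budget is the midpoint
    between \<open>\<theta>\<close> and \<open>1 / 2\<close>, which is where the condition on
    \<open>c\<close> enters.\<close>
  define \<theta> \<eta> where "\<theta> = c * ln ?r" and "\<eta> = (\<theta> + 1 / 2) / 2"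
  have \<eta>: "0 < \<eta>" "\<theta> < \<eta>" "\<eta> < 1 / 2" using assms(4,5) r by (auto simp: \<theta>_def \<eta>_def intro: add_pos_pos)
  let ?N = "\<lambda>n. nat \<lfloor>real n powr \<eta>\<rfloor>"
  let ?b = "\<lambda>n. 4 / p\<^sup>2 * (1 / real n + 2 * (real n powr (2 * \<eta> - 1) + real n powr (\<eta> - 1) * ?r\<^sup>2) +
      16 * (?r\<^sup>2 / (?r - 1)) * real n powr (\<theta> - \<eta>))"
  have pw: "(\<lambda>n. real n powr x) \<longlonglongrightarrow> 0" if "x < 0" for x
    by (rule tendsto_neg_powr[OF that filterlim_real_sequentially])
  have b: "?b \<longlonglongrightarrow> 0"
  proof -
    have "?b \<longlonglongrightarrow> 4 / p\<^sup>2 * (0 + 2 * (0 + 0 * ?r\<^sup>2) + 16 * (?r\<^sup>2 / (?r - 1)) * 0)"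
      by (intro tendsto_add tendsto_mult tendsto_const pw lim_1_over_n) (use \<eta> in auto)
    then show ?thesis by simp
  qed
  \<comment> \<open>Above 2 the floor keeps at least half of the value, so the budget
    \<open>?N n\<close> is positive and may be replaced by \<open>n powr \<eta> / 2\<close> in
    denominators.\<close>
  have e: "\<forall>\<^sub>F n in sequentially. real n powr \<eta> > 2"
  proof -
    have "\<forall>\<^sub>F n in sequentially. real n powr - \<eta> < 1 / 2" using \<eta> by (intro order_tendstoD(2)[OF pw]) auto
    then show ?thesis using eventually_gt_at_top[of 0]
      by eventually_elim (simp add: powr_minus field_simps)
  qed
  have er: "\<forall>\<^sub>F n in sequentially. real n > ?r"
    using filterlim_real_sequentially by (simp add: filterlim_at_top_dense)
  let ?P = "\<lambda>n. measure_pmf.prob (correlated_graphs lam s n)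
           {(G, G', \<sigma>). 1 / real n *
              (\<Sum>i = 1..n. of_bool ((i, \<sigma> i) \<in> MPAlign lam s n G G' (?d n) (?\<beta> n))) \<ge> p / 2}"
  have "\<forall>\<^sub>F n in sequentially. 1 - ?b n \<le> ?P n"
    using ev e er eventually_gt_at_top[of 0]
  proof eventually_elim
    case (elim n)
    let ?x = "real n powr \<eta>" and ?\<mu> = "edges_pmf lam s n"
    let ?X = "\<lambda>e. 1 / real n * (\<Sum>i = 1..n. of_bool ((i, i) \<in> MPAlign lam s n (graph1 e) (graph2 e) (?d n) (?\<beta> n))) :: real"
    have N: "real (?N n) \<le> ?x" "?x / 2 \<le> real (?N n)" using elim(2) by linarith+
    have "?x \<le> real n powr 1" using elim(4) \<eta> by (intro powr_mono) auto
    then have "real (?N n) \<le> real n powr 1" by (rule order.trans[OF N(1)])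
    then have "real (?N n) \<le> real n" by simp
    then have Nn: "0 < ?N n" "?N n \<le> n" using elim(2) N(2) by linarith+
    have "?r ^ ?d n = exp (real (?d n) * ln ?r)" using r by (simp add: exp_of_nat_mult)
    also have "\<dots> \<le> exp (c * ln (real n) * ln ?r)"
    proof -
      have "0 \<le> c * ln (real n)" using elim(4) assms(4) by simp
      then have "real (?d n) \<le> c * ln (real n)" by linarith
      then show ?thesis using r by (auto intro: mult_right_mono)
    qed
    also have "\<dots> = real n powr \<theta>" using elim(4) by (simp add: powr_def \<theta>_def mult_ac)
    finally have rd: "?r ^ ?d n \<le> real n powr \<theta>" .
    have t1: "real (?N n) * (real (?N n) + ?r\<^sup>2) / real n \<le> real n powr (2 * \<eta> - 1) + real n powr (\<eta> - 1) * ?r\<^sup>2"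
    proof -
      have "real (?N n) * (real (?N n) + ?r\<^sup>2) / real n \<le> ?x * (?x + ?r\<^sup>2) / real n"
        using N(1) by (intro divide_right_mono mult_mono add_right_mono) auto
      also have "\<dots> = real n powr (2 * \<eta> - 1) + real n powr (\<eta> - 1) * ?r\<^sup>2"
        using elim(4) powr_add[of "real n" \<eta> \<eta>] by (simp add: powr_diff field_simps)
      finally show ?thesis .
    qed
    have t2: "8 * (?r ^ (?d n + 2) / (?r - 1)) / real (?N n) \<le> 16 * (?r\<^sup>2 / (?r - 1)) * real n powr (\<theta> - \<eta>)"
    proof -
      have "8 * (?r ^ (?d n + 2) / (?r - 1)) / real (?N n) \<le> 8 * (real n powr \<theta> * ?r\<^sup>2 / (?r - 1)) / (?x / 2)"
        unfolding power_add using rd r N elim(4)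
        by (intro frac_le mult_left_mono divide_right_mono mult_right_mono) auto
      also have "\<dots> = 16 * (?r\<^sup>2 / (?r - 1)) * real n powr (\<theta> - \<eta>)" by (simp add: powr_diff)
      finally show ?thesis .
    qed
    have "measure_pmf.prob ?\<mu> {e. ?X e < p / 2} \<le> 4 / p\<^sup>2 * (1 / real n + 2 * (real (?N n) * (real (?N n) + ?r\<^sup>2) / real n) +
        8 * (?r ^ (?d n + 2) / (?r - 1)) / real (?N n))"
      by (rule MPAlign_overlap_prob[OF lam s elim(4) less_imp_le[OF elim(3)] r Nn p elim(1)])
    also have "\<dots> \<le> ?b n" by (intro mult_left_mono add_mono t1 t2 order.refl) auto
    finally have "1 - ?b n \<le> 1 - measure_pmf.prob ?\<mu> {e. ?X e < p / 2}" by simp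
    also have "\<dots> = measure_pmf.prob ?\<mu> (- {e. ?X e < p / 2})"
      using measure_pmf.prob_compl[of "{e. ?X e < p / 2}" ?\<mu>] by (simp add: Compl_eq_Diff_UNIV)
    also have "- {e. ?X e < p / 2} = {e. p / 2 \<le> ?X e}" by (rule set_eqI) (simp only: Compl_iff mem_Collect_eq not_less)
    also have "measure_pmf.prob ?\<mu> {e. p / 2 \<le> ?X e} = ?P n"
      using correlated_graphs_prob[of lam s n "\<lambda>A. p / 2 \<le> 1 / real n * (\<Sum>i = 1..n. of_bool (A i))" "?d n" "?\<beta> n"] by (rule sym)
    finally show ?case .
  qed
  moreover have "\<forall>\<^sub>F n in sequentially. ?P n \<le> 1"
    by (rule always_eventually, rule allI, rule measure_pmf.prob_le_1)
  moreover have "(\<lambda>n. 1 - ?b n) \<longlonglongrightarrow> 1" using tendsto_diff[OF tendsto_const[of 1] b] by simp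
  ultimately have "?P \<longlonglongrightarrow> 1" by (rule tendsto_sandwich[OF _ _ _ tendsto_const])
  moreover have "p / 2 > 0" using p by simp
  ultimately show ?thesis by blast
qed

end
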